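(* Let $n\ge2$, let $\Omega\subset\mathbb R^n$ be an open set, and let $A$ be a Young function; if $n\ge3$, assume that $\int^\infty\big(\frac{t}{A(t)}\big)^{\frac1{n-2}}dt<\infty$, so that the Young function $A_{n-1}$ associated with $A$ and $n$ (defined in the context) is well defined. Assume that $$\int^\infty\frac{A_{n-1}(t)}{t^{n+1}}\,dt=\infty .$$ Then every weakly monotone function $u\in W^{1,A}_{\rm loc}(\Omega)$ admits a continuous representative. Moreover, provided that $A$ has been modified near $0$, if necessary, in such a way that $\int_0\frac{A_{n-1}(t)}{t^{1+n}}\,dt<\infty$ (which leaves $W^{1,A}_{\rm loc}(\Omega)$ unchanged), one has $u\in C^{\omega(\cdot)}_{\rm loc}(\Omega)$, where $$\omega(r)=r\,B^{-1}(r^{-n})\quad\text{for } r>0,\qquad B(t)=t^n\int_0^t\frac{A_{n-1}(s)}{s^{1+n}}\,ds\quad\text{for } t>0 .$$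
   Context: Young function: a convex function $A:[0,\infty)\to[0,\infty]$, non-constant in $(0,\infty)$, with $A(0)=0$. An integral $\int^\infty$ (resp. $\int_0$) with one unspecified endpoint refers only to behaviour near infinity (resp. near $0$). The Young conjugate is $\widetilde A(t)=\sup\{st-A(s): s\ge0\}$, $t\ge0$. Function $A_{n-1}$: if $n=2$, $A_{1}=A$. If $n\ge3$, $A_{n-1}$ is the Young conjugate of the function $t\mapsto t^{\frac{n-1}{n-2}}\int_t^\infty \frac{\widetilde A(r)}{r^{1+\frac{n-1}{n-2}}}\,dr$, $t>0$ (with value $0$ at $t=0$); the integral converges exactly when $\int^\infty(t/A(t))^{1/(n-2)}dt<\infty$. When $\int_0 A_{n-1}(t)t^{-1-n}dt<\infty$, the function $B$ is a Young function, and $B^{-1}$ denotes its (generalized right-continuous) inverse. $C^{\omega(\cdot)}_{\rm loc}(\Omega)$ is the space of functions on $\Omega$ that are locally uniformly continuous with modulus of continuity not exceeding $\omega$, up to a multiplicative constant: for every compact $K\subset\Omega$ there is a constant $C$ (depending on $u$ and $K$) with $|u(x)-u(y)|\le C\,\omega(|x-y|)$ for all distinct $x,y\in K$ (for the continuous representative of $u$). Orlicz and Orlicz–Sobolev spaces: for measurable $E\subset\mathbb R^n$, $L^A(E)$ is the space of measurable real-valued $u$ on $E$ with finite Luxemburg norm $\|u\|_{L^A(E)}=\inf\{\lambda>0:\int_E A(|u|/\lambda)\,dx\le1\}$. $W^{1,A}(\Omega)$ is the set of weakly differentiable $u\in L^A(\Omega)$ with $|\nabla u|\in L^A(\Omega)$;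 $W^{1,A}_{\rm loc}(\Omega)$ is the set of measurable $u$ with $u\in W^{1,A}(\Omega')$ for every bounded open $\Omega'\subset\subset\Omega$. Weakly monotone: $u\in W^{1,1}_{\rm loc}(\Omega)$ is weakly monotone if for every open $\Omega'\subset\subset\Omega$ and every $m,M\in\mathbb R$ with $m\le M$ and $(u-M)_+-(m-u)_+\in W^{1,1}_0(\Omega')$, one has $m\le u\le M$ a.e. in $\Omega'$ (here $_+$ denotes positive part). *)

theory Defs
  imports "HOL-Analysis.Analysis"
begin

section \<open>Young functions\<close>

text \<open>A function on \<open>[0,\<infinity>)\<close> is represented by a function on \<open>real\<close> whose values at negative
  arguments are never used.\<close>

definition young_function :: "(real \<Rightarrow> ennreal) \<Rightarrow> bool" where
  "young_function A \<longleftrightarrow>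
     A 0 = 0 \<and>
     (\<forall>s\<ge>0. \<forall>t\<ge>0. \<forall>\<theta>\<in>{0..1}.
        A ((1 - \<theta>) * s + \<theta> * t) \<le> ennreal (1 - \<theta>) * A s + ennreal \<theta> * A t) \<and>
     (\<exists>s>0. \<exists>t>0. A s \<noteq> A t)"

text \<open>Subtraction on \<^typ>\<open>ennreal\<close> truncates at \<open>0\<close>. This does not change the supremum for
  \<open>A 0 = 0\<close>, because \<open>s = 0\<close> already contributes the value \<open>0\<close>.\<close>

definition young_conjugate :: "(real \<Rightarrow> ennreal) \<Rightarrow> real \<Rightarrow> ennreal" where
  "young_conjugate A t = (SUP s\<in>{0..}. ennreal (s * t) - A s)"

text \<open>Integrals with one unspecified endpoint only refer to the behaviour near the given one:
  convergence is required from some point on, divergence from every point on.\<close>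

definition finite_at_infinity :: "(real \<Rightarrow> ennreal) \<Rightarrow> bool" where
  "finite_at_infinity f \<longleftrightarrow> (\<exists>a>0. (\<integral>\<^sup>+t\<in>{a<..}. f t \<partial>lborel) < \<infinity>)"

definition infinite_at_infinity :: "(real \<Rightarrow> ennreal) \<Rightarrow> bool" where
  "infinite_at_infinity f \<longleftrightarrow> (\<forall>a>0. (\<integral>\<^sup>+t\<in>{a<..}. f t \<partial>lborel) = \<infinity>)"

definition finite_at_zero :: "(real \<Rightarrow> ennreal) \<Rightarrow> bool" where
  "finite_at_zero f \<longleftrightarrow> (\<exists>a>0. (\<integral>\<^sup>+t\<in>{0<..<a}. f t \<partial>lborel) < \<infinity>)"

text \<open>The exponent is meaningful for \<open>n \<ge> 3\<close>.
  A Young function is positive for all large arguments, so that \<open>t / A t\<close> is finite there (and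
  equals \<open>0\<close> where \<open>A t = \<infinity>\<close>); hence \<^const>\<open>enn2real\<close> loses no information near infinity.\<close>

definition growth_condition :: "nat \<Rightarrow> (real \<Rightarrow> ennreal) \<Rightarrow> bool" where
  "growth_condition n A \<longleftrightarrow>
     finite_at_infinity (\<lambda>t. ennreal (enn2real (ennreal t / A t) powr (1 / (real n - 2))))"

text \<open>\<open>A_sub n A\<close> is the function \<open>A\<close> with index \<open>n - 1\<close>; it is meant for \<open>n \<ge> 2\<close>.\<close>

definition A_sub :: "nat \<Rightarrow> (real \<Rightarrow> ennreal) \<Rightarrow> real \<Rightarrow> ennreal" where
  "A_sub n A =
     (if n = 2 then A
      else let p = (real n - 1) / (real n - 2) in
        young_conjugate (\<lambda>t. if t = 0 then 0
          else ennreal (t powr p) *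
            (\<integral>\<^sup>+r\<in>{t<..}. young_conjugate A r / ennreal (r powr (1 + p)) \<partial>lborel)))"

definition B_fun :: "nat \<Rightarrow> (real \<Rightarrow> ennreal) \<Rightarrow> real \<Rightarrow> ennreal" where
  "B_fun n A t =
     ennreal (t ^ n) * (\<integral>\<^sup>+s\<in>{0<..<t}. A_sub n A s / ennreal (s ^ (1 + n)) \<partial>lborel)"

definition right_inverse :: "(real \<Rightarrow> ennreal) \<Rightarrow> real \<Rightarrow> real" where
  "right_inverse B s = Inf {t. t \<ge> 0 \<and> ennreal s < B t}"

definition omega :: "nat \<Rightarrow> (real \<Rightarrow> ennreal) \<Rightarrow> real \<Rightarrow> real" where
  "omega n A r = r * right_inverse (B_fun n A) (1 / r ^ n)"

text \<open>\<open>A'\<close> is obtained from \<open>A\<close> by a modification near \<open>0\<close> (that is, \<open>A'\<close> and \<open>A\<close> agree near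
  infinity) which makes the integral defining \<open>B\<close> converge. If \<open>A\<close> already has this property,
  then \<open>A' = A\<close> is allowed.\<close>

definition admissible_modification :: "nat \<Rightarrow> (real \<Rightarrow> ennreal) \<Rightarrow> (real \<Rightarrow> ennreal) \<Rightarrow> bool" where
  "admissible_modification n A A' \<longleftrightarrow>
     young_function A' \<and> (\<exists>t0. \<forall>t\<ge>t0. A' t = A t) \<and>
     finite_at_zero (\<lambda>t. A_sub n A' t / ennreal (t ^ (1 + n)))"


section \<open>Orlicz spaces\<close>

text \<open>Functions on \<open>E\<close> are total functions whose values outside \<open>E\<close> are irrelevant.\<close>

definition luxemburg_norm ::
    "(real \<Rightarrow> ennreal) \<Rightarrow> (real^'n) set \<Rightarrow> (real^'n \<Rightarrow> real) \<Rightarrow> ennreal" where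
  "luxemburg_norm A E u =
     Inf {ennreal l | l. l > 0 \<and> (\<integral>\<^sup>+x. A (\<bar>u x\<bar> / l) \<partial>lebesgue_on E) \<le> 1}"

definition orlicz :: "(real \<Rightarrow> ennreal) \<Rightarrow> (real^'n) set \<Rightarrow> (real^'n \<Rightarrow> real) set" where
  "orlicz A E = {u \<in> borel_measurable (lebesgue_on E). luxemburg_norm A E u < \<infinity>}"


section \<open>Test functions and weak gradients\<close>

definition partial_deriv :: "'n \<Rightarrow> (real^'n \<Rightarrow> real) \<Rightarrow> real^'n \<Rightarrow> real" where
  "partial_deriv i f x = frechet_derivative f (at x) (axis i 1)"

fun C_k :: "nat \<Rightarrow> (real^'n \<Rightarrow> real) \<Rightarrow> bool" where
  "C_k 0 f \<longleftrightarrow> continuous_on UNIV f"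
| "C_k (Suc k) f \<longleftrightarrow> f differentiable_on UNIV \<and> (\<forall>i. C_k k (partial_deriv i f))"

definition test_functions :: "(real^'n) set \<Rightarrow> (real^'n \<Rightarrow> real) set" where
  "test_functions \<Omega> =
     {\<phi>. (\<forall>k. C_k k \<phi>) \<and> compact (closure {x. \<phi> x \<noteq> 0}) \<and> closure {x. \<phi> x \<noteq> 0} \<subseteq> \<Omega>}"

definition weak_gradient ::
    "(real^'n) set \<Rightarrow> (real^'n \<Rightarrow> real) \<Rightarrow> (real^'n \<Rightarrow> real^'n) \<Rightarrow> bool" where
  "weak_gradient \<Omega> u g \<longleftrightarrow>
     (\<forall>K. compact K \<and> K \<subseteq> \<Omega> \<longrightarrow> u absolutely_integrable_on K \<and> g absolutely_integrable_on K) \<and>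
     (\<forall>\<phi>\<in>test_functions \<Omega>. \<forall>i.
        (\<integral>x. u x * partial_deriv i \<phi> x \<partial>lebesgue_on \<Omega>) = - (\<integral>x. g x $ i * \<phi> x \<partial>lebesgue_on \<Omega>))"


section \<open>Sobolev spaces\<close>

definition compactly_inside :: "(real^'n) set \<Rightarrow> (real^'n) set \<Rightarrow> bool" where
  "compactly_inside \<Omega>' \<Omega> \<longleftrightarrow> compact (closure \<Omega>') \<and> closure \<Omega>' \<subseteq> \<Omega>"

definition W1_Orlicz :: "(real \<Rightarrow> ennreal) \<Rightarrow> (real^'n) set \<Rightarrow> (real^'n \<Rightarrow> real) set" where
  "W1_Orlicz A \<Omega> =
     {u \<in> orlicz A \<Omega>. \<exists>g. weak_gradient \<Omega> u g \<and> (\<lambda>x. norm (g x)) \<in> orlicz A \<Omega>}"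

definition W1_Orlicz_loc :: "(real \<Rightarrow> ennreal) \<Rightarrow> (real^'n) set \<Rightarrow> (real^'n \<Rightarrow> real) set" where
  "W1_Orlicz_loc A \<Omega> =
     {u \<in> borel_measurable (lebesgue_on \<Omega>).
        \<forall>\<Omega>'. open \<Omega>' \<and> bounded \<Omega>' \<and> compactly_inside \<Omega>' \<Omega> \<longrightarrow> u \<in> W1_Orlicz A \<Omega>'}"

definition W11 :: "(real^'n) set \<Rightarrow> (real^'n \<Rightarrow> real) set" where
  "W11 \<Omega> =
     {u. u absolutely_integrable_on \<Omega> \<and>
         (\<exists>g. weak_gradient \<Omega> u g \<and> g absolutely_integrable_on \<Omega>)}"

definition W11_loc :: "(real^'n) set \<Rightarrow> (real^'n \<Rightarrow> real) set" where
  "W11_loc \<Omega> =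
     {u \<in> borel_measurable (lebesgue_on \<Omega>).
        \<forall>\<Omega>'. open \<Omega>' \<and> bounded \<Omega>' \<and> compactly_inside \<Omega>' \<Omega> \<longrightarrow> u \<in> W11 \<Omega>'}"

definition W11_0 :: "(real^'n) set \<Rightarrow> (real^'n \<Rightarrow> real) set" where
  "W11_0 \<Omega> =
     {u. u absolutely_integrable_on \<Omega> \<and>
         (\<exists>g. weak_gradient \<Omega> u g \<and> g absolutely_integrable_on \<Omega> \<and>
           (\<exists>\<phi>. (\<forall>k::nat. \<phi> k \<in> test_functions \<Omega>) \<and>
             (\<lambda>k. \<integral>x. \<bar>u x - \<phi> k x\<bar> \<partial>lebesgue_on \<Omega>) \<longlonglongrightarrow> 0 \<and>
             (\<lambda>k. \<integral>x. norm (g x - (\<chi> i. partial_deriv i (\<phi> k) x)) \<partial>lebesgue_on \<Omega>) \<longlonglongrightarrow> 0))}"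

definition weakly_monotone :: "(real^'n) set \<Rightarrow> (real^'n \<Rightarrow> real) \<Rightarrow> bool" where
  "weakly_monotone \<Omega> u \<longleftrightarrow>
     u \<in> W11_loc \<Omega> \<and>
     (\<forall>\<Omega>' m M. open \<Omega>' \<and> compactly_inside \<Omega>' \<Omega> \<and> m \<le> M \<and>
        (\<lambda>x. max (u x - M) 0 - max (m - u x) 0) \<in> W11_0 \<Omega>' \<longrightarrow>
        (AE x in lebesgue_on \<Omega>'. m \<le> u x \<and> u x \<le> M))"


section \<open>Continuous representatives and moduli of continuity\<close>

definition continuous_representative ::
    "(real^'n) set \<Rightarrow> (real^'n \<Rightarrow> real) \<Rightarrow> (real^'n \<Rightarrow> real) \<Rightarrow> bool" where
  "continuous_representative \<Omega> u v \<longleftrightarrow>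
     continuous_on \<Omega> v \<and> (AE x in lebesgue_on \<Omega>. v x = u x)"

definition C_omega_loc :: "(real \<Rightarrow> real) \<Rightarrow> (real^'n) set \<Rightarrow> (real^'n \<Rightarrow> real) set" where
  "C_omega_loc \<omega> \<Omega> =
     {v. \<forall>K. compact K \<and> K \<subseteq> \<Omega> \<longrightarrow>
        (\<exists>C. \<forall>x\<in>K. \<forall>y\<in>K. x \<noteq> y \<longrightarrow> \<bar>v x - v y\<bar> \<le> C * \<omega> (norm (x - y)))}"

end

theory Submission
  imports Defs "HOL-Computational_Algebra.Polynomial"
begin

text \<open>
  By weak monotonicity, the oscillation of \<open>u\<close> on almost every cube is at most its oscillation on
  the boundary of the cube. On the faces, which have dimension \<open>n - 1\<close>, the difference of two
  values is bounded by the integral of the gradient against the Riesz kernel \<open>|y - z|\<^sup>2\<^sup>-\<^sup>n\<close>, and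
  Young's inequality with the integrand \<open>A (|grad u|)\<close> turns this into
  \<open>A\<^sub>n\<^sub>-\<^sub>1 (c osc / s) s\<^sup>n\<^sup>-\<^sup>1 \<le> \<beta> s\<close>, where \<open>\<beta>\<close> is integrable with respect to the half edge \<open>s\<close> of the
  cube. Since the oscillation increases with the cube, integration over \<open>r < s < R\<close> and the
  substitution \<open>t = c osc / s\<close> bound \<open>osc\<^sup>n\<close> times an integral of \<open>A\<^sub>n\<^sub>-\<^sub>1 t / t\<^sup>n\<^sup>+\<^sup>1\<close>, which says that
  the oscillation is at most a constant times \<open>\<omega> r\<close>. Divergence of the integral at infinity gives
  \<open>\<omega> r \<rightarrow> 0\<close>. All estimates are made for mollifications of \<open>u\<close>, and the integral over the boundary
  passes to the limit along a subsequence.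
\<close>

section \<open>Smooth functions\<close>

text \<open>Weak monotonicity speaks only of \<open>W11_0\<close>, that is, of limits of test
  functions, so the comparison on the boundary of a cube is made for smooth approximations. These
  are truncated at levels pushed outwards by \<open>\<delta> > 0\<close>: the truncation then
  vanishes near the boundary and extends by zero to a test function of the cube. The levels have to
  be values that \<open>u\<close> takes only on a null set, and \<open>\<delta>\<close> tends to
  \<open>0\<close> at the end. The estimates carry a free factor \<open>T > 0\<close>: the
  oscillation times \<open>T\<close> is bounded by a boundary integral plus a multiple of
  \<open>sub_kernel n A T\<close>, and the supremum over \<open>T\<close> is a Young conjugate,
  which gives \<open>A_sub\<close> up to a factor \<open>2\<close> in the argument. The subsequence
  that passes to the limit depends on the cube, so \<open>\<beta>\<close> is defined as a lower
  limit; Fatou's lemma bounds its integral by a number that depends neither on the kernels nor on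
  the centre of the cubes, and this uniformity gives a local modulus. Convergence of the integral of
  \<open>A_sub n A t / t ^ (n + 1)\<close> near \<open>0\<close> serves to add the range of small
  \<open>t\<close> that \<open>r < s < R\<close> does not reach.\<close>

definition smooth :: "(real^'n \<Rightarrow> real) \<Rightarrow> bool" where
  "smooth f \<longleftrightarrow> (\<forall>k. C_k k f)"

lemma smoothD: "smooth f \<Longrightarrow> C_k k f"
  by (simp add: smooth_def)

lemma C_k_SucD: "C_k (Suc k) f \<Longrightarrow> C_k k f"
proof (induction k arbitrary: f)
  case 0
  then show ?case by (auto intro: differentiable_imp_continuous_on)
next
  case (Suc k)
  then show ?case by (metis C_k.simps(2))
qed

lemma C_k_differentiable: "C_k (Suc k) f \<Longrightarrow> f differentiable at x"
  by (simp add: differentiable_on_def)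

lemma C_k_continuous: "C_k k f \<Longrightarrow> continuous_on UNIV f"
  by (cases k) (auto intro: differentiable_imp_continuous_on)

lemma smooth_differentiable: "smooth f \<Longrightarrow> f differentiable at x"
  using C_k_differentiable smoothD by blast

lemma smooth_continuous: "smooth f \<Longrightarrow> continuous_on S f"
  using C_k_continuous smoothD continuous_on_subset by blast

lemma smooth_partial_deriv: "smooth f \<Longrightarrow> smooth (partial_deriv i f)"
  unfolding smooth_def by (metis C_k.simps(2))

lemma partial_derivI:
  "(f has_derivative f') (at x) \<Longrightarrow> partial_deriv i f x = f' (axis i 1)"
  unfolding partial_deriv_def by (metis frechet_derivative_at)

lemma has_derivative_partial_deriv:
  assumes "f differentiable at x"
  shows "(f has_derivative (\<lambda>v. \<Sum>i\<in>UNIV. v $ i * partial_deriv i f x)) (at x)"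
proof -
  have D: "(f has_derivative frechet_derivative f (at x)) (at x)"
    using assms frechet_derivative_works by blast
  then have lin: "linear (frechet_derivative f (at x))"
    using has_derivative_linear by blast
  have "frechet_derivative f (at x) v = (\<Sum>i\<in>UNIV. v $ i * partial_deriv i f x)" for v
  proof -
    have "frechet_derivative f (at x) v = frechet_derivative f (at x) (\<Sum>i\<in>UNIV. v $ i *s axis i 1)"
      by (simp add: basis_expansion)
    also have "\<dots> = (\<Sum>i\<in>UNIV. frechet_derivative f (at x) (v $ i *\<^sub>R axis i 1))"
      by (simp add: linear_sum[OF lin] scalar_mult_eq_scaleR)
    also have "\<dots> = (\<Sum>i\<in>UNIV. v $ i * partial_deriv i f x)"
      by (simp add: linear_cmul[OF lin] partial_deriv_def)
    finally show ?thesis .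
  qed
  then have "frechet_derivative f (at x) = (\<lambda>v. \<Sum>i\<in>UNIV. v $ i * partial_deriv i f x)"
    by blast
  with D show ?thesis by simp
qed

lemma partial_deriv_const [simp]: "partial_deriv i (\<lambda>x. c) = (\<lambda>x. 0)"
  by (rule ext, subst partial_derivI[where f' = "\<lambda>x. 0"]) auto

lemma partial_deriv_add:
  assumes "f differentiable at x" "g differentiable at x"
  shows "partial_deriv i (\<lambda>x. f x + g x) x = partial_deriv i f x + partial_deriv i g x"
  using partial_derivI[OF has_derivative_add[OF assms[unfolded frechet_derivative_works]]]
  by (simp add: partial_deriv_def)

lemma partial_deriv_mult:
  assumes "f differentiable at x" "g differentiable at x"
  shows "partial_deriv i (\<lambda>x. f x * g x) x = f x * partial_deriv i g x + partial_deriv i f x * g x"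
  using partial_derivI[OF has_derivative_mult[OF assms[unfolded frechet_derivative_works]]]
  by (simp add: partial_deriv_def)

lemma partial_deriv_compose:
  assumes "f differentiable at x" "(h has_real_derivative d) (at (f x))"
  shows "partial_deriv i (\<lambda>x. h (f x)) x = d * partial_deriv i f x"
proof -
  have "((\<lambda>x. h (f x)) has_derivative (\<lambda>v. d * frechet_derivative f (at x) v)) (at x)"
    using has_derivative_compose[OF assms(1)[unfolded frechet_derivative_works]
        assms(2)[unfolded has_field_derivative_def]] by simp
  from partial_derivI[OF this] show ?thesis
    by (simp add: partial_deriv_def)
qed

lemma partial_deriv_cong_open:
  assumes "open S" "x \<in> S" "\<And>y. y \<in> S \<Longrightarrow> f y = g y"
  shows "partial_deriv i f x = partial_deriv i g x"
proof -
  have "(f has_derivative D) (at x) \<longleftrightarrow> (g has_derivative D) (at x)" for D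
    using has_derivative_transform_within_open[OF _ assms(1,2)] assms(3) by metis
  then show ?thesis
    unfolding partial_deriv_def frechet_derivative_def by simp
qed

text \<open>Lets the weak gradient be tested with \<open>\<phi> (x - y)\<close> as a function of
  \<open>y\<close>: the minus sign produced here cancels the one in \<open>weak_gradient\<close>,
  which leaves an identity between two convolutions.\<close>

lemma partial_deriv_reflect:
  assumes "f differentiable at (x - y)"
  shows "partial_deriv i (\<lambda>y. f (x - y)) y = - partial_deriv i f (x - y)"
proof -
  have D: "(f has_derivative frechet_derivative f (at (x - y))) (at (x - y))"
    using assms frechet_derivative_works by blast
  have "((\<lambda>y. f (x - y)) has_derivative (\<lambda>v. frechet_derivative f (at (x - y)) (- v))) (at y)"
    by (rule has_derivative_compose[where f = "\<lambda>y. x - y" and f' = uminus and s = UNIV, simplified])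
      (auto intro!: derivative_eq_intros D)
  from partial_derivI[OF this] show ?thesis
    using linear_neg[OF has_derivative_linear[OF D]]
    by (simp add: partial_deriv_def)
qed

lemma C_k_const [simp]: "C_k k (\<lambda>x. c)"
  by (induction k arbitrary: c) auto

lemma C_k_nth [simp]: "C_k k (\<lambda>x::real^'n. x $ j)"
proof (cases k)
  case (Suc l)
  have *: "((\<lambda>x::real^'n. x $ j) has_derivative (\<lambda>x. x $ j)) (at x)" for x
    by (simp add: bounded_linear_imp_has_derivative bounded_linear_vec_nth)
  have "partial_deriv i (\<lambda>x. x $ j) = (\<lambda>x. axis i 1 $ j)" for i :: 'n
    using partial_derivI[OF *] by blast
  moreover have "(\<lambda>x::real^'n. x $ j) differentiable_on UNIV"
    unfolding differentiable_on_def differentiable_def using * by blast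
  ultimately show ?thesis by (simp add: Suc)
qed (auto intro: continuous_intros)

lemma C_k_add: "C_k k f \<Longrightarrow> C_k k g \<Longrightarrow> C_k k (\<lambda>x. f x + g x)"
proof (induction k arbitrary: f g)
  case (Suc k)
  have "partial_deriv i (\<lambda>x. f x + g x) = (\<lambda>x. partial_deriv i f x + partial_deriv i g x)" for i
    using partial_deriv_add Suc.prems C_k_differentiable by blast
  with Suc show ?case by (auto intro: differentiable_on_add)
qed (auto intro: continuous_intros)

lemma C_k_mult: "C_k k f \<Longrightarrow> C_k k g \<Longrightarrow> C_k k (\<lambda>x. f x * g x)"
proof (induction k arbitrary: f g)
  case (Suc k)
  have "partial_deriv i (\<lambda>x. f x * g x) = (\<lambda>x. f x * partial_deriv i g x + partial_deriv i f x * g x)" for i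
    using partial_deriv_mult Suc.prems C_k_differentiable by blast
  moreover have "C_k k (\<lambda>x. f x * partial_deriv i g x + partial_deriv i f x * g x)" for i
    using Suc C_k_SucD by (intro C_k_add Suc.IH) auto
  ultimately show ?case using Suc.prems by (auto intro: differentiable_on_mult)
qed (auto intro: continuous_intros)

lemma C_k_sum: "(\<And>i. i \<in> I \<Longrightarrow> C_k k (f i)) \<Longrightarrow> C_k k (\<lambda>x. \<Sum>i\<in>I. f i x)"
  by (induction I rule: infinite_finite_induct) (auto intro: C_k_add)

text \<open>Differentiating the outer function \<open>H j\<close> produces \<open>H (Suc j)\<close>,
  so an induction on \<open>k\<close> needs all derivatives of the outer function at once; the
  family \<open>H\<close> lists them, and the claim is made for every \<open>j\<close>.\<close>

lemma C_k_compose: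
  assumes "\<And>j x. (H j has_real_derivative H (Suc j) x) (at x)" "C_k k f"
  shows "C_k k (\<lambda>x. H j (f x))"
  using assms(2)
proof (induction k arbitrary: j)
  case 0
  have "continuous_on UNIV (H j)"
    using assms(1) DERIV_continuous_on by blast
  with 0 show ?case
    using continuous_on_compose2 by (metis C_k.simps(1) subset_UNIV)
next
  case (Suc k)
  have "partial_deriv i (\<lambda>x. H j (f x)) = (\<lambda>x. H (Suc j) (f x) * partial_deriv i f x)" for i
    using partial_deriv_compose[OF _ assms(1)] Suc.prems C_k_differentiable by blast
  moreover have "C_k k (\<lambda>x. H (Suc j) (f x) * partial_deriv i f x)" for i
    using Suc C_k_SucD by (intro C_k_mult Suc.IH) auto
  moreover have "(\<lambda>x. H j (f x)) differentiable at x" for x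
    using differentiable_compose[of "H j" f x] C_k_differentiable[OF Suc.prems] assms(1)
      has_field_derivative_imp_has_derivative differentiable_def
    by (metis)
  ultimately show ?case by (simp add: differentiable_on_def)
qed

lemma C_k_reflect: "C_k k f \<Longrightarrow> C_k k (\<lambda>y. f (x - y))"
proof (induction k arbitrary: f)
  case 0
  then show ?case by (auto intro!: continuous_intros continuous_on_compose2[of UNIV f])
next
  case (Suc k)
  have d: "f differentiable at y" for y using Suc.prems C_k_differentiable by blast
  have "partial_deriv i (\<lambda>y. f (x - y)) = (\<lambda>y. (-1) * partial_deriv i f (x - y))" for i
    by (rule ext) (simp add: partial_deriv_reflect[OF d])
  moreover have "C_k k (\<lambda>y. (-1) * partial_deriv i f (x - y))" for i
    using Suc.prems by (intro C_k_mult C_k_const Suc.IH) simp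
  moreover have "(\<lambda>y. f (x - y)) differentiable at y" for y
    by (rule differentiable_compose[OF d]) simp
  ultimately show ?case by (simp add: differentiable_on_def)
qed

lemma smooth_const: "smooth (\<lambda>x. c)"
  and smooth_add: "smooth f \<Longrightarrow> smooth g \<Longrightarrow> smooth (\<lambda>x. f x + g x)"
  and smooth_mult: "smooth f \<Longrightarrow> smooth g \<Longrightarrow> smooth (\<lambda>x. f x * g x)"
  and smooth_reflect: "smooth f \<Longrightarrow> smooth (\<lambda>y. f (x - y))"
  by (auto simp: smooth_def C_k_add C_k_mult C_k_reflect)

lemma smooth_minus: "smooth f \<Longrightarrow> smooth g \<Longrightarrow> smooth (\<lambda>x. f x - g x)"
  using smooth_add[OF _ smooth_mult[OF smooth_const[of "-1"]]] by fastforce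

lemma partial_deriv_minus:
  assumes "smooth f" "smooth g"
  shows "partial_deriv i (\<lambda>x. f x - g x) x = partial_deriv i f x - partial_deriv i g x"
  using partial_derivI[OF has_derivative_diff[OF
    smooth_differentiable[OF assms(1), unfolded frechet_derivative_works]
    smooth_differentiable[OF assms(2), unfolded frechet_derivative_works]]]
  by (auto simp: partial_deriv_def)

text \<open>The open sets \<open>U\<close> and \<open>- Z\<close> cover the space; the extension
  equals \<open>F\<close> on the first and \<open>0\<close> on the second, so all derivatives are
  computed locally. With \<open>U\<close> a cube and \<open>Z\<close> a compact set inside it, this
  makes a truncated mollification into a test function of the cube.\<close>

lemma smooth_extend_zero:
  assumes "open U" "closed Z" "Z \<subseteq> U" "smooth F" "\<And>x. x \<in> U \<Longrightarrow> x \<notin> Z \<Longrightarrow> F x = 0"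
  shows "smooth (\<lambda>x. if x \<in> U then F x else 0)"
    and "partial_deriv i (\<lambda>x. if x \<in> U then F x else 0) = (\<lambda>x. if x \<in> U then partial_deriv i F x else 0)"
proof -
  have pd: "partial_deriv i (\<lambda>x. if x \<in> U then F x else 0) = (\<lambda>x. if x \<in> U then partial_deriv i F x else 0)"
    if z: "\<And>x. x \<in> U \<Longrightarrow> x \<notin> Z \<Longrightarrow> F x = 0" for F :: "real^'a \<Rightarrow> real" and i
  proof
    fix x show "partial_deriv i (\<lambda>x. if x \<in> U then F x else 0) x = (if x \<in> U then partial_deriv i F x else 0)"
    proof (cases "x \<in> U")
      case True
      then show ?thesis using partial_deriv_cong_open[OF assms(1) True, of "\<lambda>x. if x \<in> U then F x else 0" F] by simp
    next
      case False
      then have "x \<in> - Z" using assms(3) by auto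
      then show ?thesis
        using partial_deriv_cong_open[of "- Z" x "\<lambda>x. if x \<in> U then F x else 0" "\<lambda>_. 0" i] z False assms(2)
        by (simp add: open_Compl)
    qed
  qed
  then show "partial_deriv i (\<lambda>x. if x \<in> U then F x else 0) = (\<lambda>x. if x \<in> U then partial_deriv i F x else 0)"
    using assms(5) by blast
  \<comment> \<open>Stated for every \<open>F\<close>, since the induction step passes to
    \<open>partial_deriv i F\<close>, which again vanishes on the open set
    \<open>U - Z\<close>.\<close>
  have ck: "C_k k (\<lambda>x. if x \<in> U then F x else 0)"
    if "C_k k F" "\<And>x. x \<in> U \<Longrightarrow> x \<notin> Z \<Longrightarrow> F x = 0" for k F
    using that
  proof (induction k arbitrary: F)
    case 0
    have "isCont (\<lambda>x. if x \<in> U then F x else 0) x" for x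
    proof (cases "x \<in> U")
      case True
      have "\<forall>\<^sub>F x in nhds x. (if x \<in> U then F x else 0) = F x"
        using eventually_nhds_in_open[OF assms(1) True] by eventually_elim auto
      moreover have "isCont F x" using 0 by (simp add: continuous_on_eq_continuous_at)
      ultimately show ?thesis using isCont_cong[of "\<lambda>x. if x \<in> U then F x else 0" F x] by blast
    next
      case False
      then have "x \<in> - Z" using assms(3) by auto
      then have "\<forall>\<^sub>F x in nhds x. x \<in> - Z"
        using assms(2) eventually_nhds_in_open by blast
      then have "\<forall>\<^sub>F x in nhds x. (if x \<in> U then F x else 0) = 0"
        by eventually_elim (use 0 in auto)
      then show ?thesis using isCont_cong[of "\<lambda>x. if x \<in> U then F x else 0" "\<lambda>_. 0" x] by simp
    qed
    then show ?case by (simp add: continuous_at_imp_continuous_on)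
  next
    case (Suc k)
    have "(\<lambda>x. if x \<in> U then F x else 0) differentiable at x" for x
    proof (cases "x \<in> U")
      case True
      have "(F has_derivative frechet_derivative F (at x)) (at x)"
        using Suc.prems(1) C_k_differentiable frechet_derivative_works by blast
      from has_derivative_transform_within_open[OF this assms(1) True, of "\<lambda>x. if x \<in> U then F x else 0"]
      show ?thesis by (auto simp: differentiable_def)
    next
      case False
      then have "x \<in> - Z" using assms(3) by auto
      then have "((\<lambda>x. if x \<in> U then F x else 0) has_derivative (\<lambda>_. 0)) (at x)"
        using has_derivative_transform_within_open[OF has_derivative_const[of 0 "at x"] open_Compl[OF assms(2)],
            of "\<lambda>x. if x \<in> U then F x else 0"] Suc.prems(2) by simp
      then show ?thesis by (auto simp: differentiable_def)
    qed
    moreover have "C_k k (\<lambda>x. if x \<in> U then partial_deriv i F x else 0)" for i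
    proof (rule Suc.IH)
      show "C_k k (partial_deriv i F)" using Suc.prems by simp
      show "partial_deriv i F x = 0" if "x \<in> U" "x \<notin> Z" for x
        using partial_deriv_cong_open[of "U - Z" x F "\<lambda>_. 0" i] that Suc.prems(2) assms(1,2)
        by (auto simp: open_Diff)
    qed
    ultimately show ?case by (simp add: differentiable_on_def pd[OF Suc.prems(2)])
  qed
  show "smooth (\<lambda>x. if x \<in> U then F x else 0)"
    using ck assms(4,5) by (simp add: smooth_def)
qed

lemma test_functionsI:
  assumes "smooth f" "compact Z" "Z \<subseteq> \<Omega>" "\<And>x. x \<notin> Z \<Longrightarrow> f x = 0"
  shows "f \<in> test_functions \<Omega>"
proof -
  have *: "closure {x. f x \<noteq> 0} \<subseteq> Z"
    using assms(2,4) by (intro closure_minimal) (auto intro: compact_imp_closed)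
  then have "compact (closure {x. f x \<noteq> 0})"
    using assms(2) by (metis closed_closure compact_Int_closed inf.absorb_iff2)
  with * assms show ?thesis by (auto simp: test_functions_def smooth_def)
qed

section \<open>The function exp(-1/x) and its derivatives\<close>

definition flat :: "real poly \<Rightarrow> real \<Rightarrow> real" where
  "flat P x = (if x > 0 then poly P (1 / x) * exp (- (1 / x)) else 0)"

lemma poly_exp_tendsto_0: "((\<lambda>y. poly P y * exp (- y)) \<longlongrightarrow> (0::real)) at_top"
proof -
  have "((\<lambda>y. \<Sum>i\<le>degree P. coeff P i * (y ^ i / exp y)) \<longlongrightarrow> (\<Sum>i\<le>degree P. coeff P i * 0)) at_top"
    by (intro tendsto_intros tendsto_power_div_exp_0)
  then show ?thesis
    by (simp add: poly_altdef exp_minus sum_distrib_right field_simps sum_distrib_left)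
qed

text \<open>With \<open>y = 1 / x\<close>, the chain rule turns \<open>P y * exp (- y)\<close> into
  \<open>y\<^sup>2 * (P y - P' y) * exp (- y)\<close>, which explains the polynomial. At
  \<open>0\<close> the difference quotient carries one more factor \<open>y\<close>, and the
  exponential still wins.\<close>

lemma flat_has_derivative:
  "(flat P has_real_derivative flat (monom 1 2 * (P - pderiv P)) x) (at x)"
proof -
  consider "x > 0" | "x < 0" | "x = 0" by linarith
  then show ?thesis
  proof cases
    case 1
    have "((\<lambda>x. poly P (1 / x) * exp (- (1 / x))) has_real_derivative flat (monom 1 2 * (P - pderiv P)) x) (at x)"
      using 1 by (auto intro!: derivative_eq_intros simp: flat_def poly_monom field_simps power2_eq_square)
    then show ?thesis
      by (rule has_field_derivative_transform_within_open[where S = "{0<..}"]) (use 1 in \<open>auto simp: flat_def\<close>)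
  next
    case 2
    have "((\<lambda>x. 0) has_real_derivative flat (monom 1 2 * (P - pderiv P)) x) (at x)"
      using 2 by (auto simp: flat_def)
    then show ?thesis
      by (rule has_field_derivative_transform_within_open[where S = "{..<0}"]) (use 2 in \<open>auto simp: flat_def\<close>)
  next
    case 3
    have "((\<lambda>h. flat P h / h) \<longlongrightarrow> 0) (at_right 0)"
    proof -
      have "((\<lambda>h. poly (pCons 0 P) (inverse h) * exp (- inverse h)) \<longlongrightarrow> 0) (at_right (0::real))"
        using filterlim_compose[OF poly_exp_tendsto_0 filterlim_inverse_at_top_right] .
      moreover have "\<forall>\<^sub>F h in at_right (0::real). poly (pCons 0 P) (inverse h) * exp (- inverse h) = flat P h / h"
        using eventually_at_right_less[of "0::real"] by eventually_elim (auto simp: flat_def field_simps)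
      ultimately show ?thesis by (rule Lim_transform_eventually)
    qed
    moreover have "((\<lambda>h. flat P h / h) \<longlongrightarrow> 0) (at_left 0)"
      by (rule Lim_transform_eventually[of "\<lambda>_. 0"])
        (auto simp: flat_def eventually_at_filter)
    ultimately have "((\<lambda>h. flat P h / h) \<longlongrightarrow> 0) (at 0)"
      using filterlim_split_at by blast
    then show ?thesis
      using 3 by (simp add: DERIV_def flat_def)
  qed
qed

lemma C_k_flat:
  assumes "C_k k f" shows "C_k k (\<lambda>x. flat P (f x))"
proof -
  \<comment> \<open>The derivatives of \<open>flat P\<close> are again of this form, so iterating
    the map on polynomials gives the family that \<open>C_k_compose\<close> asks for.\<close>
  define H where "H j = flat (((\<lambda>P. monom 1 2 * (P - pderiv P)) ^^ j) P)" for j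
  have "C_k k (\<lambda>x. H 0 (f x))"
    by (rule C_k_compose[OF _ assms]) (simp add: H_def flat_has_derivative)
  then show ?thesis by (simp add: H_def)
qed

lemma smooth_flat: "smooth f \<Longrightarrow> smooth (\<lambda>x. flat P (f x))"
  by (simp add: smooth_def C_k_flat)

section \<open>Mollification\<close>

text \<open>A predicate rather than a fixed family of kernels: the approximation results hold for
  every kernel of small radius, so that one kernel can be chosen for a function and its gradient at
  once.\<close>

definition mollifier :: "real \<Rightarrow> (real^'n \<Rightarrow> real) \<Rightarrow> bool" where
  "mollifier r \<phi> \<longleftrightarrow> smooth \<phi> \<and> (\<forall>x. \<phi> x \<ge> 0) \<and> (\<forall>x. r \<le> norm x \<longrightarrow> \<phi> x = 0) \<and>
     integrable lborel \<phi> \<and> (\<integral>x. \<phi> x \<partial>lborel) = 1"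

text \<open>\<open>flat 1 (r\<^sup>2 - |x|\<^sup>2)\<close> is positive exactly in the ball of
  radius \<open>r\<close>. The squared norm is written as a sum over coordinates, so that smoothness
  follows from the closure properties of \<open>C_k\<close>; the integral can be normalised because
  an open ball is not a null set.\<close>

lemma mollifier_exists:
  assumes "r > 0"
  shows "\<exists>\<phi> :: real^'n \<Rightarrow> real. mollifier r \<phi>"
proof -
  define \<phi> :: "real^'n \<Rightarrow> real" where "\<phi> x = flat 1 (r\<^sup>2 + (-1) * (\<Sum>i\<in>UNIV. x $ i * x $ i))" for x
  have \<phi>: "\<phi> x = flat 1 (r\<^sup>2 - (norm x)\<^sup>2)" for x
    unfolding \<phi>_def power2_norm_eq_inner by (simp add: inner_vec_def)
  have sm: "smooth \<phi>"
    unfolding \<phi>_def smooth_def by (intro allI C_k_flat C_k_add C_k_mult C_k_sum C_k_const C_k_nth)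
  have pos: "\<phi> x \<ge> 0" for x by (simp add: \<phi> flat_def)
  have pos0: "\<phi> x > 0" if "norm x < r" for x
  proof -
    have "0 < r\<^sup>2 - (norm x)\<^sup>2"
      using power_strict_mono[OF that norm_ge_zero, of 2] by simp
    then show ?thesis unfolding \<phi> flat_def by simp
  qed
  have supp: "\<phi> x = 0" if "r \<le> norm x" for x
  proof -
    have "\<not> 0 < r\<^sup>2 - (norm x)\<^sup>2"
      using power_mono[OF that, of 2] assms by linarith
    then show ?thesis unfolding \<phi> flat_def by (rule if_not_P)
  qed
  have "integrable lborel (\<lambda>x. indicator (cball 0 r) x *\<^sub>R \<phi> x)"
    by (rule borel_integrable_compact[OF compact_cball smooth_continuous[OF sm]])
  moreover have "(\<lambda>x. indicator (cball 0 r) x *\<^sub>R \<phi> x) = \<phi>"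
    using supp by (auto simp: indicator_def fun_eq_iff)
  ultimately have int: "integrable lborel \<phi>" by simp
  define c where "c = (\<integral>x. \<phi> x \<partial>lborel)"
  have "c \<noteq> 0"
  proof
    assume "c = 0"
    then have "AE x in lborel. \<phi> x = 0"
      using integral_nonneg_eq_0_iff_AE[OF int] pos c_def by auto
    then have "AE x in lborel. x \<notin> ball (0::real^'n) r"
      by eventually_elim (use pos0 in force)
    then have "ball (0::real^'n) r \<in> null_sets lborel"
      by (simp add: AE_iff_null_sets)
    then have "negligible (ball (0::real^'n) r)"
      by (simp add: negligible_iff_null_sets null_sets_completionI)
    moreover have "\<not> negligible (ball (0::real^'n) r)"
      using assms by (intro open_not_negligible) auto
    ultimately show False by simp
  qed
  moreover have "c \<ge> 0" unfolding c_def using pos by (simp add: integral_nonneg_AE)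
  ultimately have "c > 0" by simp
  have "smooth (\<lambda>x. (1 / c) * \<phi> x)"
    by (intro smooth_mult smooth_const sm)
  then have "mollifier r (\<lambda>x. (1 / c) * \<phi> x)"
    unfolding mollifier_def using pos supp int \<open>c > 0\<close> by (simp add: c_def[symmetric])
  then show ?thesis by blast
qed

text \<open>Partial derivatives of a mollifier serve as kernels as well. They lose sign and
  normalisation but keep smoothness and bounded support, and these two suffice for differentiating a
  convolution.\<close>

definition bump :: "(real^'n \<Rightarrow> real) \<Rightarrow> bool" where
  "bump \<phi> \<longleftrightarrow> smooth \<phi> \<and> (\<exists>R. \<forall>x. R < norm x \<longrightarrow> \<phi> x = 0)"

lemma bump_partial_deriv:
  assumes "bump \<phi>" shows "bump (partial_deriv i \<phi>)"
proof -
  obtain R where R: "\<And>x. R < norm x \<Longrightarrow> \<phi> x = 0" using assms by (auto simp: bump_def)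
  have "partial_deriv i \<phi> x = 0" if "R < norm x" for x
    using partial_deriv_cong_open[of "{x. R < norm x}" x \<phi> "\<lambda>_. 0" i] that R
    by (simp add: open_Collect_less continuous_on_norm_id)
  then show ?thesis using assms smooth_partial_deriv unfolding bump_def by blast
qed

lemma mollifier_bump: "mollifier r \<phi> \<Longrightarrow> bump \<phi>"
  unfolding mollifier_def bump_def by (meson less_imp_le)

lemma bump_bounded:
  assumes "bump \<phi>" obtains B where "\<And>x. \<bar>\<phi> x\<bar> \<le> B"
proof -
  obtain R where R: "\<And>x. R < norm x \<Longrightarrow> \<phi> x = 0" using assms by (auto simp: bump_def)
  have "compact (\<phi> ` cball 0 R)"
    using assms by (intro compact_continuous_image smooth_continuous) (auto simp: bump_def)
  then obtain B where B: "\<And>x. x \<in> cball 0 R \<Longrightarrow> \<bar>\<phi> x\<bar> \<le> B"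
    by (metis bounded_real compact_imp_bounded image_eqI)
  have "\<bar>\<phi> x\<bar> \<le> max B 0" for x
    using B[of x] R[of x] by (cases "norm x \<le> R") auto
  then show thesis using that by blast
qed

text \<open>The modulus is taken on a ball enlarged by \<open>1\<close>, and the distance is kept
  below \<open>1\<close>: two such points either both lie in that ball, or \<open>\<phi>\<close>
  vanishes at both.\<close>

lemma bump_uniformly_continuous:
  assumes "bump \<phi>" "e > 0"
  obtains d where "d > 0" "\<And>x y. dist x y < d \<Longrightarrow> \<bar>\<phi> x - \<phi> y\<bar> < e"
proof -
  obtain R where R: "\<And>x. R < norm x \<Longrightarrow> \<phi> x = 0" using assms by (auto simp: bump_def)
  have "uniformly_continuous_on (cball 0 (R + 1)) \<phi>"
    using assms by (intro compact_uniformly_continuous smooth_continuous) (auto simp: bump_def)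
  then obtain d where d: "d > 0" "\<And>x y. x \<in> cball 0 (R + 1) \<Longrightarrow> y \<in> cball 0 (R + 1) \<Longrightarrow> dist y x < d \<Longrightarrow> dist (\<phi> y) (\<phi> x) < e"
    unfolding uniformly_continuous_on_def using \<open>e > 0\<close> by metis
  show thesis
  proof (rule that[of "min d 1"])
    show "min d 1 > 0" using d by simp
    fix x y :: "real^'a" assume xy: "dist x y < min d 1"
    show "\<bar>\<phi> x - \<phi> y\<bar> < e"
    proof (cases "norm x \<le> R \<or> norm y \<le> R")
      case True
      have "\<bar>norm x - norm y\<bar> < 1" using xy norm_triangle_ineq3[of x y] by (simp add: dist_norm)
      with True have "x \<in> cball 0 (R + 1)" "y \<in> cball 0 (R + 1)" by auto
      then show ?thesis using d(2)[of y x] xy by (simp add: dist_real_def)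
    next
      case False
      then show ?thesis using R[of x] R[of y] \<open>e > 0\<close> by simp
    qed
  qed
qed

text \<open>The mean value estimate along a segment, with the uniform continuity of the partial
  derivatives; dividing \<open>e\<close> by the dimension pays for the sum over the coordinates.
  Uniformity in \<open>x\<close> allows the expansion to be integrated over \<open>x\<close>, both
  for convolutions and for integrals of derivatives.\<close>

lemma bump_uniformly_differentiable:
  fixes \<phi> :: "real^'n \<Rightarrow> real"
  assumes "bump \<phi>" "e > 0"
  obtains d where "d > 0"
    "\<And>x v. norm v < d \<Longrightarrow> \<bar>\<phi> (x + v) - \<phi> x - (\<Sum>i\<in>UNIV. v $ i * partial_deriv i \<phi> x)\<bar> \<le> e * norm v"
proof -
  define e' where "e' = e / real CARD('n)"
  have "e' > 0" using assms by (simp add: e'_def)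
  have "\<exists>d>0. \<forall>x y. dist x y < d \<longrightarrow> \<bar>partial_deriv i \<phi> x - partial_deriv i \<phi> y\<bar> < e'" for i
    using bump_uniformly_continuous[OF bump_partial_deriv[OF assms(1)] \<open>e' > 0\<close>, of i] by metis
  then obtain d where d: "\<And>i. d i > 0"
    "\<And>i x y. dist x y < d i \<Longrightarrow> \<bar>partial_deriv i \<phi> x - partial_deriv i \<phi> y\<bar> < e'" by metis
  define dm where "dm = Min (range d)"
  have dm: "dm > 0" "dm \<le> d i" for i using d(1) by (auto simp: dm_def)
  have sm: "smooth \<phi>" using assms by (simp add: bump_def)
  show thesis
  proof (rule that[OF dm(1)])
    fix x v :: "real^'n" assume v: "norm v < dm"
    let ?D = "\<lambda>x v. \<Sum>i\<in>UNIV. v $ i * partial_deriv i \<phi> x"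
    have "norm (\<phi> (x + v) - \<phi> x - ?D x ((x + v) - x)) \<le> norm ((x + v) - x) * e"
    proof (rule differentiable_bound_linearization[where S = "closed_segment x (x + v)" and f' = ?D])
      show "x + t *\<^sub>R (x + v - x) \<in> closed_segment x (x + v)" if "t \<in> {0..1}" for t
        using that by (auto simp: closed_segment_def algebra_simps)
      show "(\<phi> has_derivative ?D y) (at y within closed_segment x (x + v))" for y
        using has_derivative_partial_deriv[OF smooth_differentiable[OF sm]] has_derivative_at_withinI by blast
      show "x \<in> closed_segment x (x + v)" by simp
      fix y assume y: "y \<in> closed_segment x (x + v)"
      then have yx: "dist y x < dm"
        using v segment_bound1[OF y] by (simp add: dist_norm norm_minus_commute)
      show "onorm (?D y - ?D x) \<le> e"
      proof (rule onorm_le)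
        fix w
        have "\<bar>(?D y - ?D x) w\<bar> = \<bar>\<Sum>i\<in>UNIV. w $ i * (partial_deriv i \<phi> y - partial_deriv i \<phi> x)\<bar>"
          by (simp add: sum_subtractf[symmetric] algebra_simps)
        also have "\<dots> \<le> (\<Sum>i\<in>UNIV. \<bar>w $ i * (partial_deriv i \<phi> y - partial_deriv i \<phi> x)\<bar>)"
          by (rule sum_abs)
        also have "\<dots> \<le> (\<Sum>i\<in>(UNIV::'n set). norm w * e')"
        proof (rule sum_mono)
          fix i
          have "\<bar>partial_deriv i \<phi> y - partial_deriv i \<phi> x\<bar> \<le> e'"
            using d(2)[of y x i] yx dm(2)[of i] by linarith
          then show "\<bar>w $ i * (partial_deriv i \<phi> y - partial_deriv i \<phi> x)\<bar> \<le> norm w * e'"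
            unfolding abs_mult by (intro mult_mono component_le_norm_cart) auto
        qed
        also have "\<dots> = e * norm w" by (simp add: e'_def)
        finally show "norm ((?D y - ?D x) w) \<le> e * norm w" by simp
      qed
    qed
    then show "\<bar>\<phi> (x + v) - \<phi> x - ?D x v\<bar> \<le> e * norm v" by (simp add: mult.commute)
  qed
qed

section \<open>Convolution with a smooth kernel\<close>

definition conv :: "(real^'n \<Rightarrow> real) \<Rightarrow> (real^'n \<Rightarrow> 'b::{banach, second_countable_topology}) \<Rightarrow> real^'n \<Rightarrow> 'b" where
  "conv \<phi> h x = (\<integral>y. \<phi> (x - y) *\<^sub>R h y \<partial>lborel)"

lemma bump_measurable: "bump \<phi> \<Longrightarrow> \<phi> \<in> borel_measurable borel"
  using borel_measurable_continuous_onI smooth_continuous bump_def by blast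

lemma conv_integrable:
  fixes h :: "real^'n \<Rightarrow> 'b::{banach, second_countable_topology}"
  assumes "bump \<phi>" "integrable lborel h"
  shows "integrable lborel (\<lambda>y. \<phi> (x - y) *\<^sub>R h y)"
proof -
  obtain B where B: "\<And>x. \<bar>\<phi> x\<bar> \<le> B" using bump_bounded assms(1) by blast
  have [measurable]: "\<phi> \<in> borel_measurable borel" using assms(1) by (rule bump_measurable)
  have [measurable]: "h \<in> borel_measurable borel" using assms(2) by auto
  show ?thesis
  proof (rule Bochner_Integration.integrable_bound)
    show "integrable lborel (\<lambda>y. B *\<^sub>R h y)" using assms(2) by simp
    show "AE y in lborel. norm (\<phi> (x - y) *\<^sub>R h y) \<le> norm (B *\<^sub>R h y)"
      using order_trans[OF B abs_ge_self] by (intro AE_I2) (simp add: mult_right_mono)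
  qed measurable
qed

text \<open>All derivatives fall on the kernel. The first order expansion of \<open>\<phi>\<close>
  has a remainder that is uniform in the point, so it integrates against \<open>h\<close> with the
  factor \<open>I\<close>, the integral of \<open>|h|\<close>; dividing by \<open>I + 1\<close>
  covers the case \<open>I = 0\<close>.\<close>

lemma conv_has_derivative:
  fixes h :: "real^'n \<Rightarrow> real"
  assumes "bump \<phi>" "integrable lborel h"
  shows "(conv \<phi> h has_derivative (\<lambda>v. \<Sum>i\<in>UNIV. v $ i * conv (partial_deriv i \<phi>) h x)) (at x)"
  unfolding has_derivative_at_alt
proof (intro conjI allI impI)
  show "bounded_linear (\<lambda>v. \<Sum>i\<in>UNIV. v $ i * conv (partial_deriv i \<phi>) h x)"
    by (intro bounded_linear_sum bounded_linear_mult_const bounded_linear_vec_nth)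
  fix e :: real assume "e > 0"
  define I where "I = (\<integral>y. \<bar>h y\<bar> \<partial>lborel)"
  have "I \<ge> 0" by (simp add: I_def)
  obtain d where d: "d > 0"
    "\<And>x v. norm v < d \<Longrightarrow> \<bar>\<phi> (x + v) - \<phi> x - (\<Sum>i\<in>UNIV. v $ i * partial_deriv i \<phi> x)\<bar> \<le> e / (I + 1) * norm v"
    using bump_uniformly_differentiable[OF assms(1), of "e / (I + 1)"] \<open>e > 0\<close> \<open>I \<ge> 0\<close> by auto
  show "\<exists>d>0. \<forall>y. norm (y - x) < d \<longrightarrow> norm (conv \<phi> h y - conv \<phi> h x - (\<Sum>i\<in>UNIV. (y - x) $ i * conv (partial_deriv i \<phi>) h x)) \<le> e * norm (y - x)"
  proof (intro exI[of _ d] conjI allI impI d(1))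
    fix y assume y: "norm (y - x) < d"
    let ?E = "\<lambda>z. \<phi> (y - z) - \<phi> (x - z) - (\<Sum>i\<in>UNIV. (y - x) $ i * partial_deriv i \<phi> (x - z))"
    have int: "integrable lborel (\<lambda>z. \<phi> (y - z) * h z)" for y
      using conv_integrable[OF assms] by simp
    have int': "integrable lborel (\<lambda>z. partial_deriv i \<phi> (y - z) * h z)" for y i
      using conv_integrable[OF bump_partial_deriv[OF assms(1)] assms(2)] by simp
    have "conv \<phi> h y - conv \<phi> h x - (\<Sum>i\<in>UNIV. (y - x) $ i * conv (partial_deriv i \<phi>) h x)
        = (\<integral>z. \<phi> (y - z) * h z - \<phi> (x - z) * h z - (\<Sum>i\<in>UNIV. (y - x) $ i * (partial_deriv i \<phi> (x - z) * h z)) \<partial>lborel)"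
      unfolding conv_def using int int' by simp
    also have "\<dots> = (\<integral>z. ?E z * h z \<partial>lborel)"
      by (simp add: algebra_simps sum_distrib_left sum_distrib_right)
    also have "norm \<dots> \<le> (\<integral>z. e / (I + 1) * norm (y - x) * \<bar>h z\<bar> \<partial>lborel)"
    proof (rule Bochner_Integration.integral_norm_bound_integral)
      have "integrable lborel (\<lambda>z. \<phi> (y - z) * h z - \<phi> (x - z) * h z - (\<Sum>i\<in>UNIV. (y - x) $ i * (partial_deriv i \<phi> (x - z) * h z)))"
        using int int' by simp
      then show "integrable lborel (\<lambda>z. ?E z * h z)"
        by (simp add: algebra_simps sum_distrib_left sum_distrib_right)
      show "integrable lborel (\<lambda>z. e / (I + 1) * norm (y - x) * \<bar>h z\<bar>)"
        using assms(2) by simp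
      fix z
      have "\<bar>?E z\<bar> \<le> e / (I + 1) * norm (y - x)"
        using d(2)[OF y, of "x - z"] by (simp add: algebra_simps)
      then show "norm (?E z * h z) \<le> e / (I + 1) * norm (y - x) * \<bar>h z\<bar>"
        unfolding real_norm_def abs_mult by (intro mult_right_mono abs_ge_zero)
    qed
    also have "\<dots> = e * norm (y - x) * (I / (I + 1))"
      using assms(2) by (simp add: I_def)
    also have "\<dots> \<le> e * norm (y - x) * 1"
      using \<open>e > 0\<close> \<open>I \<ge> 0\<close> by (intro mult_left_mono) auto
    finally show "norm (conv \<phi> h y - conv \<phi> h x - (\<Sum>i\<in>UNIV. (y - x) $ i * conv (partial_deriv i \<phi>) h x)) \<le> e * norm (y - x)"
      by simp
  qed
qed

lemma partial_deriv_conv: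
  fixes h :: "real^'n \<Rightarrow> real"
  assumes "bump \<phi>" "integrable lborel h"
  shows "partial_deriv i (conv \<phi> h) = conv (partial_deriv i \<phi>) h"
proof
  fix x
  have "(\<Sum>j\<in>UNIV. axis i 1 $ j * conv (partial_deriv j \<phi>) h x) = conv (partial_deriv i \<phi>) h x"
    by (simp add: axis_def if_distrib[of "\<lambda>c. c * _"] cong: if_cong)
  then show "partial_deriv i (conv \<phi> h) x = conv (partial_deriv i \<phi>) h x"
    using partial_derivI[OF conv_has_derivative[OF assms]] by metis
qed

lemma smooth_conv:
  fixes h :: "real^'n \<Rightarrow> real"
  assumes "bump \<phi>" "integrable lborel h"
  shows "smooth (conv \<phi> h)"
proof -
  have df: "conv \<phi> h differentiable_on UNIV" if "bump \<phi>" for \<phi>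
    using conv_has_derivative[OF that assms(2)] by (auto simp: differentiable_on_def differentiable_def)
  have "C_k k (conv \<phi> h)" for k
    using assms(1)
  proof (induction k arbitrary: \<phi>)
    case 0
    then show ?case using df differentiable_imp_continuous_on by (simp add: differentiable_imp_continuous_on)
  next
    case (Suc k)
    then show ?case using df by (simp add: partial_deriv_conv[OF _ assms(2)] bump_partial_deriv)
  qed
  then show ?thesis by (simp add: smooth_def)
qed

section \<open>Invariance of Lebesgue measure and mass of a convolution\<close>

lemma lborel_distr_reflect:
  "distr lborel borel (\<lambda>y. x - y) = (lborel :: 'a::euclidean_space measure)"
  by (subst (2) lborel_affine[of "-1" x]) (auto simp: density_1)

lemma nn_integral_reflect:
  fixes f :: "'a::euclidean_space \<Rightarrow> ennreal"
  assumes "f \<in> borel_measurable borel"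
  shows "(\<integral>\<^sup>+y. f (x - y) \<partial>lborel) = (\<integral>\<^sup>+y. f y \<partial>lborel)"
  by (subst (2) lborel_distr_reflect[of x, symmetric], subst nn_integral_distr) (use assms in auto)

lemma nn_integral_translate:
  fixes f :: "'a::euclidean_space \<Rightarrow> ennreal"
  assumes "f \<in> borel_measurable borel"
  shows "(\<integral>\<^sup>+y. f (y - x) \<partial>lborel) = (\<integral>\<^sup>+y. f y \<partial>lborel)"
  by (subst (2) lborel_distr_plus[of "-x", symmetric], subst nn_integral_distr) (use assms in auto)

lemma conv_commute:
  fixes h :: "real^'n \<Rightarrow> 'b::{banach, second_countable_topology}"
  assumes [measurable]: "bump \<phi>" "integrable lborel h"
  shows "conv \<phi> h x = (\<integral>y. \<phi> y *\<^sub>R h (x - y) \<partial>lborel)"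
proof -
  have [measurable]: "\<phi> \<in> borel_measurable borel" using assms(1) by (rule bump_measurable)
  have [measurable]: "h \<in> borel_measurable borel" using assms(2) by auto
  have "conv \<phi> h x = (\<integral>y. \<phi> (x - y) *\<^sub>R h y \<partial>distr lborel borel (\<lambda>y. x - y))"
    by (simp add: conv_def lborel_distr_reflect)
  also have "\<dots> = (\<integral>y. \<phi> y *\<^sub>R h (x - y) \<partial>lborel)"
    by (subst integral_distr) auto
  finally show ?thesis .
qed

text \<open>The counterpart of \<open>conv\<close> for densities with values in
  \<open>ennreal\<close>; densities such as \<open>A (|g|)\<close>, which may be infinite, are
  averaged with it.\<close>

definition conv_nn :: "(real^'n \<Rightarrow> real) \<Rightarrow> (real^'n \<Rightarrow> ennreal) \<Rightarrow> real^'n \<Rightarrow> ennreal" where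
  "conv_nn \<phi> h x = (\<integral>\<^sup>+y. ennreal (\<phi> (x - y)) * h y \<partial>lborel)"

lemma conv_nn_measurable [measurable]:
  assumes [measurable]: "\<phi> \<in> borel_measurable borel" "h \<in> borel_measurable borel"
  shows "conv_nn \<phi> h \<in> borel_measurable borel"
proof -
  have "(\<lambda>x. \<integral>\<^sup>+y. ennreal (\<phi> (x - y)) * h y \<partial>lborel) \<in> borel_measurable borel"
    by measurable
  then show ?thesis by (simp add: conv_nn_def[abs_def])
qed

lemma mollifier_nn_integral:
  "mollifier r \<phi> \<Longrightarrow> (\<integral>\<^sup>+x. ennreal (\<phi> x) \<partial>lborel) = 1"
  by (simp add: mollifier_def nn_integral_eq_integral)

text \<open>Tonelli and the unit mass of the kernel. That mollified densities keep their total mass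
  makes later bounds independent of the kernel.\<close>

lemma nn_integral_conv_nn:
  assumes \<phi>: "mollifier r \<phi>" and [measurable]: "h \<in> borel_measurable borel"
  shows "(\<integral>\<^sup>+x. conv_nn \<phi> h x \<partial>lborel) = (\<integral>\<^sup>+x. h x \<partial>lborel)"
proof -
  have [measurable]: "\<phi> \<in> borel_measurable borel" by (rule bump_measurable[OF mollifier_bump[OF \<phi>]])
  have "(\<integral>\<^sup>+x. conv_nn \<phi> h x \<partial>lborel) = (\<integral>\<^sup>+y. \<integral>\<^sup>+x. ennreal (\<phi> (x - y)) * h y \<partial>lborel \<partial>lborel)"
    unfolding conv_nn_def by (rule lborel_pair.Fubini') measurable
  also have "\<dots> = (\<integral>\<^sup>+y. h y \<partial>lborel)"
  proof (rule nn_integral_cong)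
    fix y
    have "(\<integral>\<^sup>+x. ennreal (\<phi> (x - y)) * h y \<partial>lborel) = (\<integral>\<^sup>+x. ennreal (\<phi> (x - y)) \<partial>lborel) * h y"
      by (rule nn_integral_multc) measurable
    also have "(\<integral>\<^sup>+x. ennreal (\<phi> (x - y)) \<partial>lborel) = 1"
      using nn_integral_translate[of "\<lambda>x. ennreal (\<phi> x)" y] mollifier_nn_integral[OF \<phi>] by simp
    finally show "(\<integral>\<^sup>+x. ennreal (\<phi> (x - y)) * h y \<partial>lborel) = h y" by simp
  qed
  finally show ?thesis .
qed

lemma norm_conv_le:
  assumes "mollifier r \<phi>" "integrable lborel h"
  shows "ennreal (norm (conv \<phi> h x)) \<le> conv_nn \<phi> (\<lambda>y. ennreal (norm (h y))) x"
proof -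
  have "ennreal (norm (conv \<phi> h x)) \<le> (\<integral>\<^sup>+y. norm (\<phi> (x - y) *\<^sub>R h y) \<partial>lborel)"
    unfolding conv_def
    by (rule integral_norm_bound_ennreal[OF conv_integrable[OF mollifier_bump[OF assms(1)] assms(2)]])
  also have "\<dots> = conv_nn \<phi> (\<lambda>y. ennreal (norm (h y))) x"
    using assms(1) by (simp add: conv_nn_def mollifier_def ennreal_mult)
  finally show ?thesis .
qed

text \<open>A density argument. The indicator of a set \<open>A\<close> is enclosed by a compact
  \<open>K\<close> and an open \<open>U\<close> with \<open>K \<subseteq> A \<subseteq> U\<close>:
  if \<open>|y|\<close> is less than the distance from \<open>K\<close> to the complement of
  \<open>U\<close> and \<open>A\<close> contains exactly one of \<open>x\<close> and
  \<open>x - y\<close>, then one of these points lies in \<open>U - K\<close>, a set of small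
  measure.\<close>

lemma translation_continuous_L1:
  fixes h :: "real^'n \<Rightarrow> 'b::{banach, second_countable_topology}"
  assumes "integrable lborel h"
  shows "\<forall>e>0. \<exists>d>0. \<forall>y. norm y < d \<longrightarrow> (\<integral>\<^sup>+x. norm (h (x - y) - h x) \<partial>lborel) \<le> ennreal e"
  using assms
proof (induction rule: integrable_induct)
  case (base A c)
  show ?case
  proof (intro allI impI)
    fix e :: real assume "e > 0"
    \<comment> \<open>Three approximations cost \<open>e'\<close> each, \<open>U - K\<close> is
      counted once for \<open>x\<close> and once for \<open>x - y\<close>, and the jump has norm
      \<open>norm c\<close>; the \<open>+ 1\<close> covers \<open>c = 0\<close>.\<close>
    define e' where "e' = e / (6 * (norm c + 1))"
    have e': "e' > 0" using \<open>e > 0\<close> by (simp add: e'_def add_nonneg_pos)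
    have A: "A \<in> sets lebesgue" "A \<in> sets borel" using base by auto
    obtain U where U: "open U" "A \<subseteq> U" "emeasure lebesgue (U - A) < ennreal e'"
      using sets_lebesgue_outer_open[OF A(1) e'] by metis
    obtain T where T: "closed T" "T \<subseteq> A" "emeasure lebesgue (A - T) < ennreal e'"
      using sets_lebesgue_inner_closed[OF A(1) e'] by metis
    have [measurable]: "T \<in> sets borel" using T by auto
    \<comment> \<open>The closed set \<open>T\<close> is cut off by a large ball; the measure of
      what is lost tends to \<open>0\<close> by continuity from above, because \<open>A\<close> has
      finite measure.\<close>
    obtain K where K: "compact K" "K \<subseteq> T" "emeasure lborel (T - K) < ennreal e'"
    proof -
      have fin: "emeasure lborel (T - cball 0 (real i)) \<noteq> \<infinity>" for i
        using emeasure_mono[of "T - cball 0 (real i)" A lborel] T(2) base A(2)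
        by (metis Diff_subset order.trans infinity_ennreal_def neq_top_trans sets_lborel top.not_eq_extremum)
      have "(\<lambda>i. emeasure lborel (T - cball 0 (real i))) \<longlonglongrightarrow> emeasure lborel (\<Inter>i. T - cball 0 (real i))"
        using fin by (intro Lim_emeasure_decseq) (auto simp: decseq_def)
      moreover have "(\<Inter>i. T - cball 0 (real i)) = {}"
        using real_arch_simple by auto
      ultimately have "(\<lambda>i. emeasure lborel (T - cball 0 (real i))) \<longlonglongrightarrow> 0"
        by (metis emeasure_empty)
      then have "\<forall>\<^sub>F i in sequentially. emeasure lborel (T - cball 0 (real i)) < ennreal e'"
        using e' by (intro order_tendstoD) auto
      then obtain i where "emeasure lborel (T - cball 0 (real i)) < ennreal e'"
        by (meson eventually_sequentially order_refl)
      moreover have "T - cball 0 (real i) = T - (T \<inter> cball 0 (real i))" by auto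
      ultimately show thesis
        using that[of "T \<inter> cball 0 (real i)"] T(1) closed_Int_compact[OF T(1) compact_cball] by auto
    qed
    have [measurable]: "U \<in> sets borel" "T \<in> sets borel" "K \<in> sets borel" "A \<in> sets borel"
      using U T K A by (auto intro: borel_compact)
    have UK: "emeasure lborel (U - K) \<le> ennreal (3 * e')"
    proof -
      have "emeasure lborel (U - K) \<le> emeasure lborel ((U - A) \<union> (A - T) \<union> (T - K))"
        by (rule emeasure_mono) auto
      also have "\<dots> \<le> emeasure lborel (U - A) + emeasure lborel (A - T) + emeasure lborel (T - K)"
        by (intro order_trans[OF emeasure_subadditive] add_mono emeasure_subadditive) auto
      also have "\<dots> \<le> ennreal e' + ennreal e' + ennreal e'"
        using U T K by (intro add_mono) (auto simp: less_imp_le)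
      finally show ?thesis using e' by (simp flip: ennreal_plus)
    qed
    obtain d where d: "d > 0" "\<And>x y. x \<in> K \<Longrightarrow> dist x y < d \<Longrightarrow> y \<in> U"
    proof -
      have "K \<subseteq> U" using K T U by blast
      then obtain d where "d > 0" "(\<Union>x\<in>K. ball x d) \<subseteq> U"
        by (rule compact_subset_open_imp_ball_epsilon_subset[OF K(1) U(1)])
      then show thesis by (intro that[of d]) (auto simp: subset_eq)
    qed
    show "\<exists>d>0. \<forall>y. norm y < d \<longrightarrow> (\<integral>\<^sup>+x. norm (indicat_real A (x - y) *\<^sub>R c - indicat_real A x *\<^sub>R c) \<partial>lborel) \<le> ennreal e"
    proof (intro exI[of _ d] conjI allI impI d(1))
      fix y :: "real^'n" assume y: "norm y < d"
      have pw: "ennreal (norm (indicat_real A (x - y) *\<^sub>R c - indicat_real A x *\<^sub>R c))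
          \<le> ennreal (norm c) * (indicator (U - K) x + indicator (U - K) (x - y))" for x
      proof -
        have "x \<in> U - K \<or> x - y \<in> U - K" if "(x \<in> A) \<noteq> (x - y \<in> A)"
          using that d(2)[of x "x - y"] d(2)[of "x - y" x] y K(2) T(2) U(2)
          by (auto simp: dist_norm)
        then have "ennreal (norm (indicat_real A (x - y) *\<^sub>R c - indicat_real A x *\<^sub>R c))
            \<le> ennreal (norm c) * (if x \<in> U - K \<or> x - y \<in> U - K then 1 else 0)"
          by (auto simp: indicator_def)
        also have "\<dots> \<le> ennreal (norm c) * (indicator (U - K) x + indicator (U - K) (x - y))"
          by (intro mult_left_mono) (auto simp: indicator_def)
        finally show ?thesis .
      qed
      have "(\<integral>\<^sup>+x. norm (indicat_real A (x - y) *\<^sub>R c - indicat_real A x *\<^sub>R c) \<partial>lborel)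
         \<le> (\<integral>\<^sup>+x. ennreal (norm c) * (indicator (U - K) x + indicator (U - K) (x - y)) \<partial>lborel)"
        by (rule nn_integral_mono) (rule pw)
      also have "\<dots> = ennreal (norm c) * (emeasure lborel (U - K) + (\<integral>\<^sup>+x. indicator (U - K) (x - y) \<partial>lborel))"
        by (simp add: nn_integral_cmult nn_integral_add)
      also have "(\<integral>\<^sup>+x. indicator (U - K) (x - y) \<partial>lborel) = emeasure lborel (U - K)"
        using nn_integral_translate[of "indicator (U - K)" y] by simp
      also have "ennreal (norm c) * (emeasure lborel (U - K) + emeasure lborel (U - K))
          \<le> ennreal (norm c) * (ennreal (3 * e') + ennreal (3 * e'))"
        by (intro mult_left_mono add_mono UK) auto
      also have "\<dots> = ennreal (norm c * (6 * e'))"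
      proof -
        have "ennreal (3 * e') + ennreal (3 * e') = ennreal (6 * e')"
          using e' by (subst ennreal_plus[symmetric]) auto
        then show ?thesis using e' by (subst ennreal_mult) auto
      qed
      also have "\<dots> \<le> ennreal e"
      proof (rule ennreal_leI)
        have "norm c + 1 > 0" by (simp add: add_nonneg_pos)
        then have "e = (norm c + 1) * (6 * e')" by (simp add: e'_def field_simps)
        moreover have "norm c * (6 * e') \<le> (norm c + 1) * (6 * e')"
          using e' by (intro mult_right_mono) auto
        ultimately show "norm c * (6 * e') \<le> e" by simp
      qed
      finally show "(\<integral>\<^sup>+x. norm (indicat_real A (x - y) *\<^sub>R c - indicat_real A x *\<^sub>R c) \<partial>lborel) \<le> ennreal e" .
    qed
  qed
next
  case (add f g)
  have [measurable]: "f \<in> borel_measurable borel" "g \<in> borel_measurable borel"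
    using add by auto
  show ?case
  proof (intro allI impI)
    fix e :: real assume "e > 0"
    then have e2: "e / 2 > 0" by simp
    obtain d1 where d1: "d1 > 0"
      "\<And>y. norm y < d1 \<Longrightarrow> (\<integral>\<^sup>+x. norm (f (x - y) - f x) \<partial>lborel) \<le> ennreal (e / 2)"
      using add.IH(1) e2 by blast
    obtain d2 where d2: "d2 > 0"
      "\<And>y. norm y < d2 \<Longrightarrow> (\<integral>\<^sup>+x. norm (g (x - y) - g x) \<partial>lborel) \<le> ennreal (e / 2)"
      using add.IH(2) e2 by blast
    note d = d1 d2
    show "\<exists>d>0. \<forall>y. norm y < d \<longrightarrow> (\<integral>\<^sup>+x. norm (f (x - y) + g (x - y) - (f x + g x)) \<partial>lborel) \<le> ennreal e"
    proof (intro exI[of _ "min d1 d2"] conjI allI impI)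
      fix y :: "real^'n" assume y: "norm y < min d1 d2"
      have "(\<integral>\<^sup>+x. norm (f (x - y) + g (x - y) - (f x + g x)) \<partial>lborel)
        \<le> (\<integral>\<^sup>+x. ennreal (norm (f (x - y) - f x)) + ennreal (norm (g (x - y) - g x)) \<partial>lborel)"
      proof (rule nn_integral_mono)
        fix x
        have "norm (f (x - y) + g (x - y) - (f x + g x)) \<le> norm (f (x - y) - f x) + norm (g (x - y) - g x)"
          using norm_triangle_ineq[of "f (x - y) - f x" "g (x - y) - g x"] by (simp add: add_diff_add)
        then show "ennreal (norm (f (x - y) + g (x - y) - (f x + g x))) \<le> ennreal (norm (f (x - y) - f x)) + ennreal (norm (g (x - y) - g x))"
          by (simp flip: ennreal_plus)
      qed
      also have "\<dots> = (\<integral>\<^sup>+x. norm (f (x - y) - f x) \<partial>lborel) + (\<integral>\<^sup>+x. norm (g (x - y) - g x) \<partial>lborel)"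
        by (rule nn_integral_add) auto
      also have "\<dots> \<le> ennreal (e / 2) + ennreal (e / 2)"
        using d y by (intro add_mono) auto
      also have "\<dots> = ennreal e" using \<open>e > 0\<close> by (simp flip: ennreal_plus)
      finally show "(\<integral>\<^sup>+x. norm (f (x - y) + g (x - y) - (f x + g x)) \<partial>lborel) \<le> ennreal e" .
    qed (use d in auto)
  qed
next
  case (lim f s)
  have f[measurable]: "f \<in> borel_measurable borel" using lim by auto
  have s[measurable]: "s i \<in> borel_measurable borel" for i using lim.hyps(1)[of i] by auto
  show ?case
  proof (intro allI impI)
    fix e :: real assume "e > 0"
    have "(\<lambda>i. \<integral>\<^sup>+x. norm (f x - s i x) \<partial>lborel) \<longlonglongrightarrow> 0"
    proof (rule nn_integral_dominated_convergence_norm[where w = "\<lambda>x. 2 * norm (f x)"])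
      have "integrable lborel (\<lambda>x. 2 * norm (f x))" using lim.hyps(4) by simp
      then show "(\<integral>\<^sup>+x. ennreal (2 * norm (f x)) \<partial>lborel) < \<infinity>"
        by (simp add: integrable_iff_bounded ennreal_mult nn_integral_cmult ennreal_mult_less_top)
    qed (use lim in auto)
    then have "(\<lambda>i. \<integral>\<^sup>+x. norm (s i x - f x) \<partial>lborel) \<longlonglongrightarrow> 0"
      by (simp add: norm_minus_commute)
    then have "\<forall>\<^sub>F i in sequentially. (\<integral>\<^sup>+x. norm (s i x - f x) \<partial>lborel) < ennreal (e / 3)"
      using \<open>e > 0\<close> by (intro order_tendstoD) auto
    then obtain i where i: "(\<integral>\<^sup>+x. norm (s i x - f x) \<partial>lborel) \<le> ennreal (e / 3)"
      by (meson eventually_sequentially less_imp_le order_refl)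
    obtain d where d: "d > 0" "\<And>y. norm y < d \<Longrightarrow> (\<integral>\<^sup>+x. norm (s i (x - y) - s i x) \<partial>lborel) \<le> ennreal (e / 3)"
    proof -
      have "e / 3 > 0" using \<open>e > 0\<close> by simp
      then show thesis using lim.IH(1)[of i] that by blast
    qed
    show "\<exists>d>0. \<forall>y. norm y < d \<longrightarrow> (\<integral>\<^sup>+x. norm (f (x - y) - f x) \<partial>lborel) \<le> ennreal e"
    proof (intro exI[of _ d] conjI allI impI d(1))
      fix y :: "real^'n" assume y: "norm y < d"
      have "(\<integral>\<^sup>+x. norm (f (x - y) - f x) \<partial>lborel)
        \<le> (\<integral>\<^sup>+x. ennreal (norm (s i (x - y) - f (x - y))) + (ennreal (norm (s i (x - y) - s i x)) + ennreal (norm (s i x - f x))) \<partial>lborel)"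
      proof (rule nn_integral_mono)
        fix x
        have "norm (f (x - y) - f x) \<le> norm (s i (x - y) - f (x - y)) + (norm (s i (x - y) - s i x) + norm (s i x - f x))"
          by norm
        then show "ennreal (norm (f (x - y) - f x)) \<le> ennreal (norm (s i (x - y) - f (x - y))) + (ennreal (norm (s i (x - y) - s i x)) + ennreal (norm (s i x - f x)))"
          by (simp flip: ennreal_plus)
      qed
      also have "\<dots> = (\<integral>\<^sup>+x. norm (s i (x - y) - f (x - y)) \<partial>lborel) + ((\<integral>\<^sup>+x. norm (s i (x - y) - s i x) \<partial>lborel) + (\<integral>\<^sup>+x. norm (s i x - f x) \<partial>lborel))"
        by (subst nn_integral_add; (subst nn_integral_add)?) auto
      also have "(\<integral>\<^sup>+x. norm (s i (x - y) - f (x - y)) \<partial>lborel) = (\<integral>\<^sup>+x. norm (s i x - f x) \<partial>lborel)"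
        by (rule nn_integral_translate[of "\<lambda>x. ennreal (norm (s i x - f x))"]) measurable
      also have "\<dots> + ((\<integral>\<^sup>+x. norm (s i (x - y) - s i x) \<partial>lborel) + (\<integral>\<^sup>+x. norm (s i x - f x) \<partial>lborel))
          \<le> ennreal (e / 3) + (ennreal (e / 3) + ennreal (e / 3))"
        by (intro add_mono i d(2) y)
      also have "\<dots> = ennreal e" using \<open>e > 0\<close> by (simp flip: ennreal_plus)
      finally show "(\<integral>\<^sup>+x. norm (f (x - y) - f x) \<partial>lborel) \<le> ennreal e" .
    qed
  qed
qed

text \<open>\<open>conv \<phi> h - h\<close> is the average of \<open>h (x - y) - h x\<close>
  against \<open>\<phi> y\<close>, since \<open>\<phi>\<close> has integral \<open>1\<close>. After
  Tonelli only translations with \<open>|y| < d\<close> count, as \<open>\<phi>\<close> vanishes at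
  the others.\<close>

lemma conv_L1_close:
  fixes h :: "real^'n \<Rightarrow> 'b::{banach, second_countable_topology}"
  assumes h: "integrable lborel h" and "e > 0"
  obtains d where "d > 0"
    "\<And>\<phi>. mollifier d \<phi> \<Longrightarrow> (\<integral>\<^sup>+x. norm (conv \<phi> h x - h x) \<partial>lborel) \<le> ennreal e"
proof -
  have [measurable]: "h \<in> borel_measurable borel" using h by auto
  obtain d where d: "d > 0" "\<And>y. norm y < d \<Longrightarrow> (\<integral>\<^sup>+x. norm (h (x - y) - h x) \<partial>lborel) \<le> ennreal e"
    using translation_continuous_L1[OF h] \<open>e > 0\<close> by blast
  show thesis
  proof (rule that[OF d(1)])
    fix \<phi> :: "real^'n \<Rightarrow> real" assume \<phi>: "mollifier d \<phi>"
    have b: "bump \<phi>" using \<phi> by (rule mollifier_bump)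
    have [measurable]: "\<phi> \<in> borel_measurable borel" by (rule bump_measurable[OF b])
    have p: "\<phi> y \<ge> 0" "integrable lborel \<phi>" "integral\<^sup>L lborel \<phi> = 1" "d \<le> norm y \<Longrightarrow> \<phi> y = 0" for y
      using \<phi> by (auto simp: mollifier_def)
    have int: "integrable lborel (\<lambda>y. \<phi> y *\<^sub>R h (x - y))" for x
    proof -
      have "integrable (distr lborel borel (\<lambda>y. x - y)) (\<lambda>y. \<phi> (x - y) *\<^sub>R h y)"
        unfolding lborel_distr_reflect by (rule conv_integrable[OF b h])
      then show ?thesis by (subst (asm) integrable_distr_eq) auto
    qed
    have "ennreal (norm (conv \<phi> h x - h x)) \<le> (\<integral>\<^sup>+y. \<phi> y * norm (h (x - y) - h x) \<partial>lborel)" for x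
    proof -
      have "conv \<phi> h x - h x = (\<integral>y. \<phi> y *\<^sub>R h (x - y) - \<phi> y *\<^sub>R h x \<partial>lborel)"
        by (subst Bochner_Integration.integral_diff) (use int p conv_commute[OF b h] in auto)
      also have "ennreal (norm \<dots>) \<le> (\<integral>\<^sup>+y. norm (\<phi> y *\<^sub>R h (x - y) - \<phi> y *\<^sub>R h x) \<partial>lborel)"
        by (rule integral_norm_bound_ennreal) (use int p in auto)
      also have "\<dots> = (\<integral>\<^sup>+y. \<phi> y * norm (h (x - y) - h x) \<partial>lborel)"
        using p(1) by (simp flip: scaleR_diff_right)
      finally show ?thesis .
    qed
    then have "(\<integral>\<^sup>+x. norm (conv \<phi> h x - h x) \<partial>lborel) \<le> (\<integral>\<^sup>+x. \<integral>\<^sup>+y. \<phi> y * norm (h (x - y) - h x) \<partial>lborel \<partial>lborel)"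
      by (intro nn_integral_mono)
    also have "\<dots> = (\<integral>\<^sup>+y. \<integral>\<^sup>+x. \<phi> y * norm (h (x - y) - h x) \<partial>lborel \<partial>lborel)"
      by (rule lborel_pair.Fubini') measurable
    also have "\<dots> = (\<integral>\<^sup>+y. \<phi> y * (\<integral>\<^sup>+x. norm (h (x - y) - h x) \<partial>lborel) \<partial>lborel)"
      using p(1) by (simp add: ennreal_mult nn_integral_cmult)
    also have "\<dots> \<le> (\<integral>\<^sup>+y. \<phi> y * ennreal e \<partial>lborel)"
    proof (rule nn_integral_mono)
      fix y show "\<phi> y * (\<integral>\<^sup>+x. norm (h (x - y) - h x) \<partial>lborel) \<le> \<phi> y * ennreal e"
        using d(2)[of y] p(4)[of y] by (cases "norm y < d") (auto intro: mult_left_mono)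
    qed
    also have "\<dots> = ennreal e"
      using mollifier_nn_integral[OF \<phi>] by (simp add: nn_integral_multc)
    finally show "(\<integral>\<^sup>+x. norm (conv \<phi> h x - h x) \<partial>lborel) \<le> ennreal e" .
  qed
qed

section \<open>Young functions\<close>

lemma young_zero: "young_function A \<Longrightarrow> A 0 = 0"
  by (simp add: young_function_def)

lemma young_convex:
  "young_function A \<Longrightarrow> 0 \<le> s \<Longrightarrow> 0 \<le> t \<Longrightarrow> 0 \<le> \<theta> \<Longrightarrow> \<theta> \<le> 1 \<Longrightarrow>
     A ((1 - \<theta>) * s + \<theta> * t) \<le> ennreal (1 - \<theta>) * A s + ennreal \<theta> * A t"
  by (simp add: young_function_def)

lemma young_scale:
  "young_function A \<Longrightarrow> 0 \<le> t \<Longrightarrow> 0 \<le> \<theta> \<Longrightarrow> \<theta> \<le> 1 \<Longrightarrow> A (\<theta> * t) \<le> ennreal \<theta> * A t"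
  using young_convex[of A 0 t \<theta>] young_zero[of A] by simp

lemma young_mono:
  assumes "young_function A" "0 \<le> s" "s \<le> t"
  shows "A s \<le> A t"
proof (cases "t = 0")
  case False
  then have t: "t > 0" using assms by linarith
  have "A s = A ((s / t) * t)" using t by simp
  also have "\<dots> \<le> ennreal (s / t) * A t"
    using assms t by (intro young_scale) auto
  also have "\<dots> \<le> 1 * A t"
    using assms t by (intro mult_right_mono) (auto simp: ennreal_le_1)
  finally show ?thesis by simp
qed (use assms in auto)

lemma borel_measurable_mono_ennreal:
  fixes f :: "real \<Rightarrow> ennreal"
  assumes "mono f" shows "f \<in> borel_measurable borel"
proof (rule borel_measurableI_greater)
  fix y
  define S where "S = {x. y < f x}"
  have up: "x \<in> S" if "z \<in> S" "z \<le> x" for x z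
    using that monoD[OF assms that(2)] by (auto simp: S_def)
  consider "S = {}" | "\<not> bdd_below S" | "S \<noteq> {}" "bdd_below S" by blast
  then have "S \<in> sets borel"
  proof cases
    case 2
    then have "S = UNIV" using up by (auto simp: bdd_below_def) (meson linorder_le_cases)
    then show ?thesis by simp
  next
    case 3
    have "x \<in> S" if "Inf S < x" for x
      using that up by (metis cInf_less_iff[OF 3] less_imp_le)
    moreover have "Inf S \<le> x" if "x \<in> S" for x using that 3 by (simp add: cInf_lower)
    ultimately have "S = {Inf S..} \<or> S = {Inf S<..}"
      by (cases "Inf S \<in> S") (force simp: order_le_less)+
    then show ?thesis by (metis borel_closed borel_open closed_atLeast open_greaterThan)
  qed simp
  then show "{x \<in> space borel. y < f x} \<in> sets borel" by (simp add: S_def)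
qed

text \<open>The values of \<open>A\<close> at negative arguments are arbitrary, so measurability is
  available only after composition with the absolute value. This is why \<open>\<bar>t\<bar>\<close>
  appears in many integrands below.\<close>

lemma young_measurable [measurable]:
  assumes "young_function A" shows "(\<lambda>t. A \<bar>t\<bar>) \<in> borel_measurable borel"
proof -
  have "(\<lambda>t. A (max 0 t)) \<in> borel_measurable borel"
    by (intro borel_measurable_mono_ennreal monoI young_mono[OF assms]) auto
  then have "(\<lambda>t. A (max 0 \<bar>t\<bar>)) \<in> borel_measurable borel"
    by (rule measurable_compose[rotated]) auto
  then show ?thesis by simp
qed

lemma young_ex_finite:
  assumes "young_function A" obtains a where "a > 0" "A a < \<infinity>"
proof -
  obtain s t where "s > 0" "t > 0" "A s \<noteq> A t"
    using assms by (auto simp: young_function_def)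
  then have "A s < \<infinity> \<or> A t < \<infinity>" by (metis infinity_ennreal_def top.not_eq_extremum)
  then show thesis using that \<open>s > 0\<close> \<open>t > 0\<close> by blast
qed

text \<open>Convexity between \<open>x\<close> and \<open>z\<close>, multiplied by
  \<open>z - x\<close> so that no quotient is left and \<open>x = z\<close> is included. Finiteness
  at \<open>z\<close> passes to \<open>x\<close> and \<open>y\<close> by monotonicity, which permits
  real arithmetic.\<close>

lemma young_three_points:
  assumes A: "young_function A" and xyz: "0 \<le> x" "x \<le> y" "y \<le> z" "A z < \<infinity>"
  shows "(z - x) * enn2real (A y) \<le> (z - y) * enn2real (A x) + (y - x) * enn2real (A z)"
proof (cases "x = z")
  case False
  then have "x < z" using xyz by linarith
  define \<theta> where "\<theta> = (y - x) / (z - x)"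
  have \<theta>: "0 \<le> \<theta>" "\<theta> \<le> 1" "(1 - \<theta>) * x + \<theta> * z = y"
  proof -
    show "0 \<le> \<theta>" "\<theta> \<le> 1" using xyz \<open>x < z\<close> by (auto simp: \<theta>_def)
    have "\<theta> * (z - x) = y - x" using \<open>x < z\<close> by (simp add: \<theta>_def)
    then show "(1 - \<theta>) * x + \<theta> * z = y" by (simp add: algebra_simps)
  qed
  have fin: "A x < \<infinity>" "A y < \<infinity>"
    using young_mono[OF A xyz(1), of z] young_mono[OF A _ xyz(3)] xyz by (auto intro: order.strict_trans1)
  obtain a b c where abc: "A x = ennreal a" "A y = ennreal b" "A z = ennreal c" "a \<ge> 0" "b \<ge> 0" "c \<ge> 0"
    using fin xyz(4) by (metis ennreal_cases infinity_ennreal_def order_less_irrefl)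
  have "ennreal b \<le> ennreal (1 - \<theta>) * ennreal a + ennreal \<theta> * ennreal c"
    using young_convex[OF A xyz(1), of z \<theta>] \<theta> xyz abc by simp
  also have "\<dots> = ennreal ((1 - \<theta>) * a + \<theta> * c)"
    using \<theta> abc by (simp add: ennreal_mult ennreal_plus)
  finally have "b \<le> (1 - \<theta>) * a + \<theta> * c"
    using \<theta> abc by (subst (asm) ennreal_le_iff) auto
  then have "(z - x) * b \<le> (z - x) * ((1 - \<theta>) * a + \<theta> * c)"
    using \<open>x < z\<close> by (intro mult_left_mono) auto
  also have "\<dots> = ((z - x) - (z - x) * \<theta>) * a + ((z - x) * \<theta>) * c"
    by (simp add: algebra_simps)
  also have "(z - x) * \<theta> = y - x" using \<open>x < z\<close> by (simp add: \<theta>_def)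
  finally show ?thesis using abc by simp
qed (use xyz in auto)

section \<open>Young conjugates\<close>

lemma conjugate_mono:
  assumes "s \<le> t" shows "young_conjugate A s \<le> young_conjugate A t"
  unfolding young_conjugate_def
proof (rule SUP_mono)
  fix r :: real assume "r \<in> {0..}"
  then show "\<exists>m\<in>{0..}. ennreal (r * s) - A r \<le> ennreal (m * t) - A m"
    using assms by (intro bexI[of _ r] ennreal_minus_mono ennreal_leI mult_left_mono) auto
qed

lemma conjugate_measurable [measurable]: "young_conjugate A \<in> borel_measurable borel"
  by (intro borel_measurable_mono_ennreal monoI conjugate_mono)

text \<open>Moving \<open>K s\<close> to the other side removes the truncated subtraction and stays
  correct when \<open>K s\<close> or \<open>c\<close> is infinite. Upper bounds of conjugates are
  proved in this form below.\<close>

lemma conjugate_le_iff: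
  "young_conjugate K t \<le> c \<longleftrightarrow> (\<forall>s\<ge>0. ennreal (s * t) \<le> K s + c)"
proof -
  have "ennreal (s * t) - K s \<le> c \<longleftrightarrow> ennreal (s * t) \<le> K s + c" for s
    by (simp add: ennreal_minus_le_iff)
  then show ?thesis by (auto simp: young_conjugate_def SUP_le_iff)
qed

lemma young_inequality: "0 \<le> s \<Longrightarrow> ennreal (s * t) \<le> A s + young_conjugate A t"
  using conjugate_le_iff by blast

text \<open>A Young function may have a finite left limit at a point where it is infinite, and then
  it exceeds its biconjugate at that point. Halving the argument leaves room for a line below the
  graph: its slope \<open>T\<close> is that of a chord from \<open>a / 2\<close> to some
  \<open>b \<le> a\<close> where \<open>A\<close> is finite.\<close>

lemma biconjugate_ge:
  assumes A: "young_function A" and "a > 0"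
  shows "A (a / 2) \<le> young_conjugate (young_conjugate A) a"
proof (cases "\<exists>b>a / 2. A b < \<infinity>")
  case True
  define \<alpha> where "\<alpha> = a / 2"
  have "\<alpha> > 0" using assms by (simp add: \<alpha>_def)
  obtain b0 where "b0 > \<alpha>" "A b0 < \<infinity>" using True \<alpha>_def by blast
  define b where "b = min b0 a"
  have b: "b > \<alpha>" "b \<le> a" "A b < \<infinity>"
    using \<open>b0 > \<alpha>\<close> \<open>A b0 < \<infinity>\<close> young_mono[OF A, of b b0] \<open>a > 0\<close>
    by (auto simp: b_def \<alpha>_def intro: order.strict_trans1)
  define f where "f t = enn2real (A t)" for t
  have f: "A t = ennreal (f t)" if "A t < \<infinity>" for t using that by (simp add: f_def)
  have f_nonneg: "f t \<ge> 0" for t by (simp add: f_def)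
  have fin_\<alpha>: "A \<alpha> < \<infinity>"
    using young_mono[OF A, of \<alpha> b] b \<open>\<alpha> > 0\<close> by (auto intro: order.strict_trans1)
  have f_mono: "f s \<le> f t" if "0 \<le> s" "s \<le> t" "A t < \<infinity>" for s t
    using young_mono[OF A that(1,2)] that(3) by (auto simp: f_def intro!: enn2real_mono)
  have three: "(z - x) * f y \<le> (z - y) * f x + (y - x) * f z"
    if "0 \<le> x" "x \<le> y" "y \<le> z" "A z < \<infinity>" for x y z
    using young_three_points[OF A that] by (simp add: f_def)
  define T where "T = (f b - f \<alpha>) / (b - \<alpha>)"
  have T: "T * (b - \<alpha>) = f b - f \<alpha>" using b by (simp add: T_def)
  have "T \<ge> 0" using f_mono[of \<alpha> b] b \<open>\<alpha> > 0\<close> by (simp add: T_def)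
  \<comment> \<open>The line through the points over \<open>\<alpha>\<close> and \<open>b\<close>
    lies below \<open>f\<close> outside \<open>[\<alpha>, b]\<close>. Lowered to the line of slope
    \<open>T\<close> through \<open>(b, f \<alpha>)\<close>, it lies below \<open>f\<close>
    everywhere, inside the interval by monotonicity.\<close>
  have key: "s * T \<le> f s + (T * b - f \<alpha>)" if "s \<ge> 0" "A s < \<infinity>" for s
  proof -
    consider "s \<le> \<alpha>" | "\<alpha> \<le> s" "s \<le> b" | "b \<le> s" by linarith
    then show ?thesis
    proof cases
      case 1
      have "(b - s) * f \<alpha> \<le> (b - \<alpha>) * f s + (\<alpha> - s) * f b"
        using three[of s \<alpha> b] that 1 b by simp
      also have "\<dots> = (b - \<alpha>) * f s + (\<alpha> - s) * (f \<alpha> + T * (b - \<alpha>))"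
        using T by simp
      finally have "(b - \<alpha>) * (f \<alpha>) \<le> (b - \<alpha>) * (f s + (\<alpha> - s) * T)"
        by (simp add: algebra_simps)
      then have "f \<alpha> \<le> f s + (\<alpha> - s) * T" using b by simp
      moreover have "\<alpha> * T \<le> b * T" using b \<open>T \<ge> 0\<close> by (intro mult_right_mono) auto
      ultimately show ?thesis by (simp add: algebra_simps)
    next
      case 2
      have "f \<alpha> \<le> f s" using f_mono[of \<alpha> s] 2 \<open>\<alpha> > 0\<close> that by simp
      moreover have "s * T \<le> b * T" using 2 \<open>T \<ge> 0\<close> by (intro mult_right_mono) auto
      ultimately show ?thesis by (simp add: algebra_simps)
    next
      case 3
      have "(s - \<alpha>) * f b \<le> (s - b) * f \<alpha> + (b - \<alpha>) * f s"
        using three[of \<alpha> b s] that 3 b \<open>\<alpha> > 0\<close> by simp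
      then have "(s - \<alpha>) * (f \<alpha> + T * (b - \<alpha>)) \<le> (s - b) * f \<alpha> + (b - \<alpha>) * f s"
        using T by simp
      then have "(b - \<alpha>) * (f \<alpha> + (s - \<alpha>) * T) \<le> (b - \<alpha>) * f s"
        by (simp add: algebra_simps)
      then have "f \<alpha> + (s - \<alpha>) * T \<le> f s" using b by simp
      moreover have "\<alpha> * T \<le> b * T" using b \<open>T \<ge> 0\<close> by (intro mult_right_mono) auto
      ultimately show ?thesis by (simp add: algebra_simps)
    qed
  qed
  have c0: "T * b - f \<alpha> \<ge> 0" using key[of 0] young_zero[OF A] by (simp add: f_def)
  have conj: "young_conjugate A T \<le> ennreal (T * b - f \<alpha>)"
    unfolding conjugate_le_iff
  proof (intro allI impI)
    fix s :: real assume "s \<ge> 0"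
    show "ennreal (s * T) \<le> A s + ennreal (T * b - f \<alpha>)"
    proof (cases "A s < \<infinity>")
      case True
      show ?thesis
        using key[OF \<open>s \<ge> 0\<close> True] c0 f_nonneg[of s] f[OF True] by (simp flip: ennreal_plus)
    qed (auto simp: top.not_eq_extremum[symmetric])
  qed
  have "ennreal (T * a) - ennreal (T * b - f \<alpha>) \<le> ennreal (T * a) - young_conjugate A T"
    using conj by (intro ennreal_minus_mono) auto
  also have "\<dots> \<le> young_conjugate (young_conjugate A) a"
    unfolding young_conjugate_def[of "young_conjugate A"] using \<open>T \<ge> 0\<close> by (intro SUP_upper) auto
  finally have "ennreal (T * a - (T * b - f \<alpha>)) \<le> young_conjugate (young_conjugate A) a"
    using c0 by (simp add: ennreal_minus)
  moreover have "f \<alpha> \<le> T * a - (T * b - f \<alpha>)"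
    using b \<open>T \<ge> 0\<close> by (simp add: mult_left_mono)
  ultimately show ?thesis
    using f[OF fin_\<alpha>] ennreal_leI order_trans by (metis \<alpha>_def)
next
  case False
  \<comment> \<open>Here \<open>A\<close> is infinite beyond \<open>a / 2\<close>, so its conjugate
    at \<open>T\<close> is at most \<open>T * (a / 2)\<close>, and
    \<open>T * a - T * (a / 2)\<close> is unbounded in \<open>T\<close>.\<close>
  have le: "young_conjugate A T \<le> ennreal (T * (a / 2))" if "T \<ge> 0" for T
    unfolding conjugate_le_iff
  proof (intro allI impI)
    fix s :: real assume "s \<ge> 0"
    show "ennreal (s * T) \<le> A s + ennreal (T * (a / 2))"
    proof (cases "s \<le> a / 2")
      case True
      have "ennreal (s * T) \<le> ennreal (T * (a / 2))"
        using True mult_right_mono[OF True that] by (intro ennreal_leI) (simp add: mult.commute)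
      also have "\<dots> \<le> A s + ennreal (T * (a / 2))" by simp
      finally show ?thesis .
    next
      case *: False
      then have "\<not> A s < \<infinity>" using False by auto
      then have "A s = \<infinity>" by (simp add: top.not_eq_extremum[symmetric])
      then show ?thesis by simp
    qed
  qed
  have "ennreal r \<le> young_conjugate (young_conjugate A) a" for r
  proof -
    define T where "T = 2 * max r 0 / a"
    have "T \<ge> 0" using assms by (simp add: T_def)
    have "ennreal r \<le> ennreal (T * a - T * (a / 2))"
      using assms by (intro ennreal_leI) (simp add: T_def)
    also have "\<dots> = ennreal (T * a) - ennreal (T * (a / 2))"
      using \<open>T \<ge> 0\<close> assms by (simp add: ennreal_minus)
    also have "\<dots> \<le> ennreal (T * a) - young_conjugate A T"
      using le[OF \<open>T \<ge> 0\<close>] by (intro ennreal_minus_mono) auto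
    also have "\<dots> \<le> young_conjugate (young_conjugate A) a"
      unfolding young_conjugate_def[of "young_conjugate A"] using \<open>T \<ge> 0\<close> by (intro SUP_upper) auto
    finally show ?thesis .
  qed
  then have "young_conjugate (young_conjugate A) a = \<infinity>"
    by (metis ennreal_cases ennreal_le_iff2 infinity_ennreal_def less_irrefl linorder_not_le order_less_le_trans
        less_add_one)
  then show ?thesis by simp
qed

text \<open>Among convex functions vanishing at \<open>0\<close>, a linear one is determined by its
  values near infinity, hence the exclusion. If \<open>A\<close> reaches \<open>\<infinity>\<close>,
  the function that is \<open>0\<close> below such a point and \<open>\<infinity>\<close> from there
  on will do. Otherwise a chord of the graph is chosen whose line meets the axis at some
  \<open>a > 0\<close>; the line is followed down to the axis, and \<open>A\<close> is kept from the
  upper end of the chord on.\<close>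

lemma young_modification_exists:
  assumes A: "young_function A" and nl: "\<not> (\<exists>c\<ge>0. \<forall>t\<ge>0. A t = ennreal (c * t))"
  obtains A' a t0 where "young_function A'" "a > 0" "\<And>t. 0 \<le> t \<Longrightarrow> t \<le> a \<Longrightarrow> A' t = 0" "\<And>t. t \<ge> t0 \<Longrightarrow> A' t = A t"
proof (cases "\<exists>t0>0. A t0 = \<infinity>")
  case True
  then obtain t0 where t0: "t0 > 0" "A t0 = \<infinity>" by blast
  define A' :: "real \<Rightarrow> ennreal" where "A' t = (if t < t0 then 0 else \<infinity>)" for t
  have "young_function A'"
    unfolding young_function_def
  proof (intro conjI ballI allI impI)
    show "A' 0 = 0" using t0 by (simp add: A'_def)
    show "\<exists>s>0. \<exists>t>0. A' s \<noteq> A' t"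
      by (intro exI[of _ "t0 / 2"] exI[of _ t0] conjI) (use t0 in \<open>auto simp: A'_def\<close>)
    fix s t \<theta> :: real assume st: "s \<ge> 0" "t \<ge> 0" "\<theta> \<in> {0..1}"
    show "A' ((1 - \<theta>) * s + \<theta> * t) \<le> ennreal (1 - \<theta>) * A' s + ennreal \<theta> * A' t"
    proof (cases "(1 - \<theta>) * s + \<theta> * t < t0")
      case True
      then show ?thesis by (simp add: A'_def)
    next
      case False
      have "(s \<ge> t0 \<and> \<theta> < 1) \<or> (t \<ge> t0 \<and> \<theta> > 0)"
      proof (rule ccontr)
        assume *: "\<not> ?thesis"
        then consider "\<theta> = 0" "s < t0" | "\<theta> = 1" "t < t0" | "s < t0" "t < t0" using st by force
        then show False
        proof cases
          case 3
          have "(1 - \<theta>) * s + \<theta> * t < t0" using convex_bound_lt[OF 3, of "1 - \<theta>" \<theta>] st by simp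
          with False show False by simp
        qed (use False in auto)
      qed
      then show ?thesis
        by (auto simp: A'_def ennreal_mult_top split: if_splits)
    qed
  qed
  moreover have "A' t = A t" if "t \<ge> t0" for t
    using young_mono[OF A _ that] t0 that by (simp add: A'_def top_unique)
  ultimately show thesis using that[of A' "t0 / 2" t0] t0 by (simp add: A'_def)
next
  case False
  define f where "f t = enn2real (A t)" for t
  have fin: "A t < \<infinity>" if "t \<ge> 0" for t
    using False young_zero[OF A] that by (cases "t = 0") (auto simp: top.not_eq_extremum[symmetric])
  have f: "A t = ennreal (f t)" if "t \<ge> 0" for t using fin[OF that] by (simp add: f_def)
  have f0: "f 0 = 0" using young_zero[OF A] by (simp add: f_def)
  have f_nonneg: "f t \<ge> 0" for t by (simp add: f_def)
  have three: "(z - x) * f y \<le> (z - y) * f x + (y - x) * f z"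
    if "0 \<le> x" "x \<le> y" "y \<le> z" for x y z
    using young_three_points[OF A that fin] that by (simp add: f_def)
  \<comment> \<open>The ratio \<open>f t / t\<close> is nondecreasing by convexity, and it is not
    constant because \<open>A\<close> is not linear.\<close>
  obtain x y where xy: "0 < x" "x < y" "f x * y < f y * x"
  proof -
    have "\<exists>t>0. f t \<noteq> f 1 * t"
    proof (rule ccontr)
      assume "\<not> ?thesis"
      then have "f t = f 1 * t" if "t > 0" for t using that by blast
      then have "A t = ennreal (f 1 * t)" if "t \<ge> 0" for t
        unfolding f[OF that] using f0 that by (metis mult_zero_right order_le_less)
      then show False using nl f_nonneg by blast
    qed
    then obtain t where t: "t > 0" "f t \<noteq> f 1 * t" by blast
    have le: "f x * y \<le> f y * x" if "0 < x" "x \<le> y" for x y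
      using three[of 0 x y] that f0 by (simp add: mult.commute)
    have "t \<noteq> 1" using t by auto
    then consider "t < 1" | "t > 1" by linarith
    then show thesis
    proof cases
      case 1 then show thesis using that[of t 1] le[of t 1] t by simp
    next
      case 2 then show thesis using that[of 1 t] le[of 1 t] t by simp
    qed
  qed
  define q where "q = (f y - f x) / (y - x)"
  have q: "q * (y - x) = f y - f x" using xy by (simp add: q_def)
  have "f y * (y - x) < (f y - f x) * y" using xy by (simp add: algebra_simps)
  then have "f y * (y - x) < q * (y - x) * y" using q by simp
  then have "(y - x) * f y < (y - x) * (q * y)" by (simp add: algebra_simps)
  then have qy: "f y < q * y" using xy by (simp)
  have "q > 0"
  proof (rule ccontr)
    assume "\<not> q > 0"
    then have "q * y \<le> 0" using xy by (intro mult_nonpos_nonneg) auto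
    then show False using qy f_nonneg[of y] by simp
  qed
  \<comment> \<open>The zero of \<open>l\<close>, which is the line through \<open>(x, f x)\<close>
    and \<open>(y, f y)\<close>.\<close>
  define a where "a = y - f y / q"
  have a: "a > 0" "a \<le> y" using qy \<open>q > 0\<close> f_nonneg[of y] by (auto simp: a_def field_simps)
  define l where "l t = q * (t - a)" for t
  have ly: "l y = f y" using \<open>q > 0\<close> by (simp add: l_def a_def)
  have lf: "l t \<le> f t" if "t \<ge> y" for t
  proof -
    have "(t - x) * f y \<le> (t - y) * f x + (y - x) * f t"
      using three[of x y t] xy that by simp
    also have "f x = f y - q * (y - x)" using q by simp
    finally have "(y - x) * (f y + q * (t - y)) \<le> (y - x) * f t" by (simp add: algebra_simps)
    then have "f y + q * (t - y) \<le> f t" using xy by simp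
    moreover have "l t = l y + q * (t - y)" by (simp add: l_def algebra_simps)
    ultimately show ?thesis using ly by simp
  qed
  define g where "g t = (if t < y then max 0 (l t) else f t)" for t
  have g_nonneg: "g t \<ge> 0" for t using f_nonneg by (simp add: g_def)
  have lg: "l t \<le> g t" for t using lf by (auto simp: g_def)
  have aff: "l ((1 - \<theta>) * s + \<theta> * t) = (1 - \<theta>) * l s + \<theta> * l t" for s t \<theta>
    by (simp add: l_def algebra_simps)
  \<comment> \<open>Convexity across the junction \<open>y\<close>, with \<open>s\<close> on the
    modified side and \<open>p\<close>, \<open>t\<close> on the side of \<open>f\<close>.
    Subtracting the affine \<open>l\<close> leaves the excess \<open>D\<close> at \<open>t\<close>,
    and \<open>(p - y) / (t - y) \<le> (p - s) / (t - s)\<close> compares its weights.\<close>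
  have conv0: "f p * (t - s) \<le> (t - p) * g s + (p - s) * f t"
    if "s < y" "y \<le> p" "p \<le> t" "0 \<le> s" for s p t
  proof (cases "t = y")
    case True
    with that have "p = t" by simp
    then show ?thesis by simp
  next
    case False
    then have ty: "t > y" using that by simp
    define D where "D = f t - l t"
    have D: "D \<ge> 0" using lf ty by (simp add: D_def)
    have 1: "(t - y) * f p \<le> (t - p) * l y + (p - y) * (l t + D)"
      using three[of y p t] that xy ly by (simp add: D_def)
    have 2: "(t - p) * l y + (p - y) * (l t + D) = (t - y) * l p + (p - y) * D"
      by (simp add: l_def algebra_simps)
    have 3: "(t - s) * ((p - y) * D) \<le> (t - y) * ((p - s) * D)"
    proof -
      have "(t - s) * (p - y) \<le> (t - y) * (p - s)"
      proof -
        have "0 \<le> (t - p) * (y - s)" using that by simp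
        then show ?thesis by (simp add: algebra_simps)
      qed
      then show ?thesis using mult_right_mono[OF _ D] by (metis mult.assoc)
    qed
    have "(t - s) * ((t - y) * f p) \<le> (t - s) * ((t - y) * l p + (p - y) * D)"
      using 1 2 that by (intro mult_left_mono) auto
    also have "\<dots> \<le> (t - y) * ((t - s) * l p + (p - s) * D)"
      using 3 by (simp add: algebra_simps)
    finally have "(t - y) * ((t - s) * f p) \<le> (t - y) * ((t - s) * l p + (p - s) * D)"
      by (simp add: algebra_simps)
    then have "(t - s) * f p \<le> (t - s) * l p + (p - s) * D" using ty by simp
    also have "\<dots> = (t - p) * l s + (p - s) * f t"
      by (simp add: D_def l_def algebra_simps)
    also have "\<dots> \<le> (t - p) * g s + (p - s) * f t"
      using lg[of s] that by (simp add: mult_left_mono)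
    finally show ?thesis by (simp add: mult.commute)
  qed
  have gc: "g ((1 - \<theta>) * s + \<theta> * t) \<le> (1 - \<theta>) * g s + \<theta> * g t"
    if st: "0 \<le> s" "s \<le> t" and \<theta>: "0 \<le> \<theta>" "\<theta> \<le> 1" for s t \<theta>
  proof -
    define p where "p = (1 - \<theta>) * s + \<theta> * t"
    have ps: "p - s = \<theta> * (t - s)" "t - p = (1 - \<theta>) * (t - s)" by (auto simp: p_def algebra_simps)
    have sp: "s \<le> p" "p \<le> t"
    proof -
      have "0 \<le> p - s" "0 \<le> t - p" unfolding ps using st \<theta> by auto
      then show "s \<le> p" "p \<le> t" by auto
    qed
    show ?thesis
    proof (cases "p < y")
      case True
      have "l p \<le> (1 - \<theta>) * g s + \<theta> * g t"
        unfolding p_def aff using lg \<theta> by (intro add_mono mult_left_mono) auto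
      moreover have "0 \<le> (1 - \<theta>) * g s + \<theta> * g t" using g_nonneg \<theta> by simp
      ultimately show ?thesis using True by (simp add: g_def[of p] flip: p_def)
    next
      case p: False
      show ?thesis
      proof (cases "s = t")
        case True
        then show ?thesis by (simp add: algebra_simps)
      next
        case False
        then have "t - s > 0" using st by simp
        have "f p * (t - s) \<le> (t - p) * g s + (p - s) * f t"
        proof (cases "s < y")
          case True
          then show ?thesis using conv0[of s p t] p sp st by simp
        next
          case False
          then show ?thesis using three[of s p t] sp st by (simp add: g_def mult.commute)
        qed
        then have "(t - s) * f p \<le> (t - s) * ((1 - \<theta>) * g s + \<theta> * f t)"
          unfolding ps by (simp add: algebra_simps)
        then have "f p \<le> (1 - \<theta>) * g s + \<theta> * f t" using \<open>t - s > 0\<close> by simp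
        moreover have "g t = f t" "g p = f p" using p sp by (auto simp: g_def)
        ultimately show ?thesis by (simp flip: p_def)
      qed
    qed
  qed
  define A' where "A' t = ennreal (g t)" for t
  have "young_function A'"
    unfolding young_function_def
  proof (intro conjI ballI allI impI)
    show "A' 0 = 0" using a xy \<open>q > 0\<close> by (simp add: A'_def g_def l_def mult_le_0_iff max_def)
    have "g (a / 2) = 0" using a \<open>q > 0\<close> by (simp add: g_def l_def mult_le_0_iff max_def)
    moreover have "g (y + 1) > 0"
      using lg[of "y + 1"] a \<open>q > 0\<close> by (smt (verit) l_def mult_pos_pos)
    ultimately show "\<exists>s>0. \<exists>t>0. A' s \<noteq> A' t"
      by (intro exI[of _ "a / 2"] exI[of _ "y + 1"] conjI) (use a xy in \<open>auto simp: A'_def\<close>)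
    fix s t \<theta> :: real assume st: "s \<ge> 0" "t \<ge> 0" "\<theta> \<in> {0..1}"
    have "g ((1 - \<theta>) * s + \<theta> * t) \<le> (1 - \<theta>) * g s + \<theta> * g t"
    proof (cases "s \<le> t")
      case True then show ?thesis using gc st by simp
    next
      case False
      then show ?thesis using gc[of t s "1 - \<theta>"] st by (simp add: algebra_simps)
    qed
    then show "A' ((1 - \<theta>) * s + \<theta> * t) \<le> ennreal (1 - \<theta>) * A' s + ennreal \<theta> * A' t"
      using st g_nonneg unfolding A'_def by (simp add: ennreal_leI flip: ennreal_mult ennreal_plus)
  qed
  moreover have "A' t = 0" if "0 \<le> t" "t \<le> a / 2" for t
  proof -
    have "l t \<le> 0" using that a \<open>q > 0\<close> by (simp add: l_def mult_nonneg_nonpos)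
    moreover have "t < y" using that a by linarith
    ultimately show ?thesis by (simp add: A'_def g_def)
  qed
  moreover have "A' t = A t" if "t \<ge> y" for t
    using f[of t] that xy by (simp add: A'_def g_def)
  ultimately show thesis using that[of A' "a / 2" y] a by simp
qed

section \<open>Membership in Orlicz spaces and changes of the Young function near zero\<close>

lemma orlicz_iff:
  assumes A: "young_function A"
  shows "u \<in> orlicz A E \<longleftrightarrow> u \<in> borel_measurable (lebesgue_on E) \<and>
    (\<exists>l>0. (\<integral>\<^sup>+x. A (\<bar>u x\<bar> / l) \<partial>lebesgue_on E) < \<infinity>)"
proof (cases "u \<in> borel_measurable (lebesgue_on E)")
  case True
  note [measurable] = True young_measurable[OF A]
  have lux: "luxemburg_norm A E u < \<infinity> \<longleftrightarrow> (\<exists>l>0. (\<integral>\<^sup>+x. A (\<bar>u x\<bar> / l) \<partial>lebesgue_on E) \<le> 1)"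
    unfolding luxemburg_norm_def Inf_less_iff by (auto simp: ennreal_less_top)
  have "\<exists>l>0. (\<integral>\<^sup>+x. A (\<bar>u x\<bar> / l) \<partial>lebesgue_on E) \<le> 1"
    if l: "l > 0" "(\<integral>\<^sup>+x. A (\<bar>u x\<bar> / l) \<partial>lebesgue_on E) < \<infinity>" for l
  proof -
    obtain I where I: "(\<integral>\<^sup>+x. A (\<bar>u x\<bar> / l) \<partial>lebesgue_on E) = ennreal I" "I \<ge> 0"
      using l(2) by (metis ennreal_cases infinity_ennreal_def order_less_irrefl)
    have m: "(\<lambda>x. A (\<bar>u x\<bar> / l)) \<in> borel_measurable (lebesgue_on E)"
    proof -
      have "(\<lambda>x. A \<bar>u x / l\<bar>) \<in> borel_measurable (lebesgue_on E)"
        by (rule measurable_compose[OF _ young_measurable[OF A]]) measurable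
      then show ?thesis using l by simp
    qed
    \<comment> \<open>A finite integral \<open>I\<close> is brought below \<open>1\<close> by
      enlarging \<open>l\<close> by the factor \<open>I + 1\<close>, since convexity gives
      \<open>A (\<theta> * t) \<le> \<theta> * A t\<close> for
      \<open>\<theta> \<le> 1\<close>.\<close>
    have "(\<integral>\<^sup>+x. A (\<bar>u x\<bar> / (l * (I + 1))) \<partial>lebesgue_on E) \<le> (\<integral>\<^sup>+x. ennreal (1 / (I + 1)) * A (\<bar>u x\<bar> / l) \<partial>lebesgue_on E)"
    proof (rule nn_integral_mono)
      fix x
      show "A (\<bar>u x\<bar> / (l * (I + 1))) \<le> ennreal (1 / (I + 1)) * A (\<bar>u x\<bar> / l)"
        using young_scale[OF A, of "\<bar>u x\<bar> / l" "1 / (I + 1)"] l I by (simp add: mult.commute)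
    qed
    also have "\<dots> = ennreal (1 / (I + 1)) * ennreal I"
      using m I by (simp add: nn_integral_cmult)
    also have "\<dots> \<le> 1" using I by (simp add: ennreal_le_1 flip: ennreal_mult)
    finally show ?thesis using l I by (intro exI[of _ "l * (I + 1)"]) auto
  qed
  moreover have "(\<integral>\<^sup>+x. A (\<bar>u x\<bar> / l) \<partial>lebesgue_on E) < \<infinity>"
    if "(\<integral>\<^sup>+x. A (\<bar>u x\<bar> / l) \<partial>lebesgue_on E) \<le> 1" for l
    using that by (auto intro: order.strict_trans1)
  ultimately show ?thesis using True lux unfolding orlicz_def mem_Collect_eq by blast
qed (simp add: orlicz_def)

text \<open>On a set of finite measure only large values of \<open>u\<close> matter. The factor
  \<open>k \<ge> 1\<close> is chosen such that arguments below \<open>t0\<close> are sent below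
  \<open>a\<close>, where \<open>A'\<close> is finite and contributes a constant; the other
  arguments only decrease.\<close>

lemma orlicz_modification:
  assumes A: "young_function A" and A': "young_function A'"
    and eq: "\<And>t. t \<ge> t0 \<Longrightarrow> A' t = A t" and E: "emeasure lebesgue E < \<infinity>" "E \<in> sets lebesgue"
    and u: "u \<in> orlicz A E"
  shows "u \<in> orlicz A' E"
proof -
  obtain l where l: "l > 0" "(\<integral>\<^sup>+x. A (\<bar>u x\<bar> / l) \<partial>lebesgue_on E) < \<infinity>" and [measurable]: "u \<in> borel_measurable (lebesgue_on E)"
    using u orlicz_iff[OF A] by auto
  obtain a where a: "a > 0" "A' a < \<infinity>" using young_ex_finite[OF A'] by blast
  define k where "k = max 1 (t0 / a)"
  have k: "k \<ge> 1" "t0 \<le> k * a" using a by (auto simp: k_def field_simps max_def)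
  have "(\<lambda>x. A \<bar>u x / l\<bar>) \<in> borel_measurable (lebesgue_on E)"
    by (rule measurable_compose[OF _ young_measurable[OF A]]) measurable
  then have m[measurable]: "(\<lambda>x. A (\<bar>u x\<bar> / l)) \<in> borel_measurable (lebesgue_on E)"
    using l by simp
  have "(\<integral>\<^sup>+x. A' (\<bar>u x\<bar> / (l * k)) \<partial>lebesgue_on E) \<le> (\<integral>\<^sup>+x. A (\<bar>u x\<bar> / l) + A' a \<partial>lebesgue_on E)"
  proof (rule nn_integral_mono)
    fix x
    show "A' (\<bar>u x\<bar> / (l * k)) \<le> A (\<bar>u x\<bar> / l) + A' a"
    proof (cases "t0 \<le> \<bar>u x\<bar> / l")
      case True
      have "\<bar>u x\<bar> / (l * k) \<le> \<bar>u x\<bar> / l"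
        using k l by (intro divide_left_mono) (auto simp: mult_le_cancel_left1)
      then have "A' (\<bar>u x\<bar> / (l * k)) \<le> A' (\<bar>u x\<bar> / l)"
        using k l by (intro young_mono[OF A']) auto
      then show ?thesis using eq[OF True] by (simp add: add_increasing2)
    next
      case False
      then have "\<bar>u x\<bar> / l \<le> a * k" using k by (simp add: mult.commute)
      then have "\<bar>u x\<bar> / (l * k) \<le> a" using k l by (simp add: field_simps)
      then have "A' (\<bar>u x\<bar> / (l * k)) \<le> A' a"
        using k l by (intro young_mono[OF A']) auto
      then show ?thesis by (simp add: add_increasing)
    qed
  qed
  also have "\<dots> = (\<integral>\<^sup>+x. A (\<bar>u x\<bar> / l) \<partial>lebesgue_on E) + A' a * emeasure (lebesgue_on E) (space (lebesgue_on E))"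
    by (subst nn_integral_add) auto
  also have "\<dots> < \<infinity>"
    using l(2) a(2) E by (simp add: emeasure_restrict_space ennreal_mult_less_top)
  finally have "(\<integral>\<^sup>+x. A' (\<bar>u x\<bar> / (l * k)) \<partial>lebesgue_on E) < \<infinity>" .
  moreover have "l * k > 0" using l k by simp
  ultimately show ?thesis using orlicz_iff[OF A'] \<open>u \<in> borel_measurable (lebesgue_on E)\<close> by blast
qed

lemma W1_Orlicz_loc_modification:
  assumes "young_function A" "young_function A'" "\<And>t. t \<ge> t0 \<Longrightarrow> A' t = A t"
  shows "W1_Orlicz_loc A' \<Omega> = W1_Orlicz_loc A \<Omega>"
proof -
  have orl: "orlicz A' E = orlicz A E" if "open E" "bounded E" for E
  proof -
    have "E \<in> sets lebesgue" "emeasure lebesgue E < \<infinity>"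
      using that emeasure_bounded_finite[of E] by auto
    then show ?thesis
      using orlicz_modification[OF assms(1,2), of t0 E] orlicz_modification[OF assms(2,1), of t0 E] assms(3) by fastforce
  qed
  then show ?thesis unfolding W1_Orlicz_loc_def W1_Orlicz_def by blast
qed

text \<open>For \<open>n \<ge> 3\<close> this is the function under the conjugate in
  \<open>A_sub\<close>. For \<open>n = 2\<close> the conjugate of \<open>A\<close> stands in its
  place, so that in both cases the estimates lead to a conjugate of
  \<open>sub_kernel\<close>.\<close>

definition sub_kernel :: "nat \<Rightarrow> (real \<Rightarrow> ennreal) \<Rightarrow> real \<Rightarrow> ennreal" where
  "sub_kernel n A t =
     (if n = 2 then young_conjugate A t
      else if t = 0 then 0
      else ennreal (t powr ((real n - 1) / (real n - 2))) *
        (\<integral>\<^sup>+r\<in>{t<..}. young_conjugate A r / ennreal (r powr (1 + (real n - 1) / (real n - 2))) \<partial>lborel))"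

lemma A_sub_eq_conjugate: "n \<noteq> 2 \<Longrightarrow> A_sub n A = young_conjugate (sub_kernel n A)"
  by (rule ext) (simp add: A_sub_def sub_kernel_def[abs_def] Let_def)

lemma A_sub_2: "A_sub 2 A = A"
  by (simp add: A_sub_def)

text \<open>In dimension \<open>2\<close> the right side is the biconjugate of \<open>A\<close>, and
  the factor \<open>2\<close> comes from \<open>biconjugate_ge\<close>; otherwise the two functions
  coincide and monotonicity gives the rest.\<close>

lemma A_sub_le_conjugate:
  assumes "young_function A" "a > 0"
  shows "A_sub n A (a / 2) \<le> young_conjugate (sub_kernel n A) a"
proof (cases "n = 2")
  case True
  then show ?thesis using biconjugate_ge[OF assms] by (simp add: A_sub_2 sub_kernel_def[abs_def])
next
  case False
  then show ?thesis using assms by (simp add: A_sub_eq_conjugate conjugate_mono)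
qed

lemma A_sub_mono:
  assumes "young_function A" "0 \<le> s" "s \<le> t" shows "A_sub n A s \<le> A_sub n A t"
  by (cases "n = 2") (use assms young_mono in \<open>auto simp: A_sub_2 A_sub_eq_conjugate conjugate_mono\<close>)

lemma A_sub_measurable [measurable]:
  assumes "young_function A" shows "(\<lambda>t. A_sub n A \<bar>t\<bar>) \<in> borel_measurable borel"
  by (cases "n = 2") (use assms in \<open>auto simp: A_sub_2 A_sub_eq_conjugate\<close>)

section \<open>Effect of a modification near zero on the function with index n - 1\<close>

lemma ennreal_unbounded_top:
  assumes "\<And>r. ennreal r \<le> x" shows "x = \<infinity>"
proof (cases x rule: ennreal_cases)
  case (real r)
  then show ?thesis using assms[of "r + 1"] by simp
qed simp

lemma nn_integral_powr_tail:
  assumes "t > 0" "q > 1"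
  shows "(\<integral>\<^sup>+r\<in>{t<..}. ennreal (r powr - q) \<partial>lborel) = ennreal (t powr (1 - q) / (q - 1))"
proof -
  have "(\<integral>\<^sup>+r. ennreal (r powr - q) * indicator {t..} r \<partial>lborel) = 0 - (- (t powr (1 - q) / (q - 1)))"
  proof (rule nn_integral_FTC_atLeast)
    show "((\<lambda>r. - (r powr (1 - q) / (q - 1))) has_real_derivative r powr - q) (at r)" if "t \<le> r" for r
    proof -
      have "((\<lambda>r. r powr (1 - q)) has_real_derivative (1 - q) * r powr (1 - q - 1)) (at r)"
        using that assms by (intro has_real_derivative_powr) auto
      then have "((\<lambda>r. (- 1 / (q - 1)) * r powr (1 - q)) has_real_derivative (- 1 / (q - 1)) * ((1 - q) * r powr (1 - q - 1))) (at r)"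
        by (rule DERIV_cmult)
      moreover have "(- 1 / (q - 1)) * ((1 - q) * y) = y" for y :: real
      proof -
        have "(- 1 / (q - 1)) * (1 - q) = 1" using assms by (simp add: field_simps)
        then show ?thesis by (metis mult.assoc mult_1)
      qed
      ultimately show ?thesis by simp
    qed
    have "((\<lambda>r. - (r powr (1 - q) / (q - 1))) \<longlongrightarrow> - (0 / (q - 1))) at_top"
      using assms by (intro tendsto_intros tendsto_neg_powr filterlim_ident) auto
    then show "((\<lambda>r. - (r powr (1 - q) / (q - 1))) \<longlongrightarrow> 0) at_top" by simp
  qed auto
  moreover have "(\<integral>\<^sup>+r. ennreal (r powr - q) * indicator {t<..} r \<partial>lborel) = (\<integral>\<^sup>+r. ennreal (r powr - q) * indicator {t..} r \<partial>lborel)"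
    by (rule nn_integral_cong_AE) (use AE_lborel_singleton[of t] in \<open>eventually_elim, auto simp: indicator_def\<close>)
  ultimately show ?thesis by simp
qed

text \<open>In the supremum the arguments \<open>s \<ge> t0\<close> see no change, and the arguments
  \<open>s < t0\<close> contribute at most \<open>t0 * r\<close>.\<close>

lemma conjugate_modification:
  assumes "\<And>s. s \<ge> t0 \<Longrightarrow> A' s = A s" "t0 \<ge> 0" "r \<ge> 0"
  shows "young_conjugate A' r \<le> young_conjugate A r + ennreal (t0 * r)"
  unfolding conjugate_le_iff
proof (intro allI impI)
  fix s :: real assume "s \<ge> 0"
  show "ennreal (s * r) \<le> A' s + (young_conjugate A r + ennreal (t0 * r))"
  proof (cases "s \<ge> t0")
    case True
    have "ennreal (s * r) \<le> A s + young_conjugate A r"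
      using \<open>s \<ge> 0\<close> by (rule young_inequality)
    also have "\<dots> \<le> A' s + (young_conjugate A r + ennreal (t0 * r))"
      using assms(1)[OF True] by (simp add: add_left_mono)
    finally show ?thesis .
  next
    case False
    then have "ennreal (s * r) \<le> ennreal (t0 * r)"
      using assms by (intro ennreal_leI mult_right_mono) auto
    then show ?thesis by (simp add: add_increasing)
  qed
qed

lemma exponent_gt_1:
  assumes "n \<ge> 3" shows "(real n - 1) / (real n - 2) > 1"
  using assms by (simp add: field_simps)

text \<open>The additional term \<open>t0 * r\<close> of the conjugate is mapped by the integral
  operator to a linear term again: \<open>t powr p\<close> times the integral of
  \<open>t0 * r powr (- p)\<close> over \<open>r > t\<close> is
  \<open>t0 / (p - 1) * t\<close>.\<close>

lemma sub_kernel_modification: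
  assumes n: "n \<ge> 3" and eq: "\<And>s. s \<ge> t0 \<Longrightarrow> A' s = A s" and "t0 > 0" and "t \<ge> 0"
  defines "p \<equiv> (real n - 1) / (real n - 2)"
  shows "sub_kernel n A' t \<le> sub_kernel n A t + ennreal (t0 / (p - 1) * t)"
proof (cases "t = 0")
  case False
  then have t: "t > 0" using assms by simp
  have p: "p > 1" using exponent_gt_1[OF n] by (simp add: p_def)
  have "(\<integral>\<^sup>+r\<in>{t<..}. young_conjugate A' r / ennreal (r powr (1 + p)) \<partial>lborel)
     \<le> (\<integral>\<^sup>+r. young_conjugate A r / ennreal (r powr (1 + p)) * indicator {t<..} r + ennreal t0 * (ennreal (r powr - p) * indicator {t<..} r) \<partial>lborel)"
  proof (rule nn_integral_mono)
    fix r :: real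
    show "young_conjugate A' r / ennreal (r powr (1 + p)) * indicator {t<..} r
      \<le> young_conjugate A r / ennreal (r powr (1 + p)) * indicator {t<..} r + ennreal t0 * (ennreal (r powr - p) * indicator {t<..} r)"
    proof (cases "r > t")
      case True
      then have r: "r > 0" using t by simp
      have "young_conjugate A' r / ennreal (r powr (1 + p)) \<le> (young_conjugate A r + ennreal (t0 * r)) / ennreal (r powr (1 + p))"
        using conjugate_modification[OF eq, of t0] \<open>t0 > 0\<close> r by (intro divide_right_mono_ennreal) auto
      also have "\<dots> = young_conjugate A r / ennreal (r powr (1 + p)) + ennreal (t0 * r) / ennreal (r powr (1 + p))"
        by (rule add_divide_distrib_ennreal)
      also have "ennreal (t0 * r) / ennreal (r powr (1 + p)) = ennreal (t0 * r powr - p)"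
        using r \<open>t0 > 0\<close> by (simp add: divide_ennreal powr_add powr_minus field_simps)
      finally show ?thesis using True \<open>t0 > 0\<close> by (simp add: ennreal_mult)
    qed simp
  qed
  also have "\<dots> = (\<integral>\<^sup>+r\<in>{t<..}. young_conjugate A r / ennreal (r powr (1 + p)) \<partial>lborel) + ennreal t0 * (\<integral>\<^sup>+r\<in>{t<..}. ennreal (r powr - p) \<partial>lborel)"
    by (subst nn_integral_add) (auto simp: nn_integral_cmult)
  also have "ennreal t0 * (\<integral>\<^sup>+r\<in>{t<..}. ennreal (r powr - p) \<partial>lborel) = ennreal (t0 * (t powr (1 - p) / (p - 1)))"
    unfolding nn_integral_powr_tail[OF t p] using p \<open>t0 > 0\<close> by (subst ennreal_mult[symmetric]) auto
  finally have "ennreal (t powr p) * (\<integral>\<^sup>+r\<in>{t<..}. young_conjugate A' r / ennreal (r powr (1 + p)) \<partial>lborel)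
    \<le> ennreal (t powr p) * ((\<integral>\<^sup>+r\<in>{t<..}. young_conjugate A r / ennreal (r powr (1 + p)) \<partial>lborel) + ennreal (t0 * (t powr (1 - p) / (p - 1))))"
    by (intro mult_left_mono) auto
  also have "\<dots> = ennreal (t powr p) * (\<integral>\<^sup>+r\<in>{t<..}. young_conjugate A r / ennreal (r powr (1 + p)) \<partial>lborel) + ennreal (t powr p) * ennreal (t0 * (t powr (1 - p) / (p - 1)))"
    by (rule distrib_left)
  also have "ennreal (t powr p) * ennreal (t0 * (t powr (1 - p) / (p - 1))) = ennreal (t0 / (p - 1) * t)"
    using t p \<open>t0 > 0\<close> by (subst ennreal_mult[symmetric]) (auto simp: powr_diff)
  finally show ?thesis using n t by (simp add: sub_kernel_def p_def)
qed (use n in \<open>auto simp: sub_kernel_def\<close>)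

text \<open>If \<open>A\<close> vanishes on \<open>[0, a]\<close>, its conjugate is at least
  \<open>a * r\<close>, and the integral operator keeps such a linear lower bound. A function above
  a line of positive slope has a conjugate that vanishes near \<open>0\<close>, which is the
  purpose.\<close>

lemma sub_kernel_lower:
  assumes n: "n \<ge> 3" and z: "\<And>s. 0 \<le> s \<Longrightarrow> s \<le> a \<Longrightarrow> A s = 0" and "a > 0" and "t \<ge> 0"
  defines "p \<equiv> (real n - 1) / (real n - 2)"
  shows "ennreal (a / (p - 1) * t) \<le> sub_kernel n A t"
proof (cases "t = 0")
  case False
  then have t: "t > 0" using assms by simp
  have p: "p > 1" using exponent_gt_1[OF n] by (simp add: p_def)
  have conj: "ennreal (a * r) \<le> young_conjugate A r" for r
    using young_inequality[of a r A] z[of a] \<open>a > 0\<close> by simp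
  have "ennreal (a / (p - 1) * t) = ennreal (t powr p) * ennreal (a * (t powr (1 - p) / (p - 1)))"
    using t p \<open>a > 0\<close> by (subst ennreal_mult[symmetric]) (auto simp: powr_diff)
  also have "ennreal (a * (t powr (1 - p) / (p - 1))) = (\<integral>\<^sup>+r. ennreal a * (ennreal (r powr - p) * indicator {t<..} r) \<partial>lborel)"
    using p \<open>a > 0\<close> by (subst nn_integral_cmult) (auto simp: nn_integral_powr_tail[OF t p] simp flip: ennreal_mult)
  also have "\<dots> \<le> (\<integral>\<^sup>+r\<in>{t<..}. young_conjugate A r / ennreal (r powr (1 + p)) \<partial>lborel)"
  proof (rule nn_integral_mono)
    fix r :: real
    show "ennreal a * (ennreal (r powr - p) * indicator {t<..} r) \<le> young_conjugate A r / ennreal (r powr (1 + p)) * indicator {t<..} r"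
    proof (cases "r > t")
      case True
      then have r: "r > 0" using t by simp
      have "ennreal a * ennreal (r powr - p) = ennreal (a * r) / ennreal (r powr (1 + p))"
        using r \<open>a > 0\<close> by (simp add: divide_ennreal powr_add powr_minus field_simps flip: ennreal_mult)
      also have "\<dots> \<le> young_conjugate A r / ennreal (r powr (1 + p))"
        by (intro divide_right_mono_ennreal conj)
      finally show ?thesis using True by simp
    qed simp
  qed
  finally have "ennreal (a / (p - 1) * t) \<le> ennreal (t powr p) * (\<integral>\<^sup>+r\<in>{t<..}. young_conjugate A r / ennreal (r powr (1 + p)) \<partial>lborel)"
    by (simp add: mult_left_mono)
  then show ?thesis using n t by (simp add: sub_kernel_def p_def)
qed simp

text \<open>For linear \<open>A\<close> the divergence fails. If \<open>n = 2\<close>, the integrand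
  is a multiple of \<open>1 / t\<^sup>2\<close>. If \<open>n \<ge> 3\<close>, the conjugate of
  \<open>A\<close> is infinite beyond the slope \<open>c\<close>, hence \<open>sub_kernel\<close> is
  infinite at every \<open>t > 0\<close>, and its conjugate \<open>A_sub\<close> is zero.\<close>

lemma A_sub_not_linear:
  assumes n: "n \<ge> 2" and inf: "infinite_at_infinity (\<lambda>t. A_sub n A t / ennreal (t ^ (n + 1)))"
  shows "\<not> (\<exists>c\<ge>0. \<forall>t\<ge>0. A t = ennreal (c * t))"
proof
  assume "\<exists>c\<ge>0. \<forall>t\<ge>0. A t = ennreal (c * t)"
  then obtain c where c: "c \<ge> 0" "\<And>t. t \<ge> 0 \<Longrightarrow> A t = ennreal (c * t)" by blast
  have "(\<integral>\<^sup>+t\<in>{1<..}. A_sub n A t / ennreal (t ^ (n + 1)) \<partial>lborel) < \<infinity>"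
  proof (cases "n = 2")
    case True
    have "(\<integral>\<^sup>+t\<in>{1<..}. A_sub n A t / ennreal (t ^ (n + 1)) \<partial>lborel)
      = (\<integral>\<^sup>+t. ennreal c * (ennreal (t powr - 2) * indicator {1<..} t) \<partial>lborel)"
    proof (rule nn_integral_cong)
      fix t :: real
      show "A_sub n A t / ennreal (t ^ (n + 1)) * indicator {1<..} t = ennreal c * (ennreal (t powr - 2) * indicator {1<..} t)"
      proof (cases "t > 1")
        case True
        then have "t powr - 2 = 1 / t ^ 2" using powr_realpow[of t 2] by (simp add: powr_minus_divide)
        then have "ennreal (c * t) / ennreal (t ^ 3) = ennreal (c * t powr - 2)"
          using True c by (simp add: divide_ennreal power2_eq_square power3_eq_cube)
        then show ?thesis using True c \<open>n = 2\<close> by (simp add: A_sub_2 ennreal_mult numeral_3_eq_3)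
      qed simp
    qed
    also have "\<dots> < \<infinity>" using nn_integral_powr_tail[of 1 2] by (simp add: nn_integral_cmult ennreal_mult_less_top)
    finally show ?thesis .
  next
    case False
    then have n: "n \<ge> 3" using n by simp
    have ct: "young_conjugate A r = \<infinity>" if "r > c" for r
    proof -
      have "ennreal b \<le> young_conjugate A r" for b
      proof -
        define s where "s = max b 0 / (r - c)"
        have s: "s \<ge> 0" using that by (simp add: s_def)
        have "ennreal b \<le> ennreal (s * r - c * s)"
        proof (rule ennreal_leI)
          have "s * r - c * s = s * (r - c)" by (simp add: algebra_simps)
          also have "\<dots> = max b 0" using that by (simp add: s_def)
          finally show "b \<le> s * r - c * s" by simp
        qed
        also have "\<dots> = ennreal (s * r) - A s"
          using s c by (simp add: ennreal_minus)
        also have "\<dots> \<le> young_conjugate A r"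
          unfolding young_conjugate_def using s by (intro SUP_upper) auto
        finally show ?thesis .
      qed
      then show ?thesis
        by (rule ennreal_unbounded_top)
    qed
    have ker: "sub_kernel n A t = \<infinity>" if "t > 0" for t
    proof -
      let ?p = "(real n - 1) / (real n - 2)"
      have "emeasure lborel {max t c<..<max t c + 1} \<le> emeasure lborel {max t c<..}"
        by (rule emeasure_mono) auto
      then have "emeasure lborel {max t c<..} \<noteq> 0" by auto
      then have "\<infinity> = (\<integral>\<^sup>+r. \<infinity> * indicator {max t c<..} r \<partial>lborel)"
        by (subst nn_integral_cmult) (auto simp: ennreal_top_mult)
      also have "\<dots> \<le> (\<integral>\<^sup>+r\<in>{t<..}. young_conjugate A r / ennreal (r powr (1 + ?p)) \<partial>lborel)"
        using ct by (intro nn_integral_mono) (auto simp: indicator_def ennreal_top_divide)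
      finally show ?thesis using that n by (simp add: sub_kernel_def top_unique ennreal_mult_top)
    qed
    have "A_sub n A t = 0" for t
    proof -
      have "young_conjugate (sub_kernel n A) t \<le> 0"
        unfolding conjugate_le_iff
      proof (intro allI impI)
        fix s :: real assume "s \<ge> 0"
        then show "ennreal (s * t) \<le> sub_kernel n A s + 0" using ker[of s] by (cases "s = 0") auto
      qed
      then show ?thesis using n by (simp add: A_sub_eq_conjugate)
    qed
    then show ?thesis by simp
  qed
  then show False using inf by (simp add: infinite_at_infinity_def)
qed

lemma admissible_modification_exists:
  assumes n: "n \<ge> 2" and A: "young_function A"
    and inf: "infinite_at_infinity (\<lambda>t. A_sub n A t / ennreal (t ^ (n + 1)))"
  shows "\<exists>A'. admissible_modification n A A'"
proof -
  obtain A' a t0 where A': "young_function A'" "a > 0" "\<And>t. 0 \<le> t \<Longrightarrow> t \<le> a \<Longrightarrow> A' t = 0" "\<And>t. t \<ge> t0 \<Longrightarrow> A' t = A t"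
    using young_modification_exists[OF A A_sub_not_linear[OF n inf]] by blast
  have "\<exists>k>0. \<forall>t. 0 \<le> t \<and> t \<le> k \<longrightarrow> A_sub n A' t = 0"
  proof (cases "n = 2")
    case True
    then show ?thesis using A' by (auto simp: A_sub_2)
  next
    case False
    then have n: "n \<ge> 3" using n by simp
    let ?p = "(real n - 1) / (real n - 2)"
    have p: "?p > 1" by (rule exponent_gt_1[OF n])
    show ?thesis
    proof (intro exI[of _ "a / (?p - 1)"] conjI allI impI)
      \<comment> \<open>\<open>sub_kernel n A'\<close> lies above the line of slope
        \<open>a / (?p - 1)\<close>, so its conjugate is \<open>0\<close> up to this slope.\<close>
      show "0 < a / (?p - 1)" using A'(2) p by simp
      fix t assume t: "0 \<le> t \<and> t \<le> a / (?p - 1)"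
      have "young_conjugate (sub_kernel n A') t \<le> 0"
        unfolding conjugate_le_iff
      proof (intro allI impI)
        fix s :: real assume s: "s \<ge> 0"
        have "ennreal (s * t) \<le> ennreal (a / (?p - 1) * s)"
          using t s by (intro ennreal_leI) (metis mult.commute mult_left_mono)
        also have "\<dots> \<le> sub_kernel n A' s" using sub_kernel_lower[OF n A'(3) A'(2) s] by simp
        finally show "ennreal (s * t) \<le> sub_kernel n A' s + 0" by simp
      qed
      then show "A_sub n A' t = 0" using n by (simp add: A_sub_eq_conjugate)
    qed
  qed
  then obtain k where k: "k > 0" "\<And>t. 0 \<le> t \<Longrightarrow> t \<le> k \<Longrightarrow> A_sub n A' t = 0" by blast
  have "(\<integral>\<^sup>+t\<in>{0<..<k}. A_sub n A' t / ennreal (t ^ (1 + n)) \<partial>lborel) = (\<integral>\<^sup>+t. 0 \<partial>(lborel :: real measure))"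
    using k by (intro nn_integral_cong) (auto simp: indicator_def)
  then have "finite_at_zero (\<lambda>t. A_sub n A' t / ennreal (t ^ (1 + n)))"
    using k unfolding finite_at_zero_def by (intro exI[of _ k]) simp
  then show ?thesis using A' unfolding admissible_modification_def by blast
qed

text \<open>A linear term \<open>k * s\<close> added to a function shifts the argument of its
  conjugate by \<open>k\<close>, and for \<open>s \<ge> 2 * k\<close> the shift is absorbed by
  halving the argument.\<close>

lemma A_sub_modification:
  assumes n: "n \<ge> 2" and A: "young_function A" and A': "young_function A'"
    and eq: "\<And>t. t \<ge> t0 \<Longrightarrow> A' t = A t"
  obtains c where "c > 0" "\<And>s. s \<ge> c \<Longrightarrow> A_sub n A (s / 2) \<le> A_sub n A' s"
proof (cases "n = 2")
  case True
  have "A_sub n A (s / 2) \<le> A_sub n A' s" if "s \<ge> max 1 t0" for s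
    using young_mono[OF A, of "s / 2" s] eq[of s] that True by (simp add: A_sub_2)
  then show thesis using that[of "max 1 t0"] by simp
next
  case False
  then have n: "n \<ge> 3" using n by simp
  let ?p = "(real n - 1) / (real n - 2)"
  define t1 where "t1 = max 1 t0"
  define k where "k = t1 / (?p - 1)"
  have p: "?p > 1" by (rule exponent_gt_1[OF n])
  have k: "k > 0" using p by (simp add: k_def t1_def)
  have eq1: "\<And>t. t \<ge> t1 \<Longrightarrow> A' t = A t" using eq by (simp add: t1_def)
  have ker: "sub_kernel n A' s \<le> sub_kernel n A s + ennreal (k * s)" if "s \<ge> 0" for s
    using sub_kernel_modification[where A = A and A' = A' and ?t0.0 = t1, OF n eq1 _ that] by (simp add: k_def t1_def)
  have "A_sub n A (s / 2) \<le> A_sub n A' s" if s: "s \<ge> 2 * k" for s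
  proof -
    have "young_conjugate (sub_kernel n A) (s / 2) \<le> young_conjugate (sub_kernel n A') s"
      unfolding conjugate_le_iff
    proof (intro allI impI)
      fix r :: real assume r: "r \<ge> 0"
      have "ennreal (r * (s / 2)) + ennreal (k * r) \<le> ennreal (r * s)"
      proof -
        have "r * (s / 2) + k * r \<le> r * s"
          using mult_left_mono[OF s r] by (simp add: field_simps)
        then show ?thesis using r s k by (simp flip: ennreal_plus)
      qed
      also have "\<dots> \<le> sub_kernel n A' r + young_conjugate (sub_kernel n A') s"
        using r by (rule young_inequality)
      also have "\<dots> \<le> (sub_kernel n A r + ennreal (k * r)) + young_conjugate (sub_kernel n A') s"
        using ker[OF r] by (rule add_right_mono)
      finally have "ennreal (k * r) + ennreal (r * (s / 2)) \<le> ennreal (k * r) + (sub_kernel n A r + young_conjugate (sub_kernel n A') s)"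
        by (simp add: ac_simps)
      then show "ennreal (r * (s / 2)) \<le> sub_kernel n A r + young_conjugate (sub_kernel n A') s"
        by (simp add: ennreal_add_left_cancel_le)
    qed
    then show ?thesis using n by (simp add: A_sub_eq_conjugate)
  qed
  then show thesis using that[of "2 * k"] k by simp
qed

text \<open>The halved argument left by \<open>A_sub_modification\<close> is undone by the
  substitution \<open>s = 2 * t\<close>, which only costs a power of \<open>2\<close>; an infinite
  integral stays infinite.\<close>

lemma infinite_at_infinity_modification:
  assumes n: "n \<ge> 2" and A: "young_function A" and A': "young_function A'"
    and eq: "\<And>t. t \<ge> t0 \<Longrightarrow> A' t = A t"
    and inf: "infinite_at_infinity (\<lambda>t. A_sub n A t / ennreal (t ^ (n + 1)))"
  shows "infinite_at_infinity (\<lambda>t. A_sub n A' t / ennreal (t ^ (n + 1)))"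
  unfolding infinite_at_infinity_def
proof (intro allI impI)
  fix a :: real assume "a > 0"
  obtain c where c: "c > 0" "\<And>s. s \<ge> c \<Longrightarrow> A_sub n A (s / 2) \<le> A_sub n A' s"
    using A_sub_modification[OF n A A' eq] by blast
  define M where "M = max a c"
  have M: "M > 0" "M \<ge> a" "M \<ge> c" using \<open>a > 0\<close> by (auto simp: M_def)
  note [measurable] = A_sub_measurable[OF A]
  define F where "F s = A_sub n A \<bar>s / 2\<bar> / ennreal (s ^ (n + 1)) * indicator {M<..} s" for s
  have [measurable]: "F \<in> borel_measurable borel"
    unfolding F_def by measurable
  have abs: "(\<integral>\<^sup>+t. A_sub n A t / ennreal (t ^ (n + 1)) * indicator {M / 2<..} t \<partial>lborel) =
     (\<integral>\<^sup>+t. A_sub n A \<bar>t\<bar> / ennreal (t ^ (n + 1)) * indicator {M / 2<..} t \<partial>lborel)"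
  proof (rule nn_integral_cong)
    fix t :: real
    show "A_sub n A t / ennreal (t ^ (n + 1)) * indicator {M / 2<..} t = A_sub n A \<bar>t\<bar> / ennreal (t ^ (n + 1)) * indicator {M / 2<..} t"
      using M by (cases "t > M / 2") auto
  qed
  have "ennreal (1 / 2 ^ (n + 1)) * (\<integral>\<^sup>+t\<in>{M / 2<..}. A_sub n A t / ennreal (t ^ (n + 1)) \<partial>lborel) =
     ennreal (1 / 2 ^ (n + 1)) * (\<integral>\<^sup>+t. A_sub n A \<bar>t\<bar> / ennreal (t ^ (n + 1)) * indicator {M / 2<..} t \<partial>lborel)"
    by (simp only: abs)
  also have "\<dots> = (\<integral>\<^sup>+t. ennreal (1 / 2 ^ (n + 1)) * (A_sub n A \<bar>t\<bar> / ennreal (t ^ (n + 1)) * indicator {M / 2<..} t) \<partial>lborel)"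
    by (rule nn_integral_cmult[symmetric]) measurable
  also have "\<dots> = (\<integral>\<^sup>+t. F (0 + 2 * t) \<partial>lborel)"
  proof (rule nn_integral_cong)
    fix t :: real
    show "ennreal (1 / 2 ^ (n + 1)) * (A_sub n A \<bar>t\<bar> / ennreal (t ^ (n + 1)) * indicator {M / 2<..} t) = F (0 + 2 * t)"
    proof (cases "t > M / 2")
      case True
      then have t: "t > 0" using M by simp
      have "F (0 + 2 * t) = A_sub n A t / (ennreal (2 ^ (n + 1)) * ennreal (t ^ (n + 1)))"
        using True t by (simp add: F_def power_mult_distrib mult_ac flip: ennreal_mult)
      also have "\<dots> = A_sub n A t * (ennreal (1 / 2 ^ (n + 1)) * inverse (ennreal (t ^ (n + 1))))"
        using t by (simp add: divide_ennreal_def ennreal_inverse_mult inverse_ennreal inverse_eq_divide del: power_Suc)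
      finally show ?thesis using True t by (simp add: divide_ennreal_def mult_ac)
    qed (simp add: F_def)
  qed
  also have "\<dots> \<le> ennreal \<bar>2\<bar> * (\<integral>\<^sup>+t. F (0 + 2 * t) \<partial>lborel)"
    using mult_right_mono[of 1 "ennreal \<bar>2\<bar>"] by simp
  also have "\<dots> = (\<integral>\<^sup>+s. F s \<partial>lborel)"
    by (rule nn_integral_real_affine[symmetric]) auto
  also have "\<dots> \<le> (\<integral>\<^sup>+t\<in>{a<..}. A_sub n A' t / ennreal (t ^ (n + 1)) \<partial>lborel)"
    using c(2) M by (intro nn_integral_mono) (auto simp: F_def indicator_def intro!: divide_right_mono_ennreal)
  finally have "ennreal (1 / 2 ^ (n + 1)) * \<infinity> \<le> (\<integral>\<^sup>+t\<in>{a<..}. A_sub n A' t / ennreal (t ^ (n + 1)) \<partial>lborel)"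
    using inf M by (simp add: infinite_at_infinity_def)
  then show "(\<integral>\<^sup>+t\<in>{a<..}. A_sub n A' t / ennreal (t ^ (n + 1)) \<partial>lborel) = \<infinity>"
    by (simp add: ennreal_mult_top top_unique)
qed

text \<open>A measure on the line whose tails beyond \<open>T\<close> are
  \<open>\<kappa> * a powr - q\<close> has the density
  \<open>\<kappa> * q * r powr (- q - 1)\<close> there, because finite tails determine it. This
  serves as change of variables, for the kernel on a face as well as for the substitution
  \<open>t = k / s\<close>.\<close>

lemma nn_integral_tail_distribution:
  assumes [measurable]: "g \<in> borel_measurable M" "f \<in> borel_measurable borel"
    and T: "T > 0" and q: "q > 0" and \<kappa>: "\<kappa> \<ge> 0"
    and tail: "\<And>a. a \<ge> T \<Longrightarrow> emeasure M {x \<in> space M. a < g x} = ennreal (\<kappa> * a powr - q)"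
  shows "(\<integral>\<^sup>+x. f (g x) * indicator {T<..} (g x) \<partial>M) =
    (\<integral>\<^sup>+r. f r * (ennreal (\<kappa> * q * r powr (- q - 1)) * indicator {T<..} r) \<partial>lborel)"
proof -
  define M1 where "M1 = density (distr M borel g) (indicator {T<..})"
  define N1 where "N1 = density lborel (\<lambda>r. ennreal (\<kappa> * q * r powr (- q - 1)) * indicator {T<..} r)"
  have em: "emeasure M1 {x<..} = ennreal (\<kappa> * (max T x) powr - q)" for x
  proof -
    have "emeasure M1 {x<..} = (\<integral>\<^sup>+r. indicator {T<..} r * indicator {x<..} r \<partial>distr M borel g)"
      unfolding M1_def by (rule emeasure_density) auto
    also have "\<dots> = (\<integral>\<^sup>+r. indicator {max T x<..} r \<partial>distr M borel g)"
      by (rule nn_integral_cong) (auto split: split_indicator)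
    also have "\<dots> = emeasure M (g -` {max T x<..} \<inter> space M)"
      by (simp add: emeasure_distr)
    also have "g -` {max T x<..} \<inter> space M = {y \<in> space M. max T x < g y}" by auto
    also have "emeasure M \<dots> = ennreal (\<kappa> * (max T x) powr - q)"
      by (rule tail) simp
    finally show ?thesis .
  qed
  have en: "emeasure N1 {x<..} = ennreal (\<kappa> * (max T x) powr - q)" for x
  proof -
    have "emeasure N1 {x<..} = (\<integral>\<^sup>+r. ennreal (\<kappa> * q) * (ennreal (r powr - (q + 1)) * indicator {max T x<..} r) \<partial>lborel)"
      unfolding N1_def using q \<kappa>
      by (subst emeasure_density) (auto intro!: nn_integral_cong simp: indicator_def ennreal_mult)
    also have "\<dots> = ennreal (\<kappa> * q) * ennreal ((max T x) powr (1 - (q + 1)) / (q + 1 - 1))"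
      using nn_integral_powr_tail[of "max T x" "q + 1"] T q by (subst nn_integral_cmult) auto
    also have "\<dots> = ennreal (\<kappa> * (max T x) powr - q)"
      using q \<kappa> by (subst ennreal_mult[symmetric]) auto
    finally show ?thesis .
  qed
  have "M1 = N1"
    by (rule measure_eqI_lessThan) (auto simp: em en, auto simp: M1_def N1_def)
  have "(\<integral>\<^sup>+x. f (g x) * indicator {T<..} (g x) \<partial>M) = (\<integral>\<^sup>+r. f r \<partial>M1)"
    unfolding M1_def by (simp add: nn_integral_density nn_integral_distr mult.commute)
  also have "\<dots> = (\<integral>\<^sup>+r. f r * (ennreal (\<kappa> * q * r powr (- q - 1)) * indicator {T<..} r) \<partial>lborel)"
    unfolding \<open>M1 = N1\<close> N1_def by (subst nn_integral_density) (auto simp: mult.commute)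
  finally show ?thesis .
qed

section \<open>Oscillation on the boundary of a cube\<close>

definition upd :: "'n \<Rightarrow> real \<Rightarrow> real^'n \<Rightarrow> real^'n" where
  "upd i \<rho> z = (\<chi> j. if j = i then \<rho> else z $ j)"

text \<open>An integral over a face \<open>z $ i = \<rho>\<close> of a cube is written as an integral over the slab
  \<open>0 < z $ i < 1\<close> of a function of \<open>upd i \<rho> z\<close>, so that no measure in dimension \<open>n - 1\<close> is needed.\<close>

definition slab :: "'n \<Rightarrow> real^'n \<Rightarrow> real \<Rightarrow> (real^'n) set" where
  "slab i x s = {z. 0 < z $ i \<and> z $ i < 1 \<and> (\<forall>j. j \<noteq> i \<longrightarrow> \<bar>z $ j - x $ j\<bar> < s)}"

text \<open>The maximum norm of the coordinates other than \<open>i\<close>; its balls inside a face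
  are slabs of known measure. Inserting \<open>0\<close> gives the maximum a value in dimension
  one.\<close>

definition offnorm :: "'n \<Rightarrow> real^'n \<Rightarrow> real" where
  "offnorm i z = Max (insert 0 ((\<lambda>j. \<bar>z $ j\<bar>) ` (UNIV - {i})))"

lemma upd_nth [simp]: "upd i \<rho> z $ j = (if j = i then \<rho> else z $ j)"
  by (simp add: upd_def)

lemma vec_nth_measurable [measurable (raw)]:
  fixes f :: "'a \<Rightarrow> real^'n"
  assumes "f \<in> borel_measurable M" shows "(\<lambda>x. f x $ i) \<in> borel_measurable M"
proof -
  have "(\<lambda>z::real^'n. z $ i) \<in> borel_measurable borel"
    by (intro borel_measurable_continuous_onI continuous_intros)
  then show ?thesis by (rule measurable_compose[OF assms])
qed

lemma upd_measurable [measurable (raw)]: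
  fixes g :: "'a \<Rightarrow> real^'n"
  assumes "f \<in> borel_measurable M" "g \<in> borel_measurable M"
  shows "(\<lambda>x. upd i (f x) (g x)) \<in> borel_measurable M"
proof -
  have "continuous_on UNIV (\<lambda>p::real \<times> (real^'n). if j = i then fst p else snd p $ j)" for j
    by (cases "j = i") (auto intro!: continuous_intros)
  then have "continuous_on UNIV (\<lambda>p::real \<times> (real^'n). upd i (fst p) (snd p))"
    unfolding upd_def by (intro continuous_on_vec_lambda)
  then have "(\<lambda>p::real \<times> (real^'n). upd i (fst p) (snd p)) \<in> borel_measurable (borel \<Otimes>\<^sub>M borel)"
    using borel_measurable_continuous_onI by (simp add: borel_prod)
  from measurable_compose[OF measurable_Pair[OF assms] this] show ?thesis by simp
qed

lemma offnorm_le_iff: "c \<ge> 0 \<Longrightarrow> offnorm i z \<le> c \<longleftrightarrow> (\<forall>j. j \<noteq> i \<longrightarrow> \<bar>z $ j\<bar> \<le> c)"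
  by (auto simp: offnorm_def)

lemma offnorm_less_iff: "c > 0 \<Longrightarrow> offnorm i z < c \<longleftrightarrow> (\<forall>j. j \<noteq> i \<longrightarrow> \<bar>z $ j\<bar> < c)"
  by (auto simp: offnorm_def)

lemma offnorm_nonneg: "offnorm i z \<ge> 0"
  by (simp add: offnorm_def Max_ge_iff)

lemma abs_le_offnorm: "j \<noteq> i \<Longrightarrow> \<bar>z $ j\<bar> \<le> offnorm i z"
  using offnorm_le_iff[OF offnorm_nonneg] by blast

lemma offnorm_measurable [measurable]: "offnorm i \<in> borel_measurable borel"
proof (rule borel_measurableI_less)
  fix c
  show "{z \<in> space borel. offnorm i z < c} \<in> sets borel"
  proof (cases "c > 0")
    case True
    have "{z::real^'a. \<forall>j. j \<noteq> i \<longrightarrow> \<bar>z $ j\<bar> < c} = (\<Inter>j\<in>UNIV - {i}. {z. \<bar>z $ j\<bar> < c})" by auto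
    moreover have "{z::real^'a. \<bar>z $ j\<bar> < c} \<in> sets borel" for j
      by (intro borel_open open_Collect_less continuous_intros)
    ultimately show ?thesis
      by (cases "UNIV - {i} = {}") (auto simp: offnorm_less_iff[OF True] intro!: sets.finite_INT)
  next
    case False
    then have "{z \<in> space borel. offnorm i z < c} = {}" using offnorm_nonneg[of i] by (auto intro: order_trans simp: not_less)
    then show ?thesis by (metis sets.empty_sets)
  qed
qed

lemma offnorm_scale:
  assumes "\<tau> > 0" "\<And>j. j \<noteq> i \<Longrightarrow> z $ j = \<tau> * w $ j"
  shows "offnorm i z = \<tau> * offnorm i w"
proof (rule antisym)
  show "offnorm i z \<le> \<tau> * offnorm i w"
    using assms offnorm_nonneg[of i w] by (subst offnorm_le_iff) (auto simp: abs_mult abs_le_offnorm)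
  have "offnorm i w \<le> offnorm i z / \<tau>"
  proof (subst offnorm_le_iff, use assms offnorm_nonneg[of i z] in simp, intro allI impI)
    fix j assume "j \<noteq> i"
    then have "\<tau> * \<bar>w $ j\<bar> \<le> offnorm i z" using abs_le_offnorm[of j i z] assms by (simp add: abs_mult)
    then show "\<bar>w $ j\<bar> \<le> offnorm i z / \<tau>" using assms(1) by (simp add: field_simps)
  qed
  then show "\<tau> * offnorm i w \<le> offnorm i z" using assms(1) by (simp add: field_simps)
qed

lemma norm_le_offnorm:
  fixes z :: "real^'n"
  assumes "z $ i = 0" shows "norm z \<le> real CARD('n) * offnorm i z"
proof -
  have "norm z \<le> (\<Sum>j\<in>UNIV. \<bar>z $ j\<bar>)" by (rule norm_le_l1_cart)
  also have "\<dots> \<le> (\<Sum>j\<in>(UNIV::'n set). offnorm i z)"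
    using assms offnorm_nonneg[of i z] abs_le_offnorm[of _ i z] by (intro sum_mono) (metis abs_zero)
  finally show ?thesis by simp
qed

section \<open>Measure of boxes and integration over faces\<close>

lemma prod_Basis_cart: "(\<Prod>b\<in>(Basis::(real^'n) set). f b) = (\<Prod>j\<in>UNIV. f (axis j 1))"
proof -
  have B: "(Basis::(real^'n) set) = (\<lambda>j. axis j 1) ` UNIV" by (auto simp: Basis_vec_def)
  have "inj (\<lambda>j::'n. axis j (1::real))" by (auto simp: inj_on_def axis_eq_axis)
  then show ?thesis unfolding B by (simp add: prod.reindex)
qed

lemma emeasure_box_cart:
  fixes a b :: "real^'n"
  assumes "\<And>j. a $ j \<le> b $ j"
  shows "emeasure lborel (box a b) = ennreal (\<Prod>j\<in>UNIV. b $ j - a $ j)"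
proof -
  have "\<forall>c\<in>Basis. a \<bullet> c \<le> b \<bullet> c" using assms by (auto simp: Basis_vec_def inner_axis)
  then show ?thesis
    by (simp add: emeasure_lborel_box_eq prod_Basis_cart inner_axis)
qed

lemma lborel_eqI_cart:
  fixes M :: "(real^'n) measure"
  assumes "\<And>l u. (\<And>j. l $ j \<le> u $ j) \<Longrightarrow> emeasure M (box l u) = ennreal (\<Prod>j\<in>UNIV. u $ j - l $ j)"
    and "sets M = sets borel"
  shows "lborel = M"
proof (rule lborel_eqI)
  fix l u :: "real^'n" assume le: "\<And>b. b \<in> Basis \<Longrightarrow> l \<bullet> b \<le> u \<bullet> b"
  have "l $ j \<le> u $ j" for j using le[of "axis j 1"] by (simp add: axis_in_Basis_iff inner_axis)
  then show "emeasure M (box l u) = ennreal (\<Prod>b\<in>Basis. (u - l) \<bullet> b)"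
    by (simp add: assms(1) prod_Basis_cart inner_axis)
qed (rule assms(2))

lemma prod_split_index:
  fixes f :: "'n::finite \<Rightarrow> real"
  shows "(\<Prod>j\<in>UNIV. f j) = f i * (\<Prod>j\<in>UNIV - {i}. f j)"
  by (subst prod.remove[of UNIV i]) auto

lemma slab_box: "slab i x s = box (\<chi> j. if j = i then 0 else x $ j - s) (\<chi> j. if j = i then 1 else x $ j + s)"
proof (intro set_eqI iffI)
  fix z assume "z \<in> slab i x s"
  then show "z \<in> box (\<chi> j. if j = i then 0 else x $ j - s) (\<chi> j. if j = i then 1 else x $ j + s)"
    by (auto simp: slab_def mem_box_cart abs_less_iff algebra_simps)
next
  fix z assume *: "z \<in> box (\<chi> j. if j = i then 0 else x $ j - s) (\<chi> j. if j = i then 1 else x $ j + s)"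
  have "0 < z $ i" "z $ i < 1" using *[unfolded mem_box_cart, rule_format, of i] by auto
  moreover have "\<bar>z $ j - x $ j\<bar> < s" if "j \<noteq> i" for j
    using *[unfolded mem_box_cart, rule_format, of j] that by auto
  ultimately show "z \<in> slab i x s" by (auto simp: slab_def)
qed

lemma slab_measurable [measurable]: "slab i x s \<in> sets borel"
  by (simp add: slab_box)

lemma emeasure_slab:
  fixes x :: "real^'n"
  assumes "s \<ge> 0" shows "emeasure lborel (slab i x s) = ennreal ((2 * s) ^ (CARD('n) - 1))"
proof -
  have "emeasure lborel (slab i x s) = ennreal (\<Prod>j\<in>UNIV. (if j = i then 1 else 2 * s))"
    unfolding slab_box using assms by (subst emeasure_box_cart) (auto intro!: arg_cong[where f = ennreal] prod.cong)
  also have "(\<Prod>j\<in>(UNIV::'n set). (if j = i then 1 else 2 * s)) = (2 * s) ^ (CARD('n) - 1)"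
    by (subst prod_split_index[of _ i]) (simp add: card_Diff_singleton)
  finally show ?thesis .
qed

text \<open>Fubini in direction \<open>i\<close>. The coordinate \<open>z $ i\<close> of the slab is
  a dummy that ranges over an interval of length \<open>1\<close> and is overwritten by
  \<open>\<rho>\<close>; the image measure agrees with Lebesgue measure on boxes.\<close>

lemma nn_integral_slices:
  fixes f :: "real^'n \<Rightarrow> ennreal"
  assumes [measurable]: "f \<in> borel_measurable borel"
  shows "(\<integral>\<^sup>+\<rho>. (\<integral>\<^sup>+z. f (upd i \<rho> z) * indicator {0<..<1} (z $ i) \<partial>lborel) \<partial>lborel) = (\<integral>\<^sup>+z. f z \<partial>lborel)"
proof -
  define M where "M = distr (density (lborel \<Otimes>\<^sub>M lborel) (\<lambda>p. indicator {0<..<1} (snd p $ i))) borel (\<lambda>p::real \<times> (real^'n). upd i (fst p) (snd p))"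
  have int: "(\<integral>\<^sup>+z. g z \<partial>M) = (\<integral>\<^sup>+\<rho>. (\<integral>\<^sup>+z. g (upd i \<rho> z) * indicator {0<..<1} (z $ i) \<partial>lborel) \<partial>lborel)"
    if [measurable]: "g \<in> borel_measurable borel" for g
  proof -
    have "(\<integral>\<^sup>+z. g z \<partial>M) = (\<integral>\<^sup>+p. indicator {0<..<1} (snd p $ i) * g (upd i (fst p) (snd p)) \<partial>(lborel \<Otimes>\<^sub>M lborel))"
      unfolding M_def by (subst nn_integral_distr) (auto simp: nn_integral_density)
    also have "\<dots> = (\<integral>\<^sup>+\<rho>. (\<integral>\<^sup>+z. indicator {0<..<1} (z $ i) * g (upd i \<rho> z) \<partial>lborel) \<partial>lborel)"
      by (subst lborel.nn_integral_fst[symmetric]) auto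
    finally show ?thesis by (simp add: mult.commute)
  qed
  have "lborel = M"
  proof (rule lborel_eqI_cart)
    fix l u :: "real^'n" assume le: "\<And>j. l $ j \<le> u $ j"
    have "emeasure M (box l u) = (\<integral>\<^sup>+z. indicator (box l u) z \<partial>M)"
      by (simp add: M_def)
    also have "\<dots> = (\<integral>\<^sup>+\<rho>. (\<integral>\<^sup>+z. indicator (box l u) (upd i \<rho> z) * indicator {0<..<1} (z $ i) \<partial>lborel) \<partial>lborel)"
      by (rule int) simp
    also have "\<dots> = (\<integral>\<^sup>+\<rho>. (\<integral>\<^sup>+z. indicator {l $ i<..<u $ i} \<rho> * indicator (box (upd i 0 l) (upd i 1 u)) z \<partial>lborel) \<partial>lborel)"
    proof (intro nn_integral_cong)
      fix \<rho> and z :: "real^'n"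
      have "upd i \<rho> z \<in> box l u \<and> z $ i \<in> {0<..<1} \<longleftrightarrow> \<rho> \<in> {l $ i<..<u $ i} \<and> z \<in> box (upd i 0 l) (upd i 1 u)"
        unfolding mem_box_cart by (auto split: if_splits)
      then show "indicator (box l u) (upd i \<rho> z) * indicator {0<..<1} (z $ i) = (indicator {l $ i<..<u $ i} \<rho> * indicator (box (upd i 0 l) (upd i 1 u)) z :: ennreal)"
        by (auto simp: indicator_def)
    qed
    also have "\<dots> = ennreal (u $ i - l $ i) * emeasure lborel (box (upd i 0 l) (upd i 1 u))"
      using le[of i] by (simp add: nn_integral_cmult nn_integral_multc)
    also have "emeasure lborel (box (upd i 0 l) (upd i 1 u)) = ennreal (\<Prod>j\<in>UNIV - {i}. u $ j - l $ j)"
      using le by (subst emeasure_box_cart) (auto simp: prod_split_index[of _ i] intro!: arg_cong[where f = ennreal] prod.cong)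
    also have "ennreal (u $ i - l $ i) * \<dots> = ennreal (\<Prod>j\<in>UNIV. u $ j - l $ j)"
      using le by (subst ennreal_mult[symmetric]) (auto simp: prod_split_index[of _ i] intro!: prod_nonneg)
    finally show "emeasure M (box l u) = ennreal (\<Prod>j\<in>UNIV. u $ j - l $ j)" .
  qed (simp add: M_def)
  then show ?thesis using int[OF assms] by simp
qed

section \<open>The Riesz potential estimate on a face\<close>

definition contract :: "'n \<Rightarrow> real \<Rightarrow> real^'n \<Rightarrow> real^'n \<Rightarrow> real^'n" where
  "contract i \<tau> y w = (\<chi> j. if j = i then w $ j else y $ j + \<tau> * (w $ j - y $ j))"

lemma contract_nth: "contract i \<tau> y w $ j = (if j = i then w $ j else y $ j + \<tau> * (w $ j - y $ j))"
  by (simp add: contract_def)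

lemma contract_measurable [measurable (raw)]:
  fixes g :: "'a \<Rightarrow> real^'n"
  assumes "f \<in> borel_measurable M" "g \<in> borel_measurable M"
  shows "(\<lambda>x. contract i (f x) y (g x)) \<in> borel_measurable M"
proof -
  have "continuous_on UNIV (\<lambda>p::real \<times> (real^'n). if j = i then snd p $ j else y $ j + fst p * (snd p $ j - y $ j))" for j
    by (cases "j = i") (auto intro!: continuous_intros)
  then have "continuous_on UNIV (\<lambda>p::real \<times> (real^'n). contract i (fst p) y (snd p))"
    unfolding contract_def by (intro continuous_on_vec_lambda)
  then have "(\<lambda>p::real \<times> (real^'n). contract i (fst p) y (snd p)) \<in> borel_measurable (borel \<Otimes>\<^sub>M borel)"
    using borel_measurable_continuous_onI by (simp add: borel_prod)
  from measurable_compose[OF measurable_Pair[OF assms] this] show ?thesis by simp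
qed

text \<open>Coordinate \<open>i\<close> is not scaled, which explains the exponent of the
  Jacobian.\<close>

lemma nn_integral_contract:
  fixes f :: "real^'n \<Rightarrow> ennreal"
  assumes [measurable]: "f \<in> borel_measurable borel" and \<tau>: "\<tau> > 0"
  shows "(\<integral>\<^sup>+w. f (contract i \<tau> y w) \<partial>lborel) = ennreal (1 / \<tau> ^ (CARD('n) - 1)) * (\<integral>\<^sup>+z. f z \<partial>lborel)"
proof -
  let ?c = "\<tau> ^ (CARD('n) - 1)"
  have "lborel = density (distr lborel borel (contract i \<tau> y)) (\<lambda>_. ennreal ?c)"
  proof (rule lborel_eqI_cart)
    fix l u :: "real^'n" assume le: "\<And>j. l $ j \<le> u $ j"
    define l' where "l' = (\<chi> j. if j = i then l $ j else y $ j + (l $ j - y $ j) / \<tau>)"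
    define u' where "u' = (\<chi> j. if j = i then u $ j else y $ j + (u $ j - y $ j) / \<tau>)"
    have pre: "contract i \<tau> y -` box l u = box l' u'"
    proof (intro set_eqI)
      fix w
      have "(l $ j < contract i \<tau> y w $ j \<and> contract i \<tau> y w $ j < u $ j) \<longleftrightarrow> (l' $ j < w $ j \<and> w $ j < u' $ j)" for j
        using \<tau> by (auto simp: contract_nth l'_def u'_def field_simps)
      then show "w \<in> contract i \<tau> y -` box l u \<longleftrightarrow> w \<in> box l' u'"
        by (simp add: mem_box_cart)
    qed
    have "emeasure (density (distr lborel borel (contract i \<tau> y)) (\<lambda>_. ennreal ?c)) (box l u) = ennreal ?c * emeasure lborel (box l' u')"
      by (subst emeasure_density) (auto simp: nn_integral_cmult emeasure_distr pre)
    also have "emeasure lborel (box l' u') = ennreal (\<Prod>j\<in>UNIV. u' $ j - l' $ j)"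
      using le \<tau> by (intro emeasure_box_cart) (auto simp: l'_def u'_def divide_right_mono)
    also have "(\<Prod>j\<in>UNIV. u' $ j - l' $ j) = (u $ i - l $ i) * (\<Prod>j\<in>UNIV - {i}. (u $ j - l $ j) / \<tau>)"
      by (subst prod_split_index[of _ i]) (auto simp: l'_def u'_def diff_divide_distrib intro!: prod.cong)
    also have "(\<Prod>j\<in>UNIV - {i}. (u $ j - l $ j) / \<tau>) = (\<Prod>j\<in>UNIV - {i}. u $ j - l $ j) / ?c"
      by (simp add: prod_dividef card_Diff_singleton)
    also have "ennreal ?c * ennreal ((u $ i - l $ i) * ((\<Prod>j\<in>UNIV - {i}. u $ j - l $ j) / ?c)) = ennreal (\<Prod>j\<in>UNIV. u $ j - l $ j)"
      using \<tau> le by (subst ennreal_mult[symmetric]) (auto simp: prod_split_index[of _ i] intro!: mult_nonneg_nonneg divide_nonneg_nonneg prod_nonneg)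
    finally show "emeasure (density (distr lborel borel (contract i \<tau> y)) (\<lambda>_. ennreal ?c)) (box l u) = ennreal (\<Prod>j\<in>UNIV. u $ j - l $ j)" .
  qed simp
  then have "(\<integral>\<^sup>+z. f z \<partial>lborel) = (\<integral>\<^sup>+z. f z \<partial>density (distr lborel borel (contract i \<tau> y)) (\<lambda>_. ennreal ?c))"
    by simp
  also have "\<dots> = ennreal ?c * (\<integral>\<^sup>+w. f (contract i \<tau> y w) \<partial>lborel)"
    by (subst nn_integral_density) (auto simp: nn_integral_cmult nn_integral_distr)
  finally have "ennreal (1 / ?c) * (\<integral>\<^sup>+z. f z \<partial>lborel) = ennreal (1 / ?c) * ennreal ?c * (\<integral>\<^sup>+w. f (contract i \<tau> y w) \<partial>lborel)"
    by (simp add: mult.assoc)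
  also have "ennreal (1 / ?c) * ennreal ?c = 1"
    using \<tau> by (subst ennreal_mult[symmetric]) auto
  finally show ?thesis by simp
qed

definition grad :: "(real^'n \<Rightarrow> real) \<Rightarrow> real^'n \<Rightarrow> real^'n" where
  "grad f x = (\<chi> i. partial_deriv i f x)"

lemma continuous_grad: "smooth f \<Longrightarrow> continuous_on S (grad f)"
  unfolding grad_def by (intro continuous_on_vec_lambda smooth_continuous smooth_partial_deriv)

lemma has_derivative_grad: "smooth f \<Longrightarrow> (f has_derivative (\<lambda>v. v \<bullet> grad f x)) (at x)"
  using has_derivative_partial_deriv[OF smooth_differentiable] by (simp add: inner_vec_def grad_def)

lemma segment_estimate:
  assumes "smooth f"
  shows "ennreal \<bar>f y' - f y\<bar> \<le> (\<integral>\<^sup>+\<tau>\<in>{0..1}. ennreal (norm (grad f (y + \<tau> *\<^sub>R (y' - y))) * norm (y' - y)) \<partial>lborel)"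
proof -
  let ?g = "\<lambda>\<tau>. f (y + \<tau> *\<^sub>R (y' - y))" and ?g' = "\<lambda>\<tau>. (y' - y) \<bullet> grad f (y + \<tau> *\<^sub>R (y' - y))"
  have "has_bochner_integral lborel (\<lambda>\<tau>. indicator {0..1} \<tau> *\<^sub>R ?g' \<tau>) (?g 1 - ?g 0)"
  proof (rule has_bochner_integral_FTC_Icc)
    fix \<tau> :: real
    have "((\<lambda>\<tau>. y + \<tau> *\<^sub>R (y' - y)) has_derivative (\<lambda>t. t *\<^sub>R (y' - y))) (at \<tau>)"
      by (auto intro!: derivative_eq_intros)
    from has_derivative_compose[OF this has_derivative_grad[OF assms]]
    have "(?g has_derivative (\<lambda>t. (t *\<^sub>R (y' - y)) \<bullet> grad f (y + \<tau> *\<^sub>R (y' - y)))) (at \<tau>)" .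
    then show "(?g has_vector_derivative ?g' \<tau>) (at \<tau> within {0..1})"
      unfolding has_vector_derivative_def by (simp add: has_derivative_at_withinI)
    show "continuous_on {0..1} ?g'"
    proof (rule continuous_on_inner[OF continuous_on_const])
      show "continuous_on {0..1} (\<lambda>\<tau>. grad f (y + \<tau> *\<^sub>R (y' - y)))"
        by (rule continuous_on_compose2[OF continuous_grad[OF assms, of UNIV]]) (auto intro!: continuous_intros)
    qed
  qed simp
  then have I: "integrable lborel (\<lambda>\<tau>. indicator {0..1} \<tau> *\<^sub>R ?g' \<tau>)"
    and eq: "f y' - f y = (\<integral>\<tau>. indicator {0..1} \<tau> *\<^sub>R ?g' \<tau> \<partial>lborel)"
    by (auto simp: has_bochner_integral_iff)
  have "ennreal \<bar>f y' - f y\<bar> \<le> (\<integral>\<^sup>+\<tau>. norm (indicator {0..1} \<tau> *\<^sub>R ?g' \<tau>) \<partial>lborel)"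
    unfolding eq using integral_norm_bound_ennreal[OF I] by simp
  also have "\<dots> \<le> (\<integral>\<^sup>+\<tau>\<in>{0..1}. ennreal (norm (grad f (y + \<tau> *\<^sub>R (y' - y))) * norm (y' - y)) \<partial>lborel)"
    using Cauchy_Schwarz_ineq2 by (intro nn_integral_mono) (auto simp: indicator_def mult.commute intro!: ennreal_leI)
  finally show ?thesis .
qed

definition cube :: "real^'n \<Rightarrow> real \<Rightarrow> (real^'n) set" where
  "cube x s = {y. \<forall>j. \<bar>y $ j - x $ j\<bar> < s}"

lemma cube_box: "cube x s = box (\<chi> j. x $ j - s) (\<chi> j. x $ j + s)"
  by (auto simp: cube_def mem_box_cart abs_less_iff algebra_simps)

lemma open_cube: "open (cube x s)"
  by (simp add: cube_box open_box)

lemma cube_measurable [measurable]: "cube x s \<in> sets borel"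
  by (simp add: cube_box)

lemma offnorm_cong:
  assumes "\<And>j. j \<noteq> i \<Longrightarrow> z $ j = w $ j" shows "offnorm i z = offnorm i w"
  using offnorm_scale[of 1 i z w] assms by simp

lemma upd_contract:
  "upd i \<rho> y + \<tau> *\<^sub>R (upd i \<rho> w - upd i \<rho> y) = upd i \<rho> (contract i \<tau> y w)"
  by (simp add: vec_eq_iff contract_nth)

text \<open>The difference is integrated along the segments from \<open>y\<close>, which stay in the
  face. Substituting the point \<open>z\<close> at parameter \<open>\<tau>\<close> for the end point
  \<open>w\<close> costs \<open>1 / \<tau> ^ m\<close>, and \<open>z\<close> is reached only for
  \<open>\<tau> > offnorm i (z - y) / (2 * s)\<close>; integrating over \<open>\<tau>\<close> leaves
  the Riesz kernel of the \<open>m\<close>-dimensional face.\<close>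

lemma face_morrey:
  fixes f :: "real^'n \<Rightarrow> real" and y x :: "real^'n"
  assumes f: "smooth f" and s: "s > 0" and n: "CARD('n) \<ge> 2"
    and y: "\<And>j. j \<noteq> i \<Longrightarrow> \<bar>y $ j - x $ j\<bar> \<le> s"
  defines "m \<equiv> CARD('n) - 1"
  shows "(\<integral>\<^sup>+w\<in>slab i x s. ennreal \<bar>f (upd i \<rho> w) - f (upd i \<rho> y)\<bar> \<partial>lborel)
    \<le> ennreal (real CARD('n) * (2 * s) ^ m) *
      (\<integral>\<^sup>+z\<in>slab i x s. ennreal (norm (grad f (upd i \<rho> z)) * offnorm i (z - y) powr (1 - real m)) \<partial>lborel)"
proof -
  define h where "h z = norm (grad f (upd i \<rho> z))" for z
  have [measurable]: "grad f \<in> borel_measurable borel"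
    by (rule borel_measurable_continuous_onI[OF continuous_grad[OF f]])
  have [measurable]: "h \<in> borel_measurable borel" unfolding h_def by measurable
  have h0: "h z \<ge> 0" for z by (simp add: h_def)
  let ?n = "real CARD('n)"
  let ?N = "\<lambda>z. offnorm i (z - y)"
  have m: "m \<ge> 1" using n by (simp add: m_def)
  \<comment> \<open>At \<open>z = contract i \<tau> y w\<close> the quotient
    \<open>?N z / \<tau>\<close> is the distance of \<open>w\<close> from \<open>y\<close>, and the
    last factor records that this distance is less than \<open>2 * s\<close>.\<close>
  define F where "F \<tau> z = ennreal (h z * (?n * (?N z / \<tau>))) * indicator (slab i x s) z * (if ?N z < 2 * s * \<tau> then 1 else 0)" for \<tau> z
  have [measurable]: "(\<lambda>p. F (f p) (g p)) \<in> borel_measurable M"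
    if [measurable]: "f \<in> borel_measurable M" "g \<in> borel_measurable M" for f and g :: "'z \<Rightarrow> real^'n" and M
    unfolding F_def by measurable
  have N_less: "?N w < 2 * s" if "w \<in> slab i x s" for w
  proof -
    have "\<bar>w $ j - y $ j\<bar> < 2 * s" if "j \<noteq> i" for j
    proof -
      have "\<bar>w $ j - x $ j\<bar> < s" using \<open>w \<in> slab i x s\<close> that by (simp add: slab_def)
      then show ?thesis using y[OF that] by linarith
    qed
    then show ?thesis using s by (subst offnorm_less_iff) auto
  qed
  have N_contract: "?N (contract i \<tau> y w) = \<tau> * ?N w" if "\<tau> > 0" for \<tau> w
    using that by (intro offnorm_scale) (auto simp: contract_nth)
  have slab_contract: "contract i \<tau> y w \<in> slab i x s" if "w \<in> slab i x s" "0 < \<tau>" "\<tau> \<le> 1" for \<tau> w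
  proof -
    have "\<bar>y $ j + \<tau> * (w $ j - y $ j) - x $ j\<bar> < s" if "j \<noteq> i" for j
    proof -
      have "y $ j + \<tau> * (w $ j - y $ j) - x $ j = (1 - \<tau>) * (y $ j - x $ j) + \<tau> * (w $ j - x $ j)"
        by (simp add: algebra_simps)
      also have "\<bar>\<dots>\<bar> \<le> (1 - \<tau>) * \<bar>y $ j - x $ j\<bar> + \<tau> * \<bar>w $ j - x $ j\<bar>"
        using \<open>0 < \<tau>\<close> \<open>\<tau> \<le> 1\<close> by (intro order_trans[OF abs_triangle_ineq]) (simp add: abs_mult)
      also have "\<dots> < (1 - \<tau>) * s + \<tau> * s"
      proof (rule add_le_less_mono)
        show "(1 - \<tau>) * \<bar>y $ j - x $ j\<bar> \<le> (1 - \<tau>) * s"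
          using y[OF \<open>j \<noteq> i\<close>] \<open>\<tau> \<le> 1\<close> by (intro mult_left_mono) auto
        show "\<tau> * \<bar>w $ j - x $ j\<bar> < \<tau> * s"
          using \<open>w \<in> slab i x s\<close> \<open>j \<noteq> i\<close> \<open>0 < \<tau>\<close> by (intro mult_strict_left_mono) (auto simp: slab_def)
      qed
      finally show ?thesis by (simp add: algebra_simps)
    qed
    then show ?thesis using that(1) by (auto simp: slab_def contract_nth)
  qed
  have step1: "ennreal \<bar>f (upd i \<rho> w) - f (upd i \<rho> y)\<bar> * indicator (slab i x s) w
     \<le> (\<integral>\<^sup>+\<tau>. indicator {0<..1} \<tau> * F \<tau> (contract i \<tau> y w) \<partial>lborel)" for w
  proof (cases "w \<in> slab i x s")
    case True
    have "norm (upd i \<rho> w - upd i \<rho> y) \<le> ?n * ?N w"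
      using norm_le_offnorm[of "upd i \<rho> w - upd i \<rho> y" i] offnorm_cong[of i "upd i \<rho> w - upd i \<rho> y" "w - y"] by simp
    note nle = this
    have "ennreal \<bar>f (upd i \<rho> w) - f (upd i \<rho> y)\<bar>
      \<le> (\<integral>\<^sup>+\<tau>\<in>{0..1}. ennreal (h (contract i \<tau> y w) * norm (upd i \<rho> w - upd i \<rho> y)) \<partial>lborel)"
      using segment_estimate[OF f, of "upd i \<rho> w" "upd i \<rho> y"] unfolding upd_contract h_def .
    also have "\<dots> \<le> (\<integral>\<^sup>+\<tau>. indicator {0<..1} \<tau> * F \<tau> (contract i \<tau> y w) \<partial>lborel)"
    proof (rule nn_integral_mono_AE)
      show "AE \<tau> in lborel. ennreal (h (contract i \<tau> y w) * norm (upd i \<rho> w - upd i \<rho> y)) * indicator {0..1} \<tau>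
          \<le> indicator {0<..1} \<tau> * F \<tau> (contract i \<tau> y w)"
        using AE_lborel_singleton[of 0]
      proof eventually_elim
        case (elim \<tau>)
        show ?case
        proof (cases "0 < \<tau> \<and> \<tau> \<le> 1")
          case \<tau>: True
          have "F \<tau> (contract i \<tau> y w) = ennreal (h (contract i \<tau> y w) * (?n * ?N w))"
            using \<tau> N_less[OF True] slab_contract[OF True, of \<tau>] by (simp add: F_def N_contract mult.commute)
          moreover have "ennreal (h (contract i \<tau> y w) * norm (upd i \<rho> w - upd i \<rho> y)) \<le> ennreal (h (contract i \<tau> y w) * (?n * ?N w))"
            using nle h0 by (intro ennreal_leI mult_left_mono)
          ultimately show ?thesis using \<tau> by simp
        qed (use elim in \<open>auto simp: indicator_def\<close>)
      qed
    qed
    finally show ?thesis using True by simp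
  qed simp
  have inner: "(\<integral>\<^sup>+\<tau>. indicator {0<..1} \<tau> * (ennreal (1 / \<tau> ^ m) * F \<tau> z) \<partial>lborel)
     \<le> ennreal (?n * (2 * s) ^ m) * (ennreal (h z * ?N z powr (1 - real m)) * indicator (slab i x s) z)" for z
  proof (cases "z \<in> slab i x s \<and> ?N z > 0")
    case False
    then have "F \<tau> z = 0" for \<tau> using offnorm_nonneg[of i "z - y"] by (auto simp: F_def)
    then show ?thesis by simp
  next
    case True
    \<comment> \<open>The exponent collects \<open>\<tau> ^ m\<close> from the Jacobian and one
      \<open>\<tau>\<close> from the quotient \<open>?N z / \<tau>\<close>.\<close>
    define q where "q = real m + 1"
    define t where "t = ?N z / (2 * s)"
    have t: "t > 0" using True s by (simp add: t_def)
    have "(\<integral>\<^sup>+\<tau>. indicator {0<..1} \<tau> * (ennreal (1 / \<tau> ^ m) * F \<tau> z) \<partial>lborel)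
      \<le> (\<integral>\<^sup>+\<tau>. ennreal (h z * (?n * ?N z)) * (ennreal (\<tau> powr - q) * indicator {t<..} \<tau>) \<partial>lborel)"
    proof (rule nn_integral_mono)
      fix \<tau> :: real
      show "indicator {0<..1} \<tau> * (ennreal (1 / \<tau> ^ m) * F \<tau> z) \<le> ennreal (h z * (?n * ?N z)) * (ennreal (\<tau> powr - q) * indicator {t<..} \<tau>)"
      proof (cases "0 < \<tau> \<and> ?N z < 2 * s * \<tau>")
        case \<tau>: True
        have "\<tau> powr - q = 1 / \<tau> ^ m / \<tau>"
        proof -
          have "- q = - real (Suc m)" by (simp add: q_def)
          then have "\<tau> powr - q = inverse (\<tau> ^ Suc m)"
            using \<tau> powr_realpow[of \<tau> "Suc m"] by (simp only: powr_minus)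
          then show ?thesis by (simp add: divide_inverse mult.commute)
        qed
        then have "ennreal (1 / \<tau> ^ m) * F \<tau> z = ennreal (h z * (?n * ?N z)) * ennreal (\<tau> powr - q)"
          using True \<tau> h0 by (simp add: F_def ac_simps flip: ennreal_mult)
        moreover have "t < \<tau>" using \<tau> s by (simp add: t_def field_simps)
        ultimately show ?thesis by (auto simp: indicator_def)
      qed (auto simp: F_def indicator_def)
    qed
    also have "\<dots> = ennreal (h z * (?n * ?N z)) * ennreal (t powr (1 - q) / (q - 1))"
      using nn_integral_powr_tail[OF t, of q] m by (simp add: nn_integral_cmult q_def)
    also have "\<dots> \<le> ennreal (?n * (2 * s) ^ m) * ennreal (h z * ?N z powr (1 - real m))"
    proof -
      have "t powr (1 - q) = t powr - real m" by (simp add: q_def)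
      also have "\<dots> = (2 * s) ^ m * ?N z powr - real m"
        using True s by (simp add: t_def powr_divide powr_minus powr_realpow field_simps)
      finally have "h z * (?n * ?N z) * (t powr (1 - q) / (q - 1)) = ?n * (2 * s) ^ m * (h z * (?N z * ?N z powr - real m)) / real m"
        by (simp add: q_def)
      also have "?N z * ?N z powr - real m = ?N z powr (1 - real m)"
        using True by (simp add: powr_diff powr_minus divide_inverse)
      also have "?n * (2 * s) ^ m * (h z * ?N z powr (1 - real m)) / real m \<le> ?n * (2 * s) ^ m * (h z * ?N z powr (1 - real m)) / 1"
        using m s h0 by (intro divide_left_mono mult_nonneg_nonneg) auto
      finally show ?thesis using h0 s m True by (simp add: q_def flip: ennreal_mult)
    qed
    finally show ?thesis using True by simp
  qed
  have "(\<integral>\<^sup>+w\<in>slab i x s. ennreal \<bar>f (upd i \<rho> w) - f (upd i \<rho> y)\<bar> \<partial>lborel)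
    \<le> (\<integral>\<^sup>+w. (\<integral>\<^sup>+\<tau>. indicator {0<..1} \<tau> * F \<tau> (contract i \<tau> y w) \<partial>lborel) \<partial>lborel)"
    by (intro nn_integral_mono step1)
  also have "\<dots> = (\<integral>\<^sup>+\<tau>. (\<integral>\<^sup>+w. indicator {0<..1} \<tau> * F \<tau> (contract i \<tau> y w) \<partial>lborel) \<partial>lborel)"
    by (rule lborel_pair.Fubini') measurable
  also have "\<dots> = (\<integral>\<^sup>+\<tau>. (\<integral>\<^sup>+z. indicator {0<..1} \<tau> * (ennreal (1 / \<tau> ^ m) * F \<tau> z) \<partial>lborel) \<partial>lborel)"
  proof (rule nn_integral_cong)
    fix \<tau> :: real
    show "(\<integral>\<^sup>+w. indicator {0<..1} \<tau> * F \<tau> (contract i \<tau> y w) \<partial>lborel) = (\<integral>\<^sup>+z. indicator {0<..1} \<tau> * (ennreal (1 / \<tau> ^ m) * F \<tau> z) \<partial>lborel)"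
    proof (cases "\<tau> \<in> {0<..1}")
      case True
      then show ?thesis using nn_integral_contract[of "F \<tau>" \<tau> i y] by (simp add: nn_integral_cmult m_def)
    qed simp
  qed
  also have "\<dots> = (\<integral>\<^sup>+z. (\<integral>\<^sup>+\<tau>. indicator {0<..1} \<tau> * (ennreal (1 / \<tau> ^ m) * F \<tau> z) \<partial>lborel) \<partial>lborel)"
    by (rule lborel_pair.Fubini') measurable
  also have "\<dots> \<le> (\<integral>\<^sup>+z. ennreal (?n * (2 * s) ^ m) * (ennreal (h z * ?N z powr (1 - real m)) * indicator (slab i x s) z) \<partial>lborel)"
    by (intro nn_integral_mono inner)
  also have "\<dots> = ennreal (?n * (2 * s) ^ m) * (\<integral>\<^sup>+z\<in>slab i x s. ennreal (h z * ?N z powr (1 - real m)) \<partial>lborel)"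
    by (rule nn_integral_cmult) measurable
  finally show ?thesis by (simp add: h_def)
qed

section \<open>The conjugate applied to the Riesz kernel on a face\<close>

lemma AE_nth_neq: "AE z in lborel. (z::real^'n) $ j \<noteq> c"
proof -
  have "closed {z::real^'n. z $ j = c}" by (intro closed_Collect_eq continuous_intros)
  then have "{z::real^'n. z $ j = c} \<in> null_sets lborel"
  proof -
    have "negligible {z::real^'n. z \<bullet> axis j 1 = c}"
      by (rule negligible_standard_hyperplane) (simp add: axis_in_Basis_iff)
    then have "negligible {z::real^'n. z $ j = c}" by (simp add: inner_axis)
    then show ?thesis
      using \<open>closed {z::real^'n. z $ j = c}\<close> by (simp add: negligible_iff_null_sets null_sets_completion_iff)
  qed
  then show ?thesis by (rule AE_I') auto
qed

text \<open>Where \<open>offnorm\<close> vanishes, \<open>powr\<close> returns the default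
  \<open>0\<close> instead of an infinite value of the kernel. This set is null because there is a
  coordinate other than \<open>i\<close>.\<close>

lemma AE_offnorm_pos:
  assumes "CARD('n) \<ge> 2" shows "AE z in lborel. offnorm i (z - (y::real^'n)) > 0"
proof -
  have "UNIV \<noteq> {i}" using assms by (metis card_1_singleton_iff card.empty is_singletonI is_singleton_altdef not_numeral_le_zero numeral_le_one_iff semiring_norm(69))
  then obtain j where "j \<noteq> i" by auto
  show ?thesis using AE_nth_neq[of j "y $ j"]
  proof eventually_elim
    case (elim z)
    then have "0 < \<bar>(z - y) $ j\<bar>" by simp
    also have "\<dots> \<le> offnorm i (z - y)" using \<open>j \<noteq> i\<close> by (rule abs_le_offnorm)
    finally show ?case .
  qed
qed

lemma conjugate_zero: "young_conjugate A 0 = 0"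
proof -
  have "young_conjugate A 0 \<le> 0" unfolding conjugate_le_iff by simp
  then show ?thesis by simp
qed

lemma slab_offnorm: "s > 0 \<Longrightarrow> z \<in> slab i x s \<longleftrightarrow> 0 < z $ i \<and> z $ i < 1 \<and> offnorm i (z - x) < s"
  by (simp add: slab_def offnorm_less_iff)

text \<open>Distributing the kernel \<open>offnorm powr (1 - m)\<close> turns the conjugate of \<open>A\<close> into the function
  whose conjugate is \<open>A_sub\<close>; this is where the sharp exponent \<open>m / (m - 1)\<close> comes from.\<close>

lemma kernel_integral:
  fixes y x :: "real^'n"
  assumes n: "CARD('n) \<ge> 2" and s: "s > 0" and T: "T > 0"
    and y: "\<And>j. j \<noteq> i \<Longrightarrow> \<bar>y $ j - x $ j\<bar> \<le> s"
  defines "m \<equiv> CARD('n) - 1"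
  shows "(\<integral>\<^sup>+z\<in>slab i x s. young_conjugate A (T * (2 * s) ^ (m - 1) * offnorm i (z - y) powr (1 - real m)) \<partial>lborel)
     \<le> ennreal (2 ^ CARD('n) * (2 * s) ^ m) * sub_kernel CARD('n) A T"
proof (cases "CARD('n) = 2")
  \<comment> \<open>On a one-dimensional face the kernel has exponent \<open>0\<close>; it is
    \<open>1\<close>, except for the default \<open>0 powr 0 = 0\<close>.\<close>
  case True
  then have m: "m = 1" by (simp add: m_def)
  have "(\<integral>\<^sup>+z\<in>slab i x s. young_conjugate A (T * (2 * s) ^ (m - 1) * offnorm i (z - y) powr (1 - real m)) \<partial>lborel)
    \<le> (\<integral>\<^sup>+z. young_conjugate A T * indicator (slab i x s) z \<partial>lborel)"
    using T by (intro nn_integral_mono mult_right_mono conjugate_mono) (auto simp: m powr_zero_eq_one)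
  also have "\<dots> = ennreal ((2 * s) ^ m) * young_conjugate A T"
    using s by (subst nn_integral_cmult) (auto simp: emeasure_slab m_def mult.commute)
  also have "\<dots> \<le> ennreal (2 ^ CARD('n) * (2 * s) ^ m) * young_conjugate A T"
    using s True by (intro mult_right_mono ennreal_leI) (auto simp: m)
  finally show ?thesis using True by (simp add: sub_kernel_def)
next
  case False
  then have n3: "CARD('n) \<ge> 3" using n by simp
  have m: "m \<ge> 2" using n3 by (simp add: m_def)
  \<comment> \<open>With \<open>m\<close> the dimension of the face this is the exponent in
    \<open>A_sub\<close>; it is the decay rate of the distribution of the kernel, whose superlevel
    sets have radius proportional to \<open>a powr (- 1 / (m - 1))\<close>.\<close>
  define p where "p = real m / (real m - 1)"
  have p_eq: "(real CARD('n) - 1) / (real CARD('n) - 2) = p" using n3 by (simp add: p_def m_def of_nat_diff)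
  have p: "p > 1" "p \<le> 2" using m by (auto simp: p_def field_simps)
  define t where "t = T * (2 * s) ^ (m - 1)"
  have t: "t > 0" using T s by (simp add: t_def)
  have m1: "real (m - 1) = real m - 1" using m by (simp add: of_nat_diff)
  define M where "M = density lborel (\<lambda>z::real^'n. indicator {0<..<1} (z $ i))"
  define g where "g z = t * offnorm i (z - y) powr (1 - real m)" for z
  have [measurable]: "g \<in> borel_measurable borel" unfolding g_def by measurable
  have less_iff: "a < g z \<longleftrightarrow> 0 < offnorm i (z - y) \<and> offnorm i (z - y) < (t / a) powr (1 / (real m - 1))"
    if "a > 0" for a z
  proof (cases "offnorm i (z - y) > 0")
    case True
    let ?N = "offnorm i (z - y)"
    have "g z = t / ?N powr (real m - 1)"
      using True by (simp add: g_def powr_diff)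
    then have "a < g z \<longleftrightarrow> ?N powr (real m - 1) < t / a"
      using True that by (simp add: pos_less_divide_eq mult.commute)
    also have "t / a = ((t / a) powr (1 / (real m - 1))) powr (real m - 1)"
      using t that m by (simp add: powr_powr)
    also have "?N powr (real m - 1) < \<dots> \<longleftrightarrow> ?N < (t / a) powr (1 / (real m - 1))"
    proof (cases "?N < (t / a) powr (1 / (real m - 1))")
      case *: True
      then show ?thesis using powr_less_mono2[OF _ _ *, of "real m - 1"] True m by simp
    next
      case *: False
      then have "((t / a) powr (1 / (real m - 1))) powr (real m - 1) \<le> ?N powr (real m - 1)"
        using m by (intro powr_mono2) auto
      then show ?thesis using * by linarith
    qed
    finally show ?thesis using True by simp
  next
    case False
    then have "offnorm i (z - y) = 0" using offnorm_nonneg[of i "z - y"] by simp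
    then show ?thesis using that by (simp add: g_def)
  qed
  \<comment> \<open>Up to a null set the superlevel set of \<open>g\<close> in the unit slab is a
    slab around \<open>y\<close> of radius \<open>\<rho> = (t / a) powr (1 / (m - 1))\<close>, of
    measure \<open>(2 * \<rho>) ^ m\<close>.\<close>
  have tail: "emeasure M {z \<in> space M. a < g z} = ennreal (2 ^ m * t powr p * a powr - p)" if "a \<ge> T" for a
  proof -
    have a: "a > 0" using that T by simp
    define \<rho> where "\<rho> = (t / a) powr (1 / (real m - 1))"
    have \<rho>: "\<rho> > 0" using t a by (simp add: \<rho>_def)
    have "emeasure M {z \<in> space M. a < g z} = (\<integral>\<^sup>+z. indicator {0<..<1} (z $ i) * indicator {z. a < g z} z \<partial>lborel)"
      unfolding M_def by (subst emeasure_density) auto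
    also have "\<dots> = (\<integral>\<^sup>+z. indicator (slab i y \<rho>) z \<partial>lborel)"
    proof (rule nn_integral_cong_AE)
      show "AE z in lborel. indicator {0<..<1} (z $ i) * indicator {z. a < g z} z = (indicator (slab i y \<rho>) z :: ennreal)"
        using AE_offnorm_pos[OF n, of i y]
        by eventually_elim (auto simp: indicator_def slab_offnorm[OF \<rho>] less_iff[OF a, folded \<rho>_def])
    qed
    also have "\<dots> = ennreal ((2 * \<rho>) ^ m)" using \<rho> by (simp add: emeasure_slab m_def)
    also have "(2 * \<rho>) ^ m = 2 ^ m * (t / a) powr p"
      using \<rho> m powr_powr[of "t / a" "1 / (real m - 1)" "real m"]
      by (simp add: power_mult_distrib p_def \<rho>_def flip: powr_realpow)
    also have "(t / a) powr p = t powr p * a powr - p"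
    proof -
      have "(t / a) powr p = t powr p / a powr p" using t a by (simp add: powr_divide)
      then show ?thesis by (simp add: powr_minus divide_inverse)
    qed
    finally show ?thesis by (simp add: mult.assoc)
  qed
  \<comment> \<open>At distance \<open>2 * s\<close> from \<open>y\<close> the function
    \<open>g\<close> equals \<open>T\<close>, which is what the factor
    \<open>(2 * s) ^ (m - 1)\<close> is for. Points of the slab are closer and have
    \<open>g z > T\<close>, except where \<open>offnorm\<close> is \<open>0\<close>; there
    \<open>g\<close> and the conjugate are \<open>0\<close>.\<close>
  have "(\<integral>\<^sup>+z\<in>slab i x s. young_conjugate A (g z) \<partial>lborel) \<le> (\<integral>\<^sup>+z. young_conjugate A (g z) * indicator {T<..} (g z) \<partial>M)"
  proof -
    have "(\<integral>\<^sup>+z\<in>slab i x s. young_conjugate A (g z) \<partial>lborel)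
      \<le> (\<integral>\<^sup>+z. indicator {0<..<1} (z $ i) * (young_conjugate A (g z) * indicator {T<..} (g z)) \<partial>lborel)"
    proof (rule nn_integral_mono)
      fix z
      show "young_conjugate A (g z) * indicator (slab i x s) z \<le> indicator {0<..<1} (z $ i) * (young_conjugate A (g z) * indicator {T<..} (g z))"
      proof (cases "z \<in> slab i x s \<and> offnorm i (z - y) > 0")
        case True
        have "\<bar>z $ j - y $ j\<bar> < 2 * s" if "j \<noteq> i" for j
        proof -
          have "\<bar>z $ j - x $ j\<bar> < s" using True that by (simp add: slab_def)
          then show ?thesis using y[OF that] by linarith
        qed
        then have "offnorm i (z - y) < 2 * s" using s by (subst offnorm_less_iff) auto
        moreover have "(t / T) powr (1 / (real m - 1)) = 2 * s"
        proof -
          have "t / T = (2 * s) powr (real m - 1)"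
            using T s m1 powr_realpow[of "2 * s" "m - 1"] by (simp add: t_def)
          then show ?thesis using s m by (simp add: powr_powr)
        qed
        ultimately have "T < g z" using less_iff[OF T] True by simp
        then show ?thesis using True by (simp add: slab_def)
      next
        case False
        then consider "z \<notin> slab i x s" | "offnorm i (z - y) = 0" using offnorm_nonneg[of i "z - y"] by linarith
        then show ?thesis by cases (auto simp: g_def conjugate_zero)
      qed
    qed
    also have "\<dots> = (\<integral>\<^sup>+z. young_conjugate A (g z) * indicator {T<..} (g z) \<partial>M)"
      unfolding M_def by (subst nn_integral_density) auto
    finally show ?thesis .
  qed
  also have "\<dots> = (\<integral>\<^sup>+r. young_conjugate A r * (ennreal (2 ^ m * t powr p * p * r powr (- p - 1)) * indicator {T<..} r) \<partial>lborel)"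
    by (rule nn_integral_tail_distribution[OF _ _ T _ _ tail]) (use p t in \<open>auto simp: M_def\<close>)
  also have "\<dots> = (\<integral>\<^sup>+r. ennreal (2 ^ m * t powr p * p) * (young_conjugate A r / ennreal (r powr (1 + p)) * indicator {T<..} r) \<partial>lborel)"
  proof (rule nn_integral_cong)
    fix r :: real
    show "young_conjugate A r * (ennreal (2 ^ m * t powr p * p * r powr (- p - 1)) * indicator {T<..} r) =
      ennreal (2 ^ m * t powr p * p) * (young_conjugate A r / ennreal (r powr (1 + p)) * indicator {T<..} r)"
    proof (cases "r > T")
      case True
      then have r: "r > 0" using T by simp
      have "r powr (- p - 1) = r powr (- (1 + p))" by (rule arg_cong[of _ _ "\<lambda>x. r powr x"]) simp
      also have "\<dots> = inverse (r powr (1 + p))" by (rule powr_minus)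
      finally have "ennreal (2 ^ m * t powr p * p * r powr (- p - 1)) = ennreal (2 ^ m * t powr p * p) * inverse (ennreal (r powr (1 + p)))"
        using r t p by (simp add: inverse_ennreal ennreal_mult)
      then show ?thesis using True by (simp add: divide_ennreal_def mult_ac)
    qed simp
  qed
  also have "\<dots> = ennreal (2 ^ m * t powr p * p) * (\<integral>\<^sup>+r\<in>{T<..}. young_conjugate A r / ennreal (r powr (1 + p)) \<partial>lborel)"
    by (rule nn_integral_cmult) measurable
  also have "2 ^ m * t powr p * p = 2 ^ m * p * (2 * s) ^ m * T powr p"
  proof -
    have "t powr p = T powr p * ((2 * s) powr (real m - 1)) powr p"
      using T s m1 powr_realpow[of "2 * s" "m - 1"] by (simp add: t_def powr_mult)
    also have "((2 * s) powr (real m - 1)) powr p = (2 * s) ^ m"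
      using s m powr_realpow[of "2 * s" m] by (simp add: powr_powr p_def)
    finally show ?thesis by simp
  qed
  also have "ennreal (2 ^ m * p * (2 * s) ^ m * T powr p) \<le> ennreal (2 ^ CARD('n) * (2 * s) ^ m) * ennreal (T powr p)"
  proof -
    have "2 ^ m * p \<le> 2 ^ m * 2" using p by (intro mult_left_mono) auto
    also have "\<dots> = 2 ^ CARD('n)" using n by (simp add: m_def flip: power_Suc2)
    finally have "2 ^ m * p * (2 * s) ^ m * T powr p \<le> 2 ^ CARD('n) * (2 * s) ^ m * T powr p"
      using s by (intro mult_right_mono) auto
    then show ?thesis using s by (simp add: ennreal_leI flip: ennreal_mult)
  qed
  finally have "(\<integral>\<^sup>+z\<in>slab i x s. young_conjugate A (g z) \<partial>lborel)
     \<le> ennreal (2 ^ CARD('n) * (2 * s) ^ m) * ennreal (T powr p) * (\<integral>\<^sup>+r\<in>{T<..}. young_conjugate A r / ennreal (r powr (1 + p)) \<partial>lborel)"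
    by (auto simp: mult_right_mono)
  also have "\<dots> = ennreal (2 ^ CARD('n) * (2 * s) ^ m) * sub_kernel CARD('n) A T"
    using n3 T by (simp add: sub_kernel_def p_eq mult.assoc)
  finally show ?thesis by (simp add: g_def t_def)
qed

section \<open>The modulus of continuity\<close>

text \<open>For the density \<open>s ^ (n - 1)\<close> the set \<open>a < k / s\<close> is
  \<open>s < k / a\<close>, of measure \<open>(k / a) ^ n / n\<close>. By
  \<open>nn_integral_tail_distribution\<close> the density of \<open>k / s\<close> is minus the
  derivative of this tail, \<open>k ^ n / t ^ (n + 1)\<close>.\<close>

lemma nn_integral_inversion:
  fixes f :: "real \<Rightarrow> ennreal"
  assumes [measurable]: "f \<in> borel_measurable borel" and k: "k > 0" and n: "n \<ge> 1" and rR: "0 < r" "r < R"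
  shows "(\<integral>\<^sup>+s\<in>{r<..<R}. f (k / s) * ennreal (s ^ (n - 1)) \<partial>lborel) =
    ennreal (k ^ n) * (\<integral>\<^sup>+t\<in>{k / R<..<k / r}. f t / ennreal (t ^ (n + 1)) \<partial>lborel)"
proof -
  define M where "M = density lborel (\<lambda>s. ennreal (s ^ (n - 1)) * indicator {0<..} s)"
  define h where "h t = f t * indicator {..<k / r} t" for t
  have [measurable]: "h \<in> borel_measurable borel" unfolding h_def by measurable
  have meas: "(\<lambda>s. k / s) \<in> borel_measurable M" unfolding M_def by measurable
  have tail: "emeasure M {s \<in> space M. a < k / s} = ennreal (k ^ n / real n * a powr - real n)" if "a \<ge> k / R" for a
  proof -
    have a: "a > 0" using that k rR by (meson divide_pos_pos less_le_trans order_less_trans)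
    have "emeasure M {s \<in> space M. a < k / s} = (\<integral>\<^sup>+s. ennreal (s ^ (n - 1)) * indicator {0<..} s * indicator {s. a < k / s} s \<partial>lborel)"
      unfolding M_def by (subst emeasure_density) auto
    also have "\<dots> = (\<integral>\<^sup>+s. ennreal (s ^ (n - 1)) * indicator {0..k / a} s \<partial>lborel)"
    proof (rule nn_integral_cong_AE)
      show "AE s in lborel. ennreal (s ^ (n - 1)) * indicator {0<..} s * indicator {s. a < k / s} s = ennreal (s ^ (n - 1)) * indicator {0..k / a} s"
        using AE_lborel_singleton[of 0] AE_lborel_singleton[of "k / a"]
      proof eventually_elim
        case (elim s)
        show ?case
        proof (cases "s > 0")
          case True
          then have "a < k / s \<longleftrightarrow> s < k / a" using a by (simp add: field_simps)
          then show ?thesis using True elim by (auto simp: indicator_def)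
        qed (use elim in \<open>auto simp: indicator_def\<close>)
      qed
    qed
    also have "\<dots> = ennreal ((k / a) ^ n / real n - 0 ^ n / real n)"
    proof (rule nn_integral_FTC_Icc)
      show "((\<lambda>s. s ^ n / real n) has_real_derivative s ^ (n - 1)) (at s)" for s
        using n by (auto intro!: derivative_eq_intros)
    qed (use a k in auto)
    also have "(k / a) ^ n / real n - 0 ^ n / real n = k ^ n / real n * a powr - real n"
      using n a by (simp add: powr_minus powr_realpow power_divide field_simps)
    finally show ?thesis .
  qed
  have "(\<integral>\<^sup>+s\<in>{r<..<R}. f (k / s) * ennreal (s ^ (n - 1)) \<partial>lborel) = (\<integral>\<^sup>+s. h (k / s) * indicator {k / R<..} (k / s) \<partial>M)"
    unfolding M_def
  proof (subst nn_integral_density)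
    show "(\<integral>\<^sup>+s\<in>{r<..<R}. f (k / s) * ennreal (s ^ (n - 1)) \<partial>lborel)
      = (\<integral>\<^sup>+s. ennreal (s ^ (n - 1)) * indicator {0<..} s * (h (k / s) * indicator {k / R<..} (k / s)) \<partial>lborel)"
    proof (rule nn_integral_cong)
      fix s :: real
      show "f (k / s) * ennreal (s ^ (n - 1)) * indicator {r<..<R} s
        = ennreal (s ^ (n - 1)) * indicator {0<..} s * (h (k / s) * indicator {k / R<..} (k / s))"
      proof (cases "s > 0")
        case True
        then have "k / R < k / s \<longleftrightarrow> s < R" "k / s < k / r \<longleftrightarrow> r < s"
          using k rR by (auto simp: field_simps)
        then show ?thesis using True by (auto simp: h_def indicator_def mult.commute)
      next
        case False
        then show ?thesis using rR by (simp add: indicator_def)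
      qed
    qed
  qed auto
  also have "\<dots> = (\<integral>\<^sup>+t. h t * (ennreal (k ^ n / real n * real n * t powr (- real n - 1)) * indicator {k / R<..} t) \<partial>lborel)"
    by (rule nn_integral_tail_distribution[OF meas _ _ _ _ tail]) (use k n rR in auto)
  also have "\<dots> = (\<integral>\<^sup>+t. ennreal (k ^ n) * (f t / ennreal (t ^ (n + 1)) * indicator {k / R<..<k / r} t) \<partial>lborel)"
  proof (rule nn_integral_cong)
    fix t :: real
    show "h t * (ennreal (k ^ n / real n * real n * t powr (- real n - 1)) * indicator {k / R<..} t)
      = ennreal (k ^ n) * (f t / ennreal (t ^ (n + 1)) * indicator {k / R<..<k / r} t)"
    proof (cases "k / R < t")
      case True
      then have t: "t > 0" using k rR by (meson divide_pos_pos less_trans)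
      have "t powr (- real n - 1) = t powr - real (n + 1)" by (rule arg_cong[of _ _ "\<lambda>x. t powr x"]) simp
      also have "\<dots> = inverse (t ^ (n + 1))"
        unfolding powr_minus powr_realpow[OF t] ..
      finally have "ennreal (k ^ n / real n * real n * t powr (- real n - 1)) = ennreal (k ^ n) * inverse (ennreal (t ^ (n + 1)))"
        using t k n by (simp add: ennreal_mult inverse_ennreal del: power_Suc)
      then show ?thesis using True by (auto simp: h_def indicator_def divide_ennreal_def mult_ac)
    qed simp
  qed
  also have "\<dots> = ennreal (k ^ n) * (\<integral>\<^sup>+t\<in>{k / R<..<k / r}. f t / ennreal (t ^ (n + 1)) \<partial>lborel)"
    by (rule nn_integral_cmult) measurable
  finally show ?thesis .
qed

section \<open>The functions B and omega of an admissible Young function\<close>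

locale admissible_young =
  fixes n :: nat and A :: "real \<Rightarrow> ennreal"
  assumes n2: "n \<ge> 2" and young: "young_function A"
    and infinite: "infinite_at_infinity (\<lambda>t. A_sub n A t / ennreal (t ^ (n + 1)))"
    and finite: "finite_at_zero (\<lambda>t. A_sub n A t / ennreal (t ^ (1 + n)))"
begin

definition J :: "real \<Rightarrow> ennreal" where
  "J t = (\<integral>\<^sup>+s\<in>{0<..<t}. A_sub n A s / ennreal (s ^ (1 + n)) \<partial>lborel)"

lemma B_fun_J: "B_fun n A t = ennreal (t ^ n) * J t"
  by (simp add: B_fun_def J_def)

lemma J_mono: "s \<le> t \<Longrightarrow> J s \<le> J t"
  unfolding J_def by (intro nn_integral_mono) (auto simp: indicator_def)

lemma J_finite: obtains a where "a > 0" "J a < \<infinity>"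
  using finite that by (auto simp: finite_at_zero_def J_def)

lemma J_abs: "J t = (\<integral>\<^sup>+s\<in>{0<..<t}. A_sub n A \<bar>s\<bar> / ennreal (s ^ (1 + n)) \<partial>lborel)"
  unfolding J_def
proof (rule nn_integral_cong)
  fix s
  show "A_sub n A s / ennreal (s ^ (1 + n)) * indicator {0<..<t} s = A_sub n A \<bar>s\<bar> / ennreal (s ^ (1 + n)) * indicator {0<..<t} s"
    by (cases "s > 0") auto
qed

text \<open>The intervals \<open>0 < s < i + 1\<close> exhaust the half-line, so by monotone
  convergence a bound on \<open>J\<close> would contradict the divergence at infinity.\<close>

lemma J_unbounded: "\<exists>t\<ge>1. ennreal c < J t"
proof (rule ccontr)
  assume "\<not> ?thesis"
  then have le: "J t \<le> ennreal c" if "t \<ge> 1" for t using that by (meson linorder_not_le)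
  note [measurable] = A_sub_measurable[OF young]
  let ?f = "\<lambda>i s. A_sub n A \<bar>s\<bar> / ennreal (s ^ (1 + n)) * indicator {0<..<real (Suc i)} s"
  have "\<infinity> = (\<integral>\<^sup>+t\<in>{1<..}. A_sub n A t / ennreal (t ^ (n + 1)) \<partial>lborel)"
    using infinite by (simp add: infinite_at_infinity_def)
  also have "\<dots> \<le> (\<integral>\<^sup>+s. (SUP i. ?f i s) \<partial>lborel)"
  proof (rule nn_integral_mono)
    fix s :: real
    show "A_sub n A s / ennreal (s ^ (n + 1)) * indicator {1<..} s \<le> (SUP i. ?f i s)"
    proof (cases "s > 1")
      case True
      obtain i where "s < real (Suc i)" by (meson reals_Archimedean2 less_trans lessI of_nat_less_iff)
      then have "A_sub n A s / ennreal (s ^ (n + 1)) * indicator {1<..} s \<le> ?f i s" using True by simp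
      then show ?thesis by (rule order_trans) (rule SUP_upper, simp)
    qed simp
  qed
  also have "\<dots> = (SUP i. \<integral>\<^sup>+s. ?f i s \<partial>lborel)"
    by (rule nn_integral_monotone_convergence_SUP)
      (auto simp: incseq_def le_fun_def indicator_def)
  also have "\<dots> \<le> ennreal c"
  proof (rule SUP_least)
    fix i
    have "J (real (Suc i)) \<le> ennreal c" by (rule le) simp
    then show "(\<integral>\<^sup>+s. ?f i s \<partial>lborel) \<le> ennreal c" unfolding J_abs .
  qed
  finally show False by (simp add: top_unique)
qed

lemma B_unbounded: "\<exists>t\<ge>0. ennreal c < B_fun n A t"
proof -
  obtain t where t: "t \<ge> 1" "ennreal c < J t" using J_unbounded by blast
  have "1 * J t \<le> ennreal (t ^ n) * J t"
    using t by (intro mult_right_mono) auto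
  then show ?thesis using t by (intro exI[of _ t]) (auto simp: B_fun_J intro: less_le_trans)
qed

lemma right_inverse_le: "t \<ge> 0 \<Longrightarrow> ennreal s < B_fun n A t \<Longrightarrow> right_inverse (B_fun n A) s \<le> t"
  unfolding right_inverse_def by (rule cInf_lower) (auto intro: bdd_belowI)

lemma right_inverse_ge:
  "(\<And>t. t \<ge> 0 \<Longrightarrow> ennreal s < B_fun n A t \<Longrightarrow> c \<le> t) \<Longrightarrow> c \<le> right_inverse (B_fun n A) s"
  unfolding right_inverse_def by (rule cInf_greatest) (use B_unbounded in auto)

lemma right_inverse_mono: "s \<le> t \<Longrightarrow> right_inverse (B_fun n A) s \<le> right_inverse (B_fun n A) t"
  by (rule right_inverse_ge, rule right_inverse_le) (auto intro: le_less_trans ennreal_leI)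

lemma omega_pos:
  assumes "r > 0" shows "omega n A r > 0"
proof -
  obtain a where a: "a > 0" "J a < \<infinity>" by (rule J_finite)
  obtain j where j: "J a = ennreal j" "j \<ge> 0" using a by (metis ennreal_cases infinity_ennreal_def order_less_irrefl)
  define s where "s = 1 / r ^ n"
  have s: "s > 0" using assms by (simp add: s_def)
  \<comment> \<open>Each entry of the minimum serves one estimate for \<open>t < c\<close>:
    \<open>J t \<le> J a\<close>, \<open>t ^ n \<le> t\<close> and \<open>t * j \<le> s\<close>.
    Together they keep \<open>B_fun n A t\<close> at most \<open>s\<close>.\<close>
  define c where "c = min (min a 1) (s / (j + 1))"
  have c: "c > 0" using a s j by (simp add: c_def)
  have "c \<le> right_inverse (B_fun n A) s"
  proof (rule right_inverse_ge, rule ccontr)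
    fix t assume t: "t \<ge> 0" "ennreal s < B_fun n A t" "\<not> c \<le> t"
    have "B_fun n A t \<le> ennreal t * ennreal j"
      unfolding B_fun_J
    proof (rule mult_mono)
      have "t ^ n \<le> t ^ 1" using t n2 by (intro power_decreasing) (auto simp: c_def)
      then show "ennreal (t ^ n) \<le> ennreal t" by (simp add: ennreal_leI)
      show "J t \<le> ennreal j" using J_mono[of t a] t j by (simp add: c_def)
    qed auto
    also have "\<dots> = ennreal (t * j)" using t j by (simp add: ennreal_mult)
    also have "\<dots> \<le> ennreal s"
    proof (rule ennreal_leI)
      have "t < s / (j + 1)" using t by (simp add: c_def)
      then have "t * (j + 1) \<le> s" using j by (simp add: pos_less_divide_eq)
      then show "t * j \<le> s" using t by (simp add: algebra_simps)
    qed
    finally show False using t by simp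
  qed
  then show ?thesis using c assms by (simp add: omega_def s_def)
qed

text \<open>\<open>omega n A r / r\<close> is a nondecreasing inverse evaluated at
  \<open>1 / r ^ n\<close>, hence nonincreasing in \<open>r\<close>.\<close>

lemma omega_scale:
  assumes "r > 0" "c \<ge> 1" shows "omega n A (c * r) \<le> c * omega n A r"
proof -
  have "1 / (c * r) ^ n \<le> 1 / r ^ n"
    using assms by (intro divide_left_mono power_mono) (auto simp: mult_le_cancel_right1)
  then have "right_inverse (B_fun n A) (1 / (c * r) ^ n) \<le> right_inverse (B_fun n A) (1 / r ^ n)"
    by (rule right_inverse_mono)
  then show ?thesis using assms by (simp add: omega_def mult.assoc)
qed

text \<open>The place where divergence makes the modulus tend to zero: \<open>J\<close> exceeds
  \<open>1 / \<eta> ^ n\<close> at some \<open>t\<close>, so for \<open>r < \<eta> / t\<close> the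
  value of \<open>B_fun n A\<close> at \<open>\<eta> / r\<close>, which is
  \<open>(\<eta> / r) ^ n * J (\<eta> / r)\<close>, exceeds \<open>1 / r ^ n\<close>, and the
  inverse is at most \<open>\<eta> / r\<close>.\<close>

lemma omega_small:
  assumes "\<eta> > 0" shows "\<exists>\<rho>>0. \<forall>r. 0 < r \<and> r < \<rho> \<longrightarrow> omega n A r \<le> \<eta>"
proof -
  obtain t where t: "t \<ge> 1" "ennreal (1 / \<eta> ^ n) < J t" using J_unbounded by blast
  show ?thesis
  proof (intro exI[of _ "\<eta> / t"] conjI allI impI)
    show "0 < \<eta> / t" using assms t by simp
    fix r assume r: "0 < r \<and> r < \<eta> / t"
    have "t \<le> \<eta> / r" using r t by (simp add: field_simps)
    then have "ennreal (1 / \<eta> ^ n) < J (\<eta> / r)" using t(2) J_mono less_le_trans by blast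
    then have "ennreal ((\<eta> / r) ^ n) * ennreal (1 / \<eta> ^ n) < ennreal ((\<eta> / r) ^ n) * J (\<eta> / r)"
      using assms r by (intro ennreal_mult_strict_left_mono) auto
    moreover have "ennreal ((\<eta> / r) ^ n) * ennreal (1 / \<eta> ^ n) = ennreal (1 / r ^ n)"
      using assms r by (subst ennreal_mult[symmetric]) (auto simp: power_divide)
    ultimately have "right_inverse (B_fun n A) (1 / r ^ n) \<le> \<eta> / r"
      using assms r by (intro right_inverse_le) (auto simp: B_fun_J)
    then show "omega n A r \<le> \<eta>" using r by (simp add: omega_def field_simps)
  qed
qed

text \<open>Since \<open>J\<close> is nondecreasing, multiplying the argument of
  \<open>B_fun n A\<close> by \<open>C \<ge> 1\<close> multiplies the value at least by
  \<open>C ^ n \<ge> C\<close>. A factor \<open>C\<close> in the value therefore costs at most a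
  factor \<open>C\<close> in the argument.\<close>

lemma B_bound_imp_omega:
  assumes C: "C \<ge> 1" and "r > 0" "t \<ge> 0" and B: "B_fun n A t \<le> ennreal (C / r ^ n)"
  shows "r * t \<le> C * omega n A r"
proof -
  have "t / C \<le> right_inverse (B_fun n A) (1 / r ^ n)"
  proof (rule right_inverse_ge, rule ccontr)
    fix t' assume t': "t' \<ge> 0" "ennreal (1 / r ^ n) < B_fun n A t'" "\<not> t / C \<le> t'"
    then have le: "C * t' \<le> t" using C by (simp add: field_simps)
    have "t' \<le> t" using le C t' mult_right_mono[of 1 C t'] by simp
    have "ennreal (C / r ^ n) \<le> ennreal (C ^ n * (1 / r ^ n))"
      using C n2 \<open>r > 0\<close> power_increasing[of 1 n C] by (intro ennreal_leI) (simp add: divide_right_mono)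
    also have "\<dots> = ennreal (C ^ n) * ennreal (1 / r ^ n)"
      using C \<open>r > 0\<close> by (intro ennreal_mult) auto
    also have "\<dots> < ennreal (C ^ n) * B_fun n A t'"
      using t' C by (intro ennreal_mult_strict_left_mono) auto
    also have "\<dots> = ennreal ((C * t') ^ n) * J t'"
      using C t' by (simp add: B_fun_J power_mult_distrib ennreal_mult mult.assoc)
    also have "\<dots> \<le> B_fun n A t"
      unfolding B_fun_J using le C t' \<open>t' \<le> t\<close> by (intro mult_mono J_mono ennreal_leI power_mono) auto
    finally show False using B by simp
  qed
  then have "r * C * (t / C) \<le> r * C * right_inverse (B_fun n A) (1 / r ^ n)"
    using C \<open>r > 0\<close> by (intro mult_left_mono) auto
  then show ?thesis using C by (simp add: omega_def mult_ac)
qed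

text \<open>With \<open>k = osc / C\<close> the substitution \<open>t = k / s\<close> bounds
  \<open>k ^ n\<close> times the part of \<open>J (k / r)\<close> over
  \<open>k / R < t < k / r\<close> by \<open>M\<close>. The remaining part is
  \<open>J (k / R) \<le> J a\<close>, with \<open>k \<le> a * R\<close>. Together,
  \<open>B_fun n A (k / r)\<close> is at most a constant times \<open>1 / r ^ n\<close>; the maximum
  with \<open>1\<close> meets the condition of \<open>B_bound_imp_omega\<close>.\<close>

lemma oscillation_modulus:
  assumes o: "osc \<ge> 0" and C: "C > 0" and rR: "0 < r" "r < R" and M: "M \<ge> 0"
    and a: "osc / (C * R) \<le> a" and j: "J a = ennreal j" "j \<ge> 0" and a0: "a > 0"
    and int: "(\<integral>\<^sup>+s\<in>{r<..<R}. A_sub n A (osc / (C * s)) * ennreal (s ^ (n - 1)) \<partial>lborel) \<le> ennreal M"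
  shows "osc \<le> C * (max 1 (M + (a * R) ^ n * j) * omega n A r)"
proof (cases "osc = 0")
  case True
  then show ?thesis using C omega_pos[OF rR(1)] by (simp add: le_max_iff_disj mult_nonneg_nonneg)
next
  case False
  define k where "k = osc / C"
  have k: "k > 0" using False o C by (simp add: k_def)
  have ka: "k / R \<le> a" using a by (simp add: k_def)
  note [measurable] = A_sub_measurable[OF young]
  have "ennreal (k ^ n) * (\<integral>\<^sup>+t\<in>{k / R<..<k / r}. A_sub n A \<bar>t\<bar> / ennreal (t ^ (n + 1)) \<partial>lborel)
    = (\<integral>\<^sup>+s\<in>{r<..<R}. A_sub n A \<bar>k / s\<bar> * ennreal (s ^ (n - 1)) \<partial>lborel)"
    by (rule nn_integral_inversion[symmetric]) (use k n2 rR in auto)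
  also have "\<dots> = (\<integral>\<^sup>+s\<in>{r<..<R}. A_sub n A (osc / (C * s)) * ennreal (s ^ (n - 1)) \<partial>lborel)"
  proof (rule nn_integral_cong)
    fix s
    show "A_sub n A \<bar>k / s\<bar> * ennreal (s ^ (n - 1)) * indicator {r<..<R} s = A_sub n A (osc / (C * s)) * ennreal (s ^ (n - 1)) * indicator {r<..<R} s"
    proof (cases "s > 0")
      case True
      then have "\<bar>k / s\<bar> = osc / (C * s)" using k o C by (simp add: k_def abs_mult)
      then show ?thesis by simp
    qed (use rR in auto)
  qed
  also have "\<dots> \<le> ennreal M" by (rule int)
  finally have I: "ennreal (k ^ n) * (\<integral>\<^sup>+t\<in>{k / R<..<k / r}. A_sub n A \<bar>t\<bar> / ennreal (t ^ (n + 1)) \<partial>lborel) \<le> ennreal M" .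
  have "J (k / r) \<le> (\<integral>\<^sup>+t. A_sub n A \<bar>t\<bar> / ennreal (t ^ (n + 1)) * indicator {0<..<k / R} t
       + A_sub n A \<bar>t\<bar> / ennreal (t ^ (n + 1)) * indicator {k / R<..<k / r} t \<partial>lborel)"
    unfolding J_abs
    by (rule nn_integral_mono_AE) (use AE_lborel_singleton[of "k / R"] in \<open>eventually_elim, auto simp: indicator_def\<close>)
  also have "\<dots> = J (k / R) + (\<integral>\<^sup>+t\<in>{k / R<..<k / r}. A_sub n A \<bar>t\<bar> / ennreal (t ^ (n + 1)) \<partial>lborel)"
    by (subst nn_integral_add) (auto simp: J_abs)
  finally have "ennreal (k ^ n) * J (k / r) \<le> ennreal (k ^ n) * (J (k / R) + (\<integral>\<^sup>+t\<in>{k / R<..<k / r}. A_sub n A \<bar>t\<bar> / ennreal (t ^ (n + 1)) \<partial>lborel))"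
    by (rule mult_left_mono) simp
  also have "\<dots> \<le> ennreal ((a * R) ^ n * j) + ennreal M"
    unfolding distrib_left
  proof (rule add_mono[OF _ I])
    have "k \<le> a * R" using ka rR by (simp add: field_simps)
    then have "ennreal (k ^ n) * J (k / R) \<le> ennreal ((a * R) ^ n) * ennreal j"
      using J_mono[OF ka] j k by (intro mult_mono ennreal_leI power_mono) auto
    then show "ennreal (k ^ n) * J (k / R) \<le> ennreal ((a * R) ^ n * j)"
      using j a0 rR by (simp add: ennreal_mult)
  qed
  also have "\<dots> = ennreal (M + (a * R) ^ n * j)"
    using M j a0 rR by (simp flip: ennreal_plus add: add.commute)
  also have "\<dots> \<le> ennreal (max 1 (M + (a * R) ^ n * j))" by (intro ennreal_leI) simp
  finally have "ennreal (1 / r ^ n) * (ennreal (k ^ n) * J (k / r)) \<le> ennreal (1 / r ^ n) * ennreal (max 1 (M + (a * R) ^ n * j))"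
    by (rule mult_left_mono) simp
  moreover have "ennreal (1 / r ^ n) * (ennreal (k ^ n) * J (k / r)) = B_fun n A (k / r)"
    using k rR by (simp add: B_fun_J power_divide mult.assoc[symmetric] flip: ennreal_mult)
  moreover have "ennreal (1 / r ^ n) * ennreal (max 1 (M + (a * R) ^ n * j)) = ennreal (max 1 (M + (a * R) ^ n * j) / r ^ n)"
    using rR by (subst ennreal_mult[symmetric]) auto
  ultimately have "r * (k / r) \<le> max 1 (M + (a * R) ^ n * j) * omega n A r"
    using k rR by (intro B_bound_imp_omega) auto
  then have "k \<le> max 1 (M + (a * R) ^ n * j) * omega n A r" using rR by simp
  then show ?thesis using C by (simp add: k_def field_simps)
qed

end

text \<open>Young's inequality under the integral of \<open>face_morrey\<close>, with
  \<open>b\<close> the kernel times \<open>T * (2 * s) ^ (CARD('n) - 2)\<close>; the conjugates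
  integrate to a multiple of \<open>sub_kernel\<close> at \<open>T\<close>, and \<open>T\<close>
  stays free for a later supremum. The density \<open>G\<close> plays the part of
  \<open>A (|grad f|)\<close> and is kept abstract because for mollifications it is an averaged
  density.\<close>

lemma face_estimate:
  fixes f :: "real^'n \<Rightarrow> real" and y x :: "real^'n"
  assumes f: "smooth f" and s: "s > 0" and T: "T > 0" and n: "CARD('n) \<ge> 2"
    and y: "\<And>j. j \<noteq> i \<Longrightarrow> \<bar>y $ j - x $ j\<bar> \<le> s" and \<rho>: "\<bar>\<rho> - x $ i\<bar> \<le> s"
    and [measurable]: "G \<in> borel_measurable borel"
    and Y: "\<And>z b. (\<forall>j. \<bar>z $ j - x $ j\<bar> \<le> s) \<Longrightarrow> b \<ge> 0 \<Longrightarrow>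
      ennreal (norm (grad f z) * b) \<le> G z + young_conjugate A b"
  shows "ennreal (T * (2 * s) ^ (CARD('n) - 2)) * (\<integral>\<^sup>+w\<in>slab i x s. ennreal \<bar>f (upd i \<rho> w) - f (upd i \<rho> y)\<bar> \<partial>lborel)
    \<le> ennreal (real CARD('n) * (2 * s) ^ (CARD('n) - 1)) *
      ((\<integral>\<^sup>+z\<in>slab i x s. G (upd i \<rho> z) \<partial>lborel) + ennreal (2 ^ CARD('n) * (2 * s) ^ (CARD('n) - 1)) * sub_kernel CARD('n) A T)"
proof -
  have [measurable]: "grad f \<in> borel_measurable borel"
    by (rule borel_measurable_continuous_onI[OF continuous_grad[OF f]])
  define t where "t = T * (2 * s) ^ (CARD('n) - 2)"
  have t: "t \<ge> 0" using T s by (simp add: t_def)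
  let ?b = "\<lambda>z. offnorm i (z - y) powr (1 - real (CARD('n) - 1))"
  have "ennreal t * (\<integral>\<^sup>+z\<in>slab i x s. ennreal (norm (grad f (upd i \<rho> z)) * ?b z) \<partial>lborel)
    = (\<integral>\<^sup>+z. ennreal t * (ennreal (norm (grad f (upd i \<rho> z)) * ?b z) * indicator (slab i x s) z) \<partial>lborel)"
    by (rule nn_integral_cmult[symmetric]) measurable
  also have "\<dots> \<le> (\<integral>\<^sup>+z. G (upd i \<rho> z) * indicator (slab i x s) z + young_conjugate A (t * ?b z) * indicator (slab i x s) z \<partial>lborel)"
  proof (rule nn_integral_mono)
    fix z
    show "ennreal t * (ennreal (norm (grad f (upd i \<rho> z)) * ?b z) * indicator (slab i x s) z)
      \<le> G (upd i \<rho> z) * indicator (slab i x s) z + young_conjugate A (t * ?b z) * indicator (slab i x s) z"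
    proof (cases "z \<in> slab i x s")
      case True
      have "\<forall>j. \<bar>upd i \<rho> z $ j - x $ j\<bar> \<le> s" using True \<rho> by (auto simp: slab_def less_imp_le)
      from Y[OF this, of "t * ?b z"] show ?thesis using True t by (simp add: mult_ac flip: ennreal_mult)
    qed simp
  qed
  also have "\<dots> = (\<integral>\<^sup>+z\<in>slab i x s. G (upd i \<rho> z) \<partial>lborel) + (\<integral>\<^sup>+z\<in>slab i x s. young_conjugate A (t * ?b z) \<partial>lborel)"
    by (rule nn_integral_add) measurable
  also have "\<dots> \<le> (\<integral>\<^sup>+z\<in>slab i x s. G (upd i \<rho> z) \<partial>lborel) + ennreal (2 ^ CARD('n) * (2 * s) ^ (CARD('n) - 1)) * sub_kernel CARD('n) A T"
    using kernel_integral[OF n s T y, of i A] by (simp add: t_def numeral_2_eq_2 add_left_mono)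
  finally have 1: "ennreal t * (\<integral>\<^sup>+z\<in>slab i x s. ennreal (norm (grad f (upd i \<rho> z)) * ?b z) \<partial>lborel) \<le> \<dots>" .
  have "ennreal t * (\<integral>\<^sup>+w\<in>slab i x s. ennreal \<bar>f (upd i \<rho> w) - f (upd i \<rho> y)\<bar> \<partial>lborel)
    \<le> ennreal t * (ennreal (real CARD('n) * (2 * s) ^ (CARD('n) - 1)) * (\<integral>\<^sup>+z\<in>slab i x s. ennreal (norm (grad f (upd i \<rho> z)) * ?b z) \<partial>lborel))"
    by (rule mult_left_mono[OF face_morrey[OF f s n y]]) auto
  also have "\<dots> = ennreal (real CARD('n) * (2 * s) ^ (CARD('n) - 1)) * (ennreal t * (\<integral>\<^sup>+z\<in>slab i x s. ennreal (norm (grad f (upd i \<rho> z)) * ?b z) \<partial>lborel))"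
    by (simp only: mult.left_commute)
  also have "\<dots> \<le> ennreal (real CARD('n) * (2 * s) ^ (CARD('n) - 1)) *
      ((\<integral>\<^sup>+z\<in>slab i x s. G (upd i \<rho> z) \<partial>lborel) + ennreal (2 ^ CARD('n) * (2 * s) ^ (CARD('n) - 1)) * sub_kernel CARD('n) A T)"
    by (rule mult_left_mono[OF 1]) simp
  finally show ?thesis by (simp add: t_def)
qed

text \<open>The integral over the whole hyperplane \<open>z $ i = \<rho>\<close> instead of a face.
  This is larger, and integrating it over \<open>\<rho>\<close> gives exactly the integral over the
  space.\<close>

definition face_integral :: "(real^'n \<Rightarrow> ennreal) \<Rightarrow> 'n \<Rightarrow> real \<Rightarrow> ennreal" where
  "face_integral G i \<rho> = (\<integral>\<^sup>+z. G (upd i \<rho> z) * indicator {0<..<1} (z $ i) \<partial>lborel)"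

definition boundary_integral :: "(real^'n \<Rightarrow> ennreal) \<Rightarrow> real^'n \<Rightarrow> real \<Rightarrow> ennreal" where
  "boundary_integral G x s = (\<Sum>i\<in>UNIV. face_integral G i (x $ i + s) + face_integral G i (x $ i - s))"

lemma face_integral_measurable [measurable]:
  assumes [measurable]: "G \<in> borel_measurable borel"
  shows "face_integral G i \<in> borel_measurable borel"
  unfolding face_integral_def[abs_def] by measurable

lemma boundary_integral_measurable [measurable]:
  assumes [measurable]: "G \<in> borel_measurable borel"
  shows "boundary_integral G x \<in> borel_measurable borel"
  unfolding boundary_integral_def[abs_def] by measurable

text \<open>Each of the \<open>2 * CARD('n)\<close> moving hyperplanes sweeps the space once as
  \<open>s\<close> runs through the line.\<close>

lemma nn_integral_boundary_integral:
  fixes G :: "real^'n \<Rightarrow> ennreal"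
  assumes [measurable]: "G \<in> borel_measurable borel"
  shows "(\<integral>\<^sup>+s. boundary_integral G x s \<partial>lborel) = 2 * of_nat CARD('n) * (\<integral>\<^sup>+z. G z \<partial>lborel)"
proof -
  have F: "(\<integral>\<^sup>+\<rho>. face_integral G i \<rho> \<partial>lborel) = (\<integral>\<^sup>+z. G z \<partial>lborel)" for i
    unfolding face_integral_def by (rule nn_integral_slices) measurable
  have p: "(\<integral>\<^sup>+s. face_integral G i (x $ i + s) \<partial>lborel) = (\<integral>\<^sup>+z. G z \<partial>lborel)" for i
    using nn_integral_translate[of "face_integral G i" "- x $ i"] F[of i] by (simp add: add.commute)
  have q: "(\<integral>\<^sup>+s. face_integral G i (x $ i - s) \<partial>lborel) = (\<integral>\<^sup>+z. G z \<partial>lborel)" for i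
    using nn_integral_reflect[of "face_integral G i" "x $ i"] F[of i] by simp
  have "(\<integral>\<^sup>+s. boundary_integral G x s \<partial>lborel)
     = (\<Sum>i\<in>UNIV. (\<integral>\<^sup>+s. face_integral G i (x $ i + s) \<partial>lborel) + (\<integral>\<^sup>+s. face_integral G i (x $ i - s) \<partial>lborel))"
    unfolding boundary_integral_def by (subst nn_integral_sum) (auto simp: nn_integral_add)
  also have "\<dots> = 2 * of_nat CARD('n) * (\<integral>\<^sup>+z. G z \<partial>lborel)"
    by (simp add: p q mult_2[symmetric] mult_ac)
  finally show ?thesis .
qed

lemma slab_integral_le:
  "(\<integral>\<^sup>+z\<in>slab i x s. G (upd i \<rho> z) \<partial>lborel) \<le> face_integral G i \<rho>"
  unfolding face_integral_def by (intro nn_integral_mono) (auto simp: slab_def indicator_def)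

lemma face_le_boundary:
  "face_integral G i (x $ i + s) \<le> boundary_integral G x s"
  "face_integral G i (x $ i - s) \<le> boundary_integral G x s"
proof -
  have "face_integral G i (x $ i + s) + face_integral G i (x $ i - s) \<le> boundary_integral G x s"
    unfolding boundary_integral_def by (rule member_le_sum) auto
  then show "face_integral G i (x $ i + s) \<le> boundary_integral G x s"
    "face_integral G i (x $ i - s) \<le> boundary_integral G x s"
    by (auto intro: order_trans[rotated])
qed

lemma ennreal_mult_cancel_le:
  assumes "c > 0" "ennreal c * a \<le> ennreal c * b" shows "a \<le> b"
  using assms ennreal_mult_le_mult_iff[of "ennreal c" a b] by (simp add: ennreal_eq_0_iff)

lemma ennreal_mult_swap:
  "0 \<le> a \<Longrightarrow> 0 \<le> b \<Longrightarrow> 0 \<le> c \<Longrightarrow> ennreal a * ennreal (b * c) = ennreal b * ennreal (a * c)"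
  by (simp add: ennreal_mult mult_ac)

section \<open>Oscillation over the whole boundary of a cube\<close>

locale boundary_setting =
  fixes f :: "real^'n \<Rightarrow> real" and x :: "real^'n" and s T :: real and G :: "real^'n \<Rightarrow> ennreal" and A :: "real \<Rightarrow> ennreal"
  assumes f: "smooth f" and s: "s > 0" and T: "T > 0" and n: "CARD('n) \<ge> 2"
    and G [measurable]: "G \<in> borel_measurable borel"
    and Y: "\<And>z b. (\<forall>j. \<bar>z $ j - x $ j\<bar> \<le> s) \<Longrightarrow> b \<ge> 0 \<Longrightarrow>
      ennreal (norm (grad f z) * b) \<le> G z + young_conjugate A b"
begin

abbreviation "bound \<equiv> boundary_integral G x s + ennreal (2 ^ CARD('n) * (2 * s) ^ (CARD('n) - 1)) * sub_kernel CARD('n) A T"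

lemma f_measurable [measurable]: "f \<in> borel_measurable borel"
  by (rule borel_measurable_continuous_onI[OF smooth_continuous[OF f]])

lemma face_point:
  assumes y: "\<And>j. \<bar>y $ j - x $ j\<bar> \<le> s" and yi: "y $ i = \<rho>" and \<rho>: "\<rho> = x $ i + s \<or> \<rho> = x $ i - s"
  shows "ennreal (T * (2 * s) ^ (CARD('n) - 2)) * (\<integral>\<^sup>+w\<in>slab i x s. ennreal \<bar>f (upd i \<rho> w) - f y\<bar> \<partial>lborel)
    \<le> ennreal (real CARD('n) * (2 * s) ^ (CARD('n) - 1)) * bound"
proof -
  have "upd i \<rho> y = y" using yi by (simp add: vec_eq_iff)
  moreover have "\<bar>\<rho> - x $ i\<bar> \<le> s" using \<rho> s by auto
  ultimately have "ennreal (T * (2 * s) ^ (CARD('n) - 2)) * (\<integral>\<^sup>+w\<in>slab i x s. ennreal \<bar>f (upd i \<rho> w) - f y\<bar> \<partial>lborel)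
     \<le> ennreal (real CARD('n) * (2 * s) ^ (CARD('n) - 1)) *
      ((\<integral>\<^sup>+z\<in>slab i x s. G (upd i \<rho> z) \<partial>lborel) + ennreal (2 ^ CARD('n) * (2 * s) ^ (CARD('n) - 1)) * sub_kernel CARD('n) A T)"
    using face_estimate[where i = i and \<rho> = \<rho>, OF f s T n y _ G Y] by simp
  also have "\<dots> \<le> ennreal (real CARD('n) * (2 * s) ^ (CARD('n) - 1)) * bound"
  proof (rule mult_left_mono, rule add_right_mono)
    show "(\<integral>\<^sup>+z\<in>slab i x s. G (upd i \<rho> z) \<partial>lborel) \<le> boundary_integral G x s"
      using slab_integral_le[where i = i and x = x and s = s and G = G and \<rho> = \<rho>] face_le_boundary[where G = G and i = i and x = x and s = s] \<rho> by (auto intro: order_trans)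
  qed simp
  finally show ?thesis .
qed

lemma slab_const: "ennreal ((2 * s) ^ (CARD('n) - 1) * c) = (\<integral>\<^sup>+w\<in>slab i x s. ennreal c \<partial>lborel)" if "c \<ge> 0"
  using that s by (simp add: nn_integral_cmult_indicator emeasure_slab ennreal_mult mult.commute)

text \<open>Both values are compared with \<open>f (upd i \<rho> w)\<close> for all points
  \<open>w\<close> of the slab; averaging over the face divides by its measure
  \<open>(2 * s) ^ (CARD('n) - 1)\<close>.\<close>

lemma face_oscillation:
  assumes y: "\<And>j. \<bar>y $ j - x $ j\<bar> \<le> s" "y $ i = \<rho>" and y': "\<And>j. \<bar>y' $ j - x $ j\<bar> \<le> s" "y' $ i = \<rho>"
    and \<rho>: "\<rho> = x $ i + s \<or> \<rho> = x $ i - s"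
  shows "ennreal (T * (2 * s) ^ (CARD('n) - 2) * \<bar>f y - f y'\<bar>) \<le> ennreal (2 * real CARD('n)) * bound"
proof -
  let ?t = "T * (2 * s) ^ (CARD('n) - 2)"
  have t: "?t \<ge> 0" using T s by simp
  have "ennreal ((2 * s) ^ (CARD('n) - 1)) * ennreal (?t * \<bar>f y - f y'\<bar>) = ennreal ?t * ennreal ((2 * s) ^ (CARD('n) - 1) * \<bar>f y - f y'\<bar>)"
    using t s by (intro ennreal_mult_swap) auto
  also have "\<dots> \<le> ennreal ?t * (\<integral>\<^sup>+w. ennreal \<bar>f (upd i \<rho> w) - f y\<bar> * indicator (slab i x s) w + ennreal \<bar>f (upd i \<rho> w) - f y'\<bar> * indicator (slab i x s) w \<partial>lborel)"
    unfolding slab_const[where i = i, OF abs_ge_zero]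
    by (intro mult_left_mono nn_integral_mono) (auto simp: indicator_def simp flip: ennreal_plus intro!: ennreal_leI)
  also have "\<dots> = ennreal ?t * (\<integral>\<^sup>+w\<in>slab i x s. ennreal \<bar>f (upd i \<rho> w) - f y\<bar> \<partial>lborel) + ennreal ?t * (\<integral>\<^sup>+w\<in>slab i x s. ennreal \<bar>f (upd i \<rho> w) - f y'\<bar> \<partial>lborel)"
    by (subst nn_integral_add) (auto simp: distrib_left)
  also have "\<dots> \<le> ennreal (real CARD('n) * (2 * s) ^ (CARD('n) - 1)) * bound + ennreal (real CARD('n) * (2 * s) ^ (CARD('n) - 1)) * bound"
    by (rule add_mono; rule face_point) (use assms in auto)
  also have "\<dots> = (ennreal (real CARD('n) * (2 * s) ^ (CARD('n) - 1)) + ennreal (real CARD('n) * (2 * s) ^ (CARD('n) - 1))) * bound"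
    by (rule distrib_right[symmetric])
  also have "ennreal (real CARD('n) * (2 * s) ^ (CARD('n) - 1)) + ennreal (real CARD('n) * (2 * s) ^ (CARD('n) - 1)) = ennreal ((2 * s) ^ (CARD('n) - 1)) * ennreal (2 * real CARD('n))"
    using s by (simp flip: ennreal_plus ennreal_mult)
  finally have "ennreal ((2 * s) ^ (CARD('n) - 1)) * ennreal (?t * \<bar>f y - f y'\<bar>) \<le> ennreal ((2 * s) ^ (CARD('n) - 1)) * (ennreal (2 * real CARD('n)) * bound)"
    by (simp only: mult.assoc)
  then show ?thesis by (rule ennreal_mult_cancel_le[rotated]) (use s in simp)
qed

definition vertex :: "real^'n" where "vertex = (\<chi> j. x $ j + s)"

text \<open>A point of a face with normal direction \<open>i\<close> is compared with
  \<open>v\<close>, the vertex moved in direction \<open>i\<close> onto that face. For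
  \<open>j \<noteq> i\<close> both \<open>v\<close> and the vertex lie on the face at
  \<open>x $ j + s\<close>, so two comparisons suffice, and \<open>4\<close> is twice the
  \<open>2\<close> of \<open>face_oscillation\<close>.\<close>

lemma boundary_oscillation:
  assumes y: "\<And>j. \<bar>y $ j - x $ j\<bar> \<le> s" "\<bar>y $ i - x $ i\<bar> = s"
  shows "ennreal (T * (2 * s) ^ (CARD('n) - 2) * \<bar>f y - f vertex\<bar>) \<le> ennreal (4 * real CARD('n)) * bound"
proof -
  let ?t = "T * (2 * s) ^ (CARD('n) - 2)"
  have t: "?t \<ge> 0" using T s by simp
  define \<rho> where "\<rho> = y $ i"
  have \<rho>: "\<rho> = x $ i + s \<or> \<rho> = x $ i - s" using y(2) by (auto simp: \<rho>_def abs_if split: if_splits)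
  define v where "v = upd i \<rho> vertex"
  have v: "\<bar>v $ j - x $ j\<bar> \<le> s" for j using \<rho> s by (auto simp: v_def vertex_def)
  have vx: "\<bar>vertex $ j - x $ j\<bar> \<le> s" for j using s by (simp add: vertex_def)
  have "UNIV \<noteq> {i}"
  proof
    assume "UNIV = {i}"
    then have "CARD('n) = card {i}" by metis
    then show False using n by simp
  qed
  then obtain j where j: "j \<noteq> i" by auto
  have 1: "ennreal (?t * \<bar>f y - f v\<bar>) \<le> ennreal (2 * real CARD('n)) * bound"
    by (rule face_oscillation[of y i \<rho> v]) (use y v \<rho> in \<open>auto simp: \<rho>_def v_def\<close>)
  have 2: "ennreal (?t * \<bar>f v - f vertex\<bar>) \<le> ennreal (2 * real CARD('n)) * bound"
    by (rule face_oscillation[of v j "x $ j + s" vertex]) (use v vx j in \<open>auto simp: v_def vertex_def\<close>)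
  have "ennreal (?t * \<bar>f y - f vertex\<bar>) \<le> ennreal (?t * \<bar>f y - f v\<bar>) + ennreal (?t * \<bar>f v - f vertex\<bar>)"
  proof -
    have "?t * \<bar>f y - f vertex\<bar> \<le> ?t * (\<bar>f y - f v\<bar> + \<bar>f v - f vertex\<bar>)"
      using t by (intro mult_left_mono) auto
    then show ?thesis using t by (simp add: ennreal_leI distrib_left flip: ennreal_plus)
  qed
  also have "\<dots> \<le> ennreal (2 * real CARD('n)) * bound + ennreal (2 * real CARD('n)) * bound"
    by (rule add_mono[OF 1 2])
  also have "\<dots> = (ennreal (2 * real CARD('n)) + ennreal (2 * real CARD('n))) * bound"
    by (rule distrib_right[symmetric])
  also have "ennreal (2 * real CARD('n)) + ennreal (2 * real CARD('n)) = ennreal (4 * real CARD('n))"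
    by (simp flip: ennreal_plus)
  finally show ?thesis .
qed

text \<open>An oscillation bound says nothing about the size of the values. By averaging over a face
  through the vertex, the size there is controlled by the boundary integral of a majorant
  \<open>W\<close>, which later gives compactness of the vertex values along a sequence.\<close>

lemma vertex_bound:
  assumes W: "W \<in> borel_measurable borel"
    and le: "\<And>z. (\<forall>j. \<bar>z $ j - x $ j\<bar> \<le> s) \<Longrightarrow> ennreal \<bar>f z\<bar> \<le> W z"
  shows "ennreal (T * (2 * s) ^ (CARD('n) - 2)) * ennreal ((2 * s) ^ (CARD('n) - 1) * \<bar>f vertex\<bar>)
    \<le> ennreal (T * (2 * s) ^ (CARD('n) - 2)) * boundary_integral W x s + ennreal (real CARD('n) * (2 * s) ^ (CARD('n) - 1)) * bound"
proof -
  note [measurable] = W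
  let ?t = "T * (2 * s) ^ (CARD('n) - 2)"
  fix i :: 'n
  define \<rho> where "\<rho> = x $ i + s"
  have "ennreal ((2 * s) ^ (CARD('n) - 1) * \<bar>f vertex\<bar>) \<le> (\<integral>\<^sup>+w. W (upd i \<rho> w) * indicator (slab i x s) w + ennreal \<bar>f (upd i \<rho> w) - f vertex\<bar> * indicator (slab i x s) w \<partial>lborel)"
    unfolding slab_const[where i = i, OF abs_ge_zero]
  proof (rule nn_integral_mono)
    fix w
    show "ennreal \<bar>f vertex\<bar> * indicator (slab i x s) w \<le> W (upd i \<rho> w) * indicator (slab i x s) w + ennreal \<bar>f (upd i \<rho> w) - f vertex\<bar> * indicator (slab i x s) w"
    proof (cases "w \<in> slab i x s")
      case True
      have "ennreal \<bar>f vertex\<bar> \<le> ennreal (\<bar>f (upd i \<rho> w)\<bar> + \<bar>f (upd i \<rho> w) - f vertex\<bar>)"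
        by (intro ennreal_leI) auto
      also have "\<dots> = ennreal \<bar>f (upd i \<rho> w)\<bar> + ennreal \<bar>f (upd i \<rho> w) - f vertex\<bar>" by simp
      also have "\<dots> \<le> W (upd i \<rho> w) + ennreal \<bar>f (upd i \<rho> w) - f vertex\<bar>"
        using True s by (intro add_right_mono le) (auto simp: \<rho>_def slab_def less_imp_le)
      finally show ?thesis using True by simp
    qed simp
  qed
  also have "\<dots> = (\<integral>\<^sup>+w\<in>slab i x s. W (upd i \<rho> w) \<partial>lborel) + (\<integral>\<^sup>+w\<in>slab i x s. ennreal \<bar>f (upd i \<rho> w) - f vertex\<bar> \<partial>lborel)"
    by (rule nn_integral_add) measurable
  also have "\<dots> \<le> boundary_integral W x s + (\<integral>\<^sup>+w\<in>slab i x s. ennreal \<bar>f (upd i \<rho> w) - f vertex\<bar> \<partial>lborel)"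
    using slab_integral_le[where i = i and x = x and s = s and G = W and \<rho> = \<rho>] face_le_boundary(1)[where G = W and i = i and x = x and s = s] by (intro add_right_mono) (auto simp: \<rho>_def)
  finally have "ennreal ?t * ennreal ((2 * s) ^ (CARD('n) - 1) * \<bar>f vertex\<bar>)
    \<le> ennreal ?t * (boundary_integral W x s + (\<integral>\<^sup>+w\<in>slab i x s. ennreal \<bar>f (upd i \<rho> w) - f vertex\<bar> \<partial>lborel))"
    by (rule mult_left_mono) simp
  also have "\<dots> = ennreal ?t * boundary_integral W x s + ennreal ?t * (\<integral>\<^sup>+w\<in>slab i x s. ennreal \<bar>f (upd i \<rho> w) - f vertex\<bar> \<partial>lborel)"
    by (rule distrib_left)
  also have "\<dots> \<le> ennreal ?t * boundary_integral W x s + ennreal (real CARD('n) * (2 * s) ^ (CARD('n) - 1)) * bound"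
    by (rule add_left_mono, rule face_point) (use s in \<open>auto simp: vertex_def \<rho>_def\<close>)
  finally show ?thesis .
qed

end

section \<open>Truncations of weakly monotone functions\<close>

lemma lebesgue_on_measurable_indicator:
  fixes f :: "real^'n \<Rightarrow> 'b::real_normed_vector"
  assumes "Q \<in> sets borel" "f \<in> borel_measurable (lebesgue_on Q)"
  shows "(\<lambda>x. indicator Q x *\<^sub>R f x) \<in> borel_measurable lebesgue"
  using assms by (subst (asm) borel_measurable_restrict_space_iff) auto

text \<open>Passage from \<open>lebesgue_on\<close>, used in the definitions, to
  \<open>lborel\<close>, used in the estimates, through a Borel function that agrees with
  \<open>f\<close> almost everywhere on \<open>Q\<close>.\<close>

lemma integral_lebesgue_on_borel:
  fixes f fb :: "real^'n \<Rightarrow> 'b::{banach, second_countable_topology}"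
  assumes Q: "Q \<in> sets borel" and f: "f \<in> borel_measurable (lebesgue_on Q)" and fb: "fb \<in> borel_measurable borel"
    and eq: "AE x in lborel. x \<in> Q \<longrightarrow> f x = fb x"
  shows "integral\<^sup>L (lebesgue_on Q) f = (\<integral>x. indicator Q x *\<^sub>R fb x \<partial>lborel)"
proof -
  note [measurable] = Q fb
  have "integral\<^sup>L (lebesgue_on Q) f = (\<integral>x. indicator Q x *\<^sub>R f x \<partial>lebesgue)"
    using Q by (intro integral_restrict_space) auto
  also have "\<dots> = (\<integral>x. indicator Q x *\<^sub>R fb x \<partial>lebesgue)"
  proof (rule integral_cong_AE)
    show "(\<lambda>x. indicator Q x *\<^sub>R f x) \<in> borel_measurable lebesgue"
      by (rule lebesgue_on_measurable_indicator[OF Q f])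
    show "(\<lambda>x. indicator Q x *\<^sub>R fb x) \<in> borel_measurable lebesgue"
      by (intro measurable_completion) measurable
    show "AE x in lebesgue. indicator Q x *\<^sub>R f x = indicator Q x *\<^sub>R fb x"
      using AE_completion[OF eq] by eventually_elim (auto simp: indicator_def)
  qed
  also have "\<dots> = (\<integral>x. indicator Q x *\<^sub>R fb x \<partial>lborel)"
    by (rule integral_completion) measurable
  finally show ?thesis .
qed

lemma set_integrable_lebesgue_borel:
  fixes f fb :: "real^'n \<Rightarrow> 'b::{banach, second_countable_topology}"
  assumes Q: "Q \<in> sets borel" and f: "f \<in> borel_measurable (lebesgue_on Q)"
    and fb: "integrable lborel (\<lambda>x. indicator Q x *\<^sub>R fb x)"
    and eq: "AE x in lborel. x \<in> Q \<longrightarrow> f x = fb x"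
  shows "set_integrable lebesgue Q f"
  unfolding set_integrable_def
proof (rule integrable_cong_AE_imp)
  have "(\<lambda>x. indicator Q x *\<^sub>R fb x) \<in> borel_measurable lborel" using fb by (rule borel_measurable_integrable)
  then show "integrable lebesgue (\<lambda>x. indicator Q x *\<^sub>R fb x)"
    using fb by (subst integrable_completion)
  show "(\<lambda>x. indicator Q x *\<^sub>R f x) \<in> borel_measurable lebesgue"
    by (rule lebesgue_on_measurable_indicator[OF Q f])
  show "AE x in lebesgue. indicator Q x *\<^sub>R fb x = indicator Q x *\<^sub>R f x"
    using AE_completion[OF eq] by eventually_elim (auto simp: indicator_def)
qed

lemma bump_integrable:
  assumes "bump F" shows "integrable lborel F"
proof -
  obtain R where R: "\<And>x. R < norm x \<Longrightarrow> F x = 0" using assms by (auto simp: bump_def)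
  have "integrable lborel (\<lambda>x. indicator (cball 0 R) x *\<^sub>R F x)"
    using assms by (intro borel_integrable_compact smooth_continuous) (auto simp: bump_def)
  moreover have "(\<lambda>x. indicator (cball 0 R) x *\<^sub>R F x) = F"
    using R by (auto simp: indicator_def fun_eq_iff)
  ultimately show ?thesis by simp
qed

lemma bump_mult: "smooth f \<Longrightarrow> bump \<psi> \<Longrightarrow> bump (\<lambda>x. f x * \<psi> x)"
  unfolding bump_def by (auto intro: smooth_mult)

lemma test_function_bump:
  assumes "\<psi> \<in> test_functions \<Omega>" shows "bump \<psi>"
proof -
  have "bounded {x. \<psi> x \<noteq> 0}"
    using assms by (auto simp: test_functions_def intro: bounded_subset[OF compact_imp_bounded closure_subset])
  then obtain R where "\<And>x. \<psi> x \<noteq> 0 \<Longrightarrow> norm x \<le> R" by (auto simp: bounded_iff)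
  then show ?thesis using assms unfolding bump_def test_functions_def smooth_def by (auto simp: not_le[symmetric])
qed

text \<open>By translation invariance \<open>F (x + v) - F x\<close> has integral \<open>0\<close>.
  Inserting the uniform first order expansion for a step of length \<open>t\<close> in direction
  \<open>i\<close> and dividing by \<open>t\<close> shows that the integral of the derivative is
  smaller than any \<open>e\<close>.\<close>

lemma integral_partial_deriv_zero:
  fixes F :: "real^'n \<Rightarrow> real"
  assumes "bump F" shows "(\<integral>x. partial_deriv i F x \<partial>lborel) = 0"
proof -
  obtain R where R: "\<And>x. R < norm x \<Longrightarrow> F x = 0" using assms by (auto simp: bump_def)
  have R': "partial_deriv i F x = 0" if "R < norm x" for x
    using partial_deriv_cong_open[of "{x. R < norm x}" x F "\<lambda>_. 0" i] that R
    by (simp add: open_Collect_less continuous_on_norm_id)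
  have intF: "integrable lborel F" and intD: "integrable lborel (partial_deriv i F)"
    using assms by (auto intro: bump_integrable bump_partial_deriv)
  define B where "B = measure lborel (cball (0::real^'n) (R + 1))"
  have "\<bar>\<integral>x. partial_deriv i F x \<partial>lborel\<bar> \<le> 0 + e" if "e > 0" for e
  proof -
    define e' where "e' = e / (B + 1)"
    have "B \<ge> 0" by (simp add: B_def)
    then have e': "e' > 0" using that by (simp add: e'_def)
    obtain d where d: "d > 0"
      "\<And>x v. norm v < d \<Longrightarrow> \<bar>F (x + v) - F x - (\<Sum>i\<in>UNIV. v $ i * partial_deriv i F x)\<bar> \<le> e' * norm v"
      using bump_uniformly_differentiable[OF assms e'] by metis
    \<comment> \<open>\<open>t \<le> 1\<close> keeps \<open>x + v\<close> outside the support when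
      \<open>x\<close> lies outside the ball of radius \<open>R + 1\<close>.\<close>
    define t where "t = min (d / 2) 1"
    have t: "0 < t" "t < d" "t \<le> 1" using d by (auto simp: t_def)
    define v :: "real^'n" where "v = t *\<^sub>R axis i 1"
    have v: "norm v = t" using t by (simp add: v_def)
    have sum_v: "(\<Sum>j\<in>UNIV. v $ j * partial_deriv j F x) = t * partial_deriv i F x" for x
    proof -
      have "(\<Sum>j\<in>UNIV. v $ j * partial_deriv j F x) = (\<Sum>j\<in>UNIV. if j = i then t * partial_deriv i F x else 0)"
        by (rule sum.cong) (auto simp: v_def axis_def)
      then show ?thesis by simp
    qed
    have intv: "integrable lborel (\<lambda>x. F (x + v))" and eqv: "(\<integral>x. F (x + v) \<partial>lborel) = (\<integral>x. F x \<partial>lborel)"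
    proof -
      have [measurable]: "F \<in> borel_measurable borel" using assms by (rule bump_measurable)
      have "integrable (distr lborel borel ((+) v)) F" "integral\<^sup>L (distr lborel borel ((+) v)) F = integral\<^sup>L lborel F"
        using intF by (simp_all add: lborel_distr_plus)
      then show "integrable lborel (\<lambda>x. F (x + v))" "(\<integral>x. F (x + v) \<partial>lborel) = (\<integral>x. F x \<partial>lborel)"
        by (simp_all add: integrable_distr_eq integral_distr add.commute)
    qed
    have "t * \<bar>\<integral>x. partial_deriv i F x \<partial>lborel\<bar> = norm (\<integral>x. F (x + v) - F x - t * partial_deriv i F x \<partial>lborel)"
      using intF intD intv eqv t by (simp add: abs_mult)
    also have "\<dots> \<le> (\<integral>x. indicator (cball (0::real^'n) (R + 1)) x * (e' * t) \<partial>lborel)"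
    proof (rule Bochner_Integration.integral_norm_bound_integral)
      show "integrable lborel (\<lambda>x. F (x + v) - F x - t * partial_deriv i F x)"
        using intF intD intv by simp
      show "integrable lborel (\<lambda>x. indicator (cball (0::real^'n) (R + 1)) x * (e' * t))"
        using emeasure_bounded_finite[OF bounded_cball[of "0::real^'n" "R + 1"]]
        by (intro integrable_mult_left integrable_real_indicator) auto
      fix x
      show "norm (F (x + v) - F x - t * partial_deriv i F x) \<le> indicator (cball (0::real^'n) (R + 1)) x * (e' * t)"
      proof (cases "norm x \<le> R + 1")
        case True
        then show ?thesis using d(2)[of v x] v t sum_v[of x] by simp
      next
        case False
        then have "R < norm x" "R < norm (x + v)"
          using norm_triangle_ineq2[of x "- v"] v t by auto
        then show ?thesis using R R' e' t by (simp add: indicator_def)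
      qed
    qed
    also have "\<dots> = t * (e' * B)" by (simp add: B_def)
    finally have "\<bar>\<integral>x. partial_deriv i F x \<partial>lborel\<bar> \<le> e' * B" using t by simp
    also have "\<dots> \<le> e" using that \<open>B \<ge> 0\<close> by (simp add: e'_def field_simps)
    finally show ?thesis by simp
  qed
  then have "\<bar>\<integral>x. partial_deriv i F x \<partial>lborel\<bar> \<le> 0" by (rule field_le_epsilon)
  then show ?thesis by simp
qed

lemma integration_by_parts:
  assumes f: "smooth f" and \<psi>: "bump \<psi>"
  shows "(\<integral>x. f x * partial_deriv i \<psi> x \<partial>lborel) = - (\<integral>x. partial_deriv i f x * \<psi> x \<partial>lborel)"
proof -
  have sp: "smooth \<psi>" using \<psi> by (simp add: bump_def)
  have "0 = (\<integral>x. partial_deriv i (\<lambda>x. f x * \<psi> x) x \<partial>lborel)"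
    using integral_partial_deriv_zero[OF bump_mult[OF f \<psi>], of i] by simp
  also have "\<dots> = (\<integral>x. f x * partial_deriv i \<psi> x + partial_deriv i f x * \<psi> x \<partial>lborel)"
    by (simp add: partial_deriv_mult smooth_differentiable f sp)
  also have "\<dots> = (\<integral>x. f x * partial_deriv i \<psi> x \<partial>lborel) + (\<integral>x. partial_deriv i f x * \<psi> x \<partial>lborel)"
    by (intro Bochner_Integration.integral_add bump_integrable bump_mult bump_partial_deriv f \<psi> smooth_partial_deriv)
  finally show ?thesis by simp
qed

text \<open>\<open>ramp \<kappa>\<close> is a smooth approximation of the positive part which vanishes on the negative axis.\<close>

definition ramp :: "real \<Rightarrow> real \<Rightarrow> real" where
  "ramp \<kappa> x = x * flat 1 (\<kappa> * x)"

definition ramp_deriv :: "real \<Rightarrow> real \<Rightarrow> real" where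
  "ramp_deriv \<kappa> x = (if x > 0 then exp (- (1 / (\<kappa> * x))) * (1 + 1 / (\<kappa> * x)) else 0)"

lemma ramp_has_derivative:
  assumes "\<kappa> > 0" shows "(ramp \<kappa> has_real_derivative ramp_deriv \<kappa> x) (at x)"
proof -
  have d: "((\<lambda>x. flat 1 (\<kappa> * x)) has_real_derivative flat (monom 1 2 * (1 - pderiv 1)) (\<kappa> * x) * \<kappa>) (at x)"
  proof -
    have "((\<lambda>x. \<kappa> * x) has_real_derivative \<kappa>) (at x)" by (auto intro!: derivative_eq_intros)
    from DERIV_chain2[OF flat_has_derivative this] show ?thesis .
  qed
  have "((\<lambda>x. x * flat 1 (\<kappa> * x)) has_real_derivative x * (flat (monom 1 2 * (1 - pderiv 1)) (\<kappa> * x) * \<kappa>) + 1 * flat 1 (\<kappa> * x)) (at x)"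
    using DERIV_mult[OF DERIV_ident d] by (simp add: algebra_simps)
  moreover have "x * (flat (monom 1 2 * (1 - pderiv 1)) (\<kappa> * x) * \<kappa>) + 1 * flat 1 (\<kappa> * x) = ramp_deriv \<kappa> x"
  proof (cases "x > 0")
    case True
    have "x * ((1 / (\<kappa> * x))\<^sup>2 * \<kappa>) = 1 / (\<kappa> * x)" using True assms by (simp add: power2_eq_square)
    moreover have "x * (flat (monom 1 2 * (1 - pderiv 1)) (\<kappa> * x) * \<kappa>) = (x * ((1 / (\<kappa> * x))\<^sup>2 * \<kappa>)) * exp (- (1 / (\<kappa> * x)))"
      using True assms by (simp add: flat_def poly_monom)
    moreover have "flat 1 (\<kappa> * x) = exp (- (1 / (\<kappa> * x)))"
      using True assms by (simp add: flat_def)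
    ultimately show ?thesis using True by (simp add: ramp_deriv_def algebra_simps)
  next
    case False
    then have "\<not> \<kappa> * x > 0" using assms by (simp add: zero_less_mult_iff)
    then show ?thesis using False by (simp add: flat_def ramp_deriv_def)
  qed
  ultimately show ?thesis unfolding ramp_def[abs_def] by simp
qed

text \<open>With \<open>y = 1 / (\<kappa> * x)\<close> the upper bound is
  \<open>1 + y \<le> exp y\<close>.\<close>

lemma ramp_deriv_bounds:
  assumes "\<kappa> > 0" shows "0 \<le> ramp_deriv \<kappa> x" "ramp_deriv \<kappa> x \<le> 1"
proof -
  show "0 \<le> ramp_deriv \<kappa> x" using assms by (simp add: ramp_deriv_def)
  have "1 + y \<le> exp y" for y :: real by (rule exp_ge_add_one_self)
  then have "exp (- y) * (1 + y) \<le> exp (- y) * exp y" for y :: real by (intro mult_left_mono) auto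
  then have "exp (- y) * (1 + y) \<le> 1" for y :: real by (simp add: exp_minus)
  then show "ramp_deriv \<kappa> x \<le> 1" by (simp add: ramp_deriv_def)
qed

lemma ramp_close:
  assumes "\<kappa> > 0" shows "\<bar>ramp \<kappa> x - max x 0\<bar> \<le> 1 / \<kappa>"
proof (cases "x > 0")
  case True
  have "1 - 1 / (\<kappa> * x) \<le> exp (- (1 / (\<kappa> * x)))"
    using exp_ge_add_one_self[of "- (1 / (\<kappa> * x))"] by simp
  then have "x * (1 - exp (- (1 / (\<kappa> * x)))) \<le> x * (1 / (\<kappa> * x))"
    using True by (intro mult_left_mono) auto
  also have "x * (1 / (\<kappa> * x)) = 1 / \<kappa>" using True by simp
  finally have "x - x * exp (- (1 / (\<kappa> * x))) \<le> 1 / \<kappa>" by (simp add: algebra_simps)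
  moreover have "x * exp (- (1 / (\<kappa> * x))) \<le> x * 1"
    using True assms by (intro mult_left_mono) auto
  ultimately show ?thesis using True assms by (simp add: ramp_def flat_def)
next
  case False
  then have "\<not> \<kappa> * x > 0" using assms by (simp add: zero_less_mult_iff)
  then show ?thesis using False assms by (simp add: ramp_def flat_def)
qed

lemma ramp_nonpos: "\<kappa> > 0 \<Longrightarrow> x \<le> 0 \<Longrightarrow> ramp \<kappa> x = 0"
  by (simp add: ramp_def flat_def zero_less_mult_iff)

lemma smooth_ramp: "smooth h \<Longrightarrow> smooth (\<lambda>y. ramp \<kappa> (h y))"
  unfolding ramp_def by (intro smooth_mult smooth_flat smooth_const)

text \<open>At \<open>x = 0\<close> the limit would depend on the speed of \<open>xs\<close>, so
  this value is excluded; hence truncation levels must be attained only on null sets.\<close>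

lemma ramp_deriv_tendsto:
  assumes "xs \<longlonglongrightarrow> x" "x \<noteq> 0"
  shows "(\<lambda>k. ramp_deriv (real (Suc k)) (xs k)) \<longlonglongrightarrow> (if x > 0 then 1 else 0)"
proof (cases "x > 0")
  case True
  have ev: "\<forall>\<^sub>F k in sequentially. xs k > 0" using assms(1) True by (rule order_tendstoD)
  have "(\<lambda>k. (1 / real (Suc k)) * (1 / xs k)) \<longlonglongrightarrow> 0 * (1 / x)"
    using True by (intro tendsto_mult tendsto_divide tendsto_const assms(1) LIMSEQ_Suc[OF lim_1_over_n]) auto
  then have y: "(\<lambda>k. 1 / (real (Suc k) * xs k)) \<longlonglongrightarrow> 0" by simp
  have "(\<lambda>k. exp (- (1 / (real (Suc k) * xs k))) * (1 + 1 / (real (Suc k) * xs k))) \<longlonglongrightarrow> exp (- 0) * (1 + 0)"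
    by (intro tendsto_intros y)
  then have "(\<lambda>k. exp (- (1 / (real (Suc k) * xs k))) * (1 + 1 / (real (Suc k) * xs k))) \<longlonglongrightarrow> 1" by simp
  moreover have "\<forall>\<^sub>F k in sequentially. exp (- (1 / (real (Suc k) * xs k))) * (1 + 1 / (real (Suc k) * xs k)) = ramp_deriv (real (Suc k)) (xs k)"
    using ev by eventually_elim (simp add: ramp_deriv_def)
  ultimately show ?thesis using True by (simp add: Lim_transform_eventually)
next
  case False
  then have "\<forall>\<^sub>F k in sequentially. xs k < 0" using assms by (intro order_tendstoD(2)[OF assms(1)]) auto
  then have "\<forall>\<^sub>F k in sequentially. ramp_deriv (real (Suc k)) (xs k) = 0"
    by eventually_elim (simp add: ramp_deriv_def)
  then show ?thesis using False by (simp add: tendsto_eventually)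
qed

section \<open>Weak monotonicity tested with truncated approximations\<close>

lemma frontier_cube: "y \<in> closure (cube x s) \<Longrightarrow> y \<notin> cube x s \<Longrightarrow> y \<in> frontier (cube x s)"
  by (simp add: frontier_def interior_open[OF open_cube])

lemma compact_closure_cube: "compact (closure (cube x s))"
  by (simp add: cube_box bounded_box)

lemma emeasure_cube_finite: "emeasure lborel (cube x s) < \<infinity>"
  unfolding cube_box by (rule emeasure_lborel_box_finite)

text \<open>The truncation of \<open>ub\<close> at the levels
  \<open>c \<plusminus> (ol + \<delta>)\<close> is the limit of the truncations of
  \<open>V k\<close> at \<open>ck k \<plusminus> (ok k + \<delta>)\<close>. On the frontier
  \<open>V k\<close> differs from \<open>ck k\<close> by at most \<open>ok k\<close>, so the margin
  \<open>\<delta>\<close> makes the latter vanish near the frontier; extended by zero they are test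
  functions that place the limit in \<open>W11_0\<close>, and weak monotonicity applies to the limit
  levels.\<close>

lemma weakly_monotone_truncation:
  fixes u ub :: "real^'n \<Rightarrow> real" and gb :: "real^'n \<Rightarrow> real^'n"
  assumes wm: "weakly_monotone \<Omega> u" and um: "u \<in> borel_measurable (lebesgue_on \<Omega>)"
    and cl: "closure (cube x0 s) \<subseteq> \<Omega>"
    and ub: "integrable lborel ub" and eq: "AE x in lborel. x \<in> cube x0 s \<longrightarrow> u x = ub x"
    and gb: "integrable lborel gb"
    and V: "\<And>k. smooth (V k)"
    and ae: "AE x in lborel. x \<in> cube x0 s \<longrightarrow> (\<lambda>k. V k x) \<longlonglongrightarrow> ub x"
    and L1: "(\<lambda>k. \<integral>\<^sup>+x\<in>cube x0 s. ennreal \<bar>V k x - ub x\<bar> \<partial>lborel) \<longlonglongrightarrow> 0"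
    and L1g: "(\<lambda>k. \<integral>\<^sup>+x\<in>cube x0 s. ennreal (norm (grad (V k) x - gb x)) \<partial>lborel) \<longlonglongrightarrow> 0"
    and c: "ck \<longlonglongrightarrow> c" and ol: "ok \<longlonglongrightarrow> ol" and ok0: "\<And>k. ok k \<ge> 0"
    and bd: "\<And>k y. y \<in> frontier (cube x0 s) \<Longrightarrow> \<bar>V k y - ck k\<bar> \<le> ok k"
    and \<delta>: "\<delta> > 0" and nM: "AE x in lborel. ub x \<noteq> c + ol + \<delta>" and nm: "AE x in lborel. ub x \<noteq> c - ol - \<delta>"
  shows "AE x in lborel. x \<in> cube x0 s \<longrightarrow> c - ol - \<delta> \<le> ub x \<and> ub x \<le> c + ol + \<delta>"
proof -
  define Q where "Q = cube x0 s"
  have [measurable]: "Q \<in> sets borel" and oQ: "open Q" by (auto simp: Q_def open_cube)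
  have finQ: "emeasure lborel Q < \<infinity>" unfolding Q_def by (rule emeasure_cube_finite)
  define M m where "M = c + ol + \<delta>" and "m = c - ol - \<delta>"
  define Mk mk where "Mk k = ck k + ok k + \<delta>" and "mk k = ck k - ok k - \<delta>" for k
  define \<kappa> where "\<kappa> k = real (Suc k)" for k
  have \<kappa>: "\<kappa> k > 0" for k by (simp add: \<kappa>_def)
  have limM: "Mk \<longlonglongrightarrow> M" and limm: "mk \<longlonglongrightarrow> m"
    unfolding Mk_def M_def mk_def m_def by (intro tendsto_intros c ol)+
  have "ol \<ge> 0" using ol ok0 by (intro LIMSEQ_le_const[OF ol]) auto
  then have "m \<le> M" using \<delta> by (simp add: m_def M_def)
  have [measurable]: "ub \<in> borel_measurable borel" "gb \<in> borel_measurable borel" using ub gb by auto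
  have [measurable]: "V k \<in> borel_measurable borel" "grad (V k) \<in> borel_measurable borel" for k
    by (auto intro!: borel_measurable_continuous_onI smooth_continuous V continuous_grad)
  define F where "F k y = ramp (\<kappa> k) (V k y - Mk k) - ramp (\<kappa> k) (mk k - V k y)" for k y
  define a where "a k y = ramp_deriv (\<kappa> k) (V k y - Mk k) + ramp_deriv (\<kappa> k) (mk k - V k y)" for k y
  define \<Phi> where "\<Phi> k y = (if y \<in> Q then F k y else 0)" for k y
  have smVM: "smooth (\<lambda>y. V k y - Mk k)" and smmV: "smooth (\<lambda>y. mk k - V k y)" for k
    by (intro smooth_minus V smooth_const)+
  have smF: "smooth (F k)" for k
    unfolding F_def by (intro smooth_minus smooth_ramp smVM smmV)
  have pdF: "partial_deriv i (F k) y = a k y * partial_deriv i (V k) y" for i k y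
  proof -
    have "partial_deriv i (F k) y = partial_deriv i (\<lambda>y. ramp (\<kappa> k) (V k y - Mk k)) y - partial_deriv i (\<lambda>y. ramp (\<kappa> k) (mk k - V k y)) y"
      unfolding F_def by (intro partial_deriv_minus smooth_ramp smVM smmV)
    also have "partial_deriv i (\<lambda>y. ramp (\<kappa> k) (V k y - Mk k)) y = ramp_deriv (\<kappa> k) (V k y - Mk k) * partial_deriv i (\<lambda>y. V k y - Mk k) y"
      by (rule partial_deriv_compose[OF smooth_differentiable[OF smVM] ramp_has_derivative[OF \<kappa>]])
    also have "partial_deriv i (\<lambda>y. V k y - Mk k) y = partial_deriv i (V k) y"
      by (simp add: partial_deriv_minus[OF V smooth_const])
    also have "partial_deriv i (\<lambda>y. ramp (\<kappa> k) (mk k - V k y)) y = ramp_deriv (\<kappa> k) (mk k - V k y) * partial_deriv i (\<lambda>y. mk k - V k y) y"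
      by (rule partial_deriv_compose[OF smooth_differentiable[OF smmV] ramp_has_derivative[OF \<kappa>]])
    also have "partial_deriv i (\<lambda>y. mk k - V k y) y = - partial_deriv i (V k) y"
      by (simp add: partial_deriv_minus[OF smooth_const V])
    finally show ?thesis by (simp add: a_def algebra_simps)
  qed
  \<comment> \<open>A compact set such that \<open>F k\<close> vanishes on the rest of the cube. It
    is cut from \<open>closure Q\<close> and avoids the frontier thanks to
    \<open>\<delta>\<close>.\<close>
  define Z where "Z k = closure Q \<inter> {y. Mk k \<le> V k y} \<union> closure Q \<inter> {y. V k y \<le> mk k}" for k
  have cV: "closed {y. Mk k \<le> V k y}" "closed {y. V k y \<le> mk k}" for k
    by (auto intro!: closed_Collect_le continuous_intros smooth_continuous V)
  have Zc: "compact (Z k)" for k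
    unfolding Z_def Q_def by (intro compact_Un compact_Int_closed compact_closure_cube cV)
  have ZQ: "Z k \<subseteq> Q" for k
  proof
    fix y assume y: "y \<in> Z k"
    show "y \<in> Q"
    proof (rule ccontr)
      assume "y \<notin> Q"
      then have "\<bar>V k y - ck k\<bar> \<le> ok k" using y frontier_cube[of y x0 s] bd by (auto simp: Z_def Q_def)
      then show False using y \<delta> by (auto simp: Z_def Mk_def mk_def)
    qed
  qed
  have Fz: "F k y = 0" if "y \<in> Q" "y \<notin> Z k" for k y
  proof -
    have "y \<in> closure Q" using that(1) closure_subset by blast
    then have "V k y - Mk k \<le> 0" "mk k - V k y \<le> 0" using that by (auto simp: Z_def)
    then show ?thesis using \<kappa> by (simp add: F_def ramp_nonpos)
  qed
  have sm\<Phi>: "smooth (\<Phi> k)" and pd\<Phi>: "partial_deriv i (\<Phi> k) = (\<lambda>y. if y \<in> Q then partial_deriv i (F k) y else 0)" for k i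
    unfolding \<Phi>_def using smooth_extend_zero[OF oQ compact_imp_closed[OF Zc] ZQ smF Fz] by blast+
  have tf: "\<Phi> k \<in> test_functions Q" for k
    using Fz[of _ k] by (intro test_functionsI[OF sm\<Phi> Zc[of k] ZQ]) (auto simp: \<Phi>_def)
  have grad\<Phi>: "grad (\<Phi> k) y = (if y \<in> Q then a k y *\<^sub>R grad (V k) y else 0)" for k y
    by (simp add: vec_eq_iff grad_def pd\<Phi> pdF)
  have [measurable]: "\<Phi> k \<in> borel_measurable borel" "grad (\<Phi> k) \<in> borel_measurable borel" for k
    by (auto intro!: borel_measurable_continuous_onI smooth_continuous sm\<Phi> continuous_grad)
  have [measurable]: "a k \<in> borel_measurable borel" for k
    unfolding a_def ramp_deriv_def by measurable
  have a_bd: "0 \<le> a k y" "a k y \<le> 2" for k y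
    using ramp_deriv_bounds[OF \<kappa>] by (auto simp: a_def intro: order_trans[OF add_mono, of _ 1 _ 1, simplified])
  define w where "w y = max (ub y - M) 0 - max (m - ub y) 0" for y
  \<comment> \<open>\<open>al\<close> is the limit of \<open>a k\<close> at almost every point of
    the cube, where \<open>ub\<close> misses both levels; accordingly \<open>gw\<close> is the
    gradient to expect for the truncation \<open>w\<close>.\<close>
  define al where "al y = (if ub y > M then 1 else 0) + (if ub y < m then 1 else (0::real))" for y
  define gw where "gw y = al y *\<^sub>R gb y" for y
  have [measurable]: "w \<in> borel_measurable borel" unfolding w_def by measurable
  have [measurable]: "al \<in> borel_measurable borel" unfolding al_def by measurable
  have [measurable]: "gw \<in> borel_measurable borel" unfolding gw_def by measurable
  have al_bd: "0 \<le> al y" "al y \<le> 2" for y by (auto simp: al_def)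
  have int1: "integrable lborel (\<lambda>y. indicator Q y *\<^sub>R (1::real))"
    using finQ by simp
  have intw: "integrable lborel (\<lambda>y. indicator Q y *\<^sub>R w y)"
  proof (rule Bochner_Integration.integrable_bound)
    show "integrable lborel (\<lambda>y. \<bar>ub y\<bar> + (\<bar>M\<bar> + \<bar>m\<bar>) * (indicator Q y *\<^sub>R 1))"
      using ub int1 by (intro Bochner_Integration.integrable_add integrable_abs integrable_mult_right) auto
    show "AE y in lborel. norm (indicator Q y *\<^sub>R w y) \<le> norm (\<bar>ub y\<bar> + (\<bar>M\<bar> + \<bar>m\<bar>) * (indicator Q y *\<^sub>R 1))"
      using \<open>m \<le> M\<close> by (intro AE_I2) (auto simp: w_def indicator_def max_def abs_if)
  qed measurable
  have intgw: "integrable lborel gw"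
  proof (rule Bochner_Integration.integrable_bound)
    show "integrable lborel (\<lambda>y. 2 *\<^sub>R gb y)" using gb by simp
    show "AE y in lborel. norm (gw y) \<le> norm (2 *\<^sub>R gb y)"
      using al_bd by (intro AE_I2) (auto simp: gw_def intro!: mult_right_mono)
  qed measurable
  have intgQ: "integrable lborel (\<lambda>y. indicator Q y *\<^sub>R gw y)"
    using intgw by (rule integrable_mult_indicator[rotated]) simp
  \<comment> \<open>Three errors: the distance of \<open>V k\<close> from \<open>ub\<close>, counted
    for both levels; the shift of the two levels; and the error \<open>1 / \<kappa> k\<close> of
    each smooth ramp.\<close>
  have limw: "(\<lambda>k. \<integral>\<^sup>+y\<in>Q. ennreal \<bar>w y - \<Phi> k y\<bar> \<partial>lborel) \<longlonglongrightarrow> 0"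
  proof (rule tendsto_sandwich[OF _ _ tendsto_const])
    let ?r = "\<lambda>k. 2 / \<kappa> k + \<bar>Mk k - M\<bar> + \<bar>mk k - m\<bar>"
    let ?up = "\<lambda>k. 2 * (\<integral>\<^sup>+y\<in>Q. ennreal \<bar>V k y - ub y\<bar> \<partial>lborel) + ennreal (?r k) * emeasure lborel Q"
    have "(\<lambda>k. 2 / \<kappa> k) \<longlonglongrightarrow> 0"
      using tendsto_mult[OF tendsto_const LIMSEQ_Suc[OF lim_1_over_n], of 2] by (simp add: \<kappa>_def[abs_def])
    moreover have "(\<lambda>k. \<bar>Mk k - M\<bar>) \<longlonglongrightarrow> 0" "(\<lambda>k. \<bar>mk k - m\<bar>) \<longlonglongrightarrow> 0"
      using limM limm by (auto intro!: tendsto_rabs_zero simp: LIM_zero)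
    ultimately have "?r \<longlonglongrightarrow> 0 + 0 + 0" by (intro tendsto_add)
    then have "(\<lambda>k. ennreal (?r k)) \<longlonglongrightarrow> ennreal 0" by (intro tendsto_ennrealI) simp
    then have "(\<lambda>k. ennreal (?r k) * emeasure lborel Q) \<longlonglongrightarrow> ennreal 0 * emeasure lborel Q"
      unfolding mult.commute[of _ "emeasure lborel Q"] using finQ by (intro ennreal_tendsto_cmult) auto
    moreover have "(\<lambda>k. 2 * (\<integral>\<^sup>+y\<in>Q. ennreal \<bar>V k y - ub y\<bar> \<partial>lborel)) \<longlonglongrightarrow> 2 * 0"
      using L1 by (intro ennreal_tendsto_cmult) (auto simp: Q_def)
    ultimately have "?up \<longlonglongrightarrow> 2 * 0 + ennreal 0 * emeasure lborel Q" by (rule tendsto_add[rotated])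
    then show "?up \<longlonglongrightarrow> 0" by simp
    show "\<forall>\<^sub>F k in sequentially. (\<integral>\<^sup>+y\<in>Q. ennreal \<bar>w y - \<Phi> k y\<bar> \<partial>lborel) \<le> ?up k"
    proof (intro always_eventually allI)
      fix k
      have "(\<integral>\<^sup>+y\<in>Q. ennreal \<bar>w y - \<Phi> k y\<bar> \<partial>lborel)
        \<le> (\<integral>\<^sup>+y. 2 * (ennreal \<bar>V k y - ub y\<bar> * indicator Q y) + ennreal (?r k) * indicator Q y \<partial>lborel)"
      proof (rule nn_integral_mono)
        fix y
        show "ennreal \<bar>w y - \<Phi> k y\<bar> * indicator Q y \<le> 2 * (ennreal \<bar>V k y - ub y\<bar> * indicator Q y) + ennreal (?r k) * indicator Q y"
        proof (cases "y \<in> Q")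
          case True
          have "\<bar>w y - \<Phi> k y\<bar> \<le> 2 * \<bar>V k y - ub y\<bar> + ?r k"
          proof -
            have lip: "\<bar>max p 0 - max q 0\<bar> \<le> \<bar>p - q\<bar>" for p q :: real by (auto simp: max_def)
            have 1: "\<bar>max (ub y - M) 0 - max (V k y - Mk k) 0\<bar> \<le> \<bar>V k y - ub y\<bar> + \<bar>Mk k - M\<bar>"
              using lip[of "ub y - M" "V k y - Mk k"] by linarith
            have 2: "\<bar>max (m - ub y) 0 - max (mk k - V k y) 0\<bar> \<le> \<bar>V k y - ub y\<bar> + \<bar>mk k - m\<bar>"
              using lip[of "m - ub y" "mk k - V k y"] by linarith
            have tri: "\<bar>(p - q) - (p' - q')\<bar> \<le> (\<bar>p - p''\<bar> + \<bar>p' - p''\<bar>) + (\<bar>q - q''\<bar> + \<bar>q' - q''\<bar>)"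
              for p q p' q' p'' q'' :: real by linarith
            have 4: "\<Phi> k y = ramp (\<kappa> k) (V k y - Mk k) - ramp (\<kappa> k) (mk k - V k y)"
              using True by (simp add: \<Phi>_def F_def)
            have "\<bar>w y - \<Phi> k y\<bar> \<le> (\<bar>V k y - ub y\<bar> + \<bar>Mk k - M\<bar> + 1 / \<kappa> k) + (\<bar>V k y - ub y\<bar> + \<bar>mk k - m\<bar> + 1 / \<kappa> k)"
              unfolding 4 w_def
              by (rule order_trans[OF tri[where p'' = "max (V k y - Mk k) 0" and q'' = "max (mk k - V k y) 0"]])
                (intro add_mono 1 2 ramp_close \<kappa>)
            then show ?thesis by simp
          qed
          then have "ennreal \<bar>w y - \<Phi> k y\<bar> \<le> ennreal (2 * \<bar>V k y - ub y\<bar> + ?r k)" by (rule ennreal_leI)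
          also have "\<dots> = 2 * ennreal \<bar>V k y - ub y\<bar> + ennreal (?r k)"
          proof -
            have "?r k \<ge> 0" using \<kappa>[of k] by (intro add_nonneg_nonneg) auto
            then show ?thesis by (subst ennreal_plus) (simp_all add: ennreal_mult)
          qed
          finally show ?thesis using True by simp
        qed simp
      qed
      also have "\<dots> = ?up k"
        by (subst nn_integral_add) (auto simp: nn_integral_cmult)
      finally show "(\<integral>\<^sup>+y\<in>Q. ennreal \<bar>w y - \<Phi> k y\<bar> \<partial>lborel) \<le> ?up k" .
    qed
  qed auto
  have limg: "(\<lambda>k. \<integral>\<^sup>+y\<in>Q. ennreal (norm (gw y - grad (\<Phi> k) y)) \<partial>lborel) \<longlonglongrightarrow> 0"
  proof (rule tendsto_sandwich[OF _ _ tendsto_const])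
    \<comment> \<open>The coefficients \<open>a k\<close> converge only almost everywhere. They are
      paired with the fixed function \<open>gb\<close>, where dominated convergence applies; the
      moving gradients are first replaced by \<open>gb\<close> at the cost of an L1 error times the
      bound \<open>2\<close> of \<open>a k\<close>.\<close>
    let ?d = "\<lambda>k. \<integral>\<^sup>+y. ennreal (\<bar>al y - a k y\<bar> * norm (gb y)) * indicator Q y \<partial>lborel"
    let ?up = "\<lambda>k. 2 * (\<integral>\<^sup>+y\<in>Q. ennreal (norm (grad (V k) y - gb y)) \<partial>lborel) + ?d k"
    have "?d \<longlonglongrightarrow> (\<integral>\<^sup>+y. 0 \<partial>(lborel :: (real^'n) measure))"
    proof (rule nn_integral_dominated_convergence[where w = "\<lambda>y. ennreal (2 * norm (gb y))"])
      show "(\<integral>\<^sup>+y. ennreal (2 * norm (gb y)) \<partial>lborel) < \<infinity>"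
        using integrable_norm[OF gb]
        by (simp add: integrable_iff_bounded ennreal_mult nn_integral_cmult ennreal_mult_less_top)
      show "AE y in lborel. ennreal (\<bar>al y - a k y\<bar> * norm (gb y)) * indicator Q y \<le> ennreal (2 * norm (gb y))" for k
      proof (rule AE_I2)
        fix y
        have "\<bar>al y - a k y\<bar> \<le> 2" using al_bd[of y] a_bd[of k y] by linarith
        then have "\<bar>al y - a k y\<bar> * norm (gb y) \<le> 2 * norm (gb y)" by (rule mult_right_mono) simp
        then show "ennreal (\<bar>al y - a k y\<bar> * norm (gb y)) * indicator Q y \<le> ennreal (2 * norm (gb y))"
          by (auto simp: indicator_def intro: ennreal_leI)
      qed
      show "AE y in lborel. (\<lambda>k. ennreal (\<bar>al y - a k y\<bar> * norm (gb y)) * indicator Q y) \<longlonglongrightarrow> 0"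
        using ae nM nm
      proof eventually_elim
        case (elim y)
        show ?case
        proof (cases "y \<in> Q")
          case True
          then have lim: "(\<lambda>k. V k y) \<longlonglongrightarrow> ub y" using elim by (simp add: Q_def)
          have "(\<lambda>k. ramp_deriv (real (Suc k)) (V k y - Mk k)) \<longlonglongrightarrow> (if ub y - M > 0 then 1 else 0)"
            using elim by (intro ramp_deriv_tendsto tendsto_diff lim limM) (simp add: M_def)
          moreover have "(\<lambda>k. ramp_deriv (real (Suc k)) (mk k - V k y)) \<longlonglongrightarrow> (if m - ub y > 0 then 1 else 0)"
            using elim by (intro ramp_deriv_tendsto tendsto_diff lim limm) (simp add: m_def)
          ultimately have "(\<lambda>k. a k y) \<longlonglongrightarrow> (if ub y - M > 0 then 1 else 0) + (if m - ub y > 0 then 1 else 0)"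
            unfolding a_def \<kappa>_def by (rule tendsto_add)
          then have "(\<lambda>k. a k y) \<longlonglongrightarrow> al y" by (simp add: al_def)
          then have "(\<lambda>k. \<bar>al y - a k y\<bar> * norm (gb y)) \<longlonglongrightarrow> \<bar>al y - al y\<bar> * norm (gb y)"
            by (intro tendsto_intros)
          then have "(\<lambda>k. ennreal (\<bar>al y - a k y\<bar> * norm (gb y))) \<longlonglongrightarrow> ennreal 0"
            by (intro tendsto_ennrealI) simp
          then show ?thesis using True by simp
        qed simp
      qed
    qed measurable
    then have "?d \<longlonglongrightarrow> 0" by simp
    moreover have "(\<lambda>k. 2 * (\<integral>\<^sup>+y\<in>Q. ennreal (norm (grad (V k) y - gb y)) \<partial>lborel)) \<longlonglongrightarrow> 2 * 0"
      using L1g by (intro ennreal_tendsto_cmult) (auto simp: Q_def)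
    ultimately have "?up \<longlonglongrightarrow> 2 * 0 + 0" by (rule tendsto_add[rotated])
    then show "?up \<longlonglongrightarrow> 0" by simp
    show "\<forall>\<^sub>F k in sequentially. (\<integral>\<^sup>+y\<in>Q. ennreal (norm (gw y - grad (\<Phi> k) y)) \<partial>lborel) \<le> ?up k"
    proof (intro always_eventually allI)
      fix k
      have "(\<integral>\<^sup>+y\<in>Q. ennreal (norm (gw y - grad (\<Phi> k) y)) \<partial>lborel)
        \<le> (\<integral>\<^sup>+y. 2 * (ennreal (norm (grad (V k) y - gb y)) * indicator Q y) + ennreal (\<bar>al y - a k y\<bar> * norm (gb y)) * indicator Q y \<partial>lborel)"
      proof (rule nn_integral_mono)
        fix y
        show "ennreal (norm (gw y - grad (\<Phi> k) y)) * indicator Q y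
          \<le> 2 * (ennreal (norm (grad (V k) y - gb y)) * indicator Q y) + ennreal (\<bar>al y - a k y\<bar> * norm (gb y)) * indicator Q y"
        proof (cases "y \<in> Q")
          case True
          have "gw y - grad (\<Phi> k) y = (al y - a k y) *\<^sub>R gb y - a k y *\<^sub>R (grad (V k) y - gb y)"
            using True by (simp add: gw_def grad\<Phi> algebra_simps)
          also have "norm \<dots> \<le> \<bar>al y - a k y\<bar> * norm (gb y) + a k y * norm (grad (V k) y - gb y)"
            using a_bd(1)[of k y] norm_triangle_ineq4[of "(al y - a k y) *\<^sub>R gb y" "a k y *\<^sub>R (grad (V k) y - gb y)"] by simp
          also have "\<dots> \<le> 2 * norm (grad (V k) y - gb y) + \<bar>al y - a k y\<bar> * norm (gb y)"
            using a_bd(2)[of k y] by (simp add: mult_right_mono)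
          finally have "ennreal (norm (gw y - grad (\<Phi> k) y)) \<le> ennreal (2 * norm (grad (V k) y - gb y) + \<bar>al y - a k y\<bar> * norm (gb y))"
            by (rule ennreal_leI)
          also have "\<dots> = 2 * ennreal (norm (grad (V k) y - gb y)) + ennreal (\<bar>al y - a k y\<bar> * norm (gb y))"
            by (subst ennreal_plus) (auto simp: ennreal_mult)
          finally show ?thesis using True by simp
        qed simp
      qed
      also have "\<dots> = ?up k" by (subst nn_integral_add) (auto simp: nn_integral_cmult)
      finally show "(\<integral>\<^sup>+y\<in>Q. ennreal (norm (gw y - grad (\<Phi> k) y)) \<partial>lborel) \<le> ?up k" .
    qed
  qed auto
  \<comment> \<open>Both sides are limits of the integrals for the test functions
    \<open>\<Phi> k\<close>, for which the identity is \<open>integration_by_parts\<close>; L1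
    convergence passes through the bounded factors \<open>\<psi>\<close> and
    \<open>partial_deriv i \<psi>\<close>.\<close>
  have gw_grad: "(\<integral>x. indicator Q x *\<^sub>R (w x * partial_deriv i \<psi> x) \<partial>lborel) = - (\<integral>x. indicator Q x *\<^sub>R (gw x $ i * \<psi> x) \<partial>lborel)"
    if \<psi>: "\<psi> \<in> test_functions Q" for \<psi> i
  proof -
    have b: "bump \<psi>" using \<psi> by (rule test_function_bump)
    note [measurable] = bump_measurable[OF b] bump_measurable[OF bump_partial_deriv[OF b]]
    obtain B1 where B1: "\<And>x. \<bar>\<psi> x\<bar> \<le> B1" using bump_bounded[OF b] by blast
    obtain B2 where B2: "\<And>x. \<bar>partial_deriv i \<psi> x\<bar> \<le> B2" using bump_bounded[OF bump_partial_deriv[OF b, of i]] by blast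
    have B0: "B1 \<ge> 0" "B2 \<ge> 0" using order_trans[OF abs_ge_zero B1] order_trans[OF abs_ge_zero B2] by auto
    have lim1: "(\<lambda>k. \<integral>x. \<Phi> k x * partial_deriv i \<psi> x \<partial>lborel) \<longlonglongrightarrow> (\<integral>x. indicator Q x *\<^sub>R (w x * partial_deriv i \<psi> x) \<partial>lborel)"
    proof (rule tendsto_L1_int)
      show "integrable lborel (\<lambda>x. \<Phi> k x * partial_deriv i \<psi> x)" for k
        by (intro bump_integrable bump_mult sm\<Phi> bump_partial_deriv b)
      show "integrable lborel (\<lambda>x. indicator Q x *\<^sub>R (w x * partial_deriv i \<psi> x))"
      proof (rule Bochner_Integration.integrable_bound)
        show "integrable lborel (\<lambda>x. B2 * (indicator Q x *\<^sub>R w x))" using intw by simp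
        show "AE x in lborel. norm (indicator Q x *\<^sub>R (w x * partial_deriv i \<psi> x)) \<le> norm (B2 * (indicator Q x *\<^sub>R w x))"
        proof (rule AE_I2)
          fix x
          show "norm (indicator Q x *\<^sub>R (w x * partial_deriv i \<psi> x)) \<le> norm (B2 * (indicator Q x *\<^sub>R w x))"
            using mult_right_mono[OF B2[of x], of "\<bar>w x\<bar>"] B0 by (cases "x \<in> Q") (auto simp: abs_mult mult.commute)
        qed
      qed measurable
      show "(\<lambda>k. \<integral>\<^sup>+x. ennreal (norm (\<Phi> k x * partial_deriv i \<psi> x - indicator Q x *\<^sub>R (w x * partial_deriv i \<psi> x))) \<partial>lborel) \<longlonglongrightarrow> 0"
      proof (rule tendsto_sandwich[OF _ _ tendsto_const])
        show "(\<lambda>k. ennreal B2 * (\<integral>\<^sup>+y\<in>Q. ennreal \<bar>w y - \<Phi> k y\<bar> \<partial>lborel)) \<longlonglongrightarrow> 0"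
          using ennreal_tendsto_cmult[OF _ limw, of "ennreal B2"] by simp
        show "\<forall>\<^sub>F k in sequentially. (\<integral>\<^sup>+x. ennreal (norm (\<Phi> k x * partial_deriv i \<psi> x - indicator Q x *\<^sub>R (w x * partial_deriv i \<psi> x))) \<partial>lborel)
           \<le> ennreal B2 * (\<integral>\<^sup>+y\<in>Q. ennreal \<bar>w y - \<Phi> k y\<bar> \<partial>lborel)"
        proof (intro always_eventually allI)
          fix k
          have "(\<integral>\<^sup>+x. ennreal (norm (\<Phi> k x * partial_deriv i \<psi> x - indicator Q x *\<^sub>R (w x * partial_deriv i \<psi> x))) \<partial>lborel)
            \<le> (\<integral>\<^sup>+y. ennreal B2 * (ennreal \<bar>w y - \<Phi> k y\<bar> * indicator Q y) \<partial>lborel)"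
          proof (rule nn_integral_mono)
            fix y
            have "norm (\<Phi> k y * partial_deriv i \<psi> y - w y * partial_deriv i \<psi> y) \<le> B2 * \<bar>w y - \<Phi> k y\<bar>"
              using mult_right_mono[OF B2[of y], of "\<bar>w y - \<Phi> k y\<bar>"]
              by (simp add: abs_mult[symmetric] left_diff_distrib[symmetric] abs_minus_commute mult.commute flip: abs_mult)
                (simp add: abs_mult abs_minus_commute mult.commute)
            then show "ennreal (norm (\<Phi> k y * partial_deriv i \<psi> y - indicator Q y *\<^sub>R (w y * partial_deriv i \<psi> y))) \<le> ennreal B2 * (ennreal \<bar>w y - \<Phi> k y\<bar> * indicator Q y)"
              using B0 by (cases "y \<in> Q") (auto simp: \<Phi>_def ennreal_leI simp flip: ennreal_mult)
          qed
          also have "\<dots> = ennreal B2 * (\<integral>\<^sup>+y\<in>Q. ennreal \<bar>w y - \<Phi> k y\<bar> \<partial>lborel)"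
            by (rule nn_integral_cmult) measurable
          finally show "(\<integral>\<^sup>+x. ennreal (norm (\<Phi> k x * partial_deriv i \<psi> x - indicator Q x *\<^sub>R (w x * partial_deriv i \<psi> x))) \<partial>lborel)
            \<le> ennreal B2 * (\<integral>\<^sup>+y\<in>Q. ennreal \<bar>w y - \<Phi> k y\<bar> \<partial>lborel)" .
        qed
      qed auto
    qed
    have lim2: "(\<lambda>k. \<integral>x. partial_deriv i (\<Phi> k) x * \<psi> x \<partial>lborel) \<longlonglongrightarrow> (\<integral>x. indicator Q x *\<^sub>R (gw x $ i * \<psi> x) \<partial>lborel)"
    proof (rule tendsto_L1_int)
      show "integrable lborel (\<lambda>x. partial_deriv i (\<Phi> k) x * \<psi> x)" for k
        by (intro bump_integrable bump_mult smooth_partial_deriv sm\<Phi> b)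
      show "integrable lborel (\<lambda>x. indicator Q x *\<^sub>R (gw x $ i * \<psi> x))"
      proof (rule Bochner_Integration.integrable_bound)
        show "integrable lborel (\<lambda>x. B1 *\<^sub>R (indicator Q x *\<^sub>R gw x))" by (intro integrable_scaleR_right intgQ)
        show "AE x in lborel. norm (indicator Q x *\<^sub>R (gw x $ i * \<psi> x)) \<le> norm (B1 *\<^sub>R (indicator Q x *\<^sub>R gw x))"
          using B1 B0 by (intro AE_I2) (auto simp: indicator_def abs_mult mult.commute intro!: mult_mono component_le_norm_cart)
      qed measurable
      show "(\<lambda>k. \<integral>\<^sup>+x. ennreal (norm (partial_deriv i (\<Phi> k) x * \<psi> x - indicator Q x *\<^sub>R (gw x $ i * \<psi> x))) \<partial>lborel) \<longlonglongrightarrow> 0"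
      proof (rule tendsto_sandwich[OF _ _ tendsto_const])
        show "(\<lambda>k. ennreal B1 * (\<integral>\<^sup>+y\<in>Q. ennreal (norm (gw y - grad (\<Phi> k) y)) \<partial>lborel)) \<longlonglongrightarrow> 0"
          using ennreal_tendsto_cmult[OF _ limg, of "ennreal B1"] by simp
        show "\<forall>\<^sub>F k in sequentially. (\<integral>\<^sup>+x. ennreal (norm (partial_deriv i (\<Phi> k) x * \<psi> x - indicator Q x *\<^sub>R (gw x $ i * \<psi> x))) \<partial>lborel)
           \<le> ennreal B1 * (\<integral>\<^sup>+y\<in>Q. ennreal (norm (gw y - grad (\<Phi> k) y)) \<partial>lborel)"
        proof (intro always_eventually allI)
          fix k
          have "(\<integral>\<^sup>+x. ennreal (norm (partial_deriv i (\<Phi> k) x * \<psi> x - indicator Q x *\<^sub>R (gw x $ i * \<psi> x))) \<partial>lborel)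
            \<le> (\<integral>\<^sup>+y. ennreal B1 * (ennreal (norm (gw y - grad (\<Phi> k) y)) * indicator Q y) \<partial>lborel)"
          proof (rule nn_integral_mono)
            fix y
            have "\<bar>partial_deriv i (\<Phi> k) y - gw y $ i\<bar> \<le> norm (gw y - grad (\<Phi> k) y)"
              using component_le_norm_cart[of "gw y - grad (\<Phi> k) y" i] by (simp add: grad_def abs_minus_commute)
            then have "\<bar>\<psi> y\<bar> * \<bar>partial_deriv i (\<Phi> k) y - gw y $ i\<bar> \<le> B1 * norm (gw y - grad (\<Phi> k) y)"
              using B1[of y] B0 by (intro mult_mono) auto
            moreover have "norm (partial_deriv i (\<Phi> k) y * \<psi> y - gw y $ i * \<psi> y) = \<bar>\<psi> y\<bar> * \<bar>partial_deriv i (\<Phi> k) y - gw y $ i\<bar>"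
              by (simp add: left_diff_distrib[symmetric] abs_mult)
            ultimately show "ennreal (norm (partial_deriv i (\<Phi> k) y * \<psi> y - indicator Q y *\<^sub>R (gw y $ i * \<psi> y))) \<le> ennreal B1 * (ennreal (norm (gw y - grad (\<Phi> k) y)) * indicator Q y)"
              using B0 by (cases "y \<in> Q") (auto simp: pd\<Phi> ennreal_leI simp flip: ennreal_mult)
          qed
          also have "\<dots> = ennreal B1 * (\<integral>\<^sup>+y\<in>Q. ennreal (norm (gw y - grad (\<Phi> k) y)) \<partial>lborel)"
            by (rule nn_integral_cmult) measurable
          finally show "(\<integral>\<^sup>+x. ennreal (norm (partial_deriv i (\<Phi> k) x * \<psi> x - indicator Q x *\<^sub>R (gw x $ i * \<psi> x))) \<partial>lborel)
            \<le> ennreal B1 * (\<integral>\<^sup>+y\<in>Q. ennreal (norm (gw y - grad (\<Phi> k) y)) \<partial>lborel)" .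
        qed
      qed auto
    qed
    have "(\<integral>x. \<Phi> k x * partial_deriv i \<psi> x \<partial>lborel) = - (\<integral>x. partial_deriv i (\<Phi> k) x * \<psi> x \<partial>lborel)" for k
      by (rule integration_by_parts[OF sm\<Phi> b])
    then have "(\<lambda>k. \<integral>x. \<Phi> k x * partial_deriv i \<psi> x \<partial>lborel) \<longlonglongrightarrow> - (\<integral>x. indicator Q x *\<^sub>R (gw x $ i * \<psi> x) \<partial>lborel)"
      using tendsto_minus[OF lim2] by simp
    with lim1 show ?thesis using LIMSEQ_unique by blast
  qed
  define wu where "wu = (\<lambda>x. max (u x - M) 0 - max (m - u x) 0)"
  have QO: "Q \<subseteq> \<Omega>" using cl closure_subset by (auto simp: Q_def)
  have umQ: "u \<in> borel_measurable (lebesgue_on Q)" by (rule measurable_restrict_mono[OF um QO])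
  have wuQ: "wu \<in> borel_measurable (lebesgue_on Q)" unfolding wu_def using umQ by measurable
  have eqw: "AE x in lborel. x \<in> Q \<longrightarrow> wu x = w x"
    using eq by eventually_elim (auto simp: Q_def wu_def w_def)
  have meas_on: "f \<in> borel_measurable (lebesgue_on Q)" if "f \<in> borel_measurable borel" for f :: "real^'n \<Rightarrow> 'z::topological_space"
    using that by (intro measurable_restrict_space1 measurable_completion) simp
  have si1: "set_integrable lebesgue Q wu"
    by (rule set_integrable_lebesgue_borel[OF _ wuQ intw eqw]) simp
  have si2: "set_integrable lebesgue Q gw"
    by (rule set_integrable_lebesgue_borel[OF _ meas_on intgQ]) auto
  have wg: "weak_gradient Q wu gw"
    unfolding weak_gradient_def
  proof (intro conjI allI impI ballI)
    fix K assume K: "compact K \<and> K \<subseteq> Q"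
    then have "K \<in> sets lebesgue" using borel_compact[of K] by auto
    then show "wu absolutely_integrable_on K" "gw absolutely_integrable_on K"
      using set_integrable_subset[OF si1, of K] set_integrable_subset[OF si2, of K] K by auto
  next
    fix \<psi> i assume \<psi>: "\<psi> \<in> test_functions Q"
    note b = test_function_bump[OF \<psi>]
    note [measurable] = bump_measurable[OF b] bump_measurable[OF bump_partial_deriv[OF b]]
    have "(\<integral>x. wu x * partial_deriv i \<psi> x \<partial>lebesgue_on Q) = (\<integral>x. indicator Q x *\<^sub>R (w x * partial_deriv i \<psi> x) \<partial>lborel)"
    proof (rule integral_lebesgue_on_borel)
      show "(\<lambda>x. wu x * partial_deriv i \<psi> x) \<in> borel_measurable (lebesgue_on Q)"
        by (intro borel_measurable_times wuQ meas_on) measurable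
      show "AE x in lborel. x \<in> Q \<longrightarrow> wu x * partial_deriv i \<psi> x = w x * partial_deriv i \<psi> x"
        using eqw by eventually_elim auto
    qed measurable
    also have "\<dots> = - (\<integral>x. indicator Q x *\<^sub>R (gw x $ i * \<psi> x) \<partial>lborel)" by (rule gw_grad[OF \<psi>])
    also have "(\<integral>x. indicator Q x *\<^sub>R (gw x $ i * \<psi> x) \<partial>lborel) = (\<integral>x. gw x $ i * \<psi> x \<partial>lebesgue_on Q)"
      by (rule integral_lebesgue_on_borel[symmetric]) (auto intro!: meas_on)
    finally show "(\<integral>x. wu x * partial_deriv i \<psi> x \<partial>lebesgue_on Q) = - (\<integral>x. gw x $ i * \<psi> x \<partial>lebesgue_on Q)" .
  qed
  \<comment> \<open>\<open>W11_0\<close> asks for convergence of Bochner integrals over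
    \<open>lebesgue_on Q\<close>, while the limits above are nonnegative integrals over
    \<open>lborel\<close>.\<close>
  have to_lim: "(\<lambda>k. \<integral>x. norm (h k x) \<partial>lebesgue_on Q) \<longlonglongrightarrow> 0"
    if hb: "\<And>k. hb k \<in> borel_measurable borel" and h: "\<And>k. h k \<in> borel_measurable (lebesgue_on Q)"
      and e: "\<And>k. AE x in lborel. x \<in> Q \<longrightarrow> h k x = hb k x"
      and l: "(\<lambda>k. \<integral>\<^sup>+y\<in>Q. ennreal (norm (hb k y)) \<partial>lborel) \<longlonglongrightarrow> 0"
    for h hb :: "nat \<Rightarrow> real^'n \<Rightarrow> 'z::{banach, second_countable_topology}"
  proof -
    note [measurable] = hb
    have "ennreal (\<integral>x. norm (h k x) \<partial>lebesgue_on Q) \<le> (\<integral>\<^sup>+y\<in>Q. ennreal (norm (hb k y)) \<partial>lborel)" for k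
    proof -
      have "(\<integral>x. norm (h k x) \<partial>lebesgue_on Q) = (\<integral>x. indicator Q x *\<^sub>R norm (hb k x) \<partial>lborel)"
      proof (rule integral_lebesgue_on_borel)
        show "(\<lambda>x. norm (h k x)) \<in> borel_measurable (lebesgue_on Q)" by (rule measurable_compose[OF h borel_measurable_norm])
        show "AE x in lborel. x \<in> Q \<longrightarrow> norm (h k x) = norm (hb k x)" using e[of k] by eventually_elim auto
      qed measurable
      also have "\<dots> = (\<integral>x. norm (indicator Q x *\<^sub>R hb k x) \<partial>lborel)"
        by (intro Bochner_Integration.integral_cong) (auto simp: indicator_def)
      also have "ennreal \<dots> \<le> (\<integral>\<^sup>+x. ennreal (norm (indicator Q x *\<^sub>R hb k x)) \<partial>lborel)"
      proof (cases "integrable lborel (\<lambda>x. indicator Q x *\<^sub>R hb k x)")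
        case True
        show ?thesis
          by (rule eq_refl, rule nn_integral_eq_integral[symmetric], rule integrable_norm[OF True], rule AE_I2, rule norm_ge_zero)
      next
        \<comment> \<open>The Bochner integral of a non-integrable function is \<open>0\<close> by
          convention, so the bound holds.\<close>
        case False
        then have "\<not> integrable lborel (\<lambda>x. norm (indicator Q x *\<^sub>R hb k x))"
          by (subst integrable_norm_iff) measurable
        then show ?thesis by (simp add: not_integrable_integral_eq)
      qed
      also have "\<dots> = (\<integral>\<^sup>+y\<in>Q. ennreal (norm (hb k y)) \<partial>lborel)"
        by (intro nn_integral_cong) (auto simp: indicator_def)
      finally show ?thesis .
    qed
    then have "(\<lambda>k. ennreal (\<integral>x. norm (h k x) \<partial>lebesgue_on Q)) \<longlonglongrightarrow> 0"
      using l by (intro tendsto_sandwich[OF _ _ tendsto_const l]) auto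
    then show ?thesis by (subst (asm) ennreal_tendsto_0_iff) auto
  qed
  have "wu \<in> W11_0 Q"
    unfolding W11_0_def mem_Collect_eq
  proof (intro conjI exI[of _ gw] exI[of _ \<Phi>] allI)
    show "(\<lambda>k. \<integral>x. \<bar>wu x - \<Phi> k x\<bar> \<partial>lebesgue_on Q) \<longlonglongrightarrow> 0"
    proof -
      have "(\<lambda>k. \<integral>x. norm (wu x - \<Phi> k x) \<partial>lebesgue_on Q) \<longlonglongrightarrow> 0"
      proof (rule to_lim)
        show "(\<lambda>x. w x - \<Phi> k x) \<in> borel_measurable borel" for k by measurable
        show "(\<lambda>x. wu x - \<Phi> k x) \<in> borel_measurable (lebesgue_on Q)" for k
          by (intro borel_measurable_diff wuQ meas_on) measurable
        show "AE x in lborel. x \<in> Q \<longrightarrow> wu x - \<Phi> k x = w x - \<Phi> k x" for k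
          using eqw by eventually_elim auto
        show "(\<lambda>k. \<integral>\<^sup>+y\<in>Q. ennreal (norm (w y - \<Phi> k y)) \<partial>lborel) \<longlonglongrightarrow> 0" using limw by simp
      qed
      then show ?thesis by simp
    qed
    have "(\<lambda>k. \<integral>x. norm (gw x - grad (\<Phi> k) x) \<partial>lebesgue_on Q) \<longlonglongrightarrow> 0"
    proof (rule to_lim)
      show "(\<lambda>x. gw x - grad (\<Phi> k) x) \<in> borel_measurable borel" for k by measurable
      then show "(\<lambda>x. gw x - grad (\<Phi> k) x) \<in> borel_measurable (lebesgue_on Q)" for k by (rule meas_on)
    qed (use limg in auto)
    then show "(\<lambda>k. \<integral>x. norm (gw x - (\<chi> i. partial_deriv i (\<Phi> k) x)) \<partial>lebesgue_on Q) \<longlonglongrightarrow> 0"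
      by (simp add: grad_def)
  qed (use si1 si2 wg tf in auto)
  moreover have "compactly_inside Q \<Omega>"
    unfolding compactly_inside_def Q_def using cl compact_closure_cube by blast
  ultimately have "AE x in lebesgue_on Q. m \<le> u x \<and> u x \<le> M"
    using wm \<open>m \<le> M\<close> oQ unfolding weakly_monotone_def wu_def by blast
  then have "AE x in lebesgue. x \<in> Q \<longrightarrow> m \<le> u x \<and> u x \<le> M"
    by (subst (asm) AE_restrict_space_iff) auto
  then have "AE x in lborel. x \<in> Q \<longrightarrow> m \<le> u x \<and> u x \<le> M"
    by (simp add: AE_completion_iff)
  with eq show ?thesis
    by eventually_elim (auto simp: Q_def m_def M_def)
qed

section \<open>Oscillation on almost every cube\<close>

text \<open>Setting the representative to \<open>0\<close> off \<open>K\<close> makes it integrable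
  over the whole space, so that it can be convolved.\<close>

lemma borel_representative_real:
  fixes f :: "real^'n \<Rightarrow> real"
  assumes f: "f absolutely_integrable_on K" and K: "K \<in> sets borel"
  obtains fb where "integrable lborel fb" "AE x in lborel. x \<in> K \<longrightarrow> f x = fb x" "\<And>x. x \<notin> K \<Longrightarrow> fb x = 0"
proof -
  note [measurable] = K
  have int: "integrable lebesgue (\<lambda>x. indicator K x *\<^sub>R f x)"
    using f by (simp add: set_integrable_def)
  then have "(\<lambda>x. indicator K x *\<^sub>R f x) \<in> borel_measurable lebesgue" by (rule borel_measurable_integrable)
  from completion_ex_borel_measurable_real[OF this] obtain f0 where
    f0: "f0 \<in> borel_measurable lborel" and ae: "AE x in lborel. indicator K x *\<^sub>R f x = f0 x" by blast
  have "integrable lebesgue f0"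
    by (rule integrable_cong_AE_imp[OF int measurable_completion[OF f0]]) (use AE_completion[OF ae] in \<open>eventually_elim, simp\<close>)
  then have i0: "integrable lborel f0" using f0 by (subst (asm) integrable_completion)
  show thesis
  proof (rule that)
    show "integrable lborel (\<lambda>x. indicator K x *\<^sub>R f0 x)"
      by (rule integrable_mult_indicator[OF _ i0]) simp
    show "AE x in lborel. x \<in> K \<longrightarrow> f x = indicator K x *\<^sub>R f0 x"
      using ae by eventually_elim (auto simp: indicator_def)
  qed simp
qed

lemma borel_representative_vec:
  fixes f :: "real^'n \<Rightarrow> real^'m"
  assumes f: "f absolutely_integrable_on K" and K: "K \<in> sets borel"
  obtains fb where "integrable lborel fb" "AE x in lborel. x \<in> K \<longrightarrow> f x = fb x" "\<And>x. x \<notin> K \<Longrightarrow> fb x = 0"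
proof -
  define P where "P i h \<longleftrightarrow> integrable lborel h \<and> (AE x in lborel. x \<in> K \<longrightarrow> f x $ i = h x) \<and> (\<forall>x. x \<notin> K \<longrightarrow> h x = 0)" for i h
  have ex: "\<exists>h. P i h" for i
  proof -
    have "integrable lebesgue (\<lambda>x. (indicator K x *\<^sub>R f x) $ i)"
      using f unfolding set_integrable_def by (rule integrable_bounded_linear[OF bounded_linear_vec_nth])
    then have "(\<lambda>x. f x $ i) absolutely_integrable_on K" by (simp add: set_integrable_def)
    then obtain h where "integrable lborel h" "AE x in lborel. x \<in> K \<longrightarrow> f x $ i = h x" "\<And>x. x \<notin> K \<Longrightarrow> h x = 0"
      by (rule borel_representative_real[OF _ K]) blast
    then have "P i h" by (simp add: P_def)
    then show ?thesis by blast
  qed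
  define h where "h i = (SOME h. P i h)" for i
  have "P i (h i)" for i unfolding h_def by (rule someI_ex[OF ex])
  then have h: "integrable lborel (h i)" "AE x in lborel. x \<in> K \<longrightarrow> f x $ i = h i x" "x \<notin> K \<Longrightarrow> h i x = 0" for i x
    by (auto simp: P_def)
  have comp: "(\<Sum>i\<in>UNIV. h i x *\<^sub>R axis i 1) $ j = h j x" for x j
    by (simp add: axis_def if_distrib[of "\<lambda>c. _ * c"] cong: if_cong)
  show thesis
  proof (rule that)
    show "integrable lborel (\<lambda>x. \<Sum>i\<in>UNIV. h i x *\<^sub>R axis i (1::real))"
      by (intro Bochner_Integration.integrable_sum integrable_scaleR_left h)
    have "AE x in lborel. \<forall>i\<in>UNIV. x \<in> K \<longrightarrow> f x $ i = h i x"
      using h(2) by (intro AE_finite_allI) auto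
    then show "AE x in lborel. x \<in> K \<longrightarrow> f x = (\<Sum>i\<in>UNIV. h i x *\<^sub>R axis i 1)"
      by eventually_elim (simp add: vec_eq_iff comp del: sum_component)
    show "(\<Sum>i\<in>UNIV. h i x *\<^sub>R axis i 1) = 0" if "x \<notin> K" for x using h(3)[OF that] by simp
  qed
qed

text \<open>The distribution of \<open>h\<close> restricted to a ball is a finite measure and has at
  most countably many atoms; countably many balls exhaust the space.\<close>

lemma countable_positive_levels:
  fixes h :: "real^'n \<Rightarrow> real"
  assumes [measurable]: "h \<in> borel_measurable borel"
  shows "countable {t. \<not> (AE x in lborel. h x \<noteq> t)}"
proof -
  define M where "M N = restrict_space lborel (cball (0::real^'n) (real N))" for N :: nat
  define D where "D N = distr (M N) borel h" for N
  have hm: "h \<in> M N \<rightarrow>\<^sub>M borel" for N unfolding M_def by (rule measurable_restrict_space1) measurable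
  have fin: "finite_measure (D N)" for N
  proof
    have "emeasure (D N) (space (D N)) = emeasure lborel (cball (0::real^'n) (real N))"
      using hm by (simp add: D_def emeasure_distr M_def space_restrict_space emeasure_restrict_space)
    then show "emeasure (D N) (space (D N)) \<noteq> \<infinity>"
      using emeasure_bounded_finite[OF bounded_cball[of "0::real^'n" "real N"]] by simp
  qed
  have "{t. \<not> (AE x in lborel. h x \<noteq> t)} \<subseteq> (\<Union>N. {t. measure (D N) {t} \<noteq> 0})"
  proof
    fix t assume "t \<in> {t. \<not> (AE x in lborel. h x \<noteq> t)}"
    then have nae: "\<not> (AE x in lborel. h x \<noteq> t)" by simp
    show "t \<in> (\<Union>N. {t. measure (D N) {t} \<noteq> 0})"
    proof (rule ccontr)
      assume "t \<notin> (\<Union>N. {t. measure (D N) {t} \<noteq> 0})"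
      then have z: "measure (D N) {t} = 0" for N by auto
      have "AE x in lborel. \<forall>N. x \<in> cball 0 (real N) \<longrightarrow> h x \<noteq> t"
        unfolding AE_all_countable
      proof
        fix N
        interpret finite_measure "D N" by (rule fin)
        have "emeasure (D N) {t} = 0" using z[of N] by (simp add: emeasure_eq_measure)
        then have "emeasure lborel {x \<in> cball 0 (real N). h x = t} = 0"
        proof -
          have "h -` {t} \<inter> space (M N) = {x \<in> cball 0 (real N). h x = t}"
            by (auto simp: M_def space_restrict_space)
          then have "emeasure (M N) {x \<in> cball 0 (real N). h x = t} = 0"
            using \<open>emeasure (D N) {t} = 0\<close> hm by (simp add: D_def emeasure_distr)
          moreover have "emeasure (M N) {x \<in> cball 0 (real N). h x = t} = emeasure lborel {x \<in> cball 0 (real N). h x = t}"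
            unfolding M_def by (rule emeasure_restrict_space) auto
          ultimately show ?thesis by simp
        qed
        then have "{x \<in> cball (0::real^'n) (real N). h x = t} \<in> null_sets lborel"
          by (intro null_setsI) measurable
        then show "AE x in lborel. x \<in> cball 0 (real N) \<longrightarrow> h x \<noteq> t" by (rule AE_I') auto
      qed
      then have "AE x in lborel. h x \<noteq> t"
      proof eventually_elim
        case (elim x)
        obtain N where "norm x \<le> real N" using real_arch_simple by blast
        then show ?case using elim by auto
      qed
      with nae show False by simp
    qed
  qed
  moreover have "countable (\<Union>N. {t. measure (D N) {t} \<noteq> 0})"
    using finite_measure.countable_support[OF fin] by (intro countable_UN) auto
  ultimately show ?thesis by (rule countable_subset)
qed

text \<open>An interval is uncountable, so \<open>\<delta>\<close> can avoid the countably many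
  exceptional values for both levels at once.\<close>

lemma generic_level:
  fixes h :: "real^'n \<Rightarrow> real"
  assumes "h \<in> borel_measurable borel" "e > 0"
  obtains \<delta> where "0 < \<delta>" "\<delta> < e" "AE x in lborel. h x \<noteq> a + \<delta>" "AE x in lborel. h x \<noteq> b - \<delta>"
proof -
  let ?B = "{t. \<not> (AE x in lborel. h x \<noteq> t)}"
  have "countable ((\<lambda>t. t - a) ` ?B \<union> (\<lambda>t. b - t) ` ?B)"
    using countable_positive_levels[OF assms(1)] by auto
  moreover have "uncountable {0<..<e}" using assms(2) by (simp add: uncountable_open_interval)
  ultimately have "{0<..<e} - ((\<lambda>t. t - a) ` ?B \<union> (\<lambda>t. b - t) ` ?B) \<noteq> {}"
    by (metis uncountable_minus_countable countable_empty)
  then obtain \<delta> where "\<delta> \<in> {0<..<e} - ((\<lambda>t. t - a) ` ?B \<union> (\<lambda>t. b - t) ` ?B)" by blast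
  then have \<delta>: "0 < \<delta>" "\<delta> < e" "\<delta> \<notin> (\<lambda>t. t - a) ` ?B" "\<delta> \<notin> (\<lambda>t. b - t) ` ?B" by simp_all
  have "a + \<delta> \<notin> ?B"
  proof
    assume "a + \<delta> \<in> ?B" then have "(a + \<delta>) - a \<in> (\<lambda>t. t - a) ` ?B" by (rule imageI)
    then show False using \<delta> by simp
  qed
  moreover have "b - \<delta> \<notin> ?B"
  proof
    assume "b - \<delta> \<in> ?B" then have "b - (b - \<delta>) \<in> (\<lambda>t. b - t) ` ?B" by (rule imageI)
    then show False using \<delta> by simp
  qed
  ultimately show thesis using that \<delta> by auto
qed

lemma mollifier_mono: "mollifier r \<phi> \<Longrightarrow> r \<le> r' \<Longrightarrow> mollifier r' \<phi>"
  unfolding mollifier_def by auto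

text \<open>A kernel of sufficiently small radius gives L1 errors of at most
  \<open>1 / Suc k\<close> for \<open>ub\<close> and \<open>gb\<close> together. Almost everywhere
  convergence is reached along a subsequence, which keeps the other limits.\<close>

lemma mollifying_sequence:
  fixes ub :: "real^'n \<Rightarrow> real" and gb :: "real^'n \<Rightarrow> real^'n"
  assumes ub: "integrable lborel ub" and gb: "integrable lborel gb" and "R > 0"
  obtains \<phi> where "\<And>k::nat. mollifier R (\<phi> k)" "AE x in lborel. (\<lambda>k. conv (\<phi> k) ub x) \<longlonglongrightarrow> ub x"
    "(\<lambda>k. \<integral>\<^sup>+x. ennreal \<bar>conv (\<phi> k) ub x - ub x\<bar> \<partial>lborel) \<longlonglongrightarrow> 0"
    "(\<lambda>k. \<integral>\<^sup>+x. ennreal (norm (conv (\<phi> k) gb x - gb x)) \<partial>lborel) \<longlonglongrightarrow> 0"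
proof -
  define P where "P k \<psi> \<longleftrightarrow> mollifier R \<psi> \<and> (\<integral>\<^sup>+x. ennreal \<bar>conv \<psi> ub x - ub x\<bar> \<partial>lborel) \<le> ennreal (1 / real (Suc k)) \<and>
     (\<integral>\<^sup>+x. ennreal (norm (conv \<psi> gb x - gb x)) \<partial>lborel) \<le> ennreal (1 / real (Suc k))" for k \<psi>
  have ex: "\<exists>\<psi>. P k \<psi>" for k
  proof -
    obtain d1 where d1: "d1 > 0" "\<And>\<phi>. mollifier d1 \<phi> \<Longrightarrow> (\<integral>\<^sup>+x. norm (conv \<phi> ub x - ub x) \<partial>lborel) \<le> ennreal (1 / real (Suc k))"
      using conv_L1_close[OF ub, of "1 / real (Suc k)"] by auto
    obtain d2 where d2: "d2 > 0" "\<And>\<phi>. mollifier d2 \<phi> \<Longrightarrow> (\<integral>\<^sup>+x. norm (conv \<phi> gb x - gb x) \<partial>lborel) \<le> ennreal (1 / real (Suc k))"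
      using conv_L1_close[OF gb, of "1 / real (Suc k)"] by auto
    obtain \<psi> :: "real^'n \<Rightarrow> real" where \<psi>: "mollifier (min R (min d1 d2)) \<psi>"
      using mollifier_exists[of "min R (min d1 d2)"] d1(1) d2(1) \<open>R > 0\<close> by auto
    have "mollifier R \<psi>" "mollifier d1 \<psi>" "mollifier d2 \<psi>"
      using \<psi> by (auto intro: mollifier_mono)
    then have "P k \<psi>" using d1(2)[of \<psi>] d2(2)[of \<psi>] by (simp add: P_def)
    then show ?thesis by blast
  qed
  define \<psi> where "\<psi> k = (SOME \<psi>. P k \<psi>)" for k
  have "P k (\<psi> k)" for k unfolding \<psi>_def by (rule someI_ex[OF ex])
  then have \<psi>: "mollifier R (\<psi> k)"
    "(\<integral>\<^sup>+x. ennreal \<bar>conv (\<psi> k) ub x - ub x\<bar> \<partial>lborel) \<le> ennreal (1 / real (Suc k))"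
    "(\<integral>\<^sup>+x. ennreal (norm (conv (\<psi> k) gb x - gb x)) \<partial>lborel) \<le> ennreal (1 / real (Suc k))" for k
    by (auto simp: P_def)
  have z: "(\<lambda>k. ennreal (1 / real (Suc k))) \<longlonglongrightarrow> 0"
    using tendsto_ennrealI[OF LIMSEQ_Suc[OF lim_1_over_n]] by simp
  have l1: "(\<lambda>k. \<integral>\<^sup>+x. ennreal \<bar>conv (\<psi> k) ub x - ub x\<bar> \<partial>lborel) \<longlonglongrightarrow> 0"
    by (rule tendsto_sandwich[OF _ _ tendsto_const z]) (use \<psi>(2) in auto)
  have l2: "(\<lambda>k. \<integral>\<^sup>+x. ennreal (norm (conv (\<psi> k) gb x - gb x)) \<partial>lborel) \<longlonglongrightarrow> 0"
    by (rule tendsto_sandwich[OF _ _ tendsto_const z]) (use \<psi>(3) in auto)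
  have [measurable]: "ub \<in> borel_measurable borel" using ub by auto
  have [measurable]: "conv (\<psi> k) ub \<in> borel_measurable borel" for k
    by (intro borel_measurable_continuous_onI smooth_continuous smooth_conv mollifier_bump[OF \<psi>(1)] ub)
  have int: "integrable lborel (\<lambda>x. conv (\<psi> k) ub x - ub x)" for k
  proof (rule integrableI_bounded)
    show "(\<integral>\<^sup>+x. ennreal (norm (conv (\<psi> k) ub x - ub x)) \<partial>lborel) < \<infinity>"
      using \<psi>(2)[of k] by (simp add: le_less_trans[OF _ ennreal_less_top])
  qed measurable
  have "(\<lambda>k. ennreal (\<integral>x. norm (conv (\<psi> k) ub x - ub x) \<partial>lborel)) \<longlonglongrightarrow> 0"
  proof -
    have "ennreal (\<integral>x. norm (conv (\<psi> k) ub x - ub x) \<partial>lborel) = (\<integral>\<^sup>+x. ennreal \<bar>conv (\<psi> k) ub x - ub x\<bar> \<partial>lborel)" for k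
      using nn_integral_eq_integral[OF integrable_norm[OF int[of k]]] by simp
    then show ?thesis using l1 by simp
  qed
  then have "(\<lambda>k. \<integral>x. norm (conv (\<psi> k) ub x - ub x) \<partial>lborel) \<longlonglongrightarrow> 0"
    by (subst (asm) ennreal_tendsto_0_iff) auto
  from tendsto_L1_AE_subseq[OF int this] obtain r :: "nat \<Rightarrow> nat" where
    r: "strict_mono r" "AE x in lborel. (\<lambda>k. conv (\<psi> (r k)) ub x - ub x) \<longlonglongrightarrow> 0" by blast
  show thesis
  proof (rule that[of "\<lambda>k. \<psi> (r k)"])
    show "AE x in lborel. (\<lambda>k. conv (\<psi> (r k)) ub x) \<longlonglongrightarrow> ub x"
      using r(2) by eventually_elim (simp add: LIM_zero_iff)
    show "(\<lambda>k. \<integral>\<^sup>+x. ennreal \<bar>conv (\<psi> (r k)) ub x - ub x\<bar> \<partial>lborel) \<longlonglongrightarrow> 0"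
      using LIMSEQ_subseq_LIMSEQ[OF l1 r(1)] by (simp add: o_def)
    show "(\<lambda>k. \<integral>\<^sup>+x. ennreal (norm (conv (\<psi> (r k)) gb x - gb x)) \<partial>lborel) \<longlonglongrightarrow> 0"
      using LIMSEQ_subseq_LIMSEQ[OF l2 r(1)] by (simp add: o_def)
  qed (rule \<psi>(1))
qed

text \<open>If \<open>sub_kernel\<close> were infinite at all \<open>T > 0\<close>, its conjugate
  and hence \<open>A_sub\<close> would vanish at positive arguments, against the divergence. One
  finite value is what turns the boundary estimates into numerical bounds.\<close>

lemma (in admissible_young) sub_kernel_finite: "\<exists>T>0. sub_kernel n A T < \<infinity>"
proof (rule ccontr)
  assume "\<not> ?thesis"
  then have inf: "sub_kernel n A T = \<infinity>" if "T > 0" for T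
    using that by (metis infinity_ennreal_def top.not_eq_extremum)
  have "A_sub n A t = 0" if "t > 0" for t
  proof -
    have "young_conjugate (sub_kernel n A) (2 * t) \<le> 0"
      unfolding conjugate_le_iff
    proof (intro allI impI)
      fix s :: real assume "s \<ge> 0"
      then show "ennreal (s * (2 * t)) \<le> sub_kernel n A s + 0" using inf[of s] by (cases "s = 0") auto
    qed
    then show ?thesis using A_sub_le_conjugate[OF young, of "2 * t" n] that by simp
  qed
  then have "(\<integral>\<^sup>+t\<in>{1<..}. A_sub n A t / ennreal (t ^ (n + 1)) \<partial>lborel) = (\<integral>\<^sup>+t. 0 \<partial>(lborel :: real measure))"
    by (intro nn_integral_cong) (auto simp: indicator_def)
  then show False using infinite by (simp add: infinite_at_infinity_def)
qed

text \<open>Dividing the hypothesis by \<open>8 * n * lam * 2 ^ n * (2 * s) ^ (n - 1)\<close> bounds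
  \<open>T * a\<close> by \<open>sub_kernel n A T\<close> plus a constant for all \<open>T\<close>,
  which bounds the conjugate of \<open>sub_kernel\<close> at \<open>a\<close>. The quotient of the
  powers of \<open>2 * s\<close> turns \<open>8\<close> into \<open>16\<close>, and the halved
  argument in \<open>A_sub_le_conjugate\<close> turns \<open>16\<close> into
  \<open>32\<close>.\<close>

lemma (in admissible_young) A_sub_bound:
  assumes D: "D \<ge> 0" and s: "s > 0" and lam: "lam > 0"
    and le: "\<And>T. T > 0 \<Longrightarrow> ennreal (T * (2 * s) ^ (n - 2) * D)
      \<le> ennreal (8 * real n * lam) * (\<beta> + ennreal (2 ^ n * (2 * s) ^ (n - 1)) * sub_kernel n A T)"
  shows "A_sub n A (D / (32 * real n * lam * 2 ^ n * s)) * ennreal (s ^ (n - 1)) \<le> \<beta>"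
proof (cases "D = 0")
  case True
  have "A_sub n A 0 = 0"
    using n2 young_zero[OF young] by (cases "n = 2") (auto simp: A_sub_2 A_sub_eq_conjugate conjugate_zero)
  then show ?thesis using True by simp
next
  case False
  define e where "e = 2 ^ n * (2 * s) ^ (n - 1)"
  have e: "e > 0" using s by (simp add: e_def)
  define q where "q = 8 * real n * lam"
  have q: "q > 0" using n2 lam by (simp add: q_def)
  define a where "a = D / (16 * real n * lam * 2 ^ n * s)"
  have a: "a > 0" using False D s lam n2 by (simp add: a_def)
  have "young_conjugate (sub_kernel n A) a \<le> ennreal (1 / e) * \<beta>"
    unfolding conjugate_le_iff
  proof (intro allI impI)
    fix T :: real assume "T \<ge> 0"
    show "ennreal (T * a) \<le> sub_kernel n A T + ennreal (1 / e) * \<beta>"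
    proof (cases "T = 0")
      case False
      then have T: "T > 0" using \<open>T \<ge> 0\<close> by simp
      have "2 * s * (2 * s) ^ (n - 2) = (2 * s) ^ (n - 1)"
        using n2 by (metis One_nat_def Suc_1 Suc_diff_le diff_Suc_Suc power_Suc)
      then have "T * a = (1 / (q * e)) * (T * (2 * s) ^ (n - 2) * D)"
        using s lam n2 by (simp add: a_def q_def e_def field_simps)
      then have "ennreal (T * a) = ennreal (1 / (q * e)) * ennreal (T * (2 * s) ^ (n - 2) * D)"
        using q e T s D by (simp only: ennreal_mult divide_nonneg_nonneg mult_nonneg_nonneg zero_le_one less_imp_le zero_le_power zero_le_mult_iff)
          (auto simp: ennreal_mult[symmetric])
      also have "\<dots> \<le> ennreal (1 / (q * e)) * (ennreal q * (\<beta> + ennreal e * sub_kernel n A T))"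
        using le[OF T] by (intro mult_left_mono) (auto simp: q_def e_def)
      also have "\<dots> = (ennreal (1 / (q * e)) * ennreal q) * \<beta> + (ennreal (1 / (q * e)) * ennreal q * ennreal e) * sub_kernel n A T"
        by (simp add: distrib_left mult.assoc)
      also have "ennreal (1 / (q * e)) * ennreal q = ennreal (1 / e)"
        using q e by (subst ennreal_mult[symmetric]) auto
      also have "ennreal (1 / e) * ennreal e = 1"
        using e by (subst ennreal_mult[symmetric]) auto
      finally show ?thesis by (simp add: add.commute)
    qed simp
  qed
  then have "A_sub n A (a / 2) \<le> ennreal (1 / e) * \<beta>"
    using A_sub_le_conjugate[OF young a, of n] by (rule order_trans[rotated])
  then have "A_sub n A (a / 2) * ennreal (s ^ (n - 1)) \<le> ennreal (1 / e) * \<beta> * ennreal (s ^ (n - 1))"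
    by (rule mult_right_mono) simp
  also have "\<dots> = ennreal (s ^ (n - 1) / e) * \<beta>"
    using e s by (simp add: mult_ac flip: ennreal_mult)
  also have "\<dots> \<le> 1 * \<beta>"
  proof (rule mult_right_mono)
    have "s ^ (n - 1) \<le> (2 * s) ^ (n - 1)" using s by (intro power_mono) auto
    also have "\<dots> \<le> e" using s by (simp add: e_def)
    finally show "ennreal (s ^ (n - 1) / e) \<le> 1" using e s by (simp add: ennreal_le_1)
  qed simp
  finally show ?thesis by (simp add: a_def mult.assoc)
qed

section \<open>Mollifications near a point\<close>

lemma frontier_cube_iff:
  fixes x :: "real^'n"
  assumes "s > 0"
  shows "y \<in> frontier (cube x s) \<longleftrightarrow> (\<forall>j. \<bar>y $ j - x $ j\<bar> \<le> s) \<and> (\<exists>i. \<bar>y $ i - x $ i\<bar> = s)"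
proof -
  have ne: "x \<in> cube x s" using assms by (simp add: cube_def)
  then have "frontier (cube x s) = cbox (\<chi> j. x $ j - s) (\<chi> j. x $ j + s) - cube x s"
    by (subst (1) cube_box, subst frontier_box) (auto simp: cube_box)
  moreover have "y \<in> cbox (\<chi> j. x $ j - s) (\<chi> j. x $ j + s) \<longleftrightarrow> (\<forall>j. \<bar>y $ j - x $ j\<bar> \<le> s)"
    by (auto simp: mem_box_cart abs_le_iff algebra_simps)
  ultimately show ?thesis
    by (simp add: cube_def not_less) (metis order_antisym order_refl)
qed

lemma partial_deriv_cmult:
  "smooth f \<Longrightarrow> partial_deriv i (\<lambda>x. c * f x) x = c * partial_deriv i f x"
  using partial_deriv_mult[OF smooth_differentiable[OF smooth_const[of c]] smooth_differentiable] by auto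

text \<open>Data around \<open>x1\<close>: \<open>ub\<close> and \<open>gb\<close> are to be Borel
  versions of \<open>u\<close> and its weak gradient, cut off away from \<open>x1\<close>, and
  \<open>lam\<close> is a scale at which the gradient has a finite integral under \<open>A\<close>.
  Assumption \<open>wg\<close> says that the gradient of a mollification is the mollified gradient;
  it is confined to the cube of half edge \<open>2 * R\<close>, where a kernel of radius
  \<open>R\<close> does not see the cut-off.\<close>

locale local_setting =
  fixes A :: "real \<Rightarrow> ennreal" and \<Omega> :: "(real^'n) set" and u ub :: "real^'n \<Rightarrow> real"
    and gb :: "real^'n \<Rightarrow> real^'n" and x1 :: "real^'n" and R lam :: real
  assumes adm: "admissible_young CARD('n) A"
    and R: "R > 0" and lam: "lam > 0"
    and ub: "integrable lborel ub" and gb: "integrable lborel gb"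
    and HA: "(\<integral>\<^sup>+y. A (norm (gb y) / lam) \<partial>lborel) < \<infinity>"
    and wg: "\<And>\<phi> x i. mollifier R \<phi> \<Longrightarrow> x \<in> cube x1 (2 * R) \<Longrightarrow> conv (partial_deriv i \<phi>) ub x = conv \<phi> gb x $ i"
    and ueq: "AE x in lborel. x \<in> cube x1 (2 * R) \<longrightarrow> u x = ub x"
    and wm: "weakly_monotone \<Omega> u" and um: "u \<in> borel_measurable (lebesgue_on \<Omega>)"
    and cl: "closure (cube x1 (2 * R)) \<subseteq> \<Omega>"
begin

lemma n2: "CARD('n) \<ge> 2" and young: "young_function A"
  using adm by (auto simp: admissible_young_def)

definition H0 :: "real^'n \<Rightarrow> ennreal" where "H0 y = A (norm (gb y) / lam)"
definition W0 :: "real^'n \<Rightarrow> ennreal" where "W0 y = ennreal (norm (ub y / lam))"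
text \<open>The first summand enters Young's inequality for the gradient, the second dominates the
  values of the mollification, so one boundary integral of \<open>Hf \<phi>\<close> controls both
  oscillation and size.\<close>

definition Hf :: "(real^'n \<Rightarrow> real) \<Rightarrow> real^'n \<Rightarrow> ennreal" where "Hf \<phi> y = conv_nn \<phi> H0 y + conv_nn \<phi> W0 y"

lemma ub_measurable [measurable]: "ub \<in> borel_measurable borel" and gb_measurable [measurable]: "gb \<in> borel_measurable borel"
  using ub gb by auto

lemma H0_measurable [measurable]: "H0 \<in> borel_measurable borel"
proof -
  have "(\<lambda>y. A \<bar>norm (gb y) / lam\<bar>) \<in> borel_measurable borel"
    by (rule measurable_compose[OF _ young_measurable[OF young]]) measurable
  moreover have "(\<lambda>y. A \<bar>norm (gb y) / lam\<bar>) = H0"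
    using lam by (simp add: H0_def fun_eq_iff)
  ultimately show ?thesis by simp
qed

lemma W0_measurable [measurable]: "W0 \<in> borel_measurable borel"
  unfolding W0_def[abs_def] by measurable

lemma Hf_measurable [measurable]: "mollifier R \<phi> \<Longrightarrow> Hf \<phi> \<in> borel_measurable borel"
  unfolding Hf_def[abs_def] using bump_measurable[OF mollifier_bump] by measurable

lemma grad_conv:
  assumes "mollifier R \<phi>" "x \<in> cube x1 (2 * R)" shows "grad (conv \<phi> ub) x = conv \<phi> gb x"
  using wg[OF assms] partial_deriv_conv[OF mollifier_bump[OF assms(1)] ub]
  by (simp add: grad_def vec_eq_iff)

text \<open>Young's inequality is applied to \<open>gb y\<close> for each \<open>y\<close> and then
  averaged with the kernel, whose mass \<open>1\<close> leaves the conjugate unchanged. This takes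
  the place of Jensen's inequality for \<open>A\<close>.\<close>

lemma young_conv:
  assumes \<phi>: "mollifier R \<phi>" and b: "b \<ge> 0"
  shows "ennreal (norm (conv \<phi> gb z) / lam * b) \<le> conv_nn \<phi> H0 z + young_conjugate A b"
proof -
  have [measurable]: "\<phi> \<in> borel_measurable borel" by (rule bump_measurable[OF mollifier_bump[OF \<phi>]])
  have p: "\<phi> y \<ge> 0" for y using \<phi> by (simp add: mollifier_def)
  have one: "(\<integral>\<^sup>+y. ennreal (\<phi> (z - y)) \<partial>lborel) = 1"
    using nn_integral_reflect[of "\<lambda>y. ennreal (\<phi> y)" z] mollifier_nn_integral[OF \<phi>] by simp
  have "ennreal (norm (conv \<phi> gb z) / lam * b) = ennreal (b / lam) * ennreal (norm (conv \<phi> gb z))"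
    using b lam by (simp add: mult.commute flip: ennreal_mult)
  also have "\<dots> \<le> ennreal (b / lam) * conv_nn \<phi> (\<lambda>y. ennreal (norm (gb y))) z"
    by (intro mult_left_mono norm_conv_le[OF \<phi> gb]) simp
  also have "\<dots> = (\<integral>\<^sup>+y. ennreal (b / lam) * (ennreal (\<phi> (z - y)) * ennreal (norm (gb y))) \<partial>lborel)"
    unfolding conv_nn_def by (rule nn_integral_cmult[symmetric]) measurable
  also have "\<dots> \<le> (\<integral>\<^sup>+y. ennreal (\<phi> (z - y)) * H0 y + ennreal (\<phi> (z - y)) * young_conjugate A b \<partial>lborel)"
  proof (rule nn_integral_mono)
    fix y
    have "ennreal (b / lam) * (ennreal (\<phi> (z - y)) * ennreal (norm (gb y))) = ennreal (\<phi> (z - y)) * ennreal (norm (gb y) / lam * b)"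
      using b lam p by (simp add: mult_ac flip: ennreal_mult)
    also have "\<dots> \<le> ennreal (\<phi> (z - y)) * (H0 y + young_conjugate A b)"
      unfolding H0_def using lam by (intro mult_left_mono young_inequality) auto
    finally show "ennreal (b / lam) * (ennreal (\<phi> (z - y)) * ennreal (norm (gb y))) \<le> ennreal (\<phi> (z - y)) * H0 y + ennreal (\<phi> (z - y)) * young_conjugate A b"
      by (simp add: distrib_left)
  qed
  also have "\<dots> = conv_nn \<phi> H0 z + (\<integral>\<^sup>+y. ennreal (\<phi> (z - y)) \<partial>lborel) * young_conjugate A b"
    by (subst nn_integral_add) (auto simp: nn_integral_multc conv_nn_def)
  finally show ?thesis by (simp add: one)
qed

lemma closed_cube_subset:
  assumes "x0 \<in> cube x1 R" "s < R" "\<forall>j. \<bar>z $ j - x0 $ j\<bar> \<le> s"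
  shows "z \<in> cube x1 (2 * R)"
proof -
  have "\<bar>z $ j - x1 $ j\<bar> < 2 * R" for j
  proof -
    have "\<bar>x0 $ j - x1 $ j\<bar> < R" using assms(1) by (simp add: cube_def)
    moreover have "\<bar>z $ j - x0 $ j\<bar> \<le> s" using assms(3) by blast
    ultimately show ?thesis using assms(2) by linarith
  qed
  then show ?thesis by (simp add: cube_def)
qed

lemma boundary_setting_conv:
  assumes \<phi>: "mollifier R \<phi>" and x0: "x0 \<in> cube x1 R" and s: "0 < s" "s < R" and T: "T > 0"
  shows "boundary_setting (\<lambda>y. 1 / lam * conv \<phi> ub y) x0 s T (Hf \<phi>) A"
proof
  have sm: "smooth (conv \<phi> ub)" by (rule smooth_conv[OF mollifier_bump[OF \<phi>] ub])
  then show "smooth (\<lambda>y. 1 / lam * conv \<phi> ub y)" by (intro smooth_mult smooth_const)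
  fix z b
  assume z: "\<forall>j. \<bar>z $ j - x0 $ j\<bar> \<le> s" and b: "b \<ge> (0::real)"
  have "grad (\<lambda>y. 1 / lam * conv \<phi> ub y) z = (1 / lam) *\<^sub>R conv \<phi> gb z"
    using grad_conv[OF \<phi> closed_cube_subset[OF x0 s(2) z]]
    by (simp add: grad_def vec_eq_iff partial_deriv_cmult[OF sm] del: times_divide_eq_left)
  then have "ennreal (norm (grad (\<lambda>y. 1 / lam * conv \<phi> ub y) z) * b) = ennreal (norm (conv \<phi> gb z) / lam * b)"
    using lam by simp
  also have "\<dots> \<le> conv_nn \<phi> H0 z + young_conjugate A b" by (rule young_conv[OF \<phi> b])
  also have "\<dots> \<le> Hf \<phi> z + young_conjugate A b" by (simp add: Hf_def add_right_mono)
  finally show "ennreal (norm (grad (\<lambda>y. 1 / lam * conv \<phi> ub y) z) * b) \<le> Hf \<phi> z + young_conjugate A b" .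
qed (use s T n2 Hf_measurable[OF \<phi>] in auto)

lemma value_le_Hf:
  assumes \<phi>: "mollifier R \<phi>" shows "ennreal \<bar>1 / lam * conv \<phi> ub z\<bar> \<le> Hf \<phi> z"
proof -
  have "1 / lam * conv \<phi> ub z = conv \<phi> (\<lambda>y. ub y / lam) z"
    by (simp add: conv_def flip: integral_divide_zero)
  moreover have "ennreal (norm (conv \<phi> (\<lambda>y. ub y / lam) z)) \<le> conv_nn \<phi> W0 z"
    unfolding W0_def[abs_def] using ub by (intro norm_conv_le[OF \<phi>]) simp
  ultimately have "ennreal \<bar>1 / lam * conv \<phi> ub z\<bar> \<le> conv_nn \<phi> W0 z" by simp
  then show ?thesis by (simp add: Hf_def add_increasing)
qed

text \<open>Along a subsequence that realises the lower limit the boundary integrals are bounded,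
  hence so are the vertex values and the oscillations of the mollifications on the frontier. A
  further subsequence makes both converge, and \<open>weakly_monotone_truncation\<close> transfers
  the limit bounds to \<open>ub\<close> in the cube. Both subsequences depend on \<open>s\<close>,
  which is why \<open>\<beta>\<close> is a lower limit.\<close>

lemma good_radius:
  assumes \<phi>: "\<And>k::nat. mollifier R (\<phi> k)" and ae: "AE x in lborel. (\<lambda>k. conv (\<phi> k) ub x) \<longlonglongrightarrow> ub x"
    and L1: "(\<lambda>k. \<integral>\<^sup>+x. ennreal \<bar>conv (\<phi> k) ub x - ub x\<bar> \<partial>lborel) \<longlonglongrightarrow> 0"
    and L1g: "(\<lambda>k. \<integral>\<^sup>+x. ennreal (norm (conv (\<phi> k) gb x - gb x)) \<partial>lborel) \<longlonglongrightarrow> 0"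
    and x0: "x0 \<in> cube x1 R" and s: "0 < s" "s < R"
    and \<beta>: "\<beta> = liminf (\<lambda>k. boundary_integral (Hf (\<phi> k)) x0 s)" "\<beta> < \<infinity>"
  shows "\<exists>lo hi. lo \<le> hi \<and> (AE x in lborel. x \<in> cube x0 s \<longrightarrow> lo \<le> ub x \<and> ub x \<le> hi) \<and>
     A_sub CARD('n) A ((hi - lo) / (32 * real CARD('n) * lam * 2 ^ CARD('n) * s)) * ennreal (s ^ (CARD('n) - 1)) \<le> \<beta>"
proof -
  let ?n = "CARD('n)"
  define U where "U k y = 1 / lam * conv (\<phi> k) ub y" for k y
  define b where "b k = boundary_integral (Hf (\<phi> k)) x0 s" for k
  define v :: "real^'n" where "v = (\<chi> j. x0 $ j + s)"
  define F where "F = frontier (cube x0 s)"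
  define e where "e = 2 ^ ?n * (2 * s) ^ (?n - 1)"
  have e: "e > 0" using s by (simp add: e_def)
  have bs: "boundary_setting (U k) x0 s T (Hf (\<phi> k)) A" if "T > 0" for k T
    unfolding U_def by (rule boundary_setting_conv[OF \<phi> x0 s that])
  have vert: "boundary_setting.vertex x0 s = v"
    using boundary_setting.vertex_def[OF bs[of 1 0]] by (simp add: v_def)
  have smU: "smooth (U k)" for k using bs[of 1 k] by (simp add: boundary_setting_def)
  have cF: "compact F" unfolding F_def
    by (rule compact_frontier_bounded) (use compact_closure_cube[of x0 s] in simp)
  have vF: "v \<in> F" using s by (auto simp: F_def frontier_cube_iff v_def)
  have osc: "ennreal (T * (2 * s) ^ (?n - 2) * \<bar>U k y - U k v\<bar>) \<le> ennreal (4 * real ?n) * (b k + ennreal e * sub_kernel ?n A T)"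
    if T: "T > 0" and y: "y \<in> F" for T k y
  proof -
    obtain i where "\<bar>y $ i - x0 $ i\<bar> = s" and "\<And>j. \<bar>y $ j - x0 $ j\<bar> \<le> s"
      using y s by (auto simp: F_def frontier_cube_iff)
    then show ?thesis
      using boundary_setting.boundary_oscillation[OF bs[OF T], of y i k] by (simp add: vert b_def e_def)
  qed
  \<comment> \<open>The values on the compact frontier are measured from a common reference point,
    the vertex \<open>v\<close>, so that one number per \<open>k\<close> describes the
    oscillation.\<close>
  define os where "os k = Sup ((\<lambda>y. \<bar>U k y - U k v\<bar>) ` F)" for k
  have bdd: "bdd_above ((\<lambda>y. \<bar>U k y - U k v\<bar>) ` F)" for k
    by (intro bounded_imp_bdd_above compact_imp_bounded compact_continuous_image cF continuous_intros smooth_continuous smU)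
  have le_os: "\<bar>U k y - U k v\<bar> \<le> os k" if "y \<in> F" for k y
    unfolding os_def by (rule cSup_upper[OF imageI[OF that] bdd])
  have os0: "os k \<ge> 0" for k using le_os[OF vF, of k] by simp
  have os_le: "ennreal (T * (2 * s) ^ (?n - 2) * os k) \<le> ennreal (4 * real ?n) * (b k + ennreal e * sub_kernel ?n A T)"
    if "T > 0" for T k
  proof (cases "ennreal (4 * real ?n) * (b k + ennreal e * sub_kernel ?n A T)" rule: ennreal_cases)
    case (real \<rho>)
    let ?t = "T * (2 * s) ^ (?n - 2)"
    have t: "?t > 0" using that s by simp
    have "os k \<le> \<rho> / ?t"
      unfolding os_def
    proof (rule cSup_least)
      show "(\<lambda>y. \<bar>U k y - U k v\<bar>) ` F \<noteq> {}" using vF by blast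
      fix z assume "z \<in> (\<lambda>y. \<bar>U k y - U k v\<bar>) ` F"
      then obtain y where y: "y \<in> F" "z = \<bar>U k y - U k v\<bar>" by blast
      have "ennreal (?t * z) \<le> ennreal \<rho>" using osc[OF that y(1), of k] real(2) y(2) by simp
      then have "?t * z \<le> \<rho>" using real(1) by (simp add: ennreal_le_iff)
      then show "z \<le> \<rho> / ?t" using t by (simp add: field_simps)
    qed
    then have "?t * os k \<le> \<rho>" using t by (simp add: field_simps)
    then show ?thesis unfolding real(2) by (rule ennreal_leI)
  qed simp
  obtain r1 :: "nat \<Rightarrow> nat" where r1: "strict_mono r1" "(b \<circ> r1) \<longlonglongrightarrow> \<beta>"
    using liminf_subseq_lim[of b] \<beta>(1) by (auto simp: b_def[abs_def])
  obtain \<beta>0 where \<beta>0: "\<beta> = ennreal \<beta>0" "\<beta>0 \<ge> 0"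
    using \<beta>(2) by (metis ennreal_cases infinity_ennreal_def order_less_irrefl)
  have "\<beta> < ennreal (\<beta>0 + 1)" using \<beta>0 by (simp add: ennreal_less_iff)
  then have "\<forall>\<^sub>F k in sequentially. (b \<circ> r1) k < ennreal (\<beta>0 + 1)" by (rule order_tendstoD(2)[OF r1(2)])
  then obtain N where N: "\<And>k. k \<ge> N \<Longrightarrow> b (r1 k) \<le> ennreal (\<beta>0 + 1)"
    unfolding eventually_sequentially o_def by (meson less_imp_le)
  \<comment> \<open>A single \<open>T0\<close> with finite \<open>sub_kernel\<close> suffices for
    boundedness; the final inequality uses all \<open>T\<close>.\<close>
  obtain T0 where T0: "T0 > 0" "sub_kernel ?n A T0 < \<infinity>" using admissible_young.sub_kernel_finite[OF adm] by blast
  obtain \<kappa> where \<kappa>: "sub_kernel ?n A T0 = ennreal \<kappa>" "\<kappa> \<ge> 0"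
    using T0(2) by (metis ennreal_cases infinity_ennreal_def order_less_irrefl)
  define t0 where "t0 = T0 * (2 * s) ^ (?n - 2)"
  have t0: "t0 > 0" using T0 s by (simp add: t0_def)
  define S where "S = \<beta>0 + 1 + e * \<kappa>"
  have S: "S \<ge> 0" using \<beta>0 e \<kappa> by (simp add: S_def)
  have bd_le: "b (r1 k) + ennreal e * sub_kernel ?n A T0 \<le> ennreal S" if "k \<ge> N" for k
  proof -
    have "b (r1 k) + ennreal e * sub_kernel ?n A T0 \<le> ennreal (\<beta>0 + 1) + ennreal (e * \<kappa>)"
      using N[OF that] e \<kappa> by (intro add_mono) (auto simp: ennreal_mult)
    also have "\<dots> = ennreal S" using \<beta>0 e \<kappa> by (simp add: S_def flip: ennreal_plus)
    finally show ?thesis .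
  qed
  have os_bd: "os (r1 k) \<le> 4 * real ?n * S / t0" if "k \<ge> N" for k
  proof -
    have "ennreal (t0 * os (r1 k)) \<le> ennreal (4 * real ?n) * ennreal S"
      unfolding t0_def by (rule order_trans[OF os_le[OF T0(1)] mult_left_mono[OF bd_le[OF that]]]) simp
    then have "ennreal (t0 * os (r1 k)) \<le> ennreal (4 * real ?n * S)" using S by (simp add: ennreal_mult)
    then have "t0 * os (r1 k) \<le> 4 * real ?n * S" using S by (simp add: ennreal_le_iff)
    then show ?thesis using t0 by (simp add: field_simps)
  qed
  define p where "p = (2 * s) ^ (?n - 1)"
  have p: "p > 0" using s by (simp add: p_def)
  have v_bd: "\<bar>U (r1 k) v\<bar> \<le> (t0 * (\<beta>0 + 1) + real ?n * p * S) / (t0 * p)" if "k \<ge> N" for k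
  proof -
    have "ennreal t0 * ennreal (p * \<bar>U (r1 k) v\<bar>) \<le> ennreal t0 * b (r1 k) + ennreal (real ?n * p) * (b (r1 k) + ennreal e * sub_kernel ?n A T0)"
      using boundary_setting.vertex_bound[OF bs[OF T0(1)] Hf_measurable[OF \<phi>] value_le_Hf[OF \<phi>, folded U_def], of "r1 k"]
      by (simp add: vert b_def e_def t0_def p_def)
    also have "\<dots> \<le> ennreal t0 * ennreal (\<beta>0 + 1) + ennreal (real ?n * p) * ennreal S"
      by (intro add_mono mult_left_mono N bd_le that) auto
    also have "\<dots> = ennreal (t0 * (\<beta>0 + 1) + real ?n * p * S)"
      using t0 p S \<beta>0 by (simp flip: ennreal_mult ennreal_plus)
    finally have "ennreal (t0 * (p * \<bar>U (r1 k) v\<bar>)) \<le> ennreal (t0 * (\<beta>0 + 1) + real ?n * p * S)"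
      using t0 p by (simp flip: ennreal_mult)
    then have "t0 * (p * \<bar>U (r1 k) v\<bar>) \<le> t0 * (\<beta>0 + 1) + real ?n * p * S"
      using t0 p S \<beta>0 by (subst (asm) ennreal_le_iff) auto
    then show ?thesis using t0 p by (simp add: field_simps)
  qed
  \<comment> \<open>From index \<open>N\<close> on both entries are bounded, so they converge along
    a common subsequence.\<close>
  define q where "q k = (U (r1 (k + N)) v, os (r1 (k + N)))" for k
  have "bounded (range q)"
    unfolding bounded_iff
  proof (intro exI[of _ "(t0 * (\<beta>0 + 1) + real ?n * p * S) / (t0 * p) + 4 * real ?n * S / t0"] ballI)
    fix z assume "z \<in> range q"
    then obtain k where k: "z = q k" by blast
    have "norm z \<le> \<bar>U (r1 (k + N)) v\<bar> + \<bar>os (r1 (k + N))\<bar>"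
      unfolding k q_def using norm_Pair_le[of "U (r1 (k + N)) v" "os (r1 (k + N))"] by simp
    also have "\<dots> \<le> (t0 * (\<beta>0 + 1) + real ?n * p * S) / (t0 * p) + 4 * real ?n * S / t0"
      using v_bd[of "k + N"] os_bd[of "k + N"] os0[of "r1 (k + N)"] by (intro add_mono) auto
    finally show "norm z \<le> (t0 * (\<beta>0 + 1) + real ?n * p * S) / (t0 * p) + 4 * real ?n * S / t0" .
  qed
  then obtain l r2 where r2: "strict_mono (r2 :: nat \<Rightarrow> nat)" "(q \<circ> r2) \<longlonglongrightarrow> l"
    using bounded_imp_convergent_subsequence by blast
  define r where "r k = r1 (r2 k + N)" for k
  have r: "strict_mono r" using r1(1) r2(1) by (auto simp: r_def strict_mono_def)
  have lim_v: "(\<lambda>k. U (r k) v) \<longlonglongrightarrow> fst l" and lim_os: "(\<lambda>k. os (r k)) \<longlonglongrightarrow> snd l"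
    using tendsto_fst[OF r2(2)] tendsto_snd[OF r2(2)] by (simp_all add: q_def r_def o_def)
  have "strict_mono (\<lambda>k. r2 k + N)" using r2(1) by (auto simp: strict_mono_def)
  from LIMSEQ_subseq_LIMSEQ[OF r1(2) this] have lim_b: "(\<lambda>k. b (r k)) \<longlonglongrightarrow> \<beta>"
    by (simp add: r_def o_def)
  have snd0: "snd l \<ge> 0" by (rule LIMSEQ_le_const[OF lim_os]) (use os0 in auto)
  \<comment> \<open>\<open>fst l\<close> is the limit of the vertex values, \<open>snd l\<close>
    that of the oscillations, and \<open>lam\<close> undoes the division in
    \<open>U\<close>.\<close>
  define lo hi where "lo = lam * fst l - lam * snd l" and "hi = lam * fst l + lam * snd l"
  have "lo \<le> hi" using lam snd0 by (simp add: lo_def hi_def)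
  define Q where "Q = cube x0 s"
  have [measurable]: "Q \<in> sets borel" by (simp add: Q_def)
  have Qsub: "z \<in> cube x1 (2 * R)" if "z \<in> closure Q" for z
  proof -
    have "z \<in> Q \<or> z \<in> frontier Q" using that frontier_cube[of z x0 s] by (auto simp: Q_def)
    then have "\<forall>j. \<bar>z $ j - x0 $ j\<bar> \<le> s"
      using frontier_cube_iff[OF s(1), of z x0] by (auto simp: Q_def cube_def less_imp_le)
    then show ?thesis by (rule closed_cube_subset[OF x0 s(2)])
  qed
  have trunc: "AE x in lborel. x \<in> cube x0 s \<longrightarrow> lo - \<delta> \<le> ub x \<and> ub x \<le> hi + \<delta>"
    if "0 < \<delta>" "AE x in lborel. ub x \<noteq> hi + \<delta>" "AE x in lborel. ub x \<noteq> lo - \<delta>" for \<delta>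
    unfolding lo_def hi_def
  proof (rule weakly_monotone_truncation[OF wm um _ ub _ gb, where V = "\<lambda>k. conv (\<phi> (r k)) ub" and ck = "\<lambda>k. lam * U (r k) v" and ok = "\<lambda>k. lam * os (r k)"])
    show "closure (cube x0 s) \<subseteq> \<Omega>"
      using Qsub cl closure_subset unfolding Q_def by blast
    show "AE x in lborel. x \<in> cube x0 s \<longrightarrow> u x = ub x"
      using ueq by eventually_elim (use Qsub closure_subset Q_def in blast)
    show "smooth (conv (\<phi> (r k)) ub)" for k by (rule smooth_conv[OF mollifier_bump[OF \<phi>] ub])
    show "AE x in lborel. x \<in> cube x0 s \<longrightarrow> (\<lambda>k. conv (\<phi> (r k)) ub x) \<longlonglongrightarrow> ub x"
      using ae
    proof eventually_elim
      case (elim x)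
      then show ?case using LIMSEQ_subseq_LIMSEQ[OF elim r] by (simp add: o_def)
    qed
    show "(\<lambda>k. \<integral>\<^sup>+x\<in>cube x0 s. ennreal \<bar>conv (\<phi> (r k)) ub x - ub x\<bar> \<partial>lborel) \<longlonglongrightarrow> 0"
    proof (rule tendsto_sandwich[OF _ _ tendsto_const])
      show "(\<lambda>k. \<integral>\<^sup>+x. ennreal \<bar>conv (\<phi> (r k)) ub x - ub x\<bar> \<partial>lborel) \<longlonglongrightarrow> 0"
        using LIMSEQ_subseq_LIMSEQ[OF L1 r] by (simp add: o_def)
    qed (auto intro!: always_eventually nn_integral_mono simp: indicator_def)
    show "(\<lambda>k. \<integral>\<^sup>+x\<in>cube x0 s. ennreal (norm (grad (conv (\<phi> (r k)) ub) x - gb x)) \<partial>lborel) \<longlonglongrightarrow> 0"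
    proof (rule tendsto_sandwich[OF _ _ tendsto_const])
      show "(\<lambda>k. \<integral>\<^sup>+x. ennreal (norm (conv (\<phi> (r k)) gb x - gb x)) \<partial>lborel) \<longlonglongrightarrow> 0"
        using LIMSEQ_subseq_LIMSEQ[OF L1g r] by (simp add: o_def)
      show "\<forall>\<^sub>F k in sequentially. (\<integral>\<^sup>+x\<in>cube x0 s. ennreal (norm (grad (conv (\<phi> (r k)) ub) x - gb x)) \<partial>lborel)
         \<le> (\<integral>\<^sup>+x. ennreal (norm (conv (\<phi> (r k)) gb x - gb x)) \<partial>lborel)"
      proof (intro always_eventually allI nn_integral_mono)
        fix k x
        show "ennreal (norm (grad (conv (\<phi> (r k)) ub) x - gb x)) * indicator (cube x0 s) x \<le> ennreal (norm (conv (\<phi> (r k)) gb x - gb x))"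
        proof (cases "x \<in> cube x0 s")
          case True
          then have "x \<in> cube x1 (2 * R)" using Qsub closure_subset unfolding Q_def by blast
          then show ?thesis using True grad_conv[OF \<phi>] by simp
        qed simp
      qed
    qed auto
    show "(\<lambda>k. lam * U (r k) v) \<longlonglongrightarrow> lam * fst l" "(\<lambda>k. lam * os (r k)) \<longlonglongrightarrow> lam * snd l"
      by (intro tendsto_intros lim_v lim_os)+
    show "0 \<le> lam * os (r k)" for k using lam os0 by simp
    show "\<bar>conv (\<phi> (r k)) ub y - lam * U (r k) v\<bar> \<le> lam * os (r k)" if "y \<in> frontier (cube x0 s)" for k y
    proof -
      have "conv (\<phi> (r k)) ub y - lam * U (r k) v = lam * (U (r k) y - U (r k) v)"
        using lam by (simp add: U_def right_diff_distrib)
      then show ?thesis using le_os[of y "r k"] that lam by (simp add: F_def abs_mult)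
    qed
  qed (use that in \<open>auto simp: lo_def hi_def\<close>)
  \<comment> \<open>\<open>trunc\<close> is available only for generic \<open>\<delta>\<close>. Such
    values exist below every \<open>1 / Suc j\<close>, and countably many null sets are united
    before \<open>j\<close> tends to infinity.\<close>
  have "AE x in lborel. \<forall>j::nat. x \<in> cube x0 s \<longrightarrow> lo - 1 / real (Suc j) \<le> ub x \<and> ub x \<le> hi + 1 / real (Suc j)"
    unfolding AE_all_countable
  proof
    fix j :: nat
    obtain \<delta> where \<delta>: "0 < \<delta>" "\<delta> < 1 / real (Suc j)" "AE x in lborel. ub x \<noteq> hi + \<delta>" "AE x in lborel. ub x \<noteq> lo - \<delta>"
      using generic_level[OF ub_measurable, of "1 / real (Suc j)" hi lo] by auto
    from trunc[OF \<delta>(1,3,4)]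
    show "AE x in lborel. x \<in> cube x0 s \<longrightarrow> lo - 1 / real (Suc j) \<le> ub x \<and> ub x \<le> hi + 1 / real (Suc j)"
      by eventually_elim (use \<delta>(2) in auto)
  qed
  then have "AE x in lborel. x \<in> cube x0 s \<longrightarrow> lo \<le> ub x \<and> ub x \<le> hi"
  proof eventually_elim
    case (elim x)
    have lim: "(\<lambda>j. 1 / real (Suc j)) \<longlonglongrightarrow> 0" by (rule LIMSEQ_Suc[OF lim_1_over_n])
    show ?case
    proof (intro impI conjI)
      assume x: "x \<in> cube x0 s"
      have "(\<lambda>j. lo - 1 / real (Suc j)) \<longlonglongrightarrow> lo - 0" by (intro tendsto_intros lim)
      then show "lo \<le> ub x" using elim x by (intro LIMSEQ_le_const2[of "\<lambda>j. lo - 1 / real (Suc j)" lo]) auto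
      have "(\<lambda>j. hi + 1 / real (Suc j)) \<longlonglongrightarrow> hi + 0" by (intro tendsto_intros lim)
      then show "ub x \<le> hi" using elim x by (intro LIMSEQ_le_const[of "\<lambda>j. hi + 1 / real (Suc j)" hi]) auto
    qed
  qed
  moreover have "A_sub ?n A ((hi - lo) / (32 * real ?n * lam * 2 ^ ?n * s)) * ennreal (s ^ (?n - 1)) \<le> \<beta>"
  proof (rule admissible_young.A_sub_bound[OF adm _ s(1) lam])
    show "0 \<le> hi - lo" using \<open>lo \<le> hi\<close> by simp
    fix T :: real assume T: "T > 0"
    have lim: "ennreal (T * (2 * s) ^ (?n - 2) * snd l) \<le> ennreal (4 * real ?n) * (\<beta> + ennreal e * sub_kernel ?n A T)"
    proof (rule LIMSEQ_le)
      show "(\<lambda>k. ennreal (T * (2 * s) ^ (?n - 2) * os (r k))) \<longlonglongrightarrow> ennreal (T * (2 * s) ^ (?n - 2) * snd l)"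
        by (intro tendsto_ennrealI tendsto_intros lim_os)
      show "(\<lambda>k. ennreal (4 * real ?n) * (b (r k) + ennreal e * sub_kernel ?n A T)) \<longlonglongrightarrow> ennreal (4 * real ?n) * (\<beta> + ennreal e * sub_kernel ?n A T)"
        by (intro ennreal_tendsto_cmult tendsto_add tendsto_const lim_b) simp
    qed (use os_le[OF T] in auto)
    \<comment> \<open>\<open>hi - lo\<close> is twice \<open>lam * snd l\<close>, which doubles the
      constant \<open>4\<close> of \<open>boundary_oscillation\<close>.\<close>
    have "ennreal (T * (2 * s) ^ (?n - 2) * (hi - lo)) = ennreal (2 * lam) * ennreal (T * (2 * s) ^ (?n - 2) * snd l)"
      using lam T s snd0 by (simp add: hi_def lo_def mult_ac flip: ennreal_mult)
    also have "\<dots> \<le> ennreal (2 * lam) * (ennreal (4 * real ?n) * (\<beta> + ennreal e * sub_kernel ?n A T))"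
      by (rule mult_left_mono[OF lim]) simp
    also have "\<dots> = ennreal (2 * lam) * ennreal (4 * real ?n) * (\<beta> + ennreal e * sub_kernel ?n A T)"
      by (simp add: mult.assoc)
    also have "ennreal (2 * lam) * ennreal (4 * real ?n) = ennreal (8 * real ?n * lam)"
      using lam by (subst ennreal_mult[symmetric]) auto
    finally show "ennreal (T * (2 * s) ^ (?n - 2) * (hi - lo)) \<le> ennreal (8 * real ?n * lam) * (\<beta> + ennreal (2 ^ ?n * (2 * s) ^ (?n - 1)) * sub_kernel ?n A T)"
      by (simp add: e_def)
  qed
  ultimately show ?thesis using \<open>lo \<le> hi\<close> by blast
qed

text \<open>The integral over \<open>s\<close> of the boundary integral of any
  \<open>Hf \<phi>\<close>, since mollification preserves both masses. It depends neither on the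
  kernel nor on the centre of the cubes, and this makes the modulus uniform near
  \<open>x1\<close>.\<close>

definition C1 :: ennreal where "C1 = 2 * of_nat CARD('n) * ((\<integral>\<^sup>+y. H0 y \<partial>lborel) + (\<integral>\<^sup>+y. W0 y \<partial>lborel))"

lemma C1_finite: "C1 < \<infinity>"
proof -
  have "(\<integral>\<^sup>+y. W0 y \<partial>lborel) < \<infinity>"
    using integrable_divide_zero[of lam lborel ub] ub unfolding W0_def by (simp add: integrable_iff_bounded)
  then show ?thesis using HA unfolding C1_def H0_def[symmetric] by (simp add: ennreal_mult_less_top of_nat_less_top)
qed

text \<open>Fatou's lemma for the lower limit of the boundary integrals, each of which integrates to
  \<open>C1\<close> over all \<open>s\<close>.\<close>

lemma good_radii:
  assumes x0: "x0 \<in> cube x1 R"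
  obtains \<beta> where "\<beta> \<in> borel_measurable borel" "(\<integral>\<^sup>+s. \<beta> s \<partial>lborel) \<le> C1"
    "\<And>s. 0 < s \<Longrightarrow> s < R \<Longrightarrow> \<beta> s < \<infinity> \<Longrightarrow>
      \<exists>lo hi. lo \<le> hi \<and> (AE x in lborel. x \<in> cube x0 s \<longrightarrow> lo \<le> ub x \<and> ub x \<le> hi) \<and>
       A_sub CARD('n) A ((hi - lo) / (32 * real CARD('n) * lam * 2 ^ CARD('n) * s)) * ennreal (s ^ (CARD('n) - 1)) \<le> \<beta> s"
proof -
  obtain \<phi> where \<phi>: "\<And>k::nat. mollifier R (\<phi> k)" "AE x in lborel. (\<lambda>k. conv (\<phi> k) ub x) \<longlonglongrightarrow> ub x"
    "(\<lambda>k. \<integral>\<^sup>+x. ennreal \<bar>conv (\<phi> k) ub x - ub x\<bar> \<partial>lborel) \<longlonglongrightarrow> 0"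
    "(\<lambda>k. \<integral>\<^sup>+x. ennreal (norm (conv (\<phi> k) gb x - gb x)) \<partial>lborel) \<longlonglongrightarrow> 0"
    using mollifying_sequence[OF ub gb R] by blast
  define \<beta> where "\<beta> s = liminf (\<lambda>k. boundary_integral (Hf (\<phi> k)) x0 s)" for s
  have bm: "boundary_integral (Hf (\<phi> k)) x0 \<in> borel_measurable borel" for k
    by (intro boundary_integral_measurable Hf_measurable \<phi>)
  show thesis
  proof (rule that[of \<beta>])
    show "\<beta> \<in> borel_measurable borel"
      unfolding \<beta>_def[abs_def] by (intro borel_measurable_liminf bm)
    have "(\<integral>\<^sup>+s. boundary_integral (Hf (\<phi> k)) x0 s \<partial>lborel) = C1" for k
    proof -
      have [measurable]: "\<phi> k \<in> borel_measurable borel" by (rule bump_measurable[OF mollifier_bump[OF \<phi>(1)]])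
      have "(\<integral>\<^sup>+y. Hf (\<phi> k) y \<partial>lborel) = (\<integral>\<^sup>+y. H0 y \<partial>lborel) + (\<integral>\<^sup>+y. W0 y \<partial>lborel)"
        unfolding Hf_def by (subst nn_integral_add) (auto simp: nn_integral_conv_nn[OF \<phi>(1)])
      then show ?thesis
        unfolding C1_def using nn_integral_boundary_integral[OF Hf_measurable[OF \<phi>(1)]] by metis
    qed
    then show "(\<integral>\<^sup>+s. \<beta> s \<partial>lborel) \<le> C1"
      using nn_integral_liminf[of "\<lambda>k s. boundary_integral (Hf (\<phi> k)) x0 s" lborel] bm
      by (simp add: \<beta>_def Liminf_const)
  qed (rule good_radius[OF \<phi> x0 _ _ \<beta>_def])
qed

end

section \<open>The continuous representative\<close>

lemma not_AE_not_in_open: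
  fixes S :: "(real^'n) set"
  assumes "open S" "S \<noteq> {}" shows "\<not> (AE x in lborel. x \<notin> S)"
proof
  assume "AE x in lborel. x \<notin> S"
  then have "S \<in> null_sets lborel" using assms(1) by (simp add: AE_iff_null_sets)
  then have "negligible S" by (simp add: negligible_iff_null_sets null_sets_completionI)
  then show False using open_not_negligible[OF assms] by simp
qed

lemma cube_nonempty: "s > 0 \<Longrightarrow> cube x s \<noteq> {}"
  by (auto simp: cube_def intro!: exI[of _ x])

lemma cube_mono:
  assumes "r \<le> s" shows "cube x r \<subseteq> cube x s"
proof
  fix z assume "z \<in> cube x r"
  then have "\<bar>z $ j - x $ j\<bar> < s" for j
    using assms unfolding cube_def mem_Collect_eq by (rule_tac less_le_trans) blast+
  then show "z \<in> cube x s" by (simp add: cube_def)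
qed

text \<open>The essential infimum and supremum. They are real because the bounds \<open>a\<close>
  and \<open>b\<close> exist and a nonempty open set is not null; they are bounds themselves by
  uniting the null sets for the levels shifted by \<open>1 / Suc j\<close>.\<close>

lemma essential_bounds:
  fixes f :: "real^'n \<Rightarrow> real"
  assumes S: "open S" "S \<noteq> {}" and ab: "AE x in lborel. x \<in> S \<longrightarrow> a \<le> f x \<and> f x \<le> b"
  obtains lo hi where "lo \<le> hi" "AE x in lborel. x \<in> S \<longrightarrow> lo \<le> f x \<and> f x \<le> hi"
    "\<And>a b. (AE x in lborel. x \<in> S \<longrightarrow> a \<le> f x \<and> f x \<le> b) \<Longrightarrow> a \<le> lo \<and> hi \<le> b"
proof -
  note nS = not_AE_not_in_open[OF S]
  define U where "U = {b. AE x in lborel. x \<in> S \<longrightarrow> f x \<le> b}"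
  define L where "L = {a. AE x in lborel. x \<in> S \<longrightarrow> a \<le> f x}"
  have aL: "a \<in> L" and bU: "b \<in> U" using ab by (auto simp: U_def L_def elim: eventually_mono)
  have LU: "l \<le> h" if "l \<in> L" "h \<in> U" for l h
  proof (rule ccontr)
    assume "\<not> l \<le> h"
    have "AE x in lborel. x \<in> S \<longrightarrow> l \<le> f x" "AE x in lborel. x \<in> S \<longrightarrow> f x \<le> h" using that by (auto simp: L_def U_def)
    then have "AE x in lborel. x \<notin> S" by eventually_elim (use \<open>\<not> l \<le> h\<close> in auto)
    then show False using nS by simp
  qed
  have bU': "bdd_below U" by (rule bdd_belowI[of _ a]) (rule LU[OF aL])
  have bL': "bdd_above L" by (rule bdd_aboveI[of _ b]) (rule LU[OF _ bU])
  have le: "Sup L \<le> Inf U"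
    using aL bU LU by (intro cSup_least cInf_greatest) auto
  have "AE x in lborel. \<forall>j::nat. x \<in> S \<longrightarrow> f x \<le> Inf U + 1 / real (Suc j)"
    unfolding AE_all_countable
  proof
    fix j :: nat
    obtain c where "c \<in> U" "c < Inf U + 1 / real (Suc j)"
      using cInf_lessD[of U "Inf U + 1 / real (Suc j)"] bU by auto
    then have "AE x in lborel. x \<in> S \<longrightarrow> f x \<le> c" by (simp add: U_def)
    then show "AE x in lborel. x \<in> S \<longrightarrow> f x \<le> Inf U + 1 / real (Suc j)"
      by eventually_elim (use \<open>c < Inf U + 1 / real (Suc j)\<close> in auto)
  qed
  moreover have "AE x in lborel. \<forall>j::nat. x \<in> S \<longrightarrow> Sup L - 1 / real (Suc j) \<le> f x"
    unfolding AE_all_countable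
  proof
    fix j :: nat
    obtain c where "c \<in> L" "Sup L - 1 / real (Suc j) < c"
      using less_cSupD[of L "Sup L - 1 / real (Suc j)"] aL by auto
    then have "AE x in lborel. x \<in> S \<longrightarrow> c \<le> f x" by (simp add: L_def)
    then show "AE x in lborel. x \<in> S \<longrightarrow> Sup L - 1 / real (Suc j) \<le> f x"
      by eventually_elim (use \<open>Sup L - 1 / real (Suc j) < c\<close> in auto)
  qed
  ultimately have "AE x in lborel. x \<in> S \<longrightarrow> Sup L \<le> f x \<and> f x \<le> Inf U"
  proof eventually_elim
    case (elim x)
    have lim: "(\<lambda>j. 1 / real (Suc j)) \<longlonglongrightarrow> 0" by (rule LIMSEQ_Suc[OF lim_1_over_n])
    show ?case
    proof (intro impI conjI)
      assume x: "x \<in> S"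
      have "(\<lambda>j. Sup L - 1 / real (Suc j)) \<longlonglongrightarrow> Sup L - 0" by (intro tendsto_intros lim)
      then show "Sup L \<le> f x" using elim x by (intro LIMSEQ_le_const2[of "\<lambda>j. Sup L - 1 / real (Suc j)" "Sup L"]) auto
      have "(\<lambda>j. Inf U + 1 / real (Suc j)) \<longlonglongrightarrow> Inf U + 0" by (intro tendsto_intros lim)
      then show "f x \<le> Inf U" using elim x by (intro LIMSEQ_le_const[of "\<lambda>j. Inf U + 1 / real (Suc j)" "Inf U"]) auto
    qed
  qed
  moreover have "a' \<le> Sup L \<and> Inf U \<le> b'" if "AE x in lborel. x \<in> S \<longrightarrow> a' \<le> f x \<and> f x \<le> b'" for a' b'
  proof -
    have "a' \<in> L" "b' \<in> U" using that by (auto simp: U_def L_def elim: eventually_mono)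
    then show ?thesis using bU' bL' by (auto intro: cSup_upper cInf_lower)
  qed
  ultimately show thesis using that le by blast
qed

text \<open>A bound of \<open>ub\<close> on the cube of half edge \<open>R / 2\<close> limits all
  oscillations considered, so one \<open>C\<close> can be chosen with
  \<open>osc / (C * R) \<le> a\<close>, where \<open>J a\<close> is finite. For
  \<open>r < s < R\<close> the oscillation in the cube of half edge \<open>r\<close> is at most the
  one for \<open>s\<close>, so the integrand of \<open>oscillation_modulus\<close> is at most
  \<open>\<beta> s\<close>.\<close>

lemma (in local_setting) local_modulus:
  obtains C where "C \<ge> 0"
    "\<And>x0 r. x0 \<in> cube x1 (R / 4) \<Longrightarrow> 0 < r \<Longrightarrow> r < R / 4 \<Longrightarrow>
      \<exists>lo hi. (AE x in lborel. x \<in> cube x0 r \<longrightarrow> lo \<le> ub x \<and> ub x \<le> hi) \<and> hi - lo \<le> C * omega CARD('n) A r"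
proof -
  let ?n = "CARD('n)"
  interpret admissible_young ?n A by (rule adm)
  define C0 where "C0 = 32 * real ?n * lam * 2 ^ ?n"
  have C0: "C0 > 0" using lam n2 by (simp add: C0_def)
  obtain M where M: "C1 = ennreal M" "M \<ge> 0"
    using C1_finite by (metis ennreal_cases infinity_ennreal_def order_less_irrefl)
  obtain a where a: "a > 0" "J a < \<infinity>" by (rule J_finite)
  obtain j where j: "J a = ennreal j" "j \<ge> 0" using a by (metis ennreal_cases infinity_ennreal_def order_less_irrefl)
  have x1: "x1 \<in> cube x1 R" using R by (simp add: cube_def)
  obtain lo1 hi1 where b1: "lo1 \<le> hi1" "AE x in lborel. x \<in> cube x1 (R / 2) \<longrightarrow> lo1 \<le> ub x \<and> ub x \<le> hi1"
  proof -
    obtain \<beta> where \<beta>: "\<beta> \<in> borel_measurable borel" "(\<integral>\<^sup>+s. \<beta> s \<partial>lborel) \<le> C1"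
      "\<And>s. 0 < s \<Longrightarrow> s < R \<Longrightarrow> \<beta> s < \<infinity> \<Longrightarrow>
      \<exists>lo hi. lo \<le> hi \<and> (AE x in lborel. x \<in> cube x1 s \<longrightarrow> lo \<le> ub x \<and> ub x \<le> hi) \<and>
       A_sub ?n A ((hi - lo) / (32 * real ?n * lam * 2 ^ ?n * s)) * ennreal (s ^ (?n - 1)) \<le> \<beta> s"
      using good_radii[OF x1] by blast
    have "(\<integral>\<^sup>+s. \<beta> s \<partial>lborel) \<noteq> \<infinity>" using \<beta>(2) C1_finite by (auto simp: top_unique)
    then have ae: "AE s in lborel. \<beta> s \<noteq> \<infinity>" using \<beta>(1) by (intro nn_integral_noteq_infinite) auto
    \<comment> \<open>A function with finite integral is finite almost everywhere, so some radius
      between \<open>R / 2\<close> and \<open>R\<close> is good.\<close>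
    have "\<exists>s. R / 2 < s \<and> s < R \<and> \<beta> s \<noteq> \<infinity>"
    proof (rule ccontr)
      assume "\<not> ?thesis"
      then have "AE s in lborel. s \<notin> {R / 2<..<R}" using ae by (auto elim!: eventually_mono)
      then have "{R / 2<..<R} \<in> null_sets lborel" by (simp add: AE_iff_null_sets)
      then show False using R by (simp add: null_sets_def)
    qed
    then obtain s where s: "R / 2 < s" "s < R" "\<beta> s < \<infinity>" by (auto simp: top.not_eq_extremum)
    obtain lo hi where lh: "lo \<le> hi" "AE x in lborel. x \<in> cube x1 s \<longrightarrow> lo \<le> ub x \<and> ub x \<le> hi"
      using \<beta>(3)[of s] s R by auto
    have "AE x in lborel. x \<in> cube x1 (R / 2) \<longrightarrow> lo \<le> ub x \<and> ub x \<le> hi"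
      using lh(2) by eventually_elim (use s cube_mono[of "R / 2" s x1] in auto)
    then show thesis using that lh(1) by blast
  qed
  \<comment> \<open>The first entry is the constant of \<open>good_radii\<close>; the second makes
    the a priori oscillation satisfy \<open>Ca\<close>.\<close>
  define C where "C = max C0 ((hi1 - lo1) / (R * a))"
  have C: "C > 0" "C0 \<le> C" using C0 by (auto simp: C_def)
  have Ca: "(hi1 - lo1) / (C * R) \<le> a"
  proof -
    have "(hi1 - lo1) / (R * a) \<le> C" by (simp add: C_def)
    then show ?thesis using C R a by (simp add: field_simps)
  qed
  show thesis
  proof (rule that[of "C * max 1 (M + (a * R) ^ ?n * j)"])
    show "0 \<le> C * max 1 (M + (a * R) ^ ?n * j)" using C by (simp add: le_max_iff_disj)
    fix x0 r assume x0: "x0 \<in> cube x1 (R / 4)" and r: "0 < r" "r < R / 4"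
    have x0R: "x0 \<in> cube x1 R" using x0 R cube_mono[of "R / 4" R x1] by auto
    have sub: "x \<in> cube x1 (R / 2)" if "x \<in> cube x0 r" for x
    proof -
      have "\<bar>x $ i - x1 $ i\<bar> < R / 2" for i
      proof -
        have "\<bar>x $ i - x0 $ i\<bar> < r" "\<bar>x0 $ i - x1 $ i\<bar> < R / 4" using that x0 by (auto simp: cube_def)
        then show ?thesis using r by linarith
      qed
      then show ?thesis by (simp add: cube_def)
    qed
    have b1': "AE x in lborel. x \<in> cube x0 r \<longrightarrow> lo1 \<le> ub x \<and> ub x \<le> hi1"
      using b1(2) by eventually_elim (use sub in blast)
    obtain lo hi where lh: "lo \<le> hi" "AE x in lborel. x \<in> cube x0 r \<longrightarrow> lo \<le> ub x \<and> ub x \<le> hi"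
      "\<And>a b. (AE x in lborel. x \<in> cube x0 r \<longrightarrow> a \<le> ub x \<and> ub x \<le> b) \<Longrightarrow> a \<le> lo \<and> hi \<le> b"
      using essential_bounds[OF open_cube cube_nonempty[OF r(1)] b1'] by blast
    obtain \<beta> where \<beta>: "\<beta> \<in> borel_measurable borel" "(\<integral>\<^sup>+s. \<beta> s \<partial>lborel) \<le> C1"
      "\<And>s. 0 < s \<Longrightarrow> s < R \<Longrightarrow> \<beta> s < \<infinity> \<Longrightarrow>
      \<exists>lo hi. lo \<le> hi \<and> (AE x in lborel. x \<in> cube x0 s \<longrightarrow> lo \<le> ub x \<and> ub x \<le> hi) \<and>
       A_sub ?n A ((hi - lo) / (32 * real ?n * lam * 2 ^ ?n * s)) * ennreal (s ^ (?n - 1)) \<le> \<beta> s"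
      using good_radii[OF x0R] by blast
    define osc where "osc = hi - lo"
    have osc: "osc \<ge> 0" using lh(1) by (simp add: osc_def)
    have "(\<integral>\<^sup>+s\<in>{r<..<R}. A_sub ?n A (osc / (C * s)) * ennreal (s ^ (?n - 1)) \<partial>lborel) \<le> (\<integral>\<^sup>+s. \<beta> s \<partial>lborel)"
    proof (rule nn_integral_mono)
      fix s :: real
      show "A_sub ?n A (osc / (C * s)) * ennreal (s ^ (?n - 1)) * indicator {r<..<R} s \<le> \<beta> s"
      proof (cases "s \<in> {r<..<R} \<and> \<beta> s < \<infinity>")
        case True
        then have s: "r < s" "s < R" "0 < s" "\<beta> s < \<infinity>" using r by auto
        obtain lo' hi' where lh': "AE x in lborel. x \<in> cube x0 s \<longrightarrow> lo' \<le> ub x \<and> ub x \<le> hi'"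
          "A_sub ?n A ((hi' - lo') / (C0 * s)) * ennreal (s ^ (?n - 1)) \<le> \<beta> s"
          using \<beta>(3)[OF s(3,2,4)] by (auto simp: C0_def)
        have "AE x in lborel. x \<in> cube x0 r \<longrightarrow> lo' \<le> ub x \<and> ub x \<le> hi'"
          using lh'(1) by eventually_elim (use s cube_mono[of r s x0] in auto)
        then have "osc \<le> hi' - lo'" using lh(3) by (fastforce simp: osc_def)
        moreover have "osc / (C * s) \<le> osc / (C0 * s)"
          using C C0 s osc by (intro divide_left_mono mult_right_mono mult_pos_pos) auto
        moreover have "osc / (C0 * s) \<le> (hi' - lo') / (C0 * s)" if "osc \<le> hi' - lo'"
          using C0 s that by (intro divide_right_mono) auto
        ultimately have "osc / (C * s) \<le> (hi' - lo') / (C0 * s)" by linarith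
        then have "A_sub ?n A (osc / (C * s)) \<le> A_sub ?n A ((hi' - lo') / (C0 * s))"
          using osc C s by (intro A_sub_mono[OF local.young]) auto
        then have "A_sub ?n A (osc / (C * s)) * ennreal (s ^ (?n - 1)) \<le> A_sub ?n A ((hi' - lo') / (C0 * s)) * ennreal (s ^ (?n - 1))"
          by (rule mult_right_mono) simp
        then show ?thesis using lh'(2) True by (auto intro: order_trans)
      next
        case False
        then have "s \<notin> {r<..<R} \<or> \<beta> s = \<infinity>" by (auto simp: top.not_eq_extremum[symmetric])
        then show ?thesis by auto
      qed
    qed
    then have int: "(\<integral>\<^sup>+s\<in>{r<..<R}. A_sub ?n A (osc / (C * s)) * ennreal (s ^ (?n - 1)) \<partial>lborel) \<le> ennreal M"
      using \<beta>(2) M by (auto intro: order_trans)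
    have "osc \<le> hi1 - lo1" using lh(3)[OF b1'] by (auto simp: osc_def)
    then have "osc / (C * R) \<le> a"
      using divide_right_mono[of osc "hi1 - lo1" "C * R"] C R Ca by simp
    then have "osc \<le> C * (max 1 (M + (a * R) ^ ?n * j) * omega ?n A r)"
      using r R by (intro oscillation_modulus[OF osc C(1) r(1) _ M(2) _ j a(1) int]) auto
    then show "\<exists>lo hi. (AE x in lborel. x \<in> cube x0 r \<longrightarrow> lo \<le> ub x \<and> ub x \<le> hi) \<and> hi - lo \<le> C * max 1 (M + (a * R) ^ ?n * j) * omega ?n A r"
      using lh(2) by (intro exI[of _ lo] exI[of _ hi]) (simp add: osc_def mult.assoc)
  qed
qed

section \<open>From the domain to cubes around a point\<close>

lemma closure_cube_le:
  assumes "z \<in> closure (cube x s)" shows "\<bar>z $ j - x $ j\<bar> \<le> s"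
proof -
  have "closure (cube x s) \<subseteq> cbox (\<chi> j. x $ j - s) (\<chi> j. x $ j + s)"
    unfolding cube_box by (intro closure_minimal box_subset_cbox closed_cbox)
  then have "z \<in> cbox (\<chi> j. x $ j - s) (\<chi> j. x $ j + s)" using assms by blast
  then have "x $ j - s \<le> z $ j" "z $ j \<le> x $ j + s" by (auto simp: mem_box_cart)
  then show ?thesis by linarith
qed

lemma integral_product_representative:
  fixes f fb :: "real^'n \<Rightarrow> real"
  assumes f: "f absolutely_integrable_on K" and K: "K \<in> sets borel" "K \<subseteq> Q" and Q: "Q \<in> sets borel"
    and fb: "fb \<in> borel_measurable borel" and eq: "AE x in lborel. x \<in> K \<longrightarrow> f x = fb x"
    and h: "h \<in> borel_measurable borel" "\<And>x. x \<notin> K \<Longrightarrow> h x = 0"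
  shows "(\<integral>x. f x * h x \<partial>lebesgue_on Q) = (\<integral>x. h x * fb x \<partial>lborel)"
proof -
  note [measurable] = fb h(1) Q
  have "integrable lebesgue (\<lambda>x. indicator K x *\<^sub>R f x)" using f by (simp add: set_integrable_def)
  then have m1: "(\<lambda>x. indicator K x *\<^sub>R f x) \<in> borel_measurable lebesgue" by (rule borel_measurable_integrable)
  have "h \<in> borel_measurable lebesgue" by (intro measurable_completion) simp
  then have "(\<lambda>x. (indicator K x *\<^sub>R f x) * h x) \<in> borel_measurable lebesgue" by (rule borel_measurable_times[OF m1])
  moreover have "(\<lambda>x. (indicator K x *\<^sub>R f x) * h x) = (\<lambda>x. f x * h x)"
    using h(2) by (auto simp: indicator_def fun_eq_iff)
  ultimately have "(\<lambda>x. f x * h x) \<in> borel_measurable (lebesgue_on Q)"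
    by (intro measurable_restrict_space1) simp
  then have "(\<integral>x. f x * h x \<partial>lebesgue_on Q) = (\<integral>x. indicator Q x *\<^sub>R (h x * fb x) \<partial>lborel)"
  proof (rule integral_lebesgue_on_borel[OF Q])
    show "AE x in lborel. x \<in> Q \<longrightarrow> f x * h x = h x * fb x"
      using eq by eventually_elim (use h(2) in auto)
  qed measurable
  also have "\<dots> = (\<integral>x. h x * fb x \<partial>lborel)"
    using h(2) K(2) by (intro Bochner_Integration.integral_cong) (auto simp: indicator_def)
  finally show ?thesis .
qed

text \<open>Nested cubes around \<open>x1\<close>: the open one of half edge \<open>4 * R\<close>
  provides the weak gradient, the closed one of half edge \<open>3 * R\<close> carries the Borel
  representatives, and kernels of radius \<open>R\<close> centred in the one of half edge
  \<open>2 * R\<close> are supported in the closed one, hence are test functions of the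
  largest.\<close>

lemma local_setting_exists:
  fixes \<Omega> :: "(real^'n) set"
  assumes adm: "admissible_young CARD('n) A" and \<Omega>: "open \<Omega>" and x1: "x1 \<in> \<Omega>"
    and u: "u \<in> W1_Orlicz_loc A \<Omega>" and wm: "weakly_monotone \<Omega> u"
  obtains ub gb R lam where "local_setting A \<Omega> u ub gb x1 R lam"
proof -
  have young: "young_function A" using adm by (simp add: admissible_young_def)
  obtain e where e: "e > 0" "ball x1 e \<subseteq> \<Omega>" using \<Omega> x1 by (meson open_contains_ball)
  \<comment> \<open>The norm is at most the sum of the absolute coordinates, so points within
    \<open>4 * R\<close> in each coordinate lie at distance at most \<open>e / 2\<close>.\<close>
  define R where "R = e / (8 * real CARD('n))"
  have R: "R > 0" using e by (simp add: R_def)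
  have in_ball: "z \<in> \<Omega>" if "\<And>j. \<bar>z $ j - x1 $ j\<bar> \<le> 4 * R" for z
  proof -
    have "norm (z - x1) \<le> (\<Sum>j\<in>UNIV. \<bar>(z - x1) $ j\<bar>)" by (rule norm_le_l1_cart)
    also have "\<dots> \<le> (\<Sum>j\<in>(UNIV::'n set). 4 * R)" using that by (intro sum_mono) simp
    also have "\<dots> < e" using e by (simp add: R_def)
    finally have "z \<in> ball x1 e" by (simp add: dist_norm norm_minus_commute)
    then show ?thesis using e by blast
  qed
  define Q where "Q = cube x1 (4 * R)"
  have clQ: "closure Q \<subseteq> \<Omega>" using closure_cube_le in_ball unfolding Q_def by blast
  have [measurable]: "Q \<in> sets borel" by (simp add: Q_def)
  have ci: "compactly_inside Q \<Omega>"
    unfolding compactly_inside_def using clQ unfolding Q_def by (intro conjI compact_closure_cube)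
  have "open Q" "bounded Q" unfolding Q_def
    by (rule open_cube) (rule bounded_subset[OF compact_imp_bounded[OF compact_closure_cube] closure_subset])
  then have "u \<in> W1_Orlicz A Q" using u ci by (simp add: W1_Orlicz_loc_def)
  then obtain g where g: "weak_gradient Q u g" "(\<lambda>x. norm (g x)) \<in> orlicz A Q" by (auto simp: W1_Orlicz_def)
  obtain lam where lam: "lam > 0" "(\<integral>\<^sup>+x. A (\<bar>norm (g x)\<bar> / lam) \<partial>lebesgue_on Q) < \<infinity>"
    using iffD1[OF orlicz_iff[OF young] g(2)] by (elim conjE exE) (rule that)
  define K where "K = closure (cube x1 (3 * R))"
  have K: "compact K" "K \<in> sets borel"
    unfolding K_def by (rule compact_closure_cube) (rule borel_closed[OF closed_closure])
  have KQ: "K \<subseteq> Q"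
  proof
    fix z assume "z \<in> K"
    then have z: "\<bar>z $ j - x1 $ j\<bar> \<le> 3 * R" for j unfolding K_def by (rule closure_cube_le)
    have "\<bar>z $ j - x1 $ j\<bar> < 4 * R" for j using z[of j] R by linarith
    then show "z \<in> Q" unfolding Q_def cube_def by simp
  qed
  have "u absolutely_integrable_on K" "g absolutely_integrable_on K"
    using g(1) K KQ unfolding weak_gradient_def by blast+
  note ai = this
  obtain ub where ub: "integrable lborel ub" "AE x in lborel. x \<in> K \<longrightarrow> u x = ub x" "\<And>x. x \<notin> K \<Longrightarrow> ub x = 0"
    using borel_representative_real[OF ai(1) K(2)] by blast
  obtain gb where gb: "integrable lborel gb" "AE x in lborel. x \<in> K \<longrightarrow> g x = gb x" "\<And>x. x \<notin> K \<Longrightarrow> gb x = 0"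
    using borel_representative_vec[OF ai(2) K(2)] by blast
  have [measurable]: "ub \<in> borel_measurable borel" "gb \<in> borel_measurable borel" using ub gb by auto
  have "local_setting A \<Omega> u ub gb x1 R lam"
  proof (rule local_setting.intro)
    have "(\<integral>\<^sup>+y. A (norm (gb y) / lam) \<partial>lborel) = (\<integral>\<^sup>+y. A (norm (gb y) / lam) \<partial>lebesgue)"
      by (simp add: nn_integral_completion)
    also have "\<dots> \<le> (\<integral>\<^sup>+y. A (\<bar>norm (g y)\<bar> / lam) * indicator Q y \<partial>lebesgue)"
    proof (rule nn_integral_mono_AE)
      show "AE y in lebesgue. A (norm (gb y) / lam) \<le> A (\<bar>norm (g y)\<bar> / lam) * indicator Q y"
        using AE_completion[OF gb(2)]
      proof eventually_elim
        case (elim y)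
        show ?case
        proof (cases "y \<in> K")
          case True
          then show ?thesis using elim KQ by (auto simp: indicator_def)
        next
          case False
          then show ?thesis using gb(3) young_zero[OF young] by simp
        qed
      qed
    qed
    also have "\<dots> = (\<integral>\<^sup>+x. A (\<bar>norm (g x)\<bar> / lam) \<partial>lebesgue_on Q)"
      by (subst nn_integral_restrict_space) auto
    finally show "(\<integral>\<^sup>+y. A (norm (gb y) / lam) \<partial>lborel) < \<infinity>" using lam(2) by simp
  next
    fix \<phi> :: "real^'n \<Rightarrow> real" and x :: "real^'n" and i :: 'n
    assume \<phi>: "mollifier R \<phi>" and x: "x \<in> cube x1 (2 * R)"
    define \<psi> where "\<psi> y = \<phi> (x - y)" for y
    have sm: "smooth \<phi>" and z: "\<And>z. R \<le> norm z \<Longrightarrow> \<phi> z = 0" using \<phi> by (auto simp: mollifier_def)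
    have far: "R < norm (x - y)" if "y \<notin> K" for y
    proof -
      have "y \<notin> cube x1 (3 * R)" using that closure_subset by (auto simp: K_def)
      then obtain j where "3 * R \<le> \<bar>y $ j - x1 $ j\<bar>" by (auto simp: cube_def not_less)
      moreover have "\<bar>x $ j - x1 $ j\<bar> < 2 * R" using x by (simp add: cube_def)
      ultimately have "R < \<bar>(x - y) $ j\<bar>" by simp
      also have "\<dots> \<le> norm (x - y)" by (rule component_le_norm_cart)
      finally show ?thesis .
    qed
    have pd: "partial_deriv i \<psi> y = - partial_deriv i \<phi> (x - y)" for y
      unfolding \<psi>_def by (rule partial_deriv_reflect[OF smooth_differentiable[OF sm]])
    have pd0: "partial_deriv i \<phi> w = 0" if "R < norm w" for w
      using partial_deriv_cong_open[of "{w. R < norm w}" w \<phi> "\<lambda>_. 0" i] that z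
      by (simp add: open_Collect_less continuous_on_norm_id)
    have "\<psi> \<in> test_functions Q"
    proof (rule test_functionsI)
      show "smooth \<psi>" unfolding \<psi>_def by (rule smooth_reflect[OF sm])
      show "\<psi> y = 0" if "y \<notin> K" for y using far[OF that] z by (simp add: \<psi>_def)
    qed (use K KQ in auto)
    then have w: "(\<integral>y. u y * partial_deriv i \<psi> y \<partial>lebesgue_on Q) = - (\<integral>y. g y $ i * \<psi> y \<partial>lebesgue_on Q)"
      using g(1) unfolding weak_gradient_def by blast
    have b: "bump \<phi>" by (rule mollifier_bump[OF \<phi>])
    note [measurable] = bump_measurable[OF b] bump_measurable[OF bump_partial_deriv[OF b]]
    have "(\<integral>y. u y * partial_deriv i \<psi> y \<partial>lebesgue_on Q) = (\<integral>y. partial_deriv i \<psi> y * ub y \<partial>lborel)"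
      by (rule integral_product_representative[OF ai(1) K(2) KQ _ _ ub(2)]) (auto simp: pd pd0 far)
    also have "\<dots> = - conv (partial_deriv i \<phi>) ub x" by (simp add: pd conv_def)
    finally have 1: "(\<integral>y. u y * partial_deriv i \<psi> y \<partial>lebesgue_on Q) = - conv (partial_deriv i \<phi>) ub x" .
    have "integrable lebesgue (\<lambda>x. (indicator K x *\<^sub>R g x) $ i)"
      using ai(2) unfolding set_integrable_def by (rule integrable_bounded_linear[OF bounded_linear_vec_nth])
    then have gi: "(\<lambda>x. g x $ i) absolutely_integrable_on K" by (simp add: set_integrable_def)
    have "(\<integral>y. g y $ i * \<psi> y \<partial>lebesgue_on Q) = (\<integral>y. \<psi> y * gb y $ i \<partial>lborel)"
    proof (rule integral_product_representative[OF gi K(2) KQ])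
      show "AE x in lborel. x \<in> K \<longrightarrow> g x $ i = gb x $ i" using gb(2) by eventually_elim auto
      show "\<psi> y = 0" if "y \<notin> K" for y using far[OF that] z by (simp add: \<psi>_def)
    qed (auto simp: \<psi>_def)
    also have "\<dots> = conv \<phi> gb x $ i"
    proof -
      have "conv \<phi> gb x $ i = (\<integral>y. (\<phi> (x - y) *\<^sub>R gb y) $ i \<partial>lborel)"
        unfolding conv_def by (rule integral_bounded_linear[OF bounded_linear_vec_nth conv_integrable[OF b gb(1)], symmetric])
      then show ?thesis by (simp add: \<psi>_def)
    qed
    finally show "conv (partial_deriv i \<phi>) ub x = conv \<phi> gb x $ i" using w 1 by simp
  next
    show "AE x in lborel. x \<in> cube x1 (2 * R) \<longrightarrow> u x = ub x"
      using ub(2)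
    proof eventually_elim
      case (elim x)
      have "x \<in> cube x1 (3 * R)" if "x \<in> cube x1 (2 * R)"
        using that R cube_mono[of "2 * R" "3 * R" x1] by auto
      then show ?case using elim closure_subset by (auto simp: K_def)
    qed
    show "closure (cube x1 (2 * R)) \<subseteq> \<Omega>"
    proof
      fix z assume "z \<in> closure (cube x1 (2 * R))"
      then have z: "\<bar>z $ j - x1 $ j\<bar> \<le> 2 * R" for j by (rule closure_cube_le)
      have "\<bar>z $ j - x1 $ j\<bar> \<le> 4 * R" for j using z[of j] R by linarith
      then show "z \<in> \<Omega>" by (rule in_ball)
    qed
    show "u \<in> borel_measurable (lebesgue_on \<Omega>)" using u by (simp add: W1_Orlicz_loc_def)
  qed (use adm R lam ub gb wm in blast)+
  then show thesis by (rule that)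
qed

text \<open>The local modulus comes with constants that depend on the point; compactness of
  \<open>K\<close> makes them uniform. Pairs of distant points are covered by the boundedness of
  \<open>v\<close> on \<open>K\<close> and a positive lower bound of \<open>omega\<close>.\<close>

lemma representative_exists:
  fixes \<Omega> :: "(real^'n) set"
  assumes adm: "admissible_young CARD('n) A" and \<Omega>: "open \<Omega>"
    and u: "u \<in> W1_Orlicz_loc A \<Omega>" and wm: "weakly_monotone \<Omega> u"
  shows "\<exists>v. continuous_representative \<Omega> u v \<and> v \<in> C_omega_loc (omega CARD('n) A) \<Omega>"
proof -
  let ?\<omega> = "omega CARD('n) A"
  interpret admissible_young "CARD('n)" A by (rule adm)
  have loc: "\<exists>\<rho> C. \<rho> > 0 \<and> C \<ge> 0 \<and> (\<forall>x0\<in>cube x1 \<rho>. \<forall>r. 0 < r \<and> r < \<rho> \<longrightarrow> cube x0 r \<subseteq> \<Omega> \<and>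
     (\<exists>lo hi. (AE x in lborel. x \<in> cube x0 r \<longrightarrow> lo \<le> u x \<and> u x \<le> hi) \<and> hi - lo \<le> C * ?\<omega> r))"
    if x1: "x1 \<in> \<Omega>" for x1
  proof -
    obtain ub gb R lam where ls: "local_setting A \<Omega> u ub gb x1 R lam"
      by (rule local_setting_exists[OF adm \<Omega> x1 u wm])
    then interpret local_setting A \<Omega> u ub gb x1 R lam .
    obtain C where C: "C \<ge> 0" "\<And>x0 r. x0 \<in> cube x1 (R / 4) \<Longrightarrow> 0 < r \<Longrightarrow> r < R / 4 \<Longrightarrow>
      \<exists>lo hi. (AE x in lborel. x \<in> cube x0 r \<longrightarrow> lo \<le> ub x \<and> ub x \<le> hi) \<and> hi - lo \<le> C * ?\<omega> r"
      by (rule local_modulus) blast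
    have "\<forall>x0\<in>cube x1 (R / 4). \<forall>r. 0 < r \<and> r < R / 4 \<longrightarrow> cube x0 r \<subseteq> \<Omega> \<and>
     (\<exists>lo hi. (AE x in lborel. x \<in> cube x0 r \<longrightarrow> lo \<le> u x \<and> u x \<le> hi) \<and> hi - lo \<le> C * ?\<omega> r)"
    proof (intro conjI ballI allI impI)
      fix x0 r assume x0: "x0 \<in> cube x1 (R / 4)" and r: "0 < r \<and> r < R / 4"
      have sub: "x \<in> cube x1 (2 * R)" if "x \<in> cube x0 r" for x
      proof (rule closed_cube_subset)
        show "x0 \<in> cube x1 R" using x0 R cube_mono[of "R / 4" R x1] by auto
        show "r < R" using r R by linarith
        show "\<forall>j. \<bar>x $ j - x0 $ j\<bar> \<le> r" using that by (simp add: cube_def less_imp_le)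
      qed
      then show "cube x0 r \<subseteq> \<Omega>" using cl closure_subset by blast
      obtain lo hi where lh: "AE x in lborel. x \<in> cube x0 r \<longrightarrow> lo \<le> ub x \<and> ub x \<le> hi" "hi - lo \<le> C * ?\<omega> r"
        using C(2)[OF x0, of r] r by blast
      have "AE x in lborel. x \<in> cube x0 r \<longrightarrow> lo \<le> u x \<and> u x \<le> hi"
        using lh(1) ueq by eventually_elim (use sub in auto)
      then show "\<exists>lo hi. (AE x in lborel. x \<in> cube x0 r \<longrightarrow> lo \<le> u x \<and> u x \<le> hi) \<and> hi - lo \<le> C * ?\<omega> r"
        using lh(2) by blast
    qed
    then show ?thesis using R C(1) by (intro exI[of _ "R / 4"] exI[of _ C]) auto
  qed
  \<comment> \<open>The limit of the essential suprema over shrinking cubes, written as an infimum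
    of essential upper bounds; it has a value at every point and does not see null sets.\<close>
  define v where "v x = Inf {b. \<exists>r>0. cube x r \<subseteq> \<Omega> \<and> (AE z in lborel. z \<in> cube x r \<longrightarrow> u z \<le> b)}" for x
  \<comment> \<open>Essential bounds on a cube are inherited by smaller cubes around
    \<open>y\<close>, and a cube of positive measure cannot have an essential upper bound below an
    essential lower one.\<close>
  have between: "lo \<le> v y \<and> v y \<le> hi"
    if x: "cube x r \<subseteq> \<Omega>" "AE z in lborel. z \<in> cube x r \<longrightarrow> lo \<le> u z \<and> u z \<le> hi" and y: "y \<in> cube x r" for x y r lo hi
  proof -
    obtain d where d: "d > 0" "ball y d \<subseteq> cube x r" using open_cube y by (meson open_contains_ball)
    define r' where "r' = d / (2 * real CARD('n))"
    have r': "r' > 0" using d by (simp add: r'_def)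
    have sub: "cube y r' \<subseteq> cube x r"
    proof
      fix z assume z: "z \<in> cube y r'"
      have "norm (z - y) \<le> (\<Sum>j\<in>UNIV. \<bar>(z - y) $ j\<bar>)" by (rule norm_le_l1_cart)
      also have "\<dots> \<le> (\<Sum>j\<in>(UNIV::'n set). r')" using z by (intro sum_mono) (simp add: cube_def less_imp_le)
      also have "\<dots> < d" using d by (simp add: r'_def)
      finally have "z \<in> ball y d" by (simp add: dist_norm norm_minus_commute)
      then show "z \<in> cube x r" using d by blast
    qed
    let ?S = "{b. \<exists>r>0. cube y r \<subseteq> \<Omega> \<and> (AE z in lborel. z \<in> cube y r \<longrightarrow> u z \<le> b)}"
    have "AE z in lborel. z \<in> cube y r' \<longrightarrow> u z \<le> hi" using x(2) by eventually_elim (use sub in auto)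
    then have hi: "hi \<in> ?S" using r' sub x(1) by blast
    have lo: "lo \<le> b" if b: "b \<in> ?S" for b
    proof (rule ccontr)
      assume "\<not> lo \<le> b"
      obtain s where s: "s > 0" "AE z in lborel. z \<in> cube y s \<longrightarrow> u z \<le> b"
        using b unfolding mem_Collect_eq by (elim exE conjE) (rule that)
      have "AE z in lborel. z \<notin> cube y (min s r')"
        using s(2) x(2)
      proof eventually_elim
        case (elim z)
        show ?case
        proof
          assume "z \<in> cube y (min s r')"
          then have "z \<in> cube y s" "z \<in> cube y r'" by (auto simp: cube_def)
          then show False using elim sub \<open>\<not> lo \<le> b\<close> by force
        qed
      qed
      then show False
        using not_AE_not_in_open[OF open_cube cube_nonempty, of "min s r'" y] s(1) r' by simp
    qed
    show ?thesis
    proof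
      show "lo \<le> v y" unfolding v_def using hi lo by (intro cInf_greatest) auto
      show "v y \<le> hi" unfolding v_def by (rule cInf_lower[OF hi bdd_belowI[of _ lo]]) (rule lo)
    qed
  qed
  have near: "\<bar>v x - v y\<bar> \<le> hi - lo"
    if "cube x r \<subseteq> \<Omega>" "AE z in lborel. z \<in> cube x r \<longrightarrow> lo \<le> u z \<and> u z \<le> hi" "y \<in> cube x r" "r > 0" for x y r lo hi
    using between[OF that(1,2), of x] between[OF that(1,2,3)] that(4) by (auto simp: cube_def)
  have cube_dist: "y \<in> cube x r" if "norm (x - y) < r" for x y :: "real^'n" and r
    using component_le_norm_cart[of "x - y"] that by (auto simp: cube_def abs_minus_commute intro: le_less_trans)
  have small: "\<exists>r>0. r < \<rho> \<and> C * ?\<omega> r \<le> \<epsilon>" if "\<rho> > 0" "C \<ge> 0" "\<epsilon> > 0" for \<rho> C \<epsilon>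
  proof -
    obtain \<rho>' where \<rho>': "\<rho>' > 0" "\<And>r. 0 < r \<Longrightarrow> r < \<rho>' \<Longrightarrow> ?\<omega> r \<le> \<epsilon> / (C + 1)"
      using omega_small[of "\<epsilon> / (C + 1)"] \<open>C \<ge> 0\<close> \<open>\<epsilon> > 0\<close> by auto
    define r where "r = min \<rho> \<rho>' / 2"
    have r: "r > 0" "r < \<rho>" "r < \<rho>'" using that \<rho>' by (auto simp: r_def)
    have "C * ?\<omega> r \<le> C * (\<epsilon> / (C + 1))" using \<rho>'(2)[OF r(1,3)] that by (intro mult_left_mono) auto
    also have "\<dots> \<le> \<epsilon>" using that by (simp add: field_simps)
    finally show ?thesis using r by blast
  qed
  have cont: "continuous_on \<Omega> v"
    unfolding continuous_on_iff
  proof (intro ballI allI impI)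
    fix x and \<epsilon> :: real assume x: "x \<in> \<Omega>" and "\<epsilon> > 0"
    obtain \<rho> C where \<rho>: "\<rho> > 0" "C \<ge> 0" "\<And>x0 r. x0 \<in> cube x \<rho> \<Longrightarrow> 0 < r \<and> r < \<rho> \<Longrightarrow> cube x0 r \<subseteq> \<Omega> \<and>
     (\<exists>lo hi. (AE x in lborel. x \<in> cube x0 r \<longrightarrow> lo \<le> u x \<and> u x \<le> hi) \<and> hi - lo \<le> C * ?\<omega> r)"
      using loc[OF x] by blast
    obtain r where r: "r > 0" "r < \<rho>" "C * ?\<omega> r \<le> \<epsilon> / 2" using small[OF \<rho>(1,2), of "\<epsilon> / 2"] \<open>\<epsilon> > 0\<close> by auto
    have "x \<in> cube x \<rho>" using \<rho> by (simp add: cube_def)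
    then obtain lo hi where lh: "cube x r \<subseteq> \<Omega>" "AE z in lborel. z \<in> cube x r \<longrightarrow> lo \<le> u z \<and> u z \<le> hi" "hi - lo \<le> C * ?\<omega> r"
      using \<rho>(3)[of x r] r by blast
    have "dist (v y) (v x) < \<epsilon>" if "dist y x < r" for y
      using near[OF lh(1,2) cube_dist[of x y r] r(1)] that lh(3) r(3) \<open>\<epsilon> > 0\<close> by (simp add: dist_norm norm_minus_commute)
    then show "\<exists>d>0. \<forall>y\<in>\<Omega>. dist y x < d \<longrightarrow> dist (v y) (v x) < \<epsilon>" using r by blast
  qed
  have eq: "AE x in lebesgue_on \<Omega>. v x = u x"
  proof -
    \<comment> \<open>Countably many open sets and rational bounds leave one null set; off it every
      rational essential bound on a basic open set holds pointwise.\<close>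
    obtain \<B> :: "(real^'n) set set" where \<B>: "countable \<B>" "topological_basis \<B>" using ex_countable_basis by blast
    have "AE z in lborel. \<forall>G\<in>\<B>. \<forall>q\<in>(\<rat>::real set). ((AE w in lborel. w \<in> G \<longrightarrow> u w \<le> q) \<longrightarrow> z \<in> G \<longrightarrow> u z \<le> q) \<and>
        ((AE w in lborel. w \<in> G \<longrightarrow> q \<le> u w) \<longrightarrow> z \<in> G \<longrightarrow> q \<le> u z)"
    proof (intro AE_ball_countable' \<B>(1) countable_rat)
      fix G and q :: real
      show "AE z in lborel. ((AE w in lborel. w \<in> G \<longrightarrow> u w \<le> q) \<longrightarrow> z \<in> G \<longrightarrow> u z \<le> q) \<and>
        ((AE w in lborel. w \<in> G \<longrightarrow> q \<le> u w) \<longrightarrow> z \<in> G \<longrightarrow> q \<le> u z)"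
        by (cases "AE w in lborel. w \<in> G \<longrightarrow> u w \<le> q"; cases "AE w in lborel. w \<in> G \<longrightarrow> q \<le> u w") auto
    qed
    then have "AE z in lborel. z \<in> \<Omega> \<longrightarrow> v z = u z"
    proof eventually_elim
      case (elim z)
      show ?case
      proof
        assume z: "z \<in> \<Omega>"
        obtain \<rho> C where \<rho>: "\<rho> > 0" "C \<ge> 0" "\<And>x0 r. x0 \<in> cube z \<rho> \<Longrightarrow> 0 < r \<and> r < \<rho> \<Longrightarrow> cube x0 r \<subseteq> \<Omega> \<and>
          (\<exists>lo hi. (AE x in lborel. x \<in> cube x0 r \<longrightarrow> lo \<le> u x \<and> u x \<le> hi) \<and> hi - lo \<le> C * ?\<omega> r)"
          using loc[OF z] by blast
        have "\<bar>v z - u z\<bar> \<le> 0 + \<epsilon>" if \<epsilon>: "\<epsilon> > 0" for \<epsilon>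
        proof -
          obtain r where r: "r > 0" "r < \<rho>" "C * ?\<omega> r \<le> \<epsilon> / 2" using small[OF \<rho>(1,2), of "\<epsilon> / 2"] \<epsilon> by auto
          have "z \<in> cube z \<rho>" and zr: "z \<in> cube z r" using \<rho> r by (auto simp: cube_def)
          then obtain lo hi where lh: "cube z r \<subseteq> \<Omega>" "AE w in lborel. w \<in> cube z r \<longrightarrow> lo \<le> u w \<and> u w \<le> hi" "hi - lo \<le> C * ?\<omega> r"
            using \<rho>(3)[of z r] r by blast
          obtain G where G: "G \<in> \<B>" "z \<in> G" "G \<subseteq> cube z r"
            using topological_basisE[OF \<B>(2) open_cube zr] by blast
          obtain q1 where q1: "q1 \<in> \<rat>" "hi < q1" "q1 < hi + \<epsilon> / 2" using Rats_dense_in_real[of hi "hi + \<epsilon> / 2"] \<epsilon> by auto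
          obtain q2 where q2: "q2 \<in> \<rat>" "lo - \<epsilon> / 2 < q2" "q2 < lo" using Rats_dense_in_real[of "lo - \<epsilon> / 2" lo] \<epsilon> by auto
          have "AE w in lborel. w \<in> G \<longrightarrow> u w \<le> q1" "AE w in lborel. w \<in> G \<longrightarrow> q2 \<le> u w"
            using lh(2) by (eventually_elim, use G(3) q1 q2 in force)+
          then have "u z \<le> q1" "q2 \<le> u z" using elim G q1(1) q2(1) by blast+
          moreover have "lo \<le> v z" "v z \<le> hi" using between[OF lh(1,2) zr] by auto
          ultimately show ?thesis using q1 q2 lh(3) r(3) by linarith
        qed
        then have "\<bar>v z - u z\<bar> \<le> 0" by (rule field_le_epsilon)
        then show "v z = u z" by simp
      qed
    qed
    then have "AE z in lebesgue. z \<in> \<Omega> \<longrightarrow> v z = u z" by (rule AE_completion)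
    then show ?thesis using \<Omega> by (subst AE_restrict_space_iff) auto
  qed
  have "v \<in> C_omega_loc ?\<omega> \<Omega>"
    unfolding C_omega_loc_def mem_Collect_eq
  proof (intro allI impI)
    fix K assume K: "compact K \<and> K \<subseteq> \<Omega>"
    show "\<exists>C. \<forall>x\<in>K. \<forall>y\<in>K. x \<noteq> y \<longrightarrow> \<bar>v x - v y\<bar> \<le> C * ?\<omega> (norm (x - y))"
    proof (rule ccontr)
      \<comment> \<open>If no constant serves on \<open>K\<close>, there are pairs
        \<open>xs k\<close>, \<open>ys k\<close> that violate the estimate with constant
        \<open>k\<close>; near a limit point of \<open>xs\<close> a single local constant is
        available.\<close>
      assume "\<not> ?thesis"
      then have "\<forall>k::nat. \<exists>x y. x \<in> K \<and> y \<in> K \<and> x \<noteq> y \<and> real k * ?\<omega> (norm (x - y)) < \<bar>v x - v y\<bar>"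
        by (meson linorder_not_le)
      then obtain xs ys where xy: "\<And>k::nat. xs k \<in> K" "\<And>k. ys k \<in> K" "\<And>k. xs k \<noteq> ys k"
        "\<And>k. real k * ?\<omega> (norm (xs k - ys k)) < \<bar>v (xs k) - v (ys k)\<bar>"
        by metis
      obtain x r where x: "x \<in> K" and r: "strict_mono (r :: nat \<Rightarrow> nat)" and lim: "(xs \<circ> r) \<longlonglongrightarrow> x"
        using K xy(1) unfolding compact_def by blast
      then have "x \<in> \<Omega>" using K by blast
      obtain \<rho> C where \<rho>: "\<rho> > 0" "C \<ge> 0" "\<And>x0 r. x0 \<in> cube x \<rho> \<Longrightarrow> 0 < r \<and> r < \<rho> \<Longrightarrow> cube x0 r \<subseteq> \<Omega> \<and>
          (\<exists>lo hi. (AE x in lborel. x \<in> cube x0 r \<longrightarrow> lo \<le> u x \<and> u x \<le> hi) \<and> hi - lo \<le> C * ?\<omega> r)"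
        using loc[OF \<open>x \<in> \<Omega>\<close>] by blast
      have "compact (v ` K)" using K cont continuous_on_subset by (intro compact_continuous_image) auto
      then obtain S where S: "\<And>x. x \<in> K \<Longrightarrow> \<bar>v x\<bar> \<le> S" by (metis bounded_real compact_imp_bounded image_eqI)
      obtain D0 where D0: "\<And>x. x \<in> K \<Longrightarrow> norm x \<le> D0" using K compact_imp_bounded bounded_iff by metis
      define D where "D = max (2 * D0) \<rho> + 1"
      have D: "D > \<rho>" by (simp add: D_def)
      \<comment> \<open>A lower bound of \<open>?\<omega> d\<close> for
        \<open>\<rho> / 2 \<le> d \<le> D\<close>: by \<open>omega_scale\<close> the ratio
        \<open>?\<omega> d / d\<close> is at least \<open>?\<omega> D / D\<close>.\<close>
      define c where "c = \<rho> / (2 * D) * ?\<omega> D"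
      have c: "c > 0" using \<rho> D omega_pos[of D] by (simp add: c_def)
      have far: "c \<le> ?\<omega> d" if "\<rho> / 2 \<le> d" "d \<le> D" for d
      proof -
        have d: "d > 0" using that \<rho> by linarith
        have "?\<omega> (D / d * d) \<le> D / d * ?\<omega> d" using d that by (intro omega_scale) auto
        then have "?\<omega> D \<le> D / d * ?\<omega> d" using d by simp
        then have "d / D * ?\<omega> D \<le> ?\<omega> d" using d D \<rho> by (simp add: field_simps)
        moreover have "c \<le> d / D * ?\<omega> D"
          unfolding c_def using that D \<rho> omega_pos[of D] by (intro mult_right_mono) (auto simp: field_simps)
        ultimately show ?thesis by linarith
      qed
      have "\<forall>\<^sub>F k in sequentially. xs (r k) \<in> cube x \<rho>"
        using topological_tendstoD[OF lim open_cube, of x \<rho>] \<rho> by (simp add: cube_def)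
      moreover have "\<forall>\<^sub>F k in sequentially. max (2 * C) (2 * S / c) < real k"
        by (rule eventually_gt_at_top[THEN eventually_compose_filterlim[OF _ filterlim_real_sequentially]])
      ultimately have "\<forall>\<^sub>F k in sequentially. False"
      proof eventually_elim
        case (elim k)
        define X Y where "X = xs (r k)" and "Y = ys (r k)"
        define d where "d = norm (X - Y)"
        have XY: "X \<in> K" "Y \<in> K" "X \<noteq> Y" using xy by (auto simp: X_def Y_def)
        have d: "d > 0" using XY by (simp add: d_def)
        have "real k \<le> real (r k)" using seq_suble[OF r, of k] by simp
        then have "real k * ?\<omega> d \<le> real (r k) * ?\<omega> d" using omega_pos[OF d] by (intro mult_right_mono) auto
        also have "\<dots> < \<bar>v X - v Y\<bar>" using xy(4)[of "r k"] by (simp add: X_def Y_def d_def)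
        finally have big: "real k * ?\<omega> d < \<bar>v X - v Y\<bar>" .
        show False
        proof (cases "d < \<rho> / 2")
          case True
          \<comment> \<open>The cube around \<open>X\<close> of half edge \<open>2 * d\<close>
            contains \<open>Y\<close> and stays in the local range since
            \<open>2 * d < \<rho>\<close>; \<open>omega_scale\<close> removes the factor
            \<open>2\<close>.\<close>
          have "X \<in> cube x \<rho>" using elim by (simp add: X_def)
          then obtain lo hi where lh: "cube X (2 * d) \<subseteq> \<Omega>" "AE z in lborel. z \<in> cube X (2 * d) \<longrightarrow> lo \<le> u z \<and> u z \<le> hi" "hi - lo \<le> C * ?\<omega> (2 * d)"
            using \<rho>(3)[of X "2 * d"] d True by auto
          have "\<bar>v X - v Y\<bar> \<le> hi - lo"
            using d by (intro near[OF lh(1,2)] cube_dist) (auto simp: d_def)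
          also have "\<dots> \<le> C * (2 * ?\<omega> d)"
            using lh(3) omega_scale[OF d, of 2] \<rho>(2) by (meson mult_left_mono order_trans one_le_numeral)
          also have "\<dots> \<le> real k * ?\<omega> d"
            using mult_right_mono[of "2 * C" "real k" "?\<omega> d"] elim omega_pos[OF d] by simp
          finally show False using big by simp
        next
          case False
          have "d \<le> norm X + norm Y" unfolding d_def by (rule norm_triangle_ineq4)
          then have "d \<le> D" using D0[OF XY(1)] D0[OF XY(2)] by (simp add: D_def)
          then have "c \<le> ?\<omega> d" using False by (intro far) auto
          then have "real k * c \<le> real k * ?\<omega> d" by (intro mult_left_mono) auto
          moreover have "2 * S < real k * c" using elim c by (simp add: field_simps)
          moreover have "\<bar>v X - v Y\<bar> \<le> 2 * S" using S[OF XY(1)] S[OF XY(2)] by linarith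
          ultimately show False using big by linarith
        qed
      qed
      then show False by simp
    qed
  qed
  then show ?thesis using cont eq unfolding continuous_representative_def by blast
qed

theorem theorem3p7:
  fixes \<Omega> :: "(real^'n) set" and A :: "real \<Rightarrow> ennreal"
  assumes "CARD('n) \<ge> 2"
    and "open \<Omega>"
    and "young_function A"
    and "CARD('n) \<ge> 3 \<Longrightarrow> growth_condition CARD('n) A"
    and "infinite_at_infinity (\<lambda>t. A_sub CARD('n) A t / ennreal (t ^ (CARD('n) + 1)))"
  shows "(\<forall>u \<in> W1_Orlicz_loc A \<Omega>. weakly_monotone \<Omega> u \<longrightarrow>
            (\<exists>v. continuous_representative \<Omega> u v)) \<and>
         (\<exists>A'. admissible_modification CARD('n) A A') \<and>
         (\<forall>A'. admissible_modification CARD('n) A A' \<longrightarrow>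
            W1_Orlicz_loc A' \<Omega> = W1_Orlicz_loc A \<Omega> \<and>
            (\<forall>u \<in> W1_Orlicz_loc A \<Omega>. weakly_monotone \<Omega> u \<longrightarrow>
               (\<exists>v. continuous_representative \<Omega> u v \<and> v \<in> C_omega_loc (omega CARD('n) A') \<Omega>)))"
proof -
  have ex: "\<exists>A'. admissible_modification CARD('n) A A'"
    by (rule admissible_modification_exists[OF assms(1,3,5)])
  have main: "W1_Orlicz_loc A' \<Omega> = W1_Orlicz_loc A \<Omega> \<and>
      (\<forall>u \<in> W1_Orlicz_loc A \<Omega>. weakly_monotone \<Omega> u \<longrightarrow>
        (\<exists>v. continuous_representative \<Omega> u v \<and> v \<in> C_omega_loc (omega CARD('n) A') \<Omega>))"
    if A': "admissible_modification CARD('n) A A'" for A'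
  proof -
    obtain t0 where y': "young_function A'" and eq: "\<And>t. t \<ge> t0 \<Longrightarrow> A' t = A t"
      and fin: "finite_at_zero (\<lambda>t. A_sub CARD('n) A' t / ennreal (t ^ (1 + CARD('n))))"
      using A' by (auto simp: admissible_modification_def)
    have W: "W1_Orlicz_loc A' \<Omega> = W1_Orlicz_loc A \<Omega>"
      by (rule W1_Orlicz_loc_modification[OF assms(3) y' eq])
    have "admissible_young CARD('n) A'"
      by (intro admissible_young.intro assms(1) y' fin infinite_at_infinity_modification[OF assms(1,3) y' eq assms(5)])
    then show ?thesis using W representative_exists[OF _ assms(2)] by blast
  qed
  \<comment> \<open>The first claim follows from the last one, applied to any admissible
    modification, since one exists.\<close>
  then show ?thesis using ex by blast
qed

end
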